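(* Let $d\ge2$ and let $\Omega\subset\mathbb{R}^d$ be a proper paving unit (a bounded Lipschitz domain with $\mathbb{R}^d\setminus\overline{\Omega}$ connected). Let $a>0$ be a constant with $a\ne1$ and suppose $A=a\,\mathrm{Id}$, $q=a$ in $\Omega$. Then $\mathscr{S}_{\mathrm{NS}}=\mathscr{S}_{\mathrm{TE}}=\mathscr{S}_{\mathrm{D}}\cup\mathscr{S}_{\mathrm{N}}$.
   Context: Proper paving unit. Let $\Omega$ be a polygon in $\mathbb{R}^2$ (resp. a polyhedron in $\mathbb{R}^3$, a polytope in $\mathbb{R}^d$); "facets" means edges (resp. faces, facets). $\Omega$ is a proper paving unit if: (1) one can find a combination of successive reflections of $\overline{\Omega}$ with respect to its facets (i.e. $\overline\Omega$ is reflected across its facets, the images across theirs, etc.) that covers an open set $\tilde\Omega$ with $\overline{\Omega}\subset\tilde\Omega$, with overlaps only on the skeleton $\mathcal{S}$ consisting of the facets of $\partial\Omega$ and their images by the reflections; (2) if one assigns a different colour to each facet of $\partial\Omega$, and lets the images of facets under the reflections inherit the colours, then every element of $\mathcal{S}$ has only one colour. Scattering. Set $A=\mathrm{Id}$, $q=1$ in $\mathbb{R}^d\setminus\overline\Omega$. Given $k>0$, an incident field is a non-zero function $u_i$ solving $\Delta u_i+k^2u_i=0$ in some domain $\tilde\Omega$ with $\overline\Omega\subset\tilde\Omega$ ($u_i$ need not be defined on all of $\mathbb{R}^d$). The scattered field is the function $u_s$, in $\mathrm{H}^1$ of every bounded domain, solving in the weak sense $$\mathrm{div}(A\nabla u_s)+k^2qu_s=-\mathrm{div}((A-\mathrm{Id})\nabla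 u_i)-k^2(q-1)u_i\ \text{ in }\mathbb{R}^d,\qquad \lim_{R\to+\infty}\int_{|x|=R}\Big|\frac{\partial u_s}{\partial r}-iku_s\Big|^2ds=0,$$ where $u_i$ is extended by zero outside $\tilde\Omega$. $\mathscr{S}_{\mathrm{NS}}$ (non-scattering frequencies) is the set of $k>0$ for which there is an incident field $u_i$ (for some $\tilde\Omega$) whose scattered field satisfies $u_s=0$ in $\mathbb{R}^d\setminus\Omega$. $\mathscr{S}_{\mathrm{TE}}$ is the set of $k>0$ for which there is a non-zero $(u,v)\in \mathrm{H}^1(\Omega)^2$ with $\mathrm{div}(A\nabla u)+k^2qu=0$, $\Delta v+k^2v=0$ in $\Omega$, and $u=v$, $\nu\cdot A\nabla u=\nu\cdot\nabla v$ on $\partial\Omega$ ($\nu$ the unit outward normal). $\mathscr{S}_{\mathrm{D}}$ (resp. $\mathscr{S}_{\mathrm{N}}$) is the set of $k>0$ for which there is a non-zero $w\in \mathrm{H}^1(\Omega)$ with $\Delta w+k^2w=0$ in $\Omega$ and $w=0$ (resp. $\partial_\nu w=0$) on $\partial\Omega$. *)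

theory Defs
  imports "HOL-Analysis.Analysis"
begin

section \<open>Domains, reflections and proper paving units\<close>

definition open_domain :: "'a::topological_space set \<Rightarrow> bool" where
  "open_domain D \<longleftrightarrow> open D \<and> connected D \<and> D \<noteq> {}"

text \<open>Near each boundary point, \<open>S\<close> is the strict epigraph, in some unit direction \<open>e\<close>, of a
  Lipschitz function \<open>g\<close> of the component orthogonal to \<open>e\<close>.\<close>

definition lipschitz_boundary :: "(real^'n) set \<Rightarrow> bool" where
  "lipschitz_boundary S \<longleftrightarrow>
     (\<forall>x\<in>frontier S. \<exists>e g L r. norm e = 1 \<and> r > 0 \<and> L-lipschitz_on {y. e \<bullet> y = 0} g \<and>
        (\<forall>y\<in>ball x r. y \<in> S \<longleftrightarrow> g (y - (e \<bullet> y) *\<^sub>R e) < e \<bullet> y))"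

text \<open>A polygon, polyhedron, ... need not be convex, whereas the library's \<^const>\<open>polytope\<close> is.\<close>

definition polytopal :: "(real^'n) set \<Rightarrow> bool" where
  "polytopal S \<longleftrightarrow> (\<exists>\<P>. finite \<P> \<and> (\<forall>P\<in>\<P>. polytope P) \<and> closure S = \<Union>\<P>)"

text \<open>The boundary points near which the boundary coincides with the hyperplane
  \<open>{y. a \<bullet> y = b}\<close>. Facets are the closures of the connected components of this set, for all
  hyperplanes; for convex \<open>S\<close> these are the facets in the usual sense, and a non-convex \<open>S\<close> may
  have several facets in one hyperplane.\<close>

definition flat_boundary :: "(real^'n) set \<Rightarrow> real^'n \<Rightarrow> real \<Rightarrow> (real^'n) set" where
  "flat_boundary S a b =
     {x. a \<bullet> x = b \<and> (\<exists>r>0. frontier S \<inter> ball x r = {y. a \<bullet> y = b} \<inter> ball x r)}"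

definition facets :: "(real^'n) set \<Rightarrow> (real^'n) set set" where
  "facets S = {closure C | C a b. a \<noteq> 0 \<and> C \<in> components (flat_boundary S a b)}"

definition hyperplane_reflection :: "real^'n \<Rightarrow> real \<Rightarrow> real^'n \<Rightarrow> real^'n" where
  "hyperplane_reflection a b x = x - (2 * (a \<bullet> x - b) / (a \<bullet> a)) *\<^sub>R a"

text \<open>The successive reflections of \<open>S\<close>, continued until \<open>T\<close> is covered: starting from \<open>S\<close>, each
  image is in turn reflected across those of its facets that meet \<open>T\<close>, so that images with a
  common facet meeting \<open>T\<close> are mirror images of each other. An image is represented
  by the isometry \<open>\<sigma>\<close> that carries \<open>S\<close> to it, because \<open>\<sigma>\<close> also records which facet \<open>F\<close> of \<open>S\<close> the
  facet \<open>\<sigma> ` F\<close> of the image comes from, i.e. its inherited colour. The facet \<open>\<sigma> ` F\<close> lies in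
  exactly one hyperplane.\<close>

inductive_set successive_reflections ::
    "(real^'n) set \<Rightarrow> (real^'n) set \<Rightarrow> (real^'n \<Rightarrow> real^'n) set"
  for S T :: "(real^'n) set" where
  start: "id \<in> successive_reflections S T"
| reflect: "\<lbrakk>\<sigma> \<in> successive_reflections S T; F \<in> facets S; \<sigma> ` F \<inter> T \<noteq> {};
             a \<noteq> 0; \<sigma> ` F \<subseteq> {x. a \<bullet> x = b}\<rbrakk>
            \<Longrightarrow> hyperplane_reflection a b \<circ> \<sigma> \<in> successive_reflections S T"

definition skeleton :: "(real^'n) set \<Rightarrow> (real^'n) set \<Rightarrow> (real^'n) set set" where
  "skeleton S T = {\<sigma> ` F | \<sigma> F. \<sigma> \<in> successive_reflections S T \<and> F \<in> facets S}"

text \<open>The facets of \<open>S\<close> serve as their own colours.\<close>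

definition proper_paving_unit :: "(real^'n) set \<Rightarrow> bool" where
  "proper_paving_unit S \<longleftrightarrow> polytopal S \<and>
     (\<exists>T. open T \<and> closure S \<subseteq> T \<and>
        T \<subseteq> (\<Union>\<sigma>\<in>successive_reflections S T. \<sigma> ` closure S) \<and>
        (\<forall>\<sigma>\<in>successive_reflections S T. \<forall>\<tau>\<in>successive_reflections S T.
           \<sigma> ` closure S \<noteq> \<tau> ` closure S \<longrightarrow>
           \<sigma> ` closure S \<inter> \<tau> ` closure S \<subseteq> \<Union>(skeleton S T)) \<and>
        (\<forall>E\<in>skeleton S T. \<exists>!F. F \<in> facets S \<and> (\<exists>\<sigma>\<in>successive_reflections S T. E = \<sigma> ` F)))"


section \<open>Derivatives and Sobolev spaces\<close>

definition partial :: "'n \<Rightarrow> (real^'n \<Rightarrow> complex) \<Rightarrow> real^'n \<Rightarrow> complex" where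
  "partial i f x = frechet_derivative f (at x) (axis i 1)"

definition grad :: "(real^'n \<Rightarrow> complex) \<Rightarrow> real^'n \<Rightarrow> complex^'n" where
  "grad f x = (\<chi> i. partial i f x)"

definition laplacian :: "(real^'n \<Rightarrow> complex) \<Rightarrow> real^'n \<Rightarrow> complex" where
  "laplacian f x = (\<Sum>i\<in>UNIV. partial i (partial i f) x)"

text \<open>\<open>m\<close> times continuous differentiability, for open \<open>S\<close>.\<close>

primrec Ck_on :: "nat \<Rightarrow> (real^'n) set \<Rightarrow> (real^'n \<Rightarrow> complex) \<Rightarrow> bool" where
  "Ck_on 0 S f \<longleftrightarrow> continuous_on S f"
| "Ck_on (Suc m) S f \<longleftrightarrow> (\<forall>x\<in>S. f differentiable (at x)) \<and> (\<forall>i. Ck_on m S (partial i f))"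

definition test_function :: "(real^'n) set \<Rightarrow> (real^'n \<Rightarrow> complex) \<Rightarrow> bool" where
  "test_function S \<phi> \<longleftrightarrow>
     (\<forall>m. Ck_on m UNIV \<phi>) \<and> compact (closure {x. \<phi> x \<noteq> 0}) \<and> closure {x. \<phi> x \<noteq> 0} \<subseteq> S"

text \<open>The bilinear product, without complex conjugation.\<close>

definition cdot :: "complex^'n \<Rightarrow> complex^'n \<Rightarrow> complex" where
  "cdot x y = (\<Sum>i\<in>UNIV. x $ i * y $ i)"

definition cmat :: "real^'n^'m \<Rightarrow> complex^'n^'m" where
  "cmat A = (\<chi> i j. complex_of_real (A $ i $ j))"

definition L2_on :: "(real^'n) set \<Rightarrow> (real^'n \<Rightarrow> 'b::euclidean_space) \<Rightarrow> bool" where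
  "L2_on S f \<longleftrightarrow> f \<in> borel_measurable (lebesgue_on S) \<and>
     integrable (lebesgue_on S) (\<lambda>x. (norm (f x))\<^sup>2)"

text \<open>\<open>u\<close> is in \<open>H\<^sup>1(S)\<close> with weak gradient \<open>G\<close>.\<close>

definition has_H1_gradient ::
    "(real^'n) set \<Rightarrow> (real^'n \<Rightarrow> complex) \<Rightarrow> (real^'n \<Rightarrow> complex^'n) \<Rightarrow> bool" where
  "has_H1_gradient S u G \<longleftrightarrow> L2_on S u \<and> L2_on S G \<and>
     (\<forall>\<phi> i. test_function S \<phi> \<longrightarrow>
        (\<integral>x. u x * partial i \<phi> x \<partial>lebesgue_on S) = - (\<integral>x. G x $ i * \<phi> x \<partial>lebesgue_on S))"

text \<open>The trace of the \<open>H\<^sup>1\<close> function \<open>u\<close> (with weak gradient \<open>G\<close>) vanishes on the boundary: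
  \<open>u\<close> is in \<open>H\<^sup>1\<^sub>0(S)\<close>, the closure of the test functions in \<open>H\<^sup>1(S)\<close>.\<close>

definition zero_trace ::
    "(real^'n) set \<Rightarrow> (real^'n \<Rightarrow> complex) \<Rightarrow> (real^'n \<Rightarrow> complex^'n) \<Rightarrow> bool" where
  "zero_trace S u G \<longleftrightarrow> has_H1_gradient S u G \<and>
     (\<exists>\<phi>. (\<forall>n::nat. test_function S (\<phi> n)) \<and>
        (\<lambda>n. \<integral>x. (norm (\<phi> n x - u x))\<^sup>2 + (norm (grad (\<phi> n) x - G x))\<^sup>2 \<partial>lebesgue_on S)
          \<longlonglongrightarrow> 0)"

definition has_weak_div ::
    "(real^'n) set \<Rightarrow> (real^'n \<Rightarrow> complex^'n) \<Rightarrow> (real^'n \<Rightarrow> complex) \<Rightarrow> bool" where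
  "has_weak_div S V f \<longleftrightarrow>
     (\<forall>\<phi>. test_function S \<phi> \<longrightarrow>
        (\<integral>x. cdot (V x) (grad \<phi> x) \<partial>lebesgue_on S) = - (\<integral>x. f x * \<phi> x \<partial>lebesgue_on S))"

text \<open>For \<open>V\<close> in \<open>L\<^sup>2\<close> with divergence \<open>f\<close> in \<open>L\<^sup>2\<close>, the normal component of \<open>V\<close> on the boundary is
  the functional on traces of \<open>H\<^sup>1\<close> functions given by Green's formula; \<open>normal_trace S V f \<psi> H\<close>
  is the duality product of \<open>\<nu> \<bullet> V\<close> and the trace of \<open>\<psi>\<close>, where \<open>H\<close> is the weak gradient of \<open>\<psi>\<close>.\<close>

definition normal_trace ::
    "(real^'n) set \<Rightarrow> (real^'n \<Rightarrow> complex^'n) \<Rightarrow> (real^'n \<Rightarrow> complex) \<Rightarrow>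
     (real^'n \<Rightarrow> complex) \<Rightarrow> (real^'n \<Rightarrow> complex^'n) \<Rightarrow> complex" where
  "normal_trace S V f \<psi> H = (\<integral>x. cdot (V x) (H x) + f x * \<psi> x \<partial>lebesgue_on S)"


section \<open>Scattering\<close>

text \<open>The surface integral over the sphere \<open>|x| = R\<close>, in polar coordinates: the surface measure
  of a subset of the unit sphere is \<open>d\<close> times the volume of the cone over it in the unit ball.\<close>

definition sphere_integral :: "real \<Rightarrow> (real^'n \<Rightarrow> real) \<Rightarrow> real" where
  "sphere_integral R f = real CARD('n) * R ^ (CARD('n) - 1) *
     (\<integral>x. f ((R / norm x) *\<^sub>R x) \<partial>lebesgue_on (ball 0 1 - {0}))"

definition radial_derivative :: "(real^'n \<Rightarrow> complex) \<Rightarrow> real^'n \<Rightarrow> complex" where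
  "radial_derivative f x = frechet_derivative f (at x) (x /\<^sub>R norm x)"

text \<open>\<open>u\<close> is determined only almost everywhere, so the condition refers to its continuously
  differentiable representative near infinity, which exists for solutions of the Helmholtz
  equation by interior regularity.\<close>

definition radiation_condition :: "real \<Rightarrow> (real^'n \<Rightarrow> complex) \<Rightarrow> bool" where
  "radiation_condition k u \<longleftrightarrow>
     (\<exists>R0>0. \<exists>w. Ck_on 1 {x. norm x > R0} w \<and>
        (AE x in lebesgue_on {x. norm x > R0}. u x = w x) \<and>
        ((\<lambda>R. sphere_integral R
            (\<lambda>x. (cmod (radial_derivative w x - \<i> * of_real k * w x))\<^sup>2)) \<longlongrightarrow> 0) at_top)"

definition incident_field :: "real \<Rightarrow> (real^'n) set \<Rightarrow> (real^'n \<Rightarrow> complex) \<Rightarrow> bool" where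
  "incident_field k T ui \<longleftrightarrow> open_domain T \<and> Ck_on 2 T ui \<and>
     (\<forall>x\<in>T. laplacian ui x + of_real (k\<^sup>2) * ui x = 0) \<and> (\<exists>x\<in>T. ui x \<noteq> 0)"

definition scattered_field ::
    "(real^'n \<Rightarrow> real^'n^'n) \<Rightarrow> (real^'n \<Rightarrow> real) \<Rightarrow> real \<Rightarrow> (real^'n) set \<Rightarrow>
     (real^'n \<Rightarrow> complex) \<Rightarrow> (real^'n \<Rightarrow> complex) \<Rightarrow> bool" where
  "scattered_field A q k T ui us \<longleftrightarrow>
     (let u0 = (\<lambda>x. if x \<in> T then ui x else 0);
          G0 = (\<lambda>x. if x \<in> T then grad ui x else 0) in
      \<exists>G. (\<forall>D. open_domain D \<and> bounded D \<longrightarrow> has_H1_gradient D us G) \<and>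
        (\<forall>\<phi>. test_function UNIV \<phi> \<longrightarrow>
           - (\<integral>x. cdot (cmat (A x) *v G x) (grad \<phi> x) \<partial>lebesgue)
             + of_real (k\<^sup>2) * (\<integral>x. of_real (q x) * us x * \<phi> x \<partial>lebesgue)
           = (\<integral>x. cdot (cmat (A x - mat 1) *v G0 x) (grad \<phi> x) \<partial>lebesgue)
             - of_real (k\<^sup>2) * (\<integral>x. of_real (q x - 1) * u0 x * \<phi> x \<partial>lebesgue)) \<and>
        radiation_condition k us)"

definition nonscattering_frequencies ::
    "(real^'n) set \<Rightarrow> (real^'n \<Rightarrow> real^'n^'n) \<Rightarrow> (real^'n \<Rightarrow> real) \<Rightarrow> real set" where
  "nonscattering_frequencies S A q =
     {k. k > 0 \<and> (\<exists>T ui us. closure S \<subseteq> T \<and> incident_field k T ui \<and>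
        scattered_field A q k T ui us \<and> (AE x in lebesgue_on (- S). us x = 0))}"


section \<open>Eigenvalue problems\<close>

definition transmission_eigenfrequencies ::
    "(real^'n) set \<Rightarrow> (real^'n \<Rightarrow> real^'n^'n) \<Rightarrow> (real^'n \<Rightarrow> real) \<Rightarrow> real set" where
  "transmission_eigenfrequencies S A q =
     {k. k > 0 \<and> (\<exists>u v Gu Gv. has_H1_gradient S u Gu \<and> has_H1_gradient S v Gv \<and>
        \<not> (AE x in lebesgue_on S. u x = 0 \<and> v x = 0) \<and>
        has_weak_div S (\<lambda>x. cmat (A x) *v Gu x) (\<lambda>x. - of_real (k\<^sup>2 * q x) * u x) \<and>
        has_weak_div S Gv (\<lambda>x. - of_real (k\<^sup>2) * v x) \<and>
        zero_trace S (\<lambda>x. u x - v x) (\<lambda>x. Gu x - Gv x) \<and>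
        (\<forall>\<psi> H. has_H1_gradient S \<psi> H \<longrightarrow>
           normal_trace S (\<lambda>x. cmat (A x) *v Gu x) (\<lambda>x. - of_real (k\<^sup>2 * q x) * u x) \<psi> H
           = normal_trace S Gv (\<lambda>x. - of_real (k\<^sup>2) * v x) \<psi> H))}"

definition dirichlet_eigenfrequencies :: "(real^'n) set \<Rightarrow> real set" where
  "dirichlet_eigenfrequencies S =
     {k. k > 0 \<and> (\<exists>w G. has_H1_gradient S w G \<and> \<not> (AE x in lebesgue_on S. w x = 0) \<and>
        has_weak_div S G (\<lambda>x. - of_real (k\<^sup>2) * w x) \<and> zero_trace S w G)}"

definition neumann_eigenfrequencies :: "(real^'n) set \<Rightarrow> real set" where
  "neumann_eigenfrequencies S =
     {k. k > 0 \<and> (\<exists>w G. has_H1_gradient S w G \<and> \<not> (AE x in lebesgue_on S. w x = 0) \<and>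
        has_weak_div S G (\<lambda>x. - of_real (k\<^sup>2) * w x) \<and>
        (\<forall>\<psi> H. has_H1_gradient S \<psi> H \<longrightarrow>
           normal_trace S G (\<lambda>x. - of_real (k\<^sup>2) * w x) \<psi> H = 0))}"

end

(* If (u, v) solves the transmission problem, then u - v satisfies the Dirichlet problem and a u - v
   the Neumann problem, and conversely; a non-scattering u_i gives such a pair, because u_i cannot
   vanish on Omega by unique continuation. It remains to extend an eigenfunction w to a solution near
   the closure of Omega. Extend it by reflections, with a sign change in the Dirichlet case; this is
   well defined as colours are unique. Integrating the extension against a test function phi folds
   phi to the sum of the eps(sigma) (phi o sigma) over the isometries sigma of the paving. On each
   facet the terms of sigma and of its mirror image cancel, so the folded function has zero trace, or
   zero normal derivative, and is an admissible test function for w. Hence the extension is a weak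
   solution, and smooth by Weyl's lemma. *)
theory Submission
  imports Defs
begin

text \<open>As A = a Id and q = a share one constant, u and v solve the same Helmholtz equation in
  \<Omega>; a survives only in the matching of normal derivatives. A Neumann eigenfunction gives the
  scattered field 0. A Dirichlet eigenfunction w, extended by zero, is itself the scattered field,
  and the incident field is a / (1 - a) times the smooth extension of w, the factor that balances
  the weak form. Eigenfunctions are not controlled at edges and corners, where tiles may meet in
  complicated patterns. So the extension is not matched across faces: it is a sum over isometries,
  the folded test function carries the boundary information, and edges enter only by the small
  volume of their neighbourhoods. To be excluded is a symmetry of \<Omega> that makes one tile the
  image under two isometries: the tile would count twice, possibly with opposite signs. Weyl's lemma
  and unique continuation rest on one compactly supported radial kernel: convolution with it
  multiplies every solution by a constant independent of the radius. Its construction is the same in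
  all dimensions and avoids Bessel functions.\<close>

type_synonym 'n fn = "real^'n => complex"

abbreviation lebI :: "(real^'n => 'b) => 'b::{banach, second_countable_topology}" (binder "LI " 10)
  where "lebI f == integral\<^sup>L lebesgue f"

abbreviation LIO :: "(real^'n) set => (real^'n => 'b) => 'b::{banach, second_countable_topology}"
  where "LIO S f == integral\<^sup>L (lebesgue_on S) f"

abbreviation LM :: "(real^'n => 'b::topological_space) set" where "LM == borel_measurable lebesgue"

abbreviation Lint :: "(real^'n => 'b::{banach, second_countable_topology}) => bool"
  where "Lint f == integrable lebesgue f"

abbreviation AE_leb :: "(real^'n => bool) => bool" (binder "AEL " 10)
  where "AE_leb p == AE x in lebesgue. p x"

abbreviation sumU :: "('i::finite => 'b) => 'b::comm_monoid_add" (binder "SU " 10) where "sumU f == sum f UNIV"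

notation inner (infixl "*." 70) and scaleR (infixr "*R" 75)

abbreviation iff_ascii (infixr "<->" 25) where "p <-> r == (p = r)"

abbreviation LIMSEQ_ascii (infixr "--->" 60) where "f ---> l == LIMSEQ f l"

notation has_real_derivative (infix "hrd" 50)

abbreviation "hrefl == hyperplane_reflection"
abbreviation "test == test_function"
abbreviation "NT == normal_trace"
abbreviation "H1G == has_H1_gradient"
abbreviation "WD == has_weak_div"

lemmas Bintegral_sum = Bochner_Integration.integral_sum
lemmas Bintegral_cong = Bochner_Integration.integral_cong
lemmas Bintegral_add = Bochner_Integration.integral_add
lemmas Bintegral_diff = Bochner_Integration.integral_diff
lemmas Bintegrable_add = Bochner_Integration.integrable_add
lemmas Bintegrable_sum = Bochner_Integration.integrable_sum

section \<open>Calculus of smooth functions\<close>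

text \<open>The derivative is an existential witness rather than \<open>deriv f\<close>, so an
  instance is proved by naming a formula that is valid on S.\<close>

primrec Dk :: "nat => real set => (real => real) => bool" where
 "Dk 0 S f <-> continuous_on S f"
| "Dk (Suc m) S f <-> (EX f'. (ALL x:S. (f hrd f' x) (at x)) & Dk m S f')"

lemma Dk_cong:
 assumes "open S" "!!x. x : S ==> f x = g x" "Dk m S f"
 shows "Dk m S g"
proof (cases m)
 case 0
 with assms show ?thesis using continuous_on_cong by force
next
 case (Suc k)
 with assms(3) obtain f' where f': "ALL x:S. (f hrd f' x) (at x)" "Dk k S f'" by auto
 have "(g hrd f' x) (at x)" if "x : S" for x
  using f'(1) that assms by (meson has_field_derivative_transform_within_open)
 with f'(2) Suc show ?thesis by auto
qed

lemma Dk_continuous: "Dk m S f ==> continuous_on S f"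
proof (cases m)
 case (Suc k)
 assume "Dk m S f"
 thus ?thesis unfolding Suc by (auto intro!: continuous_at_imp_continuous_on dest: DERIV_isCont)
qed auto

lemma Dk_Suc_imp: "Dk (Suc m) S f ==> Dk m S f"
proof (induction m arbitrary: f)
 case 0
 thus ?case using Dk_continuous by fastforce
next
 case (Suc m)
 thus ?case by (metis Dk.simps(2))
qed

lemma Dk_subset: "Dk m S f ==> T <= S ==> Dk m T f"
proof (induction m arbitrary: f)
 case 0
 thus ?case using continuous_on_subset by auto
next
 case (Suc m)
 from Suc.prems(1) obtain f' where "!!x. x\<in>S ==> (f hrd f' x) (at x)" "Dk m S f'" using Suc.prems by auto
 thus ?case using Suc by (auto intro!: exI[of _ f'])
qed

text \<open>On the overlap of the two open sets the derivatives agree by uniqueness, so they glue.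
  This handles a step times a power, which is zero near the singularity of the power.\<close>

lemma Dk_Un:
 assumes "open S" "open T" "Dk m S f" "Dk m T f"
 shows "Dk m (S Un T) f"
 using assms(3,4)
proof (induction m arbitrary: f)
 case 0
 thus ?case using assms(1,2) by (simp add: continuous_on_open_Un)
next
 case (Suc m)
 obtain f1 where f1: "!!x. x\<in>S ==> (f hrd f1 x) (at x)" "Dk m S f1"
  using Suc.prems by auto
 obtain f2 where f2: "!!x. x\<in>T ==> (f hrd f2 x) (at x)" "Dk m T f2"
  using Suc.prems by auto
 define h where "h x = (if x : S then f1 x else f2 x)" for x
 have "Dk m S h" by (rule Dk_cong[OF assms(1) _ f1(2)]) (simp add: h_def)
 moreover have "Dk m T h" by (rule Dk_cong[OF assms(2) _ f2(2)]) (auto simp add: h_def intro: DERIV_unique[OF f2(1) f1(1)])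
 ultimately have "Dk m (S Un T) h" by (rule Suc.IH)
 thus ?case using f1(1) f2(1) by (auto simp: h_def intro!: exI[of _ h])
qed

lemma Dk_const: "Dk m S (%x. c)" by (induction m arbitrary: c) (auto intro!: exI[of _ "%_. 0"])

lemma Dk_ident: "Dk m S (%x. x)" by (cases m) (auto intro!: exI[of _ "%_. 1"] Dk_const derivative_eq_intros)

lemma Dk_add: "Dk m S f ==> Dk m S g ==> Dk m S (%x. f x + g x)"
proof (induction m arbitrary: f g)
 case 0 thus ?case by (auto intro: continuous_on_add)
next
 case (Suc m)
 obtain f' g' where "!!x. x\<in>S ==> (f hrd f' x) (at x)" "Dk m S f'"
   "!!x. x\<in>S ==> (g hrd g' x) (at x)" "Dk m S g'" using Suc.prems by auto
 thus ?case using Suc.IH by (auto intro!: exI[of _ "%x. f' x + g' x"] derivative_intros)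
qed

lemma Dk_mult: "Dk m S f ==> Dk m S g ==> Dk m S (%x. f x * g x)"
proof (induction m arbitrary: f g)
 case 0 thus ?case by (auto intro: continuous_on_mult)
next
 case (Suc m)
 obtain f' g' where d: "!!x. x\<in>S ==> (f hrd f' x) (at x)" "Dk m S f'"
   "!!x. x\<in>S ==> (g hrd g' x) (at x)" "Dk m S g'" using Suc.prems by auto
 have "Dk m S f" "Dk m S g" using Suc.prems Dk_Suc_imp by blast+
 hence "Dk m S (%x. f' x * g x + g' x * f x)"
  using Suc.IH d by (auto intro!: Dk_add)
 thus ?case using d by (auto intro!: exI[of _ "%x. f' x * g x + g' x * f x"] derivative_eq_intros)
qed

lemma Dk_comp:
 assumes "g ` S <= T"
 shows "Dk m T f ==> Dk m S g ==> Dk m S (%x. f (g x))"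
proof (induction m arbitrary: f)
 case 0 thus ?case using assms by (auto intro: continuous_on_compose2)
next
 case (Suc m)
 obtain f' g' where d: "!!x. x\<in>T ==> (f hrd f' x) (at x)" "Dk m T f'"
   "!!x. x\<in>S ==> (g hrd g' x) (at x)" "Dk m S g'" using Suc.prems by auto
 have "Dk m S g" using Suc.prems Dk_Suc_imp by blast
 hence "Dk m S (%x. f' (g x) * g' x)"
  using Suc.IH d by (auto intro!: Dk_mult)
 moreover have "((%x. f (g x)) hrd f' (g x) * g' x) (at x)" if "x : S" for x
  using d(1,3) that assms by (intro DERIV_chain2) auto
 ultimately show ?case by (auto intro!: exI[of _ "%x. f' (g x) * g' x"])
qed

lemma Dk_powr: "Dk m {0<..} (%x. x powr a)"
proof (induction m arbitrary: a)
 case 0 thus ?case by (auto intro!: continuous_intros)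
next
 case (Suc m)
 have "Dk m {0<..} (%x. a * x powr (a - 1))" by (intro Dk_mult Dk_const Suc)
 thus ?case by (auto intro!: exI[of _ "%x. a * x powr (a - 1)"] derivative_eq_intros)
qed

section \<open>A flat function and a smooth step\<close>

definition exp_inv :: "nat => real => real" where
 "exp_inv j x = (if x > 0 then exp (- inverse x) * inverse x ^ j else 0)"

text \<open>The series term of order j + 2 bounds exp y from below for y = 1 / x. The two spare
  powers of y become x^2, enough for the derivative 0 at the origin.\<close>

lemma exp_inv_bound:
 fixes x :: real assumes "x > 0" shows "exp (- inverse x) * inverse x ^ j <= fact (j + 2) * x^2"
proof -
 define y where "y = inverse x"
 have y: "y > 0" using assms unfolding y_def by (rule positive_imp_inverse_positive)
 have "y ^ (j+2) / fact (j+2) <= exp y"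
  using exp_lower_Taylor_quadratic[of y] sum_le_suminf[of "%n. y^n /\<^sub>R fact n" "{j+2}"] summable_exp_generic[of y] y
  by (simp add: exp_def field_simps)
 hence "y ^ (j+2) <= fact (j+2) * exp y" by (simp only: pos_divide_le_eq fact_gt_zero mult.commute)
 hence "exp (-y) * y ^ (j + 2) <= fact (j+2)" by (simp add: exp_minus field_simps)
 hence "exp (-y) * y ^ j * y^2 <= fact (j+2)" by (simp add: power_add mult.assoc del: fact_Suc add_2_eq_Suc')
 hence "exp (-y) * y ^ j * y^2 * x^2 <= fact (j+2) * x^2" by (rule mult_right_mono) simp
 moreover have "y^2 * x^2 = 1" using assms by (simp add: y_def field_simps)
 ultimately show ?thesis by (simp add: y_def mult.assoc del: fact_Suc add_2_eq_Suc')
qed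

text \<open>The functions exp (-1 / x) / x^j are closed under differentiation up to linear
  combinations; carrying the index j makes the induction on the order of differentiability
  work.\<close>

lemma exp_inv_deriv: "(exp_inv j hrd exp_inv (j + 2) x - j * exp_inv (j + 1) x) (at x)"
proof -
 consider "x > 0" | "x < 0" | "x = 0" by linarith
 thus ?thesis
 proof cases
  case 1
  have "((%x. exp (- inverse x) * inverse x ^ j) hrd
   exp_inv (j + 2) x - j * exp_inv (j + 1) x) (at x)"
  proof (rule DERIV_cong)
   show "((%x. exp (- inverse x) * inverse x ^ j) hrd
   exp (- inverse x) * (real j * inverse x ^ (j - 1) * - (inverse x * inverse x)) + exp (- inverse x) * (inverse x * inverse x) * inverse x ^ j) (at x)"
   using 1 by (auto intro!: derivative_eq_intros)
  qed (use 1 in "cases j; simp add: exp_inv_def algebra_simps")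
  thus ?thesis by (rule has_field_derivative_transform_within_open[of _ _ _ "{0<..}"]) (use 1 in "auto simp: exp_inv_def")
 next
  case 2
  have "((%x. 0) hrd exp_inv (j + 2) x - j * exp_inv (j + 1) x) (at x)"
   using 2 by (auto simp: exp_inv_def)
  thus ?thesis by (rule has_field_derivative_transform_within_open[of _ _ _ "{..<0}"]) (use 2 in "auto simp: exp_inv_def")
 next
  case 3
  define c :: real where "c = fact (j + 2)"
  have le: "\<bar>exp_inv j h\<bar> <= c * \<bar>h\<bar> * \<bar>h\<bar>" for h
   using exp_inv_bound[of h j, folded c_def] by (cases "h > 0") (simp_all add: exp_inv_def power2_eq_square mult.assoc c_def)
  have q: "\<bar>exp_inv j h / h\<bar> <= c * \<bar>h\<bar>" for h
  proof (cases "h = 0")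
   case False
   thus ?thesis using divide_right_mono[OF le[of h], of "\<bar>h\<bar>"] by simp
  qed simp
  have "((%h. exp_inv j h / h) \<longlongrightarrow> 0) (at 0)"
  proof (rule Lim_null_comparison[of _ "%h. c * \<bar>h\<bar>"])
   show "((%h. c * \<bar>h\<bar>) \<longlongrightarrow> 0) (at 0)" by (auto intro!: tendsto_eq_intros)
  qed (rule always_eventually, use q in auto)
  thus ?thesis using 3 by (simp add: DERIV_def exp_inv_def)
 qed
qed

lemma Dk_exp_inv: "Dk m S (exp_inv j)"
proof (induction m arbitrary: j)
 case 0
 show ?case using exp_inv_deriv by (auto intro!: continuous_at_imp_continuous_on DERIV_isCont)
next
 case (Suc m)
 have "Dk m S (%x. exp_inv (j + 2) x + (- real j) * exp_inv (j + 1) x)" by (intro Dk_add Dk_mult Dk_const Suc)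
 thus ?case using exp_inv_deriv[of j] by (auto intro!: exI[of _ "%x. exp_inv (j + 2) x - real j * exp_inv (j + 1) x"])
qed

text \<open>Integration starts at a - 1, inside the region where f vanishes: F is zero up to a, and
  every x >= a is interior to an interval on which the fundamental theorem applies.\<close>

lemma antiderivative_pos:
 fixes f :: "real => real"
 assumes "continuous_on UNIV f" "a >= 0" "!!x. x <= a ==> f x = 0"
 obtains F where "!!x. (F hrd f x) (at x)" "!!x. x <= a ==> F x = 0"
proof
 define b where "b = a - 1"
 define F where "F x = integral {b..x} f" for x
 have z: "F x = 0" if "x <= a" for x
 proof -
  have "F x = integral {b..x} (%x. 0)" unfolding F_def using that assms(3) by (intro integral_cong) auto
  thus ?thesis by simp
 qed
 thus "F x = 0" if "x <= a" for x using that by simp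
 show "(F hrd f x) (at x)" for x
 proof (cases "x < a")
  case True
  have "((%x. 0) hrd f x) (at x)" using True assms by auto
  thus ?thesis by (rule has_field_derivative_transform_within_open[of _ _ _ "{..<a}"]) (use z True in auto)
 next
  case False
  have "(F hrd f x) (at x within {b..x+1})" unfolding F_def
   using False continuous_on_subset[OF assms(1) subset_UNIV] by (intro integral_has_real_derivative) (auto simp: b_def)
  moreover have "x : interior {b..x+1}" using False by (simp add: b_def)
  ultimately show ?thesis by (metis at_within_interior)
 qed
qed

text \<open>The derivative is a normalised product of two flat functions, one for each end of the
  interval. The ends 1/4 and 1 are the squares of 1/2 and 1, as the argument will be a squared norm.
  Strict positivity in between later makes the kernel positive somewhere.\<close>

lemma smooth_step_exists:
 "EX th th'. (ALL m. Dk m UNIV th) & (ALL m. Dk m UNIV th') & (ALL x. (th hrd th' x) (at x)) &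
   (ALL x. 0 <= th' x) & (ALL x. x <= 1/4 --> th x = 0 & th' x = 0) & (ALL x. x >= 1 --> th x = 1 & th' x = 0) &
   (ALL x. 1/4 < x & x < 1 --> th' x > 0)"
proof -
 define b where "b x = exp_inv 0 (-1/4 + 1 * x) * exp_inv 0 (1 + -1 * x)" for x
 have bD: "Dk m UNIV b" for m
 proof -
  have "Dk m UNIV (%x. exp_inv 0 (c + d * x))" for c d
   by (rule Dk_comp[where T=UNIV and f="exp_inv 0", OF _ Dk_exp_inv Dk_add[OF Dk_const Dk_mult[OF Dk_const Dk_ident]]]) simp
  from Dk_mult[OF this[of "-1/4" 1] this[of 1 "-1"]] show ?thesis unfolding b_def .
 qed
 have b0: "b x = 0" if "x <= 1/4" for x using that by (simp add: b_def exp_inv_def)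
 have b1: "b x = 0" if "x >= 1" for x using that by (simp add: b_def exp_inv_def)
 have bp: "b x > 0" if "1/4 < x" "x < 1" for x using that by (simp add: b_def exp_inv_def)
 have bn: "b x >= 0" for x by (simp add: b_def exp_inv_def)
 obtain F where F: "!!x. (F hrd b x) (at x)" "!!x. x <= 1/4 ==> F x = 0"
  using antiderivative_pos[of b "1/4"] bD[of 0] b0 by auto
 have Fcont: "continuous_on S F" for S
  using F(1) by (meson DERIV_isCont continuous_at_imp_continuous_on)
 have Fc: "F x = F 1" if "x >= 1" for x
 proof (cases "x = 1")
  case False
  have "DERIV F y :> 0" if "1 < y" for y using F(1)[of y] b1[of y] that by simp
  thus ?thesis using DERIV_isconst2[of 1 x F x] Fcont that False by auto
 qed simp
 have "EX y. DERIV F x :> y & y > 0" if "1/4 < x" "x < 1" for x using F(1)[of x] bp[OF that] by blast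
 hence "F (1/4) < F 1" using DERIV_pos_imp_increasing_open[of "1/4" 1 F] Fcont by simp
 hence F1: "F 1 > 0" using F(2) by simp
 define th where "th x = F x * (1 / F 1)" for x
 define th' where "th' x = b x * (1 / F 1)" for x
 have d: "(th hrd th' x) (at x)" for x
  unfolding th_def th'_def by (rule DERIV_cmult_right[OF F(1)])
 have D': "Dk m UNIV th'" for m unfolding th'_def by (intro Dk_mult bD Dk_const)
 have D: "Dk m UNIV th" for m
 proof -
  have "Dk (Suc m) UNIV th" using d D' by auto
  thus ?thesis by (rule Dk_Suc_imp)
 qed
 have "0 <= th' x" for x using F1 bn[of x] by (simp add: th'_def)
 moreover have "th x = 0 & th' x = 0" if "x <= 1/4" for x
  using F(2)[OF that] b0[OF that] by (simp add: th_def th'_def)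
 moreover have "th x = 1 & th' x = 0" if "x >= 1" for x
  using F1 Fc[OF that] b1[OF that] by (simp add: th_def th'_def)
 moreover have "th' x > 0" if "1/4 < x & x < 1" for x using F1 bp[of x] that by (simp add: th'_def)
 ultimately show ?thesis
  using d D D' by (intro exI[of _ th] exI[of _ th']) blast
qed

definition smooth_step :: "real => real" where
 "smooth_step = (SOME th. EX th'. (ALL m. Dk m UNIV th) & (ALL m. Dk m UNIV th') & (ALL x. (th hrd th' x) (at x)) &
   (ALL x. 0 <= th' x) & (ALL x. x <= 1/4 --> th x = 0 & th' x = 0) & (ALL x. x >= 1 --> th x = 1 & th' x = 0) &
   (ALL x. 1/4 < x & x < 1 --> th' x > 0))"

definition smooth_step' :: "real => real" where "smooth_step' = deriv smooth_step"

lemma smooth_step: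
 shows Dk_smooth_step: "Dk m UNIV smooth_step" and Dk_smooth_step': "Dk m UNIV smooth_step'"
  and smooth_step_deriv: "(smooth_step hrd smooth_step' x) (at x)"
  and smooth_step'_nonneg: "0 <= smooth_step' x"
  and smooth_step_0: "x <= 1/4 ==> smooth_step x = 0" and smooth_step'_0: "x <= 1/4 ==> smooth_step' x = 0"
  and smooth_step_1: "x >= 1 ==> smooth_step x = 1" and smooth_step'_1: "x >= 1 ==> smooth_step' x = 0"
  and smooth_step'_pos: "1/4 < x ==> x < 1 ==> smooth_step' x > 0"
proof -
 obtain th' where *: "(ALL m. Dk m UNIV smooth_step) & (ALL m. Dk m UNIV th') & (ALL x. (smooth_step hrd th' x) (at x)) &
   (ALL x. 0 <= th' x) & (ALL x. x <= 1/4 --> smooth_step x = 0 & th' x = 0) & (ALL x. x >= 1 --> smooth_step x = 1 & th' x = 0) &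
   (ALL x. 1/4 < x & x < 1 --> th' x > 0)"
  unfolding smooth_step_def using someI_ex[OF smooth_step_exists] by blast
 hence "smooth_step' = th'" unfolding smooth_step'_def using DERIV_imp_deriv by blast
 with * show "Dk m UNIV smooth_step" "Dk m UNIV smooth_step'" "(smooth_step hrd smooth_step' x) (at x)"
  "0 <= smooth_step' x" "x <= 1/4 ==> smooth_step x = 0" "x <= 1/4 ==> smooth_step' x = 0"
  "x >= 1 ==> smooth_step x = 1" "x >= 1 ==> smooth_step' x = 0" "1/4 < x ==> x < 1 ==> smooth_step' x > 0" by auto
qed

lemma smooth_step_mono: "x <= y ==> smooth_step x <= smooth_step y"
 by (rule DERIV_nonneg_imp_nondecreasing) (use smooth_step_deriv smooth_step'_nonneg in auto)

lemma smooth_step_nonneg: "0 <= smooth_step x" by (metis smooth_step_0 smooth_step_mono le_cases)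

lemma smooth_step_le_1: "smooth_step x <= 1" by (metis smooth_step_1 smooth_step_mono le_cases)

section \<open>Partial derivatives and the classes \<open>Ck_on\<close>\<close>

lemma partial_cong:
 assumes "open S" "x : S" "!!y. y : S ==> f y = g y"
 shows "partial i f x = partial i g x"
proof -
 have "(f has_derivative f') (at x) <-> (g has_derivative f') (at x)" for f'
  using has_derivative_transform_within_open[of f f' x UNIV S g] assms
   has_derivative_transform_within_open[of g f' x UNIV S f] by auto
 thus ?thesis unfolding partial_def frechet_derivative_def by simp
qed

lemma partial_eq: "(f has_derivative f') (at x) ==> partial i f x = f' (axis i 1)"
 unfolding partial_def using frechet_derivative_at by fastforce

lemma has_derivative_partial:
 fixes f :: "'n::finite fn"
 assumes "f differentiable (at x)"
 shows "(f has_derivative (%h. SU i. (h $ i) *R partial i f x)) (at x)"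
proof -
 have "linear (frechet_derivative f (at x))" using assms by (rule linear_frechet_derivative)
 hence "frechet_derivative f (at x) h = (SU i. (h $ i) *R partial i f x)" for h
  unfolding partial_def by (subst basis_expansion[of h, symmetric, unfolded scalar_mult_eq_scaleR]) (simp add: linear_sum linear_cmul)
 hence "frechet_derivative f (at x) = (%h. SU i. (h $ i) *R partial i f x)" by auto
 with assms show ?thesis using frechet_derivative_works by metis
qed

lemma Ck_on_cong:
 assumes "open S" "!!x. x : S ==> f x = g x" "Ck_on m S f"
 shows "Ck_on m S g"
 using assms(2,3)
proof (induction m arbitrary: f g)
 case 0 thus ?case using continuous_on_cong by force
next
 case (Suc m)
 have "g differentiable (at x)" if "x : S" for x
 proof -
  have "f differentiable (at x)" using Suc.prems(2) that by simp
  then obtain D where "(f has_derivative D) (at x)" unfolding differentiable_def by blast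
  hence "(g has_derivative D) (at x)"
   using has_derivative_transform_within_open[of f D x UNIV S g] assms(1) that Suc.prems(1) by auto
  thus ?thesis by (rule differentiableI)
 qed
 moreover have "Ck_on m S (partial i g)" for i
 proof (rule Suc.IH)
  show "partial i f x = partial i g x" if "x : S" for x
   using partial_cong[OF assms(1) that, of f g] Suc.prems(1) by blast
  show "Ck_on m S (partial i f)" using Suc.prems(2) by simp
 qed
 ultimately show ?case by simp
qed

lemma Ck_on_continuous: "Ck_on m S f ==> continuous_on S f"
 by (cases m) (auto intro!: continuous_at_imp_continuous_on differentiable_imp_continuous_within)

lemma Ck_on_Suc_imp: "Ck_on (Suc m) S f ==> Ck_on m S f"
proof (induction m arbitrary: f)
 case 0 thus ?case using Ck_on_continuous by (metis Ck_on.simps(1))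
next
 case (Suc m) thus ?case by (metis Ck_on.simps(2))
qed

lemma Ck_on_mono: "m <= k ==> Ck_on k S f ==> Ck_on m S f" by (induction rule: inc_induct) (use Ck_on_Suc_imp in blast)+

lemma Ck_on_subset: "Ck_on m S f ==> T <= S ==> Ck_on m T f"
proof (induction m arbitrary: f)
 case 0 thus ?case using continuous_on_subset by auto
qed auto

lemma Ck_on_SucI:
 assumes "open S" "!!x. x : S ==> (f has_derivative f' x) (at x)"
  "!!i. Ck_on m S (%x. f' x (axis i 1))"
 shows "Ck_on (Suc m) S f"
proof -
 have "Ck_on m S (partial i f)" for i by (rule Ck_on_cong[OF assms(1) _ assms(3)]) (use assms(2) partial_eq in fastforce)
 thus ?thesis using assms(2) by (auto intro: differentiableI)
qed

lemma Ck_on_const: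
 fixes S :: "(real^'n) set" shows "Ck_on m S (%x. c)"
proof (induction m arbitrary: c)
 case (Suc m)
 have "partial i (%x::real^'n. c) = (%x. 0)" for i c by (simp add: partial_def fun_eq_iff)
 thus ?case using Suc by auto
qed auto

lemma Ck_on_add:
 assumes "open S" shows "Ck_on m S f ==> Ck_on m S g ==> Ck_on m S (%x. f x + g x)"
proof (induction m arbitrary: f g)
 case 0 thus ?case by (auto intro: continuous_on_add)
next
 case (Suc m)
 show ?case
 proof (rule Ck_on_SucI[OF assms])
  show "((%x. f x + g x) has_derivative (%h. (SU i. (h $ i) *R partial i f x) + (SU i. (h $ i) *R partial i g x))) (at x)"
   if "x : S" for x using Suc.prems that by (intro has_derivative_add has_derivative_partial) auto
  show "Ck_on m S (%x. (SUM ia:UNIV. axis i 1 $ ia *R partial ia f x) + (SUM ia:UNIV. axis i 1 $ ia *R partial ia g x))" for i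
   using Suc by (simp add: axis_def if_distrib[of "%a. a *R b" for b] cong: if_cong)
 qed
qed

lemma Ck_on_mult:
 assumes "open S" shows "Ck_on m S f ==> Ck_on m S g ==> Ck_on m S (%x. f x * g x)"
proof (induction m arbitrary: f g)
 case 0 thus ?case by (auto intro: continuous_on_mult)
next
 case (Suc m)
 have *: "Ck_on m S f" "Ck_on m S g" using Suc.prems Ck_on_Suc_imp by blast+
 show ?case
 proof (rule Ck_on_SucI[OF assms])
  show "((%x. f x * g x) has_derivative (%h. f x * (SU i. (h $ i) *R partial i g x) + (SU i. (h $ i) *R partial i f x) * g x)) (at x)"
   if "x : S" for x using Suc.prems that by (intro has_derivative_mult has_derivative_partial) auto
  show "Ck_on m S (%x. f x * (SU j. axis i 1 $ j *R partial j g x) + (SU j. axis i 1 $ j *R partial j f x) * g x)" for i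
   using Suc * by (auto simp: axis_def if_distrib[of "%a. a *R b" for b] cong: if_cong intro!: Ck_on_add assms)
 qed
qed

lemma partial_mult: "f differentiable at x ==> g differentiable at x ==>
  partial i (%x. f x * g x) x = f x * partial i g x + partial i f x * g x"
 by (subst partial_eq[OF has_derivative_mult[OF has_derivative_partial has_derivative_partial]])
   (auto simp: axis_def if_distrib[of "%a. a *R b" for b] cong: if_cong)

lemma partial_const: "partial i (%x. c) x = 0" by (simp add: partial_def)

lemma Ck_on_sum:
 assumes "open S" "!!j. j : J ==> Ck_on m S (f j)"
 shows "Ck_on m S (%x. SUM j:J. f j x)"
 using assms(2) by (induction J rule: infinite_finite_induct) (auto intro: Ck_on_const Ck_on_add assms(1))

lemma Ck_on_linear:
 assumes "bounded_linear l" "open S" shows "Ck_on m S l"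
proof (cases m)
 case 0 thus ?thesis using assms by (simp add: linear_continuous_on)
next
 case (Suc k)
 show ?thesis unfolding Suc by (rule Ck_on_SucI[OF assms(2) bounded_linear_imp_has_derivative[OF assms(1)]]) (rule Ck_on_const)
qed

lemma Ck_on_affine_comp:
 fixes f :: "real^'m => complex" and L :: "real^'n => real^'m"
 assumes "linear L" "open S" "open T" "!!x. x : S ==> L x + c : T"
 shows "Ck_on m T f ==> Ck_on m S (%x. f (L x + c))"
proof (induction m arbitrary: f)
 case 0
 have "continuous_on S (%x. L x + c)"
  using assms(1) by (intro continuous_on_add linear_continuous_on linear_conv_bounded_linear[THEN iffD1] continuous_on_const)
 thus ?case using 0 assms(4) by (auto intro!: continuous_on_compose2[of T f])
next
 case (Suc m)
 have bl: "bounded_linear L" by (rule linear_conv_bounded_linear[THEN iffD1, OF assms(1)])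
 show ?case
 proof (rule Ck_on_SucI[OF assms(2)])
  fix x assume "x : S"
  have 1: "((%x. L x + c) has_derivative L) (at x)"
   using bounded_linear_imp_has_derivative[OF bl] by (auto intro!: derivative_eq_intros)
  have 2: "(f has_derivative (%h. SU i. (h $ i) *R partial i f (L x + c))) (at (L x + c))"
   using Suc.prems assms(4) \<open>x : S\<close> by (intro has_derivative_partial) auto
  show "((%x. f (L x + c)) has_derivative (%h. SU i. (L h $ i) *R partial i f (L x + c))) (at x)"
   using diff_chain_at[OF 1 2] by (simp add: o_def)
 next
  fix i
  have "Ck_on m S (%x. partial j f (L x + c))" for j using Suc by auto
  thus "Ck_on m S (%x. SU j. L (axis i 1) $ j *R partial j f (L x + c))"
   unfolding scaleR_conv_of_real by (intro Ck_on_sum Ck_on_mult Ck_on_const assms(2))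
 qed
qed

lemma partial_affine_comp:
 fixes f :: "real^'m => complex" and L :: "real^'n => real^'m"
 assumes "linear L" "f differentiable (at (L x + c))"
 shows "partial i (%x. f (L x + c)) x = (SU j. L (axis i 1) $ j *R partial j f (L x + c))"
proof -
 have bl: "bounded_linear L" by (rule linear_conv_bounded_linear[THEN iffD1, OF assms(1)])
 have 1: "((%x. L x + c) has_derivative L) (at x)"
  using bounded_linear_imp_has_derivative[OF bl] by (auto intro!: derivative_eq_intros)
 show ?thesis
  using partial_eq[OF diff_chain_at[OF 1 has_derivative_partial[OF assms(2)]]] by (simp add: o_def)
qed

text \<open>\<open>Ck_on\<close> speaks of complex functions, so p enters through its embedding; its
  derivative is recovered by taking real parts.\<close>

lemma Ck_on_real_comp:
 fixes p :: "real^'n => real"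
 assumes "open S" "p ` S <= T"
 shows "Dk m T g ==> Ck_on m S (%x. of_real (p x)) ==> Ck_on m S (%x. of_real (g (p x)))"
proof (induction m arbitrary: g)
 case 0
 have "continuous_on S (%x. Re (of_real (p x)))" using 0 by (intro continuous_on_Re) simp
 hence "continuous_on S p" by simp
 thus ?case using 0 assms(2) by (auto intro!: continuous_on_of_real continuous_on_compose2[of T g])
next
 case (Suc m)
 obtain g' where g': "!!x. x\<in>T ==> (g hrd g' x) (at x)" "Dk m T g'" using Suc.prems by auto
 have m: "Ck_on m S (%x. of_real (p x))" using Suc.prems Ck_on_Suc_imp by blast
 let ?P = "%x. complex_of_real (p x)"
 show ?case
 proof (rule Ck_on_SucI[OF assms(1)])
  fix x assume x: "x : S"
  have "(?P has_derivative frechet_derivative ?P (at x)) (at x)" using Suc.prems x frechet_derivative_works by auto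
  hence "((%x. Re (?P x)) has_derivative (%h. Re (frechet_derivative ?P (at x) h))) (at x)"
   by (rule bounded_linear.has_derivative[OF bounded_linear_Re])
  hence p: "(p has_derivative (%h. Re (frechet_derivative ?P (at x) h))) (at x)" by simp
  hence pr: "((%x. ?P x) has_derivative (%h. of_real (Re (frechet_derivative ?P (at x) h)))) (at x)" by (rule has_derivative_of_real)
  hence eq: "frechet_derivative ?P (at x) = (%h. of_real (Re (frechet_derivative ?P (at x) h)))"
   using frechet_derivative_at by metis
  have "((%x. g (p x)) has_derivative (%h. g' (p x) * Re (frechet_derivative ?P (at x) h))) (at x)"
   using diff_chain_at[OF p g'(1)[of "p x", unfolded has_field_derivative_def]] x assms(2) by (auto simp: o_def)
  hence "((%x. complex_of_real (g (p x))) has_derivative (%h. complex_of_real (g' (p x) * Re (frechet_derivative ?P (at x) h)))) (at x)"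
   by (rule has_derivative_of_real)
  moreover have "(%h. complex_of_real (g' (p x) * Re (frechet_derivative ?P (at x) h))) = (%h. of_real (g' (p x)) * frechet_derivative ?P (at x) h)"
   by (subst (2) eq) simp
  ultimately show "((%x. complex_of_real (g (p x))) has_derivative (%h. of_real (g' (p x)) * frechet_derivative ?P (at x) h)) (at x)" by simp
 next
  show "Ck_on m S (%x. of_real (g' (p x)) * frechet_derivative ?P (at x) (axis i 1))" for i
   using Suc.IH[OF g'(2) m] Suc.prems by (intro Ck_on_mult assms(1)) (auto simp: partial_def[abs_def])
 qed
qed

lemma partial_real_comp:
 fixes p :: "real^'n => real"
 assumes "(p has_derivative p') (at x)" "(g hrd g') (at (p x))"
 shows "partial i (%x. complex_of_real (g (p x))) x = of_real (g' * p' (axis i 1))"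
proof -
 have "((%x. g (p x)) has_derivative (%h. g' * p' h)) (at x)"
  using diff_chain_at[OF assms(1) assms(2)[unfolded has_field_derivative_def]] by (simp add: o_def)
 hence "((%x. complex_of_real (g (p x))) has_derivative (%h. complex_of_real (g' * p' h))) (at x)" by (rule has_derivative_of_real)
 thus ?thesis by (rule partial_eq)
qed

section \<open>Test functions\<close>

definition smooth :: "(real^'n => complex) => bool" where
 "smooth f <-> (ALL m. Ck_on m UNIV f)"

lemma smooth_differentiable: "smooth f ==> f differentiable (at x)"
 unfolding smooth_def by (metis Ck_on.simps(2) UNIV_I)

lemma smooth_continuous: "smooth f ==> continuous_on S f"
 unfolding smooth_def by (metis Ck_on.simps(1) continuous_on_subset subset_UNIV)

lemma smooth_partial: "smooth f ==> smooth (partial i f)"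
 unfolding smooth_def by (metis Ck_on.simps(2))

lemma smooth_const: "smooth (%x. c)"
 unfolding smooth_def using Ck_on_const by blast

lemma smooth_add: "smooth f ==> smooth g ==> smooth (%x. f x + g x)"
 unfolding smooth_def by (simp add: Ck_on_add)

lemma smooth_mult: "smooth f ==> smooth g ==> smooth (%x. f x * g x)"
 unfolding smooth_def by (simp add: Ck_on_mult)

lemma smooth_diff: "smooth f ==> smooth g ==> smooth (%x. f x - g x)"
 using smooth_add[of f "%x. (-1) * g x"] smooth_mult[OF smooth_const, of g "-1"] by simp

lemma smooth_sum: "(!!j. j : J ==> smooth (f j)) ==> smooth (%x. SUM j:J. f j x)"
 unfolding smooth_def by (simp add: Ck_on_sum)

lemma smooth_comp_affine: "linear L ==> smooth f ==> smooth (%x. f (L x + c))"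
 unfolding smooth_def using Ck_on_affine_comp[of L UNIV UNIV c] by blast

lemma smooth_inner: "smooth (%x. of_real (a *. x))"
proof -
 have "bounded_linear (%x. complex_of_real (a *. x))" by (intro bounded_linear_compose[OF bounded_linear_of_real] bounded_linear_inner_right)
 thus ?thesis unfolding smooth_def using Ck_on_linear by blast
qed

lemma smooth_real_comp:
 assumes "!!m. Dk m UNIV g" "smooth (%x. of_real (p x))"
 shows "smooth (%x. of_real (g (p x)))"
 unfolding smooth_def using Ck_on_real_comp[of UNIV p UNIV] assms smooth_def by blast

lemma smooth_normsq: "smooth (%x::real^'n. of_real ((norm (x - a))^2))"
proof -
 have "(norm (x - a))^2 = (SU i. (axis i 1 *. x + (- a $ i)) * (axis i 1 *. x + (- a $ i)))" for x :: "real^'n"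
  by (simp add: power2_norm_eq_inner inner_vec_def[of "x - a"] inner_axis' )
 hence "(%x. complex_of_real ((norm (x - a))^2)) =
   (%x. SU i. (of_real (axis i 1 *. x) + of_real (- a $ i)) * (of_real (axis i 1 *. x) + of_real (- a $ i)))" by simp
 thus ?thesis by (simp only:) (intro smooth_sum smooth_mult smooth_add smooth_inner smooth_const)
qed

lemma partial_outside:
 fixes f :: "'n::finite fn"
 assumes "closed K" "!!x. x ~: K ==> f x = 0" "x ~: K"
 shows "partial i f x = 0"
proof -
 have "partial i f x = partial i (%x. 0) x" by (rule partial_cong[of "- K"]) (use assms in auto)
 thus ?thesis by (simp add: partial_const)
qed

lemma test_functionI:
 assumes "smooth f" "compact K" "K <= U" "!!x. x ~: K ==> f x = 0"
 shows "test U f"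
proof -
 have "closure {x. f x ~= 0} <= K" by (rule closure_minimal) (use assms compact_imp_closed in auto)
 moreover have "bounded {x. f x ~= 0}" by (rule bounded_subset[OF compact_imp_bounded[OF assms(2)]]) (use assms(4) in auto)
 ultimately show ?thesis
  using assms(1,3) unfolding test_function_def smooth_def by (simp add: compact_closure)
qed

lemma test_functionE:
 assumes "test U f"
 obtains K where "compact K" "K <= U" "!!x. x ~: K ==> f x = 0" "!!x i. x ~: K ==> partial i f x = 0"
proof
 let ?K = "closure {x. f x ~= 0}"
 show "compact ?K" "?K <= U" using assms by (auto simp: test_function_def)
 show *: "f x = 0" if "x ~: ?K" for x
  using closure_subset[of "{x. f x ~= 0}"] that by blast
 show "partial i f x = 0" if "x ~: ?K" for x i by (rule partial_outside[OF closed_closure * that])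
qed

lemma test_smooth: "test U f ==> smooth f" by (simp add: test_function_def smooth_def)

lemma test_mono: "test U f ==> U <= V ==> test V f" by (auto simp: test_function_def)

lemma test_partial:
 assumes "test U f" shows "test U (partial i f)"
proof -
 obtain K where "compact K" "K <= U" "!!x. x ~: K ==> f x = 0" "!!x i. x ~: K ==> partial i f x = 0"
  using test_functionE[OF assms] by blast
 thus ?thesis by (intro test_functionI[of _ K] smooth_partial test_smooth[OF assms])
qed

lemma test_mult_smooth:
 assumes "smooth g" "test U f" shows "test U (%x. g x * f x)"
proof -
 obtain K where "compact K" "K <= U" "!!x. x ~: K ==> f x = 0"
  using test_functionE[OF assms(2)] by metis
 thus ?thesis by (intro test_functionI[of _ K] smooth_mult assms test_smooth[OF assms(2)]) simp_all
qed

lemma test_mult_smooth': "test U f ==> smooth g ==> test U (%x. f x * g x)"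
 using test_mult_smooth[of g U f] by (simp add: mult.commute)

lemma test_cmult: "test U f ==> test U (%x. c * f x)"
 using test_mult_smooth[OF smooth_const] .

lemma test_zero: "test U (%x. 0)" by (rule test_functionI[of _ "{}"]) (auto intro: smooth_const)

lemma test_add:
 assumes "test U f" "test U g" shows "test U (%x. f x + g x)"
proof -
 obtain K where K: "compact K" "K <= U" "!!x. x ~: K ==> f x = 0" using test_functionE[OF assms(1)] by metis
 obtain L where L: "compact L" "L <= U" "!!x. x ~: L ==> g x = 0" using test_functionE[OF assms(2)] by metis
 show ?thesis by (rule test_functionI[OF smooth_add[OF test_smooth[OF assms(1)] test_smooth[OF assms(2)]] compact_Un[OF K(1) L(1)]])
   (use K L in auto)
qed

lemma test_sum: "(!!j. j : J ==> test U (f j)) ==> test U (%x. SUM j:J. f j x)"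
 by (induction J rule: infinite_finite_induct) (auto intro: test_zero test_add)

lemma test_comp_affine:
 assumes "linear L" "linear L'" "!!x. L (L' x) = x" "!!x. L' (L x) = x" "test U f"
 shows "test {x. L x + c : U} (%x. f (L x + c))"
proof -
 obtain K where K: "compact K" "K <= U" "!!x. x ~: K ==> f x = 0" using test_functionE[OF assms(5)] by metis
 have *: "x : (%y. L' (y - c)) ` K <-> L x + c : K" for x
  using assms(3,4) by (auto simp: image_iff) (metis add_diff_cancel_right')
 show ?thesis
 proof (rule test_functionI[of _ "(%y. L' (y - c)) ` K"])
  show "smooth (%x. f (L x + c))" using assms by (intro smooth_comp_affine test_smooth)
  have "continuous_on K (%y. L' (y - c))" by (rule linear_continuous_on_compose[OF _ assms(2)]) (intro continuous_intros)
  thus "compact ((%y. L' (y - c)) ` K)" using K(1) by (rule compact_continuous_image)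
 qed (use * K in auto)
qed

lemma test_shift: "test U f ==> test {y. x - y : U} (%y. f (x - y))"
 using test_comp_affine[of uminus uminus U f x] by (simp add: linear_uminus)

lemma test_bounded:
 assumes "test U f" obtains B where "B > 0" "!!x. norm (f x) <= B"
proof -
 obtain K where K: "compact K" "!!x. x ~: K ==> f x = 0" using test_functionE[OF assms] by metis
 have "compact (f ` K)" by (intro compact_continuous_image smooth_continuous test_smooth[OF assms] K)
 then obtain B where "B > 0" "!!x. x : K ==> norm (f x) <= B"
  using compact_imp_bounded bounded_pos by (metis imageI)
 with K(2) show thesis by (intro that[of B]) (metis norm_zero less_imp_le)+
qed

lemma continuous_lebesgue_measurable: "continuous_on UNIV f ==> f : LM" by (rule measurable_completion) (simp add: borel_measurable_continuous_onI)

lemma test_measurable: "test U f ==> f : LM" by (intro continuous_lebesgue_measurable smooth_continuous test_smooth)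

lemma compact_support_integrable:
 fixes f :: "real^'n => 'b::euclidean_space"
 assumes "continuous_on UNIV f" "compact K" "!!x. x ~: K ==> f x = 0"
 shows "Lint f"
proof -
 have "integrable lborel (%x. indicator K x *R f x)" by (rule borel_integrable_compact[OF assms(2) continuous_on_subset[OF assms(1) subset_UNIV]])
 moreover have "(%x. indicator K x *R f x) = f" using assms(3) by (auto simp: indicator_def)
 ultimately have "integrable lborel f" by simp
 thus ?thesis by (simp add: integrable_completion borel_measurable_integrable)
qed

lemma test_integrable: assumes "test U f" shows "Lint f"
proof -
 obtain K where K: "compact K" "!!x. x ~: K ==> f x = 0" using test_functionE[OF assms] by metis
 show ?thesis by (rule compact_support_integrable[OF smooth_continuous[OF test_smooth[OF assms]] K])
qed

lemma integrable_mult_bounded: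
 fixes f g :: "'n::finite fn"
 assumes "Lint f" "g : LM" "!!x. norm (g x) <= B"
 shows "Lint (%x. f x * g x)"
proof (rule Bochner_Integration.integrable_bound)
 show "Lint (%x. B *R f x)" using assms(1) by simp
 show "(%x. f x * g x) : LM" by (rule borel_measurable_times[OF borel_measurable_integrable[OF assms(1)] assms(2)])
 show "AEL x. norm (f x * g x) <= norm (B *R f x)"
 proof (rule AE_I2)
  fix x
  have "norm (g x) <= \<bar>B\<bar>" using assms(3)[of x] by linarith
  from mult_left_mono[OF this norm_ge_zero[of "f x"]]
  show "norm (f x * g x) <= norm (B *R f x)" by (simp add: norm_mult mult.commute)
 qed
qed

lemma integrable_mult_test:
 assumes "Lint f" "test U g"
 shows "Lint (%x. f x * g x)"
proof -
 obtain B where "!!x. norm (g x) <= B" using test_bounded[OF assms(2)] by metis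
 thus ?thesis by (rule integrable_mult_bounded[OF assms(1) test_measurable[OF assms(2)]])
qed

section \<open>Lebesgue measure under isometries\<close>

lemma lborel_distr_reflect: "distr lborel borel (%x. t - x) = (lborel :: (real^'n) measure)"
proof -
 have "(%x. t + (SUM j:Basis. (-1 * (x *. j)) *R j)) = (%x::real^'n. t - x)" by (simp add: sum_negf euclidean_representation)
 thus ?thesis using lborel_affine_euclidean[of "%_. -1" t] by (simp add: density_1)
qed

lemma nn_integral_lborel_reflect:
 fixes h :: "real^'n => ennreal"
 assumes "h : borel_measurable borel"
 shows "(\<integral>\<^sup>+x. h (t - x) \<partial>lborel) = (\<integral>\<^sup>+x. h x \<partial>lborel)"
proof -
 have "(\<integral>\<^sup>+x. h x \<partial>distr lborel borel (%x. t - x)) = (\<integral>\<^sup>+x. h (t - x) \<partial>lborel)"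
  by (rule nn_integral_distr) (use assms in simp_all)
 thus ?thesis by (simp add: lborel_distr_reflect)
qed

lemma nn_integral_lborel_shift:
 fixes h :: "real^'n => ennreal"
 assumes "h : borel_measurable borel"
 shows "(\<integral>\<^sup>+x. h (x - t) \<partial>lborel) = (\<integral>\<^sup>+x. h x \<partial>lborel)"
proof -
 have "(\<integral>\<^sup>+x. h x \<partial>distr lborel borel ((+) (- t))) = (\<integral>\<^sup>+x. h (- t + x) \<partial>lborel)"
  by (rule nn_integral_distr) (use assms in simp_all)
 thus ?thesis by (simp add: lborel_distr_plus)
qed

text \<open>The library proves rotation invariance of Lebesgue measure only for well-ordered index types. In
  general it follows from the uniqueness of translation-invariant measures, by comparing both
  measures on a ball.\<close>

lemma nn_integral_lborel_orthogonal:
 fixes L :: "real^'n => real^'n" and f :: "real^'n => ennreal"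
 assumes L: "orthogonal_transformation L" and [measurable]: "f : borel_measurable borel"
 shows "(\<integral>\<^sup>+x. f (L x) \<partial>lborel) = (\<integral>\<^sup>+x. f x \<partial>lborel)"
proof -
 have lin: "linear L" using L by (rule orthogonal_transformation_linear)
 have [measurable]: "L : borel \<rightarrow>\<^sub>M borel"
  by (intro borel_measurable_continuous_onI linear_continuous_on linear_conv_bounded_linear[THEN iffD1, OF lin])
 \<comment> \<open>The unit ball is invariant under L and has positive finite measure, so its volume
   G can be cancelled in the end.\<close>
 define g :: "real^'n => ennreal" where "g = indicator (ball 0 1)"
 have [measurable]: "g : borel_measurable borel" unfolding g_def by (intro borel_measurable_indicator) simp
 have gL: "g (L x) = g x" for x
  using L by (simp add: g_def indicator_def orthogonal_transformation_norm)
 define G where "G = (\<integral>\<^sup>+x. g x \<partial>lborel)"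
 have G: "G = emeasure lborel (ball (0::real^'n) 1)" by (simp add: G_def g_def)
 have "emeasure lborel (ball (0::real^'n) 1) = ennreal (measure lborel (ball (0::real^'n) 1))"
  by (metis emeasure_eq_ennreal_measure emeasure_lborel_ball_finite infinity_ennreal_def less_irrefl)
 moreover have "measure lborel (ball (0::real^'n) 1) > 0" using content_ball_pos[of 1 "0::real^'n"] by simp
 ultimately have Gp: "0 < G" "G < \<infinity>" by (simp_all add: G)
 have "(\<integral>\<^sup>+x. f (L x) * g (y - L x) \<partial>lborel) = (\<integral>\<^sup>+x. f (y - L x) * g (L x) \<partial>lborel)" for y
 proof -
  \<comment> \<open>The substitution x -> z - x exchanges the arguments of the two factors; after
    integration over y, Fubini splits both sides into products with the factor G.\<close>
  obtain z where z: "L z = y" using orthogonal_transformation_surj[OF L] by (metis surjD)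
  have "(\<integral>\<^sup>+x. f (L x) * g (y - L x) \<partial>lborel) = (\<integral>\<^sup>+x. f (L (z - x)) * g (y - L (z - x)) \<partial>lborel)"
   by (rule nn_integral_lborel_reflect[symmetric]) measurable
  also have "... = (\<integral>\<^sup>+x. f (y - L x) * g (L x) \<partial>lborel)"
   using z lin by (simp add: linear_diff)
  finally show ?thesis .
 qed
 hence "(\<integral>\<^sup>+y. \<integral>\<^sup>+x. f (L x) * g (y - L x) \<partial>lborel \<partial>lborel) = (\<integral>\<^sup>+y. \<integral>\<^sup>+x. f (y - L x) * g (L x) \<partial>lborel \<partial>lborel)"
  by simp
 moreover have "(\<integral>\<^sup>+y. \<integral>\<^sup>+x. f (L x) * g (y - L x) \<partial>lborel \<partial>lborel) = (\<integral>\<^sup>+x. f (L x) \<partial>lborel) * G"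
  by (subst lborel_pair.Fubini') (simp_all add: nn_integral_cmult nn_integral_lborel_shift nn_integral_multc flip: G_def)
 moreover have "(\<integral>\<^sup>+y. \<integral>\<^sup>+x. f (y - L x) * g (L x) \<partial>lborel \<partial>lborel) = (\<integral>\<^sup>+x. f x \<partial>lborel) * G"
  by (subst lborel_pair.Fubini') (simp_all add: nn_integral_cmult nn_integral_lborel_shift nn_integral_multc gL flip: G_def)
 ultimately show ?thesis using Gp by (metis ennreal_mult_divide_eq infinity_ennreal_def not_gr_zero top.not_eq_extremum)
qed

lemma lebesgue_isometry:
 fixes L :: "real^'n => real^'n"
 assumes "orthogonal_transformation L"
 shows "distr lebesgue lebesgue (%x. L x + c) = lebesgue"
  and "(%x. L x + c) : lebesgue \<rightarrow>\<^sub>M lebesgue"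
  and "distr lborel borel (%x. L x + c) = lborel"
proof -
 let ?T = "%x. L x + c"
 have lin: "linear L" using assms by (rule orthogonal_transformation_linear)
 have cont: "continuous_on UNIV ?T"
  by (intro continuous_on_add linear_continuous_on linear_conv_bounded_linear[THEN iffD1, OF lin] continuous_on_const)
 hence [measurable]: "?T : borel \<rightarrow>\<^sub>M borel" by (rule borel_measurable_continuous_onI)
 have "lborel = distr lborel borel ?T"
 proof (rule measure_eqI)
  fix A :: "(real^'n) set" assume "A : sets lborel"
  hence A[measurable]: "A : sets borel" by simp
  have "emeasure (distr lborel borel ?T) A = (\<integral>\<^sup>+x. indicator A x \<partial>distr lborel borel ?T)" by simp
  also have "... = (\<integral>\<^sup>+x. indicator A (L x + c) \<partial>lborel)" by (rule nn_integral_distr) simp_all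
  also have "... = (\<integral>\<^sup>+x. indicator A (x + c) \<partial>lborel)"
   by (rule nn_integral_lborel_orthogonal[OF assms, of "%x. indicator A (x + c)"]) measurable
  also have "... = (\<integral>\<^sup>+x. indicator A x \<partial>lborel)"
   using nn_integral_lborel_shift[of "indicator A" "- c"] by simp
  finally show "emeasure lborel A = emeasure (distr lborel borel ?T) A" by simp
 qed simp
 thus D: "distr lborel borel ?T = lborel" by simp
 have D': "distr lebesgue lborel ?T = lborel"
  using D by (simp add: distr_completion cong: distr_cong)
 show M: "?T : lebesgue \<rightarrow>\<^sub>M lebesgue" by (simp add: completion.measurable_completion2 D' measurable_completion)
 show "distr lebesgue lebesgue ?T = lebesgue" by (subst completion.completion_distr_eq[symmetric]) (auto simp: D' measurable_completion)
qed

lemma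
 fixes f :: "real^'n => 'b::euclidean_space" and L :: "real^'n => real^'n"
 assumes "orthogonal_transformation L"
 shows isometry_measurable: "f : LM ==> (%x. f (L x + c)) \<in> borel_measurable lebesgue"
  and isometry_integral: "f : LM ==> (LI x. f (L x + c)) = (LI x. f x)"
  and isometry_integrable: "f : LM ==> Lint (%x. f (L x + c)) <-> Lint f"
 using measurable_compose[OF lebesgue_isometry(2)[OF assms], of f borel c] integral_distr[OF lebesgue_isometry(2)[OF assms, of c], of f]
  integrable_distr_eq[OF lebesgue_isometry(2)[OF assms, of c], of f] lebesgue_isometry(1)[OF assms, of c] by auto

lemma integral_reflect_shift:
 fixes f :: "real^'n => 'b::euclidean_space"
 assumes "f : LM"
 shows "(LI y. f (x - y)) = (LI y. f y)"
 using isometry_integral[of uminus f x] assms by (simp add: orthogonal_transformation_neg)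

lemma
 fixes f :: "real^'n => 'b::euclidean_space"
 assumes "f : LM"
 shows measurable_shift: "(%x. f (x + c)) \<in> borel_measurable lebesgue"
  and integral_shift: "(LI x. f (x + c)) = (LI x. f x)"
  and integrable_shift: "Lint (%x. f (x + c)) <-> Lint f"
 using isometry_measurable[of "%x. x" f c] isometry_integral[of "%x. x" f c] isometry_integrable[of "%x. x" f c] assms by auto

section \<open>Difference estimates and integration by parts\<close>

lemma partial_bound_Lipschitz:
 fixes f :: "'n::finite fn" and B :: real
 assumes "!!x. x : S ==> f differentiable (at x)" "!!x i. x : S ==> norm (partial i f x) <= B" "convex S" "x : S" "y : S"
 shows "norm (f x - f y) <= real CARD('n) * B * norm (x - y)"
proof (rule differentiable_bound[OF assms(3) _ _ assms(4,5)])
 fix x assume x: "x : S"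
 show "(f has_derivative (%h. SU i. (h $ i) *R partial i f x)) (at x within S)"
  using has_derivative_partial[OF assms(1)[OF x]] by (rule has_derivative_at_withinI)
 show "onorm (%h. SU i. (h $ i) *R partial i f x) <= CARD('n) * B"
 proof (rule onorm_le)
  fix h :: "real^'n"
  have "norm (SU i. (h $ i) *R partial i f x) <= (SUM i:(UNIV::'n set). norm h * B)"
   using assms(2)[OF x] by (intro sum_norm_le) (auto intro!: mult_mono simp: component_le_norm_cart)
  thus "norm (SU i. (h $ i) *R partial i f x) <= CARD('n) * B * norm h" by (simp add: mult.commute mult.left_commute)
 qed
qed

lemma test_partials_bounded:
 fixes f :: "'n::finite fn"
 assumes "test U f" obtains B where "B > 0" "!!x i. norm (partial i f x) <= B"
proof -
 have "EX B>0. ALL x. norm (partial i f x) <= B" for i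
  using test_bounded[OF test_partial[OF assms]] by metis
 then obtain B where B: "!!i. B i > 0" "!!i x. norm (partial i f x) <= B i" by metis
 have "B i <= (SU i. B i)" for i using B(1) by (intro member_le_sum) (auto intro: less_imp_le)
 hence "norm (partial i f x) <= (SU i. B i)" for i x using B(2)[of i x] order_trans by blast
 moreover have "(SU i. B i) > 0" using B(1) by (intro sum_pos) auto
 ultimately show thesis using that by blast
qed

lemma test_Lipschitz:
 fixes f :: "'n::finite fn"
 assumes "test U f" obtains C where "C > 0" "!!x y. norm (f x - f y) <= C * norm (x - y)"
proof -
 obtain B where B: "B > 0" "!!x i. norm (partial i f x) <= B" using test_partials_bounded[OF assms] by metis
 have "norm (f x - f y) <= CARD('n) * B * norm (x - y)" for x y
  by (rule partial_bound_Lipschitz[where S=UNIV]) (use B smooth_differentiable test_smooth[OF assms] in auto)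
 thus thesis using that[of "CARD('n) * B"] B(1) by simp
qed

text \<open>Subtracting from f its linear part at x leaves a function whose partial derivatives are
  O(|h|) on the ball of radius |h|; the mean value estimate then yields the second order, with a
  constant uniform in x.\<close>

lemma test_Taylor:
 fixes f :: "'n::finite fn"
 assumes "test U f"
 obtains C where "C > 0" "!!x h. norm (f (x + h) - f x - (SU i. (h $ i) *R partial i f x)) <= C * (norm h)^2"
proof -
 have "EX C>0. ALL x y. norm (partial i f x - partial i f y) <= C * norm (x - y)" for i
  using test_Lipschitz[OF test_partial[OF assms]] by metis
 then obtain C where C: "!!i. C i > 0" "!!i x y. norm (partial i f x - partial i f y) <= C i * norm (x - y)" by metis
 define D where "D = (SU i. C i)"
 have CD: "C i <= D" for i unfolding D_def using C(1) by (intro member_le_sum) (auto intro: less_imp_le)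
 have D: "D > 0" unfolding D_def using C(1) by (intro sum_pos) auto
 have "norm (f (x + h) - f x - (SU i. (h $ i) *R partial i f x)) <= (CARD('n) * D) * (norm h)^2" for x h
 proof -
  define g where "g y = f y - (SU i. (y $ i) *R partial i f x)" for y
  let ?S = "cball x (norm h)"
  have d: "(g has_derivative (%k. (SU i. (k $ i) *R partial i f y) - (SU i. (k $ i) *R partial i f x))) (at y)" for y
  proof -
   have "bounded_linear (%y. SU i. (y $ i) *R partial i f x)" by (intro bounded_linear_sum bounded_linear_scaleR_const bounded_linear_vec_nth)
   thus ?thesis unfolding g_def
   by (intro has_derivative_diff has_derivative_partial smooth_differentiable test_smooth[OF assms] bounded_linear_imp_has_derivative)
  qed
  have p: "partial i g y = partial i f y - partial i f x" for i y
   by (subst partial_eq[OF d]) (simp add: axis_def if_distrib[of "%a. a *R b" for b] cong: if_cong)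
  have "norm (g (x + h) - g x) <= CARD('n) * (D * norm h) * norm (x + h - x)"
  proof (rule partial_bound_Lipschitz[where S="?S"])
   show "g differentiable at y" for y using d by (rule differentiableI)
   show "norm (partial i g y) <= D * norm h" if "y : ?S" for y i
   proof -
   have "norm (partial i g y) <= C i * norm (y - x)" using C(2) p by simp
   also have "... <= D * norm h" using that CD D C(1) by (intro mult_mono) (auto simp: dist_norm norm_minus_commute intro: less_imp_le)
   finally show ?thesis .
   qed
  qed (auto simp: dist_norm)
  moreover have "g (x + h) - g x = f (x + h) - f x - (SU i. (h $ i) *R partial i f x)" by (simp add: g_def sum.distrib scaleR_add_left)
  ultimately show ?thesis by (simp add: power2_eq_square mult.assoc)
 qed
 thus thesis using that[of "CARD('n) * D"] D by simp
qed

lemma has_vector_derivative_iff_quotient: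
 fixes f :: "real => complex"
 shows "(f has_vector_derivative D) (at 0) <-> ((%s. (f s - f 0) /\<^sub>R s) \<longlongrightarrow> D) (at 0)"
proof -
 have eq: "norm (f s - f 0 - s *R D) / \<bar>s\<bar> = norm ((f s - f 0) /\<^sub>R s - D)" if "s ~= 0" for s
 proof -
  have "(f s - f 0) /\<^sub>R s - D = (f s - f 0 - s *R D) /\<^sub>R s" using that by (simp add: scaleR_diff_right)
  thus ?thesis by (simp add: divide_inverse mult.commute)
 qed
 have "(f has_vector_derivative D) (at 0) <-> ((%s. norm (f s - f 0 - s *R D) / norm s) \<longlongrightarrow> 0) (at 0)"
  unfolding has_vector_derivative_def has_derivative_at by (simp add: bounded_linear_scaleR_left)
 also have "... <-> ((%s. norm ((f s - f 0) /\<^sub>R s - D)) \<longlongrightarrow> 0) (at 0)"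
  by (rule filterlim_cong) (auto simp: eventually_at_filter eq)
 also have "... <-> ((%s. (f s - f 0) /\<^sub>R s) \<longlongrightarrow> D) (at 0)" by (simp add: tendsto_norm_zero_iff Lim_null[symmetric])
 finally show ?thesis .
qed

text \<open>Difference quotients have integral zero by translation invariance, and they converge
  dominatedly to the partial derivative; no iterated integral is involved.\<close>

lemma integral_partial_compact_support:
 fixes f :: "'n::finite fn"
 assumes "!!x. f differentiable (at x)" "!!i. continuous_on UNIV (partial i f)" "compact K" "!!x. x ~: K ==> f x = 0"
 shows "(LI x. partial i f x) = 0"
proof -
 have pK: "partial j f x = 0" if "x ~: K" for x j by (rule partial_outside[OF compact_imp_closed[OF assms(3)] assms(4) that])
 have cf: "continuous_on UNIV f" using assms(1) by (meson continuous_at_imp_continuous_on differentiable_imp_continuous_within)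
 have "EX B. ALL x. norm (partial j f x) <= B" for j
 proof -
  have "compact (partial j f ` K)" by (intro compact_continuous_image continuous_on_subset[OF assms(2)] assms(3)) auto
  then obtain B where "B > 0" "!!x. x : K ==> norm (partial j f x) <= B"
   using compact_imp_bounded bounded_pos by (metis imageI)
  thus ?thesis using pK by (metis norm_zero less_imp_le)
 qed
 then obtain B where B: "!!j x. norm (partial j f x) <= B j" by metis
 define D where "D = (SU j. \<bar>B j\<bar>)"
 have BD: "norm (partial j f x) <= D" for j x
 proof -
  have "\<bar>B j\<bar> <= D" unfolding D_def by (intro member_le_sum) auto
  thus ?thesis using B[of j x] by linarith
 qed
 define t where "t n = inverse (real (Suc n))" for n
 have t: "t n > 0" "t n <= 1" "t ---> 0" for n
  unfolding t_def using LIMSEQ_inverse_real_of_nat by (auto simp: field_simps)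
 define e where "e = (axis i 1 :: real^'n)"
 \<comment> \<open>Shifts of length at most 1 keep the supports inside this enlarged compact set,
   which carries the dominating function.\<close>
 define K' where "K' = {x + y | x y. x : K & y : cball (0::real^'n) 1}"
 have K': "compact K'" unfolding K'_def by (intro compact_sums assms(3) compact_cball)
 have inK: "x : K'" if "x + s *R e : K" "0 <= s" "s <= 1" for x s
  unfolding K'_def using that by (intro CollectI exI[of _ "x + s *R e"] exI[of _ "- s *R e"]) (auto simp: e_def norm_axis_1)
 define q where "q n x = (f (x + t n *R e) - f x) /\<^sub>R t n" for n x
 have mf: "f : LM" by (rule continuous_lebesgue_measurable[OF cf])
 have intf: "Lint f" by (rule compact_support_integrable[OF cf assms(3,4)])
 have "(%n. \<integral>x. q n x \<partial>lebesgue) ---> (LI x. partial i f x)"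
 proof (rule integral_dominated_convergence[where w="%x. CARD('n) * D * indicator K' x"])
  show "partial i f : LM" by (rule continuous_lebesgue_measurable[OF assms(2)])
  show "q n : LM" for n
   unfolding q_def using mf by (intro borel_measurable_scaleR borel_measurable_const borel_measurable_diff measurable_shift) auto
  show "Lint (%x. CARD('n) * D * indicator K' x)"
   using lmeasurable_compact[OF K'] by (intro integrable_mult_right integrable_real_indicator) (auto simp: fmeasurable_def)
  show "AEL x. (%n. q n x) ---> partial i f x"
  proof (rule AE_I2)
   fix x
   have "((%s. f (x + s *R e)) has_derivative (%h. SU j. ((h *R e) $ j) *R partial j f (x + 0 *R e))) (at 0)"
   by (rule has_derivative_compose[of "%s. x + s *R e" "%h. h *R e" _ _ f])
   (auto intro!: derivative_eq_intros has_derivative_partial assms(1) simp del: scaleR_zero_left)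
   hence "((%s. f (x + s *R e)) has_vector_derivative partial i f x) (at 0)"
   by (simp add: has_vector_derivative_def e_def axis_def if_distrib[of "%a. (c * a) *R b" for b c] cong: if_cong)
   hence "((%s. (f (x + s *R e) - f x) /\<^sub>R s) \<longlongrightarrow> partial i f x) (at 0)"
   using has_vector_derivative_iff_quotient[of "%s. f (x + s *R e)"] by simp
   thus "(%n. q n x) ---> partial i f x"
   unfolding q_def by (rule filterlim_compose) (use t in "auto simp: filterlim_at less_imp_neq[symmetric]")
  qed
  show "AEL x. norm (q n x) <= CARD('n) * D * indicator K' x" for n
  proof (rule AE_I2)
   fix x
   show "norm (q n x) <= CARD('n) * D * indicator K' x"
   proof (cases "x : K'")
   case True
   have "norm (f (x + t n *R e) - f x) <= CARD('n) * D * norm (x + t n *R e - x)"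
   by (rule partial_bound_Lipschitz[where S=UNIV]) (use assms(1) BD in auto)
   also have "norm (x + t n *R e - x) = t n" using t(1)[of n] by (simp add: e_def norm_axis_1)
   finally show ?thesis using True t(1)[of n] by (simp add: q_def divide_inverse_commute[symmetric] pos_divide_le_eq)
   next
   case False
   hence "f x = 0" "f (x + t n *R e) = 0" using inK[of x 0] inK[of x "t n"] t(1,2)[of n] assms(4) by auto
   thus ?thesis using False by (simp add: q_def)
   qed
  qed
 qed
 moreover have "(LI x. q n x) = 0" for n
  unfolding q_def using intf mf by (simp add: Bintegral_diff integral_shift integrable_shift)
 ultimately have "(%n::nat. 0) ---> (LI x. partial i f x)" by simp
 thus ?thesis by (simp add: LIMSEQ_const_iff)
qed

text \<open>f is controlled on U only. The product with ph is nevertheless C^1 on the whole space,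
  since it vanishes off a compact subset of U.\<close>

lemma integration_by_parts:
 fixes f :: "'n::finite fn"
 assumes "open U" "Ck_on 1 U f" "test U ph"
 shows "Lint (%x. f x * partial i ph x)" "Lint (%x. partial i f x * ph x)"
  "(LI x. f x * partial i ph x) = - (LI x. partial i f x * ph x)"
proof -
 obtain K where K: "compact K" "K <= U" "!!x. x ~: K ==> ph x = 0" "!!x i. x ~: K ==> partial i ph x = 0"
  using test_functionE[OF assms(3)] by metis
 have clK: "closed K" by (rule compact_imp_closed[OF K(1)])
 have fd: "f differentiable (at x)" if "x : U" for x using assms(2) that by simp
 have fc: "continuous_on U (partial j f)" for j using assms(2) by simp
 have fc0: "continuous_on U f" using Ck_on_continuous[OF assms(2)] .
 have phd: "ph differentiable (at x)" for x by (intro smooth_differentiable test_smooth[OF assms(3)])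
 have phc: "continuous_on S ph" for S by (intro smooth_continuous test_smooth[OF assms(3)])
 have phpc: "continuous_on S (partial j ph)" for S j by (intro smooth_continuous smooth_partial test_smooth[OF assms(3)])
 define g where "g x = f x * ph x" for x
 have cont: "continuous_on UNIV (%x. a x * b x)" if "continuous_on U a" "continuous_on UNIV b" "!!x. x ~: K ==> b x = 0" for a b :: "'n fn"
 proof -
  have "continuous_on (U Un - K) (%x. a x * b x)"
  proof (rule continuous_on_open_Un[OF assms(1)])
   show "open (- K)" using clK by (rule open_Compl)
   show "continuous_on U (%x. a x * b x)" using that by (auto intro!: continuous_on_mult intro: continuous_on_subset)
   show "continuous_on (- K) (%x. a x * b x)" by (rule continuous_on_eq[of _ "%x. 0"]) (use that in auto)
  qed
  moreover have "U Un - K = UNIV" using K(2) by auto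
  ultimately show ?thesis by simp
 qed
 have c1: "continuous_on UNIV (%x. f x * partial j ph x)" for j by (rule cont[OF fc0 phpc K(4)])
 have c2: "continuous_on UNIV (%x. partial j f x * ph x)" for j by (rule cont[OF fc phc K(3)])
 show i1: "Lint (%x. f x * partial i ph x)" by (rule compact_support_integrable[OF c1 K(1)]) (simp add: K)
 show i2: "Lint (%x. partial i f x * ph x)" by (rule compact_support_integrable[OF c2 K(1)]) (simp add: K)
 have gout: "g x = 0" if "x ~: K" for x using K(3) that by (simp add: g_def)
 have pg: "partial j g x = f x * partial j ph x + partial j f x * ph x" for j x
 proof (cases "x : U")
  case True
  thus ?thesis unfolding g_def using fd phd by (intro partial_mult)
 next
  case False
  hence "x ~: K" using K(2) by auto
  thus ?thesis using partial_outside[OF clK gout] K(3,4) by simp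
 qed
 have gd: "g differentiable (at x)" for x
 proof (cases "x : U")
  case True
  thus ?thesis unfolding g_def using fd phd by (intro differentiable_mult)
 next
  case False
  hence "x : - K" using K(2) by auto
  hence "(g has_derivative (%h. 0)) (at x)"
   using has_derivative_transform_within_open[of "%x. 0" "%h. 0" x UNIV "- K" g] clK gout by auto
  thus ?thesis by (rule differentiableI)
 qed
 have "(LI x. partial i g x) = 0"
  by (rule integral_partial_compact_support[OF gd _ K(1) gout]) (auto simp: pg[abs_def] intro!: continuous_on_add c1 c2)
 thus "(LI x. f x * partial i ph x) = - (LI x. partial i f x * ph x)"
  unfolding pg[abs_def] using i1 i2 by (simp add: add_eq_0_iff)
qed

section \<open>Convolution with a test function\<close>

definition conv :: "(real^'n => complex) => (real^'n => complex) => real^'n => complex" where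
 "conv g et x = (LI y. g y * et (x - y))"

lemma conv_integrable:
 assumes "Lint g" "test UNIV et"
 shows "Lint (%y. g y * et (x - y))"
 using integrable_mult_test[OF assms(1) test_shift[OF assms(2)]] .

text \<open>The Taylor remainder of et is uniform in the base point, so it integrates against |g| to
  a bound M C |h|^2; g only has to be integrable.\<close>

lemma conv_has_derivative:
 fixes et :: "'n::finite fn"
 assumes g: "Lint g" and et: "test UNIV et"
 shows "(conv g et has_derivative (%h. SU i. (h $ i) *R conv g (partial i et) x)) (at x)"
proof -
 obtain C where C: "C > 0" "!!x h. norm (et (x + h) - et x - (SU i. (h $ i) *R partial i et x)) <= C * (norm h)^2"
  using test_Taylor[OF et] by metis
 define M where "M = (LI y. norm (g y))"
 have M: "M >= 0" unfolding M_def by simp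
 have est: "norm (conv g et (x + h) - conv g et x - (SU i. (h $ i) *R conv g (partial i et) x)) <= M * C * (norm h)^2" for h
 proof -
  note i1 = conv_integrable[OF g et] and i2 = conv_integrable[OF g test_partial[OF et]]
  have "conv g et (x + h) - conv g et x - (SU i. (h $ i) *R conv g (partial i et) x) =
   (LI y. g y * et (x + h - y) - g y * et (x - y) - (SU i. (h $ i) *R (g y * partial i et (x - y))))"
   unfolding conv_def using i1 i2 by (simp add: Bintegral_diff Bintegral_sum)
  also have "... = (LI y. g y * (et ((x - y) + h) - et (x - y) - (SU i. (h $ i) *R partial i et (x - y))))"
   by (intro Bintegral_cong) (auto simp: algebra_simps sum_distrib_left)
  also have "norm ... <= (LI y. C * (norm h)^2 * norm (g y))"
  proof (rule Bochner_Integration.integral_norm_bound_integral)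
   have "Lint (%y. g y * et (x + h - y) - g y * et (x - y) - (SU i. (h $ i) *R (g y * partial i et (x - y))))"
   using i1 i2 by (intro Bochner_Integration.integrable_diff Bintegrable_sum integrable_scaleR_right)
   thus "Lint (%y. g y * (et ((x - y) + h) - et (x - y) - (SU i. (h $ i) *R partial i et (x - y))))"
   by (rule Bochner_Integration.integrable_cong[THEN iffD1, rotated 2]) (auto simp: algebra_simps sum_distrib_left)
   show "Lint (%y. C * (norm h)^2 * norm (g y))" using g by simp
   show "norm (g y * (et (x - y + h) - et (x - y) - (SU i. (h $ i) *R partial i et (x - y)))) <= C * (norm h)^2 * norm (g y)" for y
   using mult_left_mono[OF C(2)[of "x - y" h] norm_ge_zero[of "g y"]] by (simp add: norm_mult mult.commute)
  qed
  also have "... = M * C * (norm h)^2" using g by (simp add: M_def)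
  finally show ?thesis .
 qed
 have bl: "bounded_linear (%h. SU i. (h $ i) *R conv g (partial i et) x)"
  by (intro bounded_linear_sum bounded_linear_scaleR_const bounded_linear_vec_nth)
 show ?thesis unfolding has_derivative_at
 proof (intro conjI bl)
  show "(%h. norm (conv g et (x + h) - conv g et x - (SU i. (h $ i) *R conv g (partial i et) x)) / norm h) \<midarrow>0\<rightarrow> 0"
  proof (rule Lim_null_comparison)
   show "\<forall>\<^sub>F h in at 0. norm (norm (conv g et (x + h) - conv g et x - (SU i. (h $ i) *R conv g (partial i et) x)) / norm h) <= M * C * norm h"
   proof (rule always_eventually, rule allI)
   fix h
   show "norm (norm (conv g et (x + h) - conv g et x - (SU i. (h $ i) *R conv g (partial i et) x)) / norm h) <= M * C * norm h"
   proof (cases "h = 0")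
   case False
   thus ?thesis using est[of h] by (simp add: pos_divide_le_eq power2_eq_square mult.assoc)
   qed simp
   qed
   show "(%h. M * C * norm h) \<midarrow>0\<rightarrow> (0::real)" by (intro tendsto_mult_right_zero tendsto_norm_zero tendsto_ident_at)
  qed
 qed
qed

lemma partial_conv:
 assumes "Lint g" "test UNIV et"
 shows "partial i (conv g et) = conv g (partial i et)" by (rule ext, subst partial_eq[OF conv_has_derivative[OF assms]])
   (simp add: axis_def if_distrib[of "%a. a *R b" for b] cong: if_cong)

lemma smooth_conv:
 assumes g: "Lint g" and "test UNIV et"
 shows "smooth (conv g et)"
proof -
 have "Ck_on m UNIV (conv g et)" for m
  using assms(2)
 proof (induction m arbitrary: et)
  case 0
  have "conv g et differentiable (at x)" for x using conv_has_derivative[OF g 0] by (rule differentiableI)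
  thus ?case by (simp add: continuous_at_imp_continuous_on differentiable_imp_continuous_within)
 next
  case (Suc m)
  show ?case using differentiableI[OF conv_has_derivative[OF g Suc.prems]] Suc.IH[OF test_partial[OF Suc.prems]]
   by (simp add: partial_conv[OF g Suc.prems])
 qed
 thus ?thesis by (simp add: smooth_def)
qed

lemma conv_commute:
 assumes "g : LM" "et : LM"
 shows "conv g et = conv et g"
proof
 fix x
 have "(%y. et (x - y)) \<in> borel_measurable lebesgue"
  using isometry_measurable[of uminus et x] assms by (simp add: orthogonal_transformation_neg)
 hence "(%y. g y * et (x - y)) \<in> borel_measurable lebesgue" using assms by (intro borel_measurable_times)
 from integral_reflect_shift[OF this, of x] show "conv g et x = conv et g x" by (simp add: conv_def mult.commute)
qed

lemma conv_support:
 assumes "conv g et x ~= 0" obtains y where "g y ~= 0" "et (x - y) ~= 0"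
proof -
 have "EX y. g y ~= 0 & et (x - y) ~= 0"
 proof (rule ccontr)
  assume "~ ?thesis"
  hence "(%y. g y * et (x - y)) = (%y. 0)" by auto
  hence "conv g et x = 0" unfolding conv_def by simp
  with assms show False by simp
 qed
 thus thesis using that by blast
qed

section \<open>Bump functions and partitions of unity\<close>

definition bump :: "real^'n => real => real^'n => complex" where
 "bump a r x = of_real (1 - smooth_step ((norm (x - a))^2 * inverse (r^2)))"

lemma bump_inside: assumes "x : ball a (r/2)" shows "bump a r x = 1"
proof -
 have "r > 0" using assms by (metis half_gt_zero_iff ball_eq_empty empty_iff not_le)
 moreover have "(norm (x - a))^2 <= (r/2)^2" using assms by (intro power_mono) (auto simp: dist_norm norm_minus_commute)
 ultimately have "(norm (x - a))^2 * inverse (r^2) <= 1/4" by (simp add: field_simps power2_eq_square)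
 thus ?thesis by (simp add: bump_def smooth_step_0)
qed

lemma bump_outside: assumes "r > 0" "x ~: ball a r" shows "bump a r x = 0"
proof -
 have "(norm (x - a))^2 >= r^2" using assms by (intro power_mono) (auto simp: dist_norm norm_minus_commute)
 hence "(norm (x - a))^2 * inverse (r^2) >= 1" using assms by (simp add: field_simps)
 thus ?thesis by (simp add: bump_def smooth_step_1)
qed

lemma smooth_bump: "smooth (bump a r)"
proof -
 have "smooth (%x. of_real ((norm (x - a))^2 * inverse (r^2)))"
  using smooth_mult[OF smooth_normsq[of a] smooth_const[of "of_real (inverse (r^2))"]] by simp
 hence "smooth (%x. of_real (smooth_step ((norm (x - a))^2 * inverse (r^2))))" by (intro smooth_real_comp[of smooth_step] Dk_smooth_step)
 from smooth_diff[OF smooth_const[of 1] this] show ?thesis by (simp add: bump_def[abs_def])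
qed

lemma test_bump: assumes "0 < r" "r < R" shows "test (ball a R) (bump a r)"
 by (rule test_functionI[OF smooth_bump compact_cball[of a r]]) (use assms in "auto intro!: bump_outside")

lemma bump_Re: "bump a r x = of_real (Re (bump a r x))" "0 <= Re (bump a r x)" "Re (bump a r x) <= 1"
 using smooth_step_nonneg smooth_step_le_1 by (auto simp: bump_def)

text \<open>Each new bump b takes its share and leaves 1 - b to the functions built before, so the
  sum is 1 wherever some bump is. The radius is halved twice: for the support to be compact in the
  ball, and for the region where a bump equals 1.\<close>

lemma partition_of_unity:
 fixes a :: "'j => real^'n"
 assumes "finite J" "!!j. j : J ==> r j > 0"
 shows "EX ze. (ALL j:J. test (ball (a j) (r j)) (ze j)) &
   (ALL x:(UN j:J. ball (a j) (r j / 4)). (SUM j:J. ze j x) = 1)"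
 using assms
proof (induction J rule: finite_induct)
 case (insert i J)
 then obtain ze where ze: "!!j. j : J ==> test (ball (a j) (r j)) (ze j)"
   "!!x. x\<in>(UN j:J. ball (a j) (r j / 4)) ==> (SUM j:J. ze j x) = 1" by (metis insertCI)
 let ?b = "bump (a i) (r i / 2)"
 define ze' where "ze' j = (if j = i then ?b else (%x. (1 - ?b x) * ze j x))" for j
 have sm: "smooth (%x. 1 - ?b x)" by (intro smooth_diff smooth_const smooth_bump)
 have ri: "r i > 0" using insert.prems by simp
 have t: "test (ball (a j) (r j)) (ze' j)" if "j : insert i J" for j
 proof (cases "j = i")
  case True
  thus ?thesis using test_bump[of "r i / 2" "r i" "a i"] ri by (simp add: ze'_def)
 next
  case False
  thus ?thesis using test_mult_smooth[OF sm ze(1)[of j]] that by (simp add: ze'_def)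
 qed
 have s: "(SUM j:insert i J. ze' j x) = ?b x + (1 - ?b x) * (SUM j:J. ze j x)" for x
 proof -
  have "(SUM j:J. ze' j x) = (SUM j:J. (1 - ?b x) * ze j x)" by (rule sum.cong) (use insert.hyps in "auto simp: ze'_def")
  thus ?thesis using insert.hyps by (simp add: ze'_def sum_distrib_left)
 qed
 have "(SUM j:insert i J. ze' j x) = 1" if "x : (UN j:insert i J. ball (a j) (r j / 4))" for x
 proof (cases "x : ball (a i) (r i / 4)")
  case True
  hence "?b x = 1" by (intro bump_inside) simp
  thus ?thesis using s[of x] by simp
 next
  case False
  hence "(SUM j:J. ze j x) = 1" using that by (intro ze(2)) auto
  thus ?thesis using s[of x] by simp
 qed
 thus ?case using t by blast
qed auto

lemma compact_partition:
 fixes K :: "(real^'n) set"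
 assumes "compact K" "!!x. x : K ==> r x > 0"
 obtains J ze W where "finite J" "J <= K" "open W" "K <= W" "!!x. x : J ==> test (ball x (r x)) (ze x)"
  "!!y. y : W ==> (SUM x:J. ze x y) = 1"
proof -
 have "K <= (UN x:K. ball x (r x / 4))" using assms(2) by force
 then obtain J where J: "J <= K" "finite J" "K <= (UN x:J. ball x (r x / 4))"
  using compactE_image[OF assms(1), of K "%x. ball x (r x / 4)"] by (metis open_ball)
 obtain ze where "ALL j:J. test (ball j (r j)) (ze j)" "ALL x:(UN j:J. ball j (r j / 4)). (SUM j:J. ze j x) = 1"
  using partition_of_unity[OF J(2), of r "%x. x"] assms(2) J(1) by (metis subsetD)
 thus thesis using J by (intro that[of J "UN x:J. ball x (r x / 4)" ze]) auto
qed

lemma cutoff_exists: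
 fixes K :: "(real^'n) set"
 assumes "compact K" "open U" "K <= U"
 obtains ze W where "test U ze" "open W" "K <= W" "!!y. y : W ==> ze y = 1"
proof -
 have "EX r>0. ball x r <= U" if "x : K" for x using assms that by (meson openE subsetD)
 then obtain r where r: "!!x. x : K ==> r x > 0" "!!x. x : K ==> ball x (r x) <= U" by metis
 obtain J ze W where J: "finite J" "J <= K" "open W" "K <= W" "!!x. x : J ==> test (ball x (r x)) (ze x)"
  "!!y. y : W ==> (SUM x:J. ze x y) = 1" by (rule compact_partition[OF assms(1) r(1)]) (assumption, rule that)
 have "test U (%y. SUM x:J. ze x y)" by (intro test_sum test_mono[OF J(5)]) (use r(2) J(2) in auto)
 thus thesis using J by (intro that[of "%y. SUM x:J. ze x y" W])
qed

section \<open>Square integrable functions and mollification\<close>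

definition L2 :: "(real^'n => 'b::euclidean_space) => bool" where
 "L2 f <-> f : LM & Lint (%x. (norm (f x))^2)"

lemma L2_measurable: "L2 f ==> f : LM" by (simp add: L2_def)

lemma L2_sq_integrable: "L2 f ==> Lint (%x. (norm (f x))^2)" by (simp add: L2_def)

lemma integrable_dominated:
 fixes f :: "real^'n => 'b::euclidean_space" and g :: "real^'n => real"
 assumes "Lint g" "f : LM" "!!x. norm (f x) <= g x"
 shows "Lint f"
proof (rule Bochner_Integration.integrable_bound[OF assms(1,2)])
 show "AEL x. norm (f x) <= norm (g x)" by (rule AE_I2) (metis assms(3) norm_ge_zero order_trans real_norm_def abs_of_nonneg)
qed

lemma sq_sum_le: "(a + b)^2 <= 2 * a^2 + 2 * (b::real)^2"
 using zero_le_power2[of "a - b"] by (simp add: power2_eq_square algebra_simps)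

lemma norm_sq_add_le:
 fixes a b :: "'a::real_normed_vector" shows "(norm (a + b))^2 <= 2 * (norm a)^2 + 2 * (norm b)^2"
 using power_mono[OF norm_triangle_ineq[of a b] norm_ge_zero, of 2] sq_sum_le[of "norm a" "norm b"] by linarith

lemma L2_dominated:
 assumes "L2 f" "g : LM" "!!x. norm (g x) <= B * norm (f x)"
 shows "L2 g"
proof -
 have "Lint (%x. (norm (g x))^2)"
 proof (rule integrable_dominated)
  show "Lint (%x. B^2 * (norm (f x))^2)" using L2_sq_integrable[OF assms(1)] by simp
  show "(%x. (norm (g x))^2) : LM" by (rule borel_measurable_power[OF measurable_compose[OF assms(2) borel_measurable_norm]])
  show "norm ((norm (g x))^2) <= B^2 * (norm (f x))^2" for x
   using power_mono[OF assms(3)[of x] norm_ge_zero, of 2] by (simp add: power_mult_distrib)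
 qed
 thus ?thesis using assms(2) by (simp add: L2_def)
qed

lemma L2_add:
 assumes "L2 f" "L2 g" shows "L2 (%x. f x + g x)"
proof -
 have m: "(%x. f x + g x) : LM" by (rule borel_measurable_add[OF L2_measurable[OF assms(1)] L2_measurable[OF assms(2)]])
 have "Lint (%x. (norm (f x + g x))^2)"
 proof (rule integrable_dominated)
  show "Lint (%x. 2 * (norm (f x))^2 + 2 * (norm (g x))^2)"
   using L2_sq_integrable[OF assms(1)] L2_sq_integrable[OF assms(2)] by simp
  show "(%x. (norm (f x + g x))^2) : LM" by (rule borel_measurable_power[OF measurable_compose[OF m borel_measurable_norm]])
  show "norm ((norm (f x + g x))^2) <= 2 * (norm (f x))^2 + 2 * (norm (g x))^2" for x
   using norm_sq_add_le[of "f x" "g x"] by simp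
 qed
 thus ?thesis using m by (simp add: L2_def)
qed

lemma L2_zero: "L2 (%x. 0)" by (simp add: L2_def)

lemma L2_scaleR: assumes "L2 f" shows "L2 (%x. c *R f x)"
proof (rule L2_dominated[OF assms, of _ "\<bar>c\<bar>"])
 show "(%x. c *R f x) : LM"
  using L2_measurable[OF assms] by (intro borel_measurable_scaleR borel_measurable_const)
qed simp

lemma L2_cmult:
 fixes f :: "'n::finite fn"
 assumes "L2 f" shows "L2 (%x. c * f x)"
proof (rule L2_dominated[OF assms, of _ "norm c"])
 show "(%x. c * f x) : LM"
  using L2_measurable[OF assms] by (intro borel_measurable_times borel_measurable_const)
qed (simp add: norm_mult)

lemma L2_diff: assumes "L2 f" "L2 g" shows "L2 (%x. f x - g x)"
 using L2_add[OF assms(1) L2_scaleR[OF assms(2), of "-1"]] by simp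

lemma L2_sum: "(!!j. j : J ==> L2 (f j)) ==> L2 (%x. SUM j:J. f j x)" by (induction J rule: infinite_finite_induct) (auto intro: L2_zero L2_add)

lemma L2_cong_AE:
 assumes "L2 f" "AEL x. f x = g x" shows "L2 g"
proof -
 have g: "g : LM" using borel_measurable_AE[OF L2_measurable[OF assms(1)] assms(2)] .
 have "Lint (%x. (norm (g x))^2)"
 proof (rule integrable_cong_AE_imp[OF L2_sq_integrable[OF assms(1)]])
  show "(%x. (norm (g x))^2) : LM" by (rule borel_measurable_power[OF measurable_compose[OF g borel_measurable_norm]])
  show "AEL x. (norm (f x))^2 = (norm (g x))^2" using assms(2) by eventually_elim simp
 qed
 thus ?thesis using g by (simp add: L2_def)
qed

lemma L2_norm_product:
 assumes "L2 f" "L2 g"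
 shows "Lint (%x. norm (f x) * norm (g x))"
proof (rule integrable_dominated)
 show "Lint (%x. (norm (f x))^2 + (norm (g x))^2)"
  using L2_sq_integrable[OF assms(1)] L2_sq_integrable[OF assms(2)] by simp
 show "(%x. norm (f x) * norm (g x)) \<in> borel_measurable lebesgue"
  using L2_measurable[OF assms(1)] L2_measurable[OF assms(2)] by (intro borel_measurable_times measurable_compose[OF _ borel_measurable_norm])
 show "norm (norm (f x) * norm (g x)) <= (norm (f x))^2 + (norm (g x))^2" for x
 proof -
  have "norm (f x) * norm (g x) <= (norm (f x))^2 + (norm (g x))^2"
   using sum_squares_bound[of "norm (f x)" "norm (g x)"] mult_nonneg_nonneg[OF norm_ge_zero[of "f x"] norm_ge_zero[of "g x"]] by linarith
  thus ?thesis by (simp add: abs_mult)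
 qed
qed

lemma L2_product:
 fixes f g :: "'n::finite fn"
 assumes "L2 f" "L2 g" shows "Lint (%x. f x * g x)"
proof (rule integrable_dominated[OF L2_norm_product[OF assms]])
 show "(%x. f x * g x) : LM"
  using L2_measurable[OF assms(1)] L2_measurable[OF assms(2)] by (intro borel_measurable_times)
qed (simp add: norm_mult)

lemma L2_mult_bounded:
 fixes f g :: "'n::finite fn"
 assumes "L2 f" "g : LM" "!!x. norm (g x) <= B" shows "L2 (%x. g x * f x)"
proof (rule L2_dominated[OF assms(1), of _ B])
 show "(%x. g x * f x) : LM"
  using L2_measurable[OF assms(1)] assms(2) by (intro borel_measurable_times)
 show "norm (g x * f x) <= B * norm (f x)" for x
  using assms(3)[of x] by (simp add: norm_mult mult_right_mono)
qed

lemma L2_mult_test: assumes "L2 f" "test U g" shows "L2 (%x. g x * f x)"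
proof -
 obtain B where "!!x. norm (g x) <= B" using test_bounded[OF assms(2)] by metis
 thus ?thesis by (rule L2_mult_bounded[OF assms(1) test_measurable[OF assms(2)]])
qed

lemma L2_test: assumes "test U f" shows "L2 f"
proof -
 obtain B where B: "B > 0" "!!x. norm (f x) <= B" using test_bounded[OF assms] by metis
 have "Lint (%x. (norm (f x))^2)"
 proof (rule integrable_dominated)
  show "Lint (%x. B * norm (f x))" using test_integrable[OF assms] by simp
  show "(%x. (norm (f x))^2) : LM" by (rule borel_measurable_power[OF measurable_compose[OF test_measurable[OF assms] borel_measurable_norm]])
  show "norm ((norm (f x))^2) <= B * norm (f x)" for x
   using mult_right_mono[OF B(2)[of x] norm_ge_zero[of "f x"]] by (simp add: power2_eq_square)
 qed
 thus ?thesis using test_measurable[OF assms] by (simp add: L2_def)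
qed

lemma L2_integrable:
 fixes f :: "real^'n => 'b::euclidean_space"
 assumes "L2 f" "bounded S" "!!x. x ~: S ==> f x = 0" shows "Lint f"
proof -
 obtain B where "!!x. x : S ==> norm x <= B" using assms(2) unfolding bounded_iff by blast
 hence B: "S <= cball 0 B" by auto
 show ?thesis
 proof (rule integrable_dominated[OF _ L2_measurable[OF assms(1)]])
  show "Lint (%x. indicator (cball 0 B) x + (norm (f x))^2)"
   using L2_sq_integrable[OF assms(1)] by (intro Bintegrable_add integrable_real_indicator) (auto intro: emeasure_lborel_cball_finite[unfolded infinity_ennreal_def])
  show "norm (f x) <= indicator (cball 0 B) x + (norm (f x))^2" for x
  proof (cases "x : cball 0 B")
   case True
   have "norm (f x) <= 1 + (norm (f x))^2" using zero_le_power2[of "norm (f x) - 1/2"] by (simp add: power2_eq_square algebra_simps)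
   thus ?thesis using True by simp
  next
   case False
   hence "x ~: S" using B by blast
   thus ?thesis using assms(3)[of x] by simp
  qed
 qed
qed

text \<open>Analysis is done on the whole space with functions extended by zero; this equivalence
  and \<open>integral_on\<close> translate the statements about
  \<open>lebesgue_on S\<close>.\<close>

lemma L2_on_iff:
 assumes "S : sets lebesgue" shows "L2_on S f <-> L2 (%x. if x : S then f x else 0)"
proof -
 have 1: "(%x. indicator S x *R f x) = (%x. if x : S then f x else 0)" by (auto simp: indicator_def)
 have 2: "(%x. indicator S x *R (norm (f x))\<^sup>2) = (%x. (norm (if x : S then f x else 0))^2)" by (auto simp: indicator_def)
 have "f : borel_measurable (lebesgue_on S) <-> (%x. if x : S then f x else 0) : LM"
  by (subst borel_measurable_restrict_space_iff) (use assms in "simp_all add: 1")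
 moreover have "integrable (lebesgue_on S) (%x. (norm (f x))^2) <-> Lint (%x. (norm (if x : S then f x else 0))^2)"
  by (subst integrable_restrict_space) (use assms in "simp_all only: 2 space_completion space_lborel space_borel Int_UNIV_right")
 ultimately show ?thesis by (simp add: L2_on_def L2_def)
qed

lemma integral_on:
 fixes f :: "real^'n => 'b::euclidean_space"
 assumes "S : sets lebesgue" shows "(LIO S (%x. f x)) = (LI x. (if x : S then f x else 0))"
proof -
 have 1: "(%x. indicator S x *R f x) = (%x. if x : S then f x else 0)" by (auto simp: indicator_def)
 show ?thesis using assms by (subst integral_restrict_space) (simp_all add: 1)
qed

section \<open>Convergence in the square mean\<close>

definition L2lim :: "(nat => real^'n => 'b::euclidean_space) => (real^'n => 'b) => bool" where
 "L2lim F f <-> (%n. \<integral>x. (norm (F n x - f x))^2 \<partial>lebesgue) ---> 0"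

lemma L2lim_product:
 fixes f g :: "'n::finite fn"
 assumes "!!n. L2 (F n)" "L2 f" "L2lim F f" "L2 g"
 shows "(%n. \<integral>x. F n x * g x \<partial>lebesgue) ---> (LI x. f x * g x)"
proof (rule LIMSEQ_I)
 fix r :: real assume r: "r > 0"
 define b where "b = (LI x. (norm (g x))^2)"
 have b: "b >= 0" unfolding b_def by simp
 \<comment> \<open>The weight in 2 p q <= t p^2 + q^2 / t, chosen so that the part b / t with the
   fixed function g stays below r; the other part tends to 0.\<close>
 define t where "t = (b + 1) / r"
 have t: "t > 0" using b r by (simp add: t_def)
 have bt: "b / t < r" using b r by (simp add: t_def field_simps)
 have "r / t > 0" using r t by simp
 then obtain N where N: "!!n. n >= N ==> norm ((LI x. (norm (F n x - f x))^2) - 0) < r / t"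
  using LIMSEQ_D[OF assms(3)[unfolded L2lim_def]] by metis
 have "norm ((LI x. F n x * g x) - (LI x. f x * g x)) < r" if "n >= N" for n
 proof -
  define a where "a = (LI x. (norm (F n x - f x))^2)"
  have a: "a < r / t" "a >= 0" using N[OF that] by (auto simp: a_def)
  have d: "L2 (%x. F n x - f x)" by (rule L2_diff[OF assms(1,2)])
  have "(LI x. F n x * g x) - (LI x. f x * g x) = (LI x. (F n x - f x) * g x)"
   using L2_product[OF assms(1,4)] L2_product[OF assms(2,4)] by (simp add: left_diff_distrib Bintegral_diff)
  also have "norm ... <= (LI x. (t * (norm (F n x - f x))^2 + (norm (g x))^2 / t) / 2)"
  proof (rule Bochner_Integration.integral_norm_bound_integral[OF L2_product[OF d assms(4)]])
   show "Lint (%x. (t * (norm (F n x - f x))^2 + (norm (g x))^2 / t) / 2)"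
   using L2_sq_integrable[OF d] L2_sq_integrable[OF assms(4)] by simp
   fix x
   define p q where "p = norm (F n x - f x)" and "q = norm (g x)"
   have "0 <= (t * p - q)^2 / t" using t by simp
   hence "2 * (p * q) <= t * p^2 + q^2 / t" using t by (simp add: power2_eq_square field_simps)
   thus "norm ((F n x - f x) * g x) <= (t * (norm (F n x - f x))^2 + (norm (g x))^2 / t) / 2" by (simp add: norm_mult p_def q_def)
  qed
  also have "... = (t * a + b / t) / 2"
   using L2_sq_integrable[OF d] L2_sq_integrable[OF assms(4)] by (simp add: a_def b_def)
  also have "... < r"
  proof -
   have "t * a < r" using a(1) t by (simp add: pos_less_divide_eq mult.commute)
   thus ?thesis using bt by simp
  qed
  finally show ?thesis .
 qed
 thus "EX no. ALL n>=no. norm ((LI x. F n x * g x) - (LI x. f x * g x)) < r" by blast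
qed

lemma L2lim_add:
 assumes "!!n. L2 (F n)" "L2 f" "L2lim F f" "!!n. L2 (G n)" "L2 g" "L2lim G g"
 shows "L2lim (%n x. F n x + G n x) (%x. f x + g x)"
 unfolding L2lim_def
proof (rule Lim_null_comparison)
 show "(%n. 2 * (LI x. (norm (F n x - f x))^2) + 2 * (LI x. (norm (G n x - g x))^2)) ---> 0"
  using tendsto_add[OF tendsto_mult_right_zero[OF assms(3)[unfolded L2lim_def], of 2] tendsto_mult_right_zero[OF assms(6)[unfolded L2lim_def], of 2]] by simp
 show "\<forall>\<^sub>F n in sequentially. norm (LI x. (norm (F n x + G n x - (f x + g x)))^2)
   <= 2 * (LI x. (norm (F n x - f x))^2) + 2 * (LI x. (norm (G n x - g x))^2)"
 proof (rule always_eventually, rule allI)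
  fix n
  have 1: "L2 (%x. F n x - f x)" "L2 (%x. G n x - g x)" using assms by (auto intro: L2_diff)
  have eq: "F n x + G n x - (f x + g x) = (F n x - f x) + (G n x - g x)" for x by simp
  have "(LI x. (norm (F n x + G n x - (f x + g x)))^2) <= (LI x. 2 * (norm (F n x - f x))^2 + 2 * (norm (G n x - g x))^2)"
   unfolding eq by (rule integral_mono[OF L2_sq_integrable[OF L2_add[OF 1]]])
   (use L2_sq_integrable[OF 1(1)] L2_sq_integrable[OF 1(2)] norm_sq_add_le in auto)
  thus "norm (LI x. (norm (F n x + G n x - (f x + g x)))^2)
   <= 2 * (LI x. (norm (F n x - f x))^2) + 2 * (LI x. (norm (G n x - g x))^2)"
   using L2_sq_integrable[OF 1(1)] L2_sq_integrable[OF 1(2)] by simp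
 qed
qed

lemma L2lim_sum:
 assumes "finite J" "!!j n. j : J ==> L2 (F j n)" "!!j. j : J ==> L2 (f j)" "!!j. j : J ==> L2lim (F j) (f j)"
 shows "L2lim (%n x. SUM j:J. F j n x) (%x. SUM j:J. f j x)"
 using assms
proof (induction J rule: finite_induct)
 case empty thus ?case by (simp add: L2lim_def)
next
 case (insert i J)
 have "L2lim (%n x. F i n x + (SUM j:J. F j n x)) (%x. f i x + (SUM j:J. f j x))" by (rule L2lim_add) (use insert in "auto intro!: L2_sum")
 thus ?case using insert.hyps by simp
qed

lemma L2_zero_AE:
 assumes "L2 f" "(LI x. (norm (f x))^2) = 0" shows "AEL x. f x = 0"
proof -
 have "AEL x. (norm (f x))^2 = 0"
  using assms(2) by (subst integral_nonneg_eq_0_iff_AE[symmetric]) (use L2_sq_integrable[OF assms(1)] in auto)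
 thus ?thesis by eventually_elim simp
qed

section \<open>Continuity of translations in the square mean\<close>

definition L2_osc :: "(real^'n => complex) => real^'n => ennreal" where
 "L2_osc g y = (\<integral>\<^sup>+x. ennreal ((norm (g (x - y) - g x))^2) \<partial>lborel)"

text \<open>The modulus is a nonnegative integral over the Borel measure, so Fubini applies to it
  without integrability conditions.\<close>

definition L2_translation_continuous :: "(real^'n => complex) => bool" where
 "L2_translation_continuous g <-> (ALL e>0. EX d>0. ALL y. norm y < d --> L2_osc g y <= ennreal e)"

lemma borel_shift: "g : borel_measurable borel ==> (%x::real^'n. g (x - y)) \<in> borel_measurable borel"
 by (rule measurable_compose[of "%x. x - y" borel borel g]) simp_all

lemma two_ennreal: "0 <= a ==> 2 * ennreal a = ennreal (2 * a)" by (simp add: ennreal_mult)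

lemma nn_integral_sq_add:
 fixes f g :: "'n::finite fn"
 assumes "f : borel_measurable borel" "g : borel_measurable borel"
 shows "(\<integral>\<^sup>+x. ennreal ((norm (f x + g x))^2) \<partial>lborel) <=
   2 * (\<integral>\<^sup>+x. ennreal ((norm (f x))^2) \<partial>lborel) + 2 * (\<integral>\<^sup>+x. ennreal ((norm (g x))^2) \<partial>lborel)"
proof -
 note [measurable] = assms
 have "(\<integral>\<^sup>+x. ennreal ((norm (f x + g x))^2) \<partial>lborel) <= (\<integral>\<^sup>+x. 2 * ennreal ((norm (f x))^2) + 2 * ennreal ((norm (g x))^2) \<partial>lborel)"
 proof (rule nn_integral_mono)
  fix x
  have "ennreal ((norm (f x + g x))^2) <= ennreal (2 * (norm (f x))^2 + 2 * (norm (g x))^2)" by (rule ennreal_leI[OF norm_sq_add_le])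
  thus "ennreal ((norm (f x + g x))^2) <= 2 * ennreal ((norm (f x))^2) + 2 * ennreal ((norm (g x))^2)" by (simp add: ennreal_plus ennreal_mult)
 qed
 also have "... = 2 * (\<integral>\<^sup>+x. ennreal ((norm (f x))^2) \<partial>lborel) + 2 * (\<integral>\<^sup>+x. ennreal ((norm (g x))^2) \<partial>lborel)"
  by (simp add: nn_integral_add nn_integral_cmult)
 finally show ?thesis .
qed

lemma L2_osc_add:
 assumes "f : borel_measurable borel" "g : borel_measurable borel"
 shows "L2_osc (%x. f x + g x) y <= 2 * L2_osc f y + 2 * L2_osc g y"
proof -
 note [measurable] = assms borel_shift[OF assms(1)] borel_shift[OF assms(2)]
 have "f (x - y) + g (x - y) - (f x + g x) = (f (x - y) - f x) + (g (x - y) - g x)" for x by simp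
 thus ?thesis
  unfolding L2_osc_def by (simp only:) (rule nn_integral_sq_add; measurable)
qed

lemma translation_continuous_add:
 assumes "f : borel_measurable borel" "g : borel_measurable borel"
  "L2_translation_continuous f" "L2_translation_continuous g"
 shows "L2_translation_continuous (%x. f x + g x)"
 unfolding L2_translation_continuous_def
proof (intro allI impI)
 fix e :: real assume e: "e > 0"
 obtain d1 where d1: "d1 > 0" "!!y. norm y < d1 ==> L2_osc f y <= ennreal (e/4)"
  using assms(3) e unfolding L2_translation_continuous_def by (metis divide_pos_pos zero_less_numeral)
 obtain d2 where d2: "d2 > 0" "!!y. norm y < d2 ==> L2_osc g y <= ennreal (e/4)"
  using assms(4) e unfolding L2_translation_continuous_def by (metis divide_pos_pos zero_less_numeral)
 have "L2_osc (%x. f x + g x) y <= ennreal e" if "norm y < min d1 d2" for y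
 proof -
  have "L2_osc (%x. f x + g x) y <= 2 * L2_osc f y + 2 * L2_osc g y" by (rule L2_osc_add[OF assms(1,2)])
  also have "... <= 2 * ennreal (e/4) + 2 * ennreal (e/4)"
   using d1(2)[of y] d2(2)[of y] that by (intro add_mono mult_left_mono) auto
  also have "... = ennreal (2 * (e/4) + 2 * (e/4))" using e by (simp only: two_ennreal ennreal_plus[symmetric] zero_le_divide_iff zero_le_numeral less_imp_le mult_nonneg_nonneg simp_thms)
  also have "2 * (e/4) + 2 * (e/4) = e" by simp
  finally show ?thesis .
 qed
 thus "EX d>0. ALL y. norm y < d --> L2_osc (%x. f x + g x) y <= ennreal e"
  using d1(1) d2(1) by (intro exI[of _ "min d1 d2"]) auto
qed

text \<open>A is squeezed between a compact K and an open U with U - K of small measure. A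
  translation by less than the distance from K to the complement of U changes the indicator at x
  only if x or x - y lies in U - K.\<close>

lemma translation_continuous_indicator:
 fixes A :: "(real^'n) set" and c :: complex
 assumes A: "A : sets borel" "bounded A"
 shows "L2_translation_continuous (%x. indicator A x *R c)"
 unfolding L2_translation_continuous_def
proof (intro allI impI)
 fix e :: real assume e: "e > 0"
 define s where "s = (e / 2) / ((norm c)^2 + 1)"
 have s: "s > 0" using e by (simp add: s_def add_nonneg_pos)
 have s2: "(norm c)^2 * (2 * s) <= e"
 proof -
  have "(norm c)^2 + 1 ~= 0" using zero_le_power2[of "norm c"] by linarith
  hence "((norm c)^2 + 1) * s = e / 2" using nonzero_eq_divide_eq[of "(norm c)^2 + 1" s "e / 2"] s_def by (metis mult.commute)
  hence "((norm c)^2 + 1) * (2 * s) = e" by simp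
  moreover have "(norm c)^2 * (2 * s) <= ((norm c)^2 + 1) * (2 * s)" using s by (intro mult_right_mono) auto
  ultimately show ?thesis by simp
 qed
 obtain U where U: "open U" "A <= U" "emeasure lborel (U - A) < ennreal (s/2)"
  using outer_regular_lborel[OF A(1), of "s/2"] s by (metis half_gt_zero)
 have "- A : sets borel" using A(1) by (rule borel_comp)
 then obtain V where V: "open V" "- A <= V" "emeasure lborel (V - - A) < ennreal (s/2)"
  using outer_regular_lborel[of "- A" "s/2"] s by (metis half_gt_zero)
 define K where "K = - V"
 have KA: "K <= A" using V(2) by (auto simp: K_def)
 have K: "compact K" using V(1) A(2) KA bounded_subset by (auto simp: K_def compact_eq_bounded_closed closed_Compl)
 have Kb[measurable]: "K : sets borel" "U : sets borel" "A : sets borel"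
  using K U(1) A(1) by (auto simp: borel_closed compact_imp_closed)
 have "emeasure lborel (U - K) <= emeasure lborel ((U - A) Un (V - - A))" by (rule emeasure_mono) (use V(1) U(1) A(1) in "auto simp: K_def")
 also have "... <= emeasure lborel (U - A) + emeasure lborel (V - - A)" by (rule emeasure_subadditive) (use V(1) U(1) A(1) in auto)
 also have "... <= ennreal (s/2) + ennreal (s/2)" using U(3) V(3) by (intro add_mono) auto
 also have "... = ennreal s" using s by (simp flip: ennreal_plus)
 finally have UK: "emeasure lborel (U - K) <= ennreal s" .
 obtain d where d: "d > 0" "!!x y. x : K ==> y : - U ==> d <= dist x y"
 proof -
  have "K Int - U = {}" "closed (- U)" using KA U(1,2) by auto
  hence "EX d>0. ALL x:K. ALL y:- U. d <= dist x y" using separate_compact_closed[OF K] by blast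
  thus thesis using that by blast
 qed
 have KU: "z : U" if "x : K" "norm (z - x) < d" for x z
  using d(2)[OF that(1), of z] that(2) by (auto simp: dist_norm norm_minus_commute)
 have "L2_osc (%x. indicator A x *R c) y <= ennreal e" if y: "norm y < d" for y
 proof -
  have "ennreal ((norm (indicator A (x - y) *R c - indicator A x *R c))^2) <=
   ennreal ((norm c)^2) * (indicator (U - K) x + indicator (U - K) (x - y))" for x
  proof -
   consider "x : A <-> x - y : A" | "x - y : A" "x ~: A" | "x - y ~: A" "x : A" by blast
   thus ?thesis
   proof cases
   case 1 thus ?thesis by (auto simp: indicator_def)
   next
   case 2
   hence "x : U - K | x - y : U - K" using KU[of "x - y" x] y KA U(2) by auto
   hence "1 <= (indicator (U - K) x + indicator (U - K) (x - y) :: ennreal)" by (auto simp: indicator_def)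
   from mult_left_mono[OF this, of "ennreal ((norm c)^2)"] show ?thesis using 2 by (simp add: indicator_def)
   next
   case 3
   hence "x : U - K | x - y : U - K" using KU[of x "x - y"] y KA U(2) by auto
   hence "1 <= (indicator (U - K) x + indicator (U - K) (x - y) :: ennreal)" by (auto simp: indicator_def)
   from mult_left_mono[OF this, of "ennreal ((norm c)^2)"] show ?thesis using 3 by (simp add: indicator_def)
   qed
  qed
  hence "L2_osc (%x. indicator A x *R c) y <= (\<integral>\<^sup>+x. ennreal ((norm c)^2) * (indicator (U - K) x + indicator (U - K) (x - y)) \<partial>lborel)"
   unfolding L2_osc_def by (intro nn_integral_mono)
  also have "... = ennreal ((norm c)^2) * (\<integral>\<^sup>+x. (indicator (U - K) x + indicator (U - K) (x - y)) \<partial>lborel)"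
   by (rule nn_integral_cmult) measurable
  also have "(\<integral>\<^sup>+x. (indicator (U - K) x + indicator (U - K) (x - y)) \<partial>lborel) = (\<integral>\<^sup>+x. indicator (U - K) x \<partial>lborel) + (\<integral>\<^sup>+x. indicator (U - K) (x - y) \<partial>lborel)"
   by (rule nn_integral_add) measurable
  also have "(\<integral>\<^sup>+x. indicator (U - K) (x - y) \<partial>lborel) = (\<integral>\<^sup>+x. indicator (U - K) x \<partial>lborel)"
   by (rule nn_integral_lborel_shift) measurable
  also have "(\<integral>\<^sup>+x. indicator (U - K) x \<partial>lborel) = emeasure lborel (U - K)" by (simp add: nn_integral_indicator)
  also have "ennreal ((norm c)^2) * (emeasure lborel (U - K) + emeasure lborel (U - K)) <= ennreal ((norm c)^2) * (ennreal s + ennreal s)"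
   by (intro mult_left_mono add_mono UK) auto
  also have "... = ennreal ((norm c)^2 * (2 * s))" using s by (simp add: ennreal_mult flip: ennreal_plus)
  also have "... <= ennreal e" by (rule ennreal_leI[OF s2])
  finally show ?thesis .
 qed
 thus "EX d>0. ALL y. norm y < d --> L2_osc (%x. indicator A x *R c) y <= ennreal e" using d(1) by blast
qed

lemma translation_continuous_sum:
 assumes "finite J" "!!j. j : J ==> f j : borel_measurable borel" "!!j. j : J ==> L2_translation_continuous (f j)"
 shows "L2_translation_continuous (%x. SUM j:J. f j x)"
 using assms
proof (induction J rule: finite_induct)
 case empty
 thus ?case by (auto simp: L2_translation_continuous_def L2_osc_def intro!: exI[of _ 1])
next
 case (insert i J)
 have "L2_translation_continuous (%x. f i x + (SUM j:J. f j x))"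
  by (rule translation_continuous_add) (use insert in "auto intro!: borel_measurable_sum")
 thus ?case using insert.hyps by simp
qed

text \<open>The approximation error enters twice, at x and at x - y, and each splitting of a square
  costs a factor 2; hence the fractions e/4 and e/16.\<close>

lemma translation_continuous_approx:
 assumes g: "g : borel_measurable borel"
  and a: "!!e. e > 0 ==> EX h. h : borel_measurable borel & L2_translation_continuous h &
   (\<integral>\<^sup>+x. ennreal ((norm (g x - h x))^2) \<partial>lborel) <= ennreal e"
 shows "L2_translation_continuous g"
 unfolding L2_translation_continuous_def
proof (intro allI impI)
 fix e :: real assume e: "e > 0"
 then obtain h where h[measurable]: "h : borel_measurable borel" and hc: "L2_translation_continuous h"
  and gh: "(\<integral>\<^sup>+x. ennreal ((norm (g x - h x))^2) \<partial>lborel) <= ennreal (e/16)"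
  using a[of "e/16"] by auto
 note [measurable] = g borel_shift[OF g] borel_shift[OF h]
 obtain d where d: "d > 0" "!!y. norm y < d ==> L2_osc h y <= ennreal (e/4)"
  using hc e unfolding L2_translation_continuous_def by (metis divide_pos_pos zero_less_numeral)
 have "L2_osc g y <= ennreal e" if "norm y < d" for y
 proof -
  define k where "k x = g x - h x" for x
  have k[measurable]: "k : borel_measurable borel" unfolding k_def using g h by (rule borel_measurable_diff)
  note [measurable] = borel_shift[OF k]
  have "L2_osc k y = (\<integral>\<^sup>+x. ennreal ((norm (k (x - y) + - k x))^2) \<partial>lborel)" by (simp add: L2_osc_def)
  also have "... <= 2 * (\<integral>\<^sup>+x. ennreal ((norm (k (x - y)))^2) \<partial>lborel) + 2 * (\<integral>\<^sup>+x. ennreal ((norm (- k x))^2) \<partial>lborel)"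
   by (rule nn_integral_sq_add) measurable
  also have "(\<integral>\<^sup>+x. ennreal ((norm (k (x - y)))^2) \<partial>lborel) = (\<integral>\<^sup>+x. ennreal ((norm (k x))^2) \<partial>lborel)"
   by (rule nn_integral_lborel_shift[of "%x. ennreal ((norm (k x))^2)"]) measurable
  also have "(\<integral>\<^sup>+x. ennreal ((norm (- k x))^2) \<partial>lborel) = (\<integral>\<^sup>+x. ennreal ((norm (k x))^2) \<partial>lborel)"
   by (simp only: norm_minus_cancel)
  finally have ok: "L2_osc k y <= 2 * ennreal (e/16) + 2 * ennreal (e/16)"
   using add_mono[OF mult_left_mono[OF gh[folded k_def], of 2] mult_left_mono[OF gh[folded k_def], of 2]] by (auto intro: order_trans)
  have "L2_osc g y = L2_osc (%x. h x + k x) y" by (simp add: k_def)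
  also have "... <= 2 * L2_osc h y + 2 * L2_osc k y" by (rule L2_osc_add[OF h k])
  also have "... <= 2 * ennreal (e/4) + 2 * (2 * ennreal (e/16) + 2 * ennreal (e/16))"
   using d(2)[OF that] ok by (intro add_mono mult_left_mono) auto
  also have "... = ennreal (2 * (e/4) + 2 * (2 * (e/16) + 2 * (e/16)))" using e by (simp only: two_ennreal ennreal_plus[symmetric] zero_le_divide_iff zero_le_numeral less_imp_le mult_nonneg_nonneg add_nonneg_nonneg simp_thms)
  also have "2 * (e/4) + 2 * (2 * (e/16) + 2 * (e/16)) = e" by simp
  finally show ?thesis .
 qed
 thus "EX d>0. ALL y. norm y < d --> L2_osc g y <= ennreal e" using d(1) by blast
qed

text \<open>Simple functions cut off to balls are finite combinations of indicators of bounded Borel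
  sets. They converge dominatedly to g: |H i| <= 2 |g| gives the majorant (1 + 2)^2 |g|^2.\<close>

lemma translation_continuous_L2:
 fixes g :: "'n::finite fn"
 assumes g[measurable]: "g : borel_measurable borel" and fin: "(\<integral>\<^sup>+x. ennreal ((norm (g x))^2) \<partial>lborel) < \<infinity>"
 shows "L2_translation_continuous g"
proof -
 obtain F where F: "!!i. simple_function lborel (F i)" "!!x. (%i. F i x) ---> g x" "!!i x. norm (F i x) <= 2 * norm (g x)"
  using borel_measurable_implies_sequence_metric[of g lborel 0] by auto
 define H where "H i x = indicator (ball 0 (real i)) x *R F i x" for i x
 have Fm[measurable]: "F i : borel_measurable borel" for i using borel_measurable_simple_function[OF F(1)] by simp
 have Hm[measurable]: "H i : borel_measurable borel" for i unfolding H_def by (intro borel_measurable_scaleR borel_measurable_indicator Fm) simp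
 have "(%i. \<integral>\<^sup>+x. ennreal ((norm (g x - H i x))^2) \<partial>lborel) ---> (\<integral>\<^sup>+x. 0 \<partial>(lborel::(real^'n) measure))"
 proof (rule nn_integral_dominated_convergence[where w="%x. 9 * ennreal ((norm (g x))^2)"])
  show "(\<integral>\<^sup>+x. 9 * ennreal ((norm (g x))^2) \<partial>lborel) < \<infinity>"
   using fin by (simp add: nn_integral_cmult ennreal_mult_less_top)
  show "AE x in lborel. ennreal ((norm (g x - H i x))^2) <= 9 * ennreal ((norm (g x))^2)" for i
  proof (rule AE_I2)
   fix x
   have "norm (H i x) <= 2 * norm (g x)" using F(3)[of i x] by (auto simp: H_def indicator_def)
   hence "norm (g x - H i x) <= 3 * norm (g x)" using norm_triangle_ineq4[of "g x" "H i x"] by linarith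
   hence "(norm (g x - H i x))^2 <= (3 * norm (g x))^2" by (rule power_mono) simp
   hence "ennreal ((norm (g x - H i x))^2) <= ennreal (9 * (norm (g x))^2)" by (intro ennreal_leI) (simp add: power_mult_distrib)
   thus "ennreal ((norm (g x - H i x))^2) <= 9 * ennreal ((norm (g x))^2)" by (simp add: ennreal_mult)
  qed
  show "AE x in lborel. (%i. ennreal ((norm (g x - H i x))^2)) ---> 0"
  proof (rule AE_I2)
   fix x
   have "\<forall>\<^sub>F i in sequentially. F i x = H i x"
   using eventually_gt_at_top[of "nat \<lceil>norm x\<rceil>"] by eventually_elim (auto simp: H_def indicator_def dist_norm, linarith)
   hence "(%i. H i x) ---> g x" using F(2)[of x] by (rule Lim_transform_eventually[rotated])
   hence "(%i. (norm (g x - H i x))^2) ---> (norm (g x - g x))^2" by (intro tendsto_intros)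
   hence "(%i. ennreal ((norm (g x - H i x))^2)) ---> ennreal 0" by (intro tendsto_ennrealI) simp
   thus "(%i. ennreal ((norm (g x - H i x))^2)) ---> 0" by simp
  qed
 qed measurable
 hence lim: "(%i. \<integral>\<^sup>+x. ennreal ((norm (g x - H i x))^2) \<partial>lborel) ---> 0" by simp
 have tc: "L2_translation_continuous (H i)" for i
 proof -
  have fin: "finite (F i ` UNIV)" using simple_functionD(1)[OF F(1)] by simp
  have "H i x = (SUM c:F i ` UNIV. indicator (F i -` {c} Int ball 0 (real i)) x *R c)" for x
  proof -
   have "(SUM c:F i ` UNIV. indicator (F i -` {c} Int ball 0 (real i)) x *R c) = (SUM c:F i ` UNIV. if c = F i x then H i x else 0)"
   by (rule sum.cong) (auto simp: H_def indicator_def)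
   also have "... = H i x" using fin by (simp add: sum.delta)
   finally show ?thesis by simp
  qed
  hence "H i = (%x. SUM c:F i ` UNIV. indicator (F i -` {c} Int ball 0 (real i)) x *R c)" by blast
  moreover have "L2_translation_continuous (%x. SUM c:F i ` UNIV. indicator (F i -` {c} Int ball 0 (real i)) x *R c)"
  proof (rule translation_continuous_sum[OF fin])
   fix c
   have A: "F i -` {c} Int ball 0 (real i) : sets borel"
   using simple_functionD(2)[OF F(1), of i "{c}"] by simp
   show "(%x. indicator (F i -` {c} Int ball 0 (real i)) x *R c) : borel_measurable borel"
   using A by (intro borel_measurable_scaleR borel_measurable_indicator borel_measurable_const)
   show "L2_translation_continuous (%x. indicator (F i -` {c} Int ball 0 (real i)) x *R c)"
   by (rule translation_continuous_indicator[OF A]) (simp add: bounded_Int)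
  qed
  ultimately show ?thesis by simp
 qed
 show ?thesis
 proof (rule translation_continuous_approx[OF g])
  fix e :: real assume "e > 0"
  hence "\<forall>\<^sub>F i in sequentially. (\<integral>\<^sup>+x. ennreal ((norm (g x - H i x))^2) \<partial>lborel) < ennreal e"
   using order_tendstoD(2)[OF lim, of "ennreal e"] by simp
  then obtain i where "(\<integral>\<^sup>+x. ennreal ((norm (g x - H i x))^2) \<partial>lborel) < ennreal e"
   using eventually_happens'[OF sequentially_bot] by blast
  thus "EX h. h : borel_measurable borel & L2_translation_continuous h &
   (\<integral>\<^sup>+x. ennreal ((norm (g x - h x))^2) \<partial>lborel) <= ennreal e"
   using tc Hm by (intro exI[of _ "H i"]) auto
 qed
qed


section \<open>Mollification\<close>

lemma conv_reflect:
 assumes "g : LM" "et : LM"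
 shows "conv g et x = (LI y. g (x - y) * et y)"
proof -
 have "conv g et x = conv et g x" using conv_commute[OF assms] by simp
 thus ?thesis by (simp add: conv_def mult.commute)
qed

lemma conv_sub_pointwise:
 fixes g et :: "'n::finite fn" and rh :: "real^'n => real"
 assumes g: "g : borel_measurable borel" "L2 g"
  and et: "test UNIV et" "!!x. et x = of_real (rh x)" "!!x. 0 <= rh x" "(LI x. et x) = 1"
 shows "ennreal ((norm (conv g et x - g x))^2) <= (\<integral>\<^sup>+y. ennreal (rh y * (norm (g (x - y) - g x))^2) \<partial>lborel)"
proof -
 define h where "h y = norm (g (x - y) - g x)" for y
 have rh_eq: "rh = (%x. Re (et x))" using et(2) by auto
 have rhi: "Lint rh" unfolding rh_eq by (rule integrable_Re[OF test_integrable[OF et(1)]])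
 have rh1: "(LI x. rh x) = 1" unfolding rh_eq using integral_Re[OF test_integrable[OF et(1)]] et(4) by simp
 obtain B where B: "B > 0" "!!x. norm (et x) <= B" using test_bounded[OF et(1)] by metis
 have rhB: "rh x <= B" for x using B(2)[of x] et(2,3)[of x] by simp
 have gs: "L2 (%y. g (x - y))"
  using isometry_measurable[of uminus g x] isometry_integrable[of uminus "%y. (norm (g y))^2" x] L2_measurable[OF g(2)]
   L2_sq_integrable[OF g(2)] borel_measurable_integrable[OF L2_sq_integrable[OF g(2)]] by (simp add: L2_def orthogonal_transformation_neg)
 have hm: "h : LM"
  unfolding h_def by (rule measurable_compose[OF borel_measurable_diff[OF L2_measurable[OF gs] borel_measurable_const] borel_measurable_norm])
 have rhm: "rh : LM" by (rule borel_measurable_integrable[OF rhi])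
 have h0: "h y >= 0" for y by (simp add: h_def)
 have i2: "Lint (%y. rh y * (h y)^2)"
 proof (rule integrable_dominated)
  show "Lint (%y. B * (2 * (norm (g (x - y)))^2) + (2 * (norm (g x))^2) * rh y)"
   using L2_sq_integrable[OF gs] rhi by simp
  show "(%y. rh y * (h y)^2) : LM" by (intro borel_measurable_times borel_measurable_power hm rhm)
  fix y
  have "(h y)^2 <= 2 * (norm (g (x - y)))^2 + 2 * (norm (g x))^2"
   using norm_sq_add_le[of "g (x - y)" "- g x"] by (simp add: h_def)
  hence "rh y * (h y)^2 <= rh y * (2 * (norm (g (x - y)))^2 + 2 * (norm (g x))^2)" using et(3) by (rule mult_left_mono)
  also have "... = rh y * (2 * (norm (g (x - y)))^2) + rh y * (2 * (norm (g x))^2)" by (simp add: distrib_left)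
  also have "... <= B * (2 * (norm (g (x - y)))^2) + rh y * (2 * (norm (g x))^2)" by (intro add_right_mono mult_right_mono rhB) simp
  finally show "norm (rh y * (h y)^2) <= B * (2 * (norm (g (x - y)))^2) + (2 * (norm (g x))^2) * rh y"
   using et(3)[of y] by (simp add: mult.commute)
 qed
 have i1: "Lint (%y. rh y * h y)"
 proof (rule integrable_dominated)
  show "Lint (%y. rh y + rh y * (h y)^2)" using rhi i2 by simp
  show "(%y. rh y * h y) : LM" by (intro borel_measurable_times hm rhm)
  fix y
  have "h y <= 1 + (h y)^2" using zero_le_power2[of "h y - 1/2"] by (simp add: power2_eq_square algebra_simps)
  hence "rh y * h y <= rh y * (1 + (h y)^2)" using et(3) by (rule mult_left_mono)
  thus "norm (rh y * h y) <= rh y + rh y * (h y)^2" using et(3)[of y] h0[of y] by (simp add: distrib_left)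
 qed
 define m where "m = (LI y. rh y * h y)"
 have gi: "Lint (%y. g (x - y) * et y)" by (rule L2_product[OF gs L2_test[OF et(1)]])
 have "conv g et x - g x = (LI y. g (x - y) * et y) - (LI y. g x * et y)"
  using conv_reflect[OF L2_measurable[OF g(2)] test_measurable[OF et(1)], of x] et(4) test_integrable[OF et(1)] by simp
 also have "... = (LI y. g (x - y) * et y - g x * et y)"
  using gi test_integrable[OF et(1)] by simp
 also have "norm ... <= m" unfolding m_def
 proof (rule Bochner_Integration.integral_norm_bound_integral[OF _ i1])
  show "Lint (%y. g (x - y) * et y - g x * et y)" using gi test_integrable[OF et(1)] by simp
  show "norm (g (x - y) * et y - g x * et y) <= rh y * h y" for y
  proof -
   have "g (x - y) * et y - g x * et y = of_real (rh y) * (g (x - y) - g x)" by (simp add: et(2) algebra_simps)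
   thus ?thesis using et(3)[of y] by (simp add: norm_mult h_def)
  qed
 qed
 finally have "(norm (conv g et x - g x))^2 <= m^2" by (intro power_mono) auto
 also have "m^2 <= (LI y. rh y * (h y)^2)"
 proof -
  \<comment> \<open>Jensen's inequality, as nonnegativity of the variance of h under the probability
    density rh.\<close>
  have "0 <= (LI y. rh y * (h y - m)^2)" using et(3) by (intro Bochner_Integration.integral_nonneg) simp
  also have "... = (LI y. rh y * (h y)^2 - 2 * m * (rh y * h y) + m^2 * rh y)" by (rule Bintegral_cong) (auto simp: power2_eq_square algebra_simps)
  also have "... = (LI y. rh y * (h y)^2) - 2 * m * m + m^2 * 1"
   using i1 i2 rhi rh1 by (simp add: m_def)
  finally show ?thesis by (simp add: power2_eq_square)
 qed
 finally have "ennreal ((norm (conv g et x - g x))^2) <= ennreal (LI y. rh y * (h y)^2)" by (rule ennreal_leI)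
 also have "... = (\<integral>\<^sup>+y. ennreal (rh y * (h y)^2) \<partial>lebesgue)"
  using et(3) by (intro nn_integral_eq_integral[OF i2, symmetric]) simp
 also have "... = (\<integral>\<^sup>+y. ennreal (rh y * (h y)^2) \<partial>lborel)" by (rule nn_integral_completion)
 finally show ?thesis by (simp add: h_def)
qed

text \<open>By the pointwise estimate and Fubini, the mean square error is at most the average of
  the oscillations with weight rh; only shifts in the support of rh matter.\<close>

lemma conv_L2_osc:
 fixes g et :: "'n::finite fn" and rh :: "real^'n => real"
 assumes g: "g : borel_measurable borel" "L2 g"
  and et: "test UNIV et" "!!x. et x = of_real (rh x)" "!!x. 0 <= rh x" "(LI x. et x) = 1"
  and osc: "!!y. rh y ~= 0 ==> L2_osc g y <= ennreal e"
 shows "(\<integral>\<^sup>+x. ennreal ((norm (conv g et x - g x))^2) \<partial>lborel) <= ennreal e"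
proof -
 have rh_eq: "rh = (%x. Re (et x))" using et(2) by auto
 have "continuous_on UNIV rh" unfolding rh_eq by (intro continuous_on_Re smooth_continuous test_smooth[OF et(1)])
 hence rhm[measurable]: "rh : borel_measurable borel" by (rule borel_measurable_continuous_onI)
 have rhi: "Lint rh" unfolding rh_eq by (rule integrable_Re[OF test_integrable[OF et(1)]])
 have rh1: "(LI x. rh x) = 1" unfolding rh_eq using integral_Re[OF test_integrable[OF et(1)]] et(4) by simp
 note [measurable] = g(1)
 have "(\<integral>\<^sup>+y. ennreal (rh y) \<partial>lborel) = (\<integral>\<^sup>+y. ennreal (rh y) \<partial>lebesgue)" by (rule nn_integral_completion[symmetric])
 also have "... = ennreal (LI x. rh x)" using et(3) by (intro nn_integral_eq_integral[OF rhi]) simp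
 finally have mass: "(\<integral>\<^sup>+y. ennreal (rh y) \<partial>lborel) = 1" using rh1 by simp
 have "(\<integral>\<^sup>+x. ennreal ((norm (conv g et x - g x))^2) \<partial>lborel) <=
   (\<integral>\<^sup>+x. \<integral>\<^sup>+y. ennreal (rh y * (norm (g (x - y) - g x))^2) \<partial>lborel \<partial>lborel)"
  by (intro nn_integral_mono conv_sub_pointwise[OF g et])
 also have "... = (\<integral>\<^sup>+y. \<integral>\<^sup>+x. ennreal (rh y * (norm (g (x - y) - g x))^2) \<partial>lborel \<partial>lborel)"
  by (rule lborel_pair.Fubini') measurable
 also have "... = (\<integral>\<^sup>+y. ennreal (rh y) * L2_osc g y \<partial>lborel)"
 proof (rule nn_integral_cong)
  fix y
  have "(\<integral>\<^sup>+x. ennreal (rh y * (norm (g (x - y) - g x))^2) \<partial>lborel) = (\<integral>\<^sup>+x. ennreal (rh y) * ennreal ((norm (g (x - y) - g x))^2) \<partial>lborel)"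
   using et(3) by (simp add: ennreal_mult)
  also have "... = ennreal (rh y) * L2_osc g y"
   unfolding L2_osc_def by (rule nn_integral_cmult) measurable
  finally show "(\<integral>\<^sup>+x. ennreal (rh y * (norm (g (x - y) - g x))^2) \<partial>lborel) = ennreal (rh y) * L2_osc g y" .
 qed
 also have "... <= (\<integral>\<^sup>+y. ennreal (rh y) * ennreal e \<partial>lborel)"
 proof (rule nn_integral_mono)
  fix y show "ennreal (rh y) * L2_osc g y <= ennreal (rh y) * ennreal e"
   using osc[of y] by (cases "rh y = 0") (auto intro: mult_left_mono)
 qed
 also have "... = ennreal e" by (simp add: nn_integral_multc mass)
 finally show ?thesis .
qed

text \<open>Fubini is used over the product of Borel measures, whereas functions in L2 are Lebesgue
  measurable; a change on a null set does not affect a convolution.\<close>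

lemma borel_representative:
 fixes g :: "'n::finite fn"
 assumes "g : LM"
 obtains g' where "g' : borel_measurable borel" "AEL x. g x = g' x"
proof -
 have "(%x. Re (g x)) \<in> borel_measurable lebesgue" "(%x. Im (g x)) \<in> borel_measurable lebesgue"
  using assms by (simp_all add: borel_measurable_Re borel_measurable_Im)
 then obtain a b where a: "a : borel_measurable lborel" "AE x in lborel. Re (g x) = a x"
  and b: "b : borel_measurable lborel" "AE x in lborel. Im (g x) = b x"
  using completion_ex_borel_measurable_real by metis
 have m: "(%x. Complex (a x) (b x)) \<in> borel_measurable borel"
 proof -
  have "(%x. of_real (a x) + \<i> * of_real (b x)) \<in> borel_measurable borel" using a(1) b(1) by simp
  thus ?thesis by (simp add: Complex_eq)
 qed
 have "AE x in lborel. g x = Complex (a x) (b x)" using a(2) b(2) by eventually_elim (simp add: complex_eq_iff)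
 hence "AEL x. g x = Complex (a x) (b x)" by (rule AE_completion)
 with m show thesis by (rule that)
qed

text \<open>Any shape of approximate identity is allowed, not just rescaled copies of one profile:
  both the Helmholtz kernels and bumps centred off the origin are used.\<close>

definition mollifier :: "real => (real^'n => complex) => bool" where
 "mollifier d et <-> test UNIV et & (EX rh. ALL x. et x = of_real (rh x) & 0 <= rh x) &
   (LI x. et x) = 1 & (ALL x. et x ~= 0 --> norm x < d)"

lemma conv_cong_AE:
 assumes "AEL x. g x = g' x" "g : LM" "g' : LM" "et : LM"
 shows "conv g et = conv g' et"
proof
 fix x
 have m: "(%y. et (x - y)) \<in> borel_measurable lebesgue"
  using isometry_measurable[of uminus et x] assms(4) by (simp add: orthogonal_transformation_neg)
 show "conv g et x = conv g' et x" unfolding conv_def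
 proof (rule integral_cong_AE)
  show "AE y in lebesgue. g y * et (x - y) = g' y * et (x - y)" using assms(1) by eventually_elim simp
 qed (use assms(2,3) m in "auto intro!: borel_measurable_times")
qed

lemma mollify_L2lim:
 fixes g :: "'n::finite fn"
 assumes g: "L2 g" and et: "!!n. mollifier (d n) (et n)" and d: "d ---> 0"
 shows "L2lim (%n. conv g (et n)) g"
proof -
 obtain g' where g': "g' : borel_measurable borel" "AEL x. g x = g' x"
  using borel_representative[OF L2_measurable[OF g]] by metis
 have g'2: "L2 g'" by (rule L2_cong_AE[OF g g'(2)])
 have conv_eq: "conv g (et n) = conv g' (et n)" for n
  using conv_cong_AE[OF g'(2) L2_measurable[OF g] L2_measurable[OF g'2]] et[of n] test_measurable
  unfolding mollifier_def by blast
 have fin: "(\<integral>\<^sup>+x. ennreal ((norm (g' x))^2) \<partial>lborel) < \<infinity>"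
 proof -
  have "(\<integral>\<^sup>+x. ennreal ((norm (g' x))^2) \<partial>lborel) = (\<integral>\<^sup>+x. ennreal ((norm (g' x))^2) \<partial>lebesgue)"
   by (rule nn_integral_completion[symmetric])
  also have "... < \<infinity>" using L2_sq_integrable[OF g'2] by (simp add: nn_integral_eq_integral)
  finally show ?thesis .
 qed
 have tc: "L2_translation_continuous g'" by (rule translation_continuous_L2[OF g'(1) fin])
 show ?thesis unfolding L2lim_def
 proof (rule LIMSEQ_I)
  fix e :: real assume e: "e > 0"
  obtain r where r: "r > 0" "!!y. norm y < r ==> L2_osc g' y <= ennreal (e/2)"
   using tc e unfolding L2_translation_continuous_def by (metis half_gt_zero)
  obtain N where N: "!!n. n >= N ==> norm (d n - 0) < r" using LIMSEQ_D[OF d r(1)] by metis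
  have "norm ((LI x. (norm (conv g (et n) x - g x))^2) - 0) < e" if n: "n >= N" for n
  proof -
   obtain rh where rh: "!!x. et n x = of_real (rh x)" "!!x. 0 <= rh x" using et[of n] unfolding mollifier_def by blast
   have etn: "test UNIV (et n)" "(LI x. et n x) = 1" "!!x. et n x ~= 0 ==> norm x < d n"
   using et[of n] unfolding mollifier_def by blast+
   have osc: "L2_osc g' y <= ennreal (e/2)" if "rh y ~= 0" for y
   proof (rule r(2))
   have "norm y < d n" using etn(3)[of y] rh(1)[of y] that by simp
   thus "norm y < r" using N[OF n] by simp
   qed
   have le: "(\<integral>\<^sup>+x. ennreal ((norm (conv g' (et n) x - g' x))^2) \<partial>lborel) <= ennreal (e/2)"
   by (rule conv_L2_osc[OF g'(1) g'2 etn(1) rh etn(2) osc])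
   \<comment> \<open>If the function is not integrable, its Bochner integral is 0 by default, and
     the inequality still holds.\<close>
   have "(LI x. (norm (conv g (et n) x - g x))^2) <= enn2real (\<integral>\<^sup>+x. ennreal ((norm (conv g (et n) x - g x))^2) \<partial>lebesgue)"
   proof (cases "Lint (%x. (norm (conv g (et n) x - g x))^2)")
   case True
   thus ?thesis using integral_eq_nn_integral[OF borel_measurable_integrable[OF True]] by simp
   qed (simp add: not_integrable_integral_eq)
   also have "(\<integral>\<^sup>+x. ennreal ((norm (conv g (et n) x - g x))^2) \<partial>lebesgue) = (\<integral>\<^sup>+x. ennreal ((norm (conv g' (et n) x - g' x))^2) \<partial>lebesgue)"
   by (rule nn_integral_cong_AE) (use g'(2) in "eventually_elim, simp add: conv_eq")
   also have "... = (\<integral>\<^sup>+x. ennreal ((norm (conv g' (et n) x - g' x))^2) \<partial>lborel)" by (rule nn_integral_completion)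
   also have "enn2real ... <= e/2"
   using enn2real_mono[OF le] e by simp
   finally show ?thesis using e by (simp add: Bochner_Integration.integral_nonneg abs_of_nonneg)
  qed
  thus "EX no. ALL n>=no. norm ((LI x. (norm (conv g (et n) x - g x))^2) - 0) < e" by blast
 qed
qed

text \<open>With a centre p off the origin, convolution shifts by p while it smooths, which will
  push supports into a Lipschitz domain.\<close>

lemma mollifier_exists:
 fixes p :: "real^'n"
 assumes "r > 0"
 obtains et where "mollifier (norm p + r) et" "!!x. et x ~= 0 ==> x : ball p r"
proof -
 have t: "test UNIV (bump p r)" by (rule test_mono[OF test_bump[of r "r + 1"]]) (use assms in auto)
 define c where "c = (LI x. Re (bump p r x))"
 have i: "Lint (%x. Re (bump p r x))" by (rule integrable_Re[OF test_integrable[OF t]])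
 have "0 < measure lebesgue (ball p (r/2))" using content_ball_pos[of "r/2" p] assms by simp
 also have "measure lebesgue (ball p (r/2)) = (LI x. indicator (ball p (r/2)) x)" by simp
 also have "... <= c" unfolding c_def
 proof (rule integral_mono[OF _ i])
  show "Lint (indicator (ball p (r/2)) :: real^'n => real)"
   using lmeasurable_ball[of p "r/2"] by (intro integrable_real_indicator) (auto simp: fmeasurable_def)
  show "indicator (ball p (r/2)) x <= Re (bump p r x)" for x
   using bump_inside[of x p r] bump_Re(2)[of p r x] by (auto simp: indicator_def)
 qed
 finally have c: "c > 0" .
 define et where "et x = of_real (inverse c) * bump p r x" for x
 have "test UNIV et" unfolding et_def by (rule test_cmult[OF t])
 moreover have "EX rh. ALL x. et x = of_real (rh x) & 0 <= rh x"
 proof (intro exI allI)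
  fix x show "et x = of_real (inverse c * Re (bump p r x)) & 0 <= inverse c * Re (bump p r x)"
   using bump_Re[of p r x] c by (simp add: et_def)
 qed
 moreover have "(LI x. et x) = 1"
 proof -
  have "(LI x. bump p r x) = (LI x. of_real (Re (bump p r x)))" using bump_Re(1)[of p r] by simp
  also have "... = of_real c" unfolding c_def by (rule integral_complex_of_real)
  finally show ?thesis using c test_integrable[OF t] by (simp add: et_def flip: of_real_mult)
 qed
 moreover have *: "et x ~= 0 ==> x : ball p r" for x
  using bump_outside[OF assms, of x p] by (auto simp: et_def)
 moreover have "et x ~= 0 ==> norm x < norm p + r" for x
  using *[of x] norm_triangle_ineq2[of x p] by (auto simp: dist_norm norm_minus_commute)
 ultimately have "mollifier (norm p + r) et" unfolding mollifier_def by blast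
 thus thesis using * by (rule that)
qed

lemma test_conv:
 assumes "Lint g" "compact K" "!!x. x ~: K ==> g x = 0"
  and "test UNIV et" "compact C" "!!x. x ~: C ==> et x = 0"
  and U: "!!x y. x : K ==> y : C ==> x + y : U"
 shows "test U (conv g et)"
proof (rule test_functionI[OF smooth_conv[OF assms(1,4)] compact_sums[OF assms(2,5)]])
 show "{x + y |x y. x : K & y : C} <= U" using U by auto
 show "conv g et x = 0" if "x ~: {x + y |x y. x : K & y : C}" for x
 proof (rule ccontr)
  assume "conv g et x ~= 0"
  then obtain y where "g y ~= 0" "et (x - y) ~= 0" by (rule conv_support)
  hence "y : K" "x - y : C" using assms by auto
  hence "y + (x - y) : {x + y |x y. x : K & y : C}" by blast
  thus False using that by simp
 qed
qed

text \<open>A cut-off of g is mollified; every value of the result is an integral of g against a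
  test function in U, hence 0, and so is the limit in the square mean.\<close>

lemma fundamental_lemma:
 fixes g :: "'n::finite fn"
 assumes g: "L2 g" and U: "open U" and z: "!!ph. test U ph ==> (LI x. g x * ph x) = 0"
 shows "AEL x. x : U --> g x = 0"
proof -
 have K: "AEL x. x : K --> g x = 0" if K: "compact K" "K <= U" for K
 proof -
  obtain ze W where ze: "test U ze" "open W" "K <= W" "!!y. y : W ==> ze y = 1"
   using cutoff_exists[OF K(1) U K(2)] by metis
  define h where "h x = ze x * g x" for x
  have h: "L2 h" unfolding h_def by (rule L2_mult_test[OF g ze(1)])
  have "EX et::real^'n=>complex. mollifier (inverse (real (Suc n))) et" for n
   using mollifier_exists[of "inverse (real (Suc n))" "0::real^'n"] by auto
  then obtain et :: "nat => real^'n => complex" where et: "!!n. mollifier (inverse (real (Suc n))) (et n)" by metis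
  have lim: "L2lim (%n. conv h (et n)) h" by (rule mollify_L2lim[OF h et LIMSEQ_inverse_real_of_nat])
  have "conv h (et n) x = 0" for n x
  proof -
   have "test UNIV (et n)" using et[of n] by (simp add: mollifier_def)
   hence "smooth (%y. et n (x - y))" using test_smooth[OF test_shift] by blast
   hence "test U (%y. et n (x - y) * ze y)" using ze(1) by (rule test_mult_smooth)
   from z[OF this] show ?thesis by (simp add: conv_def h_def mult.assoc mult.left_commute mult.commute)
  qed
  hence "(%n::nat. (LI x. (norm (h x))^2)) ---> 0" using lim by (simp add: L2lim_def)
  hence "(LI x. (norm (h x))^2) = 0" by (simp add: LIMSEQ_const_iff)
  from L2_zero_AE[OF h this] show ?thesis by eventually_elim (use ze(3,4) in "auto simp: h_def")
 qed
 obtain F :: "nat => (real^'n) set" where F: "!!n. compact (F n)" "(\<Union>n. F n) = U"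
  using open_Union_compact_subsets[OF U] by metis
 have "AEL x. ALL n. x : F n --> g x = 0" by (subst AE_all_countable) (use K F in blast)
 thus ?thesis by eventually_elim (use F(2) in blast)
qed

section \<open>A mean value kernel for the Helmholtz equation\<close>

text \<open>If \<open>u\<close> solves the Helmholtz equation in dimension \<open>n\<close>, then \<open>u x * exp (k * s)\<close> is harmonic in
  dimension \<open>n + 1\<close>. The kernel is obtained by integrating over \<open>s\<close> the Laplacian of a radial
  function that agrees with the fundamental solution in dimension \<open>n + 1 \<ge> 3\<close> outside a small ball;
  \<open>step_power n e\<close> is the derivative of the radial profile, as a function of the squared radius.\<close>

definition step_power1 :: "nat => real => real" where
 "step_power1 n r = smooth_step r * r powr (- (real n + 1) / 2)"

definition step_power1' :: "nat => real => real" where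
 "step_power1' n r = smooth_step' r * r powr (- (real n + 1) / 2) + (- (real n + 1) / 2) * (smooth_step r * r powr (- (real n + 1) / 2 - 1))"

lemma Dk_step_mult_powr:
 assumes "!!m. Dk m UNIV f" "!!x. x <= 1/4 ==> f x = 0"
 shows "Dk m UNIV (%r. f r * r powr a)"
proof -
 have "Dk m {0<..} (%r. f r * r powr a)" by (rule Dk_mult[OF Dk_subset[OF assms(1) subset_UNIV] Dk_powr])
 moreover have "Dk m {..<1/4} (%r. f r * r powr a)" by (rule Dk_cong[OF _ _ Dk_const[of m _ 0]]) (use assms(2) in auto)
 ultimately have "Dk m ({0<..} Un {..<1/4}) (%r. f r * r powr a)" by (intro Dk_Un) auto
 moreover have "{0<..} Un {..<1/4} = (UNIV :: real set)" by auto
 ultimately show ?thesis by simp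
qed

lemma Dk_cmult: "Dk m S f ==> Dk m S (%x. c * f x)" by (rule Dk_mult[OF Dk_const])

lemma Dk_step_power1: "Dk m UNIV (step_power1 n)"
 unfolding step_power1_def[abs_def] by (rule Dk_step_mult_powr[OF Dk_smooth_step smooth_step_0])

lemma Dk_step_power1': "Dk m UNIV (step_power1' n)"
 unfolding step_power1'_def[abs_def] by (intro Dk_add Dk_cmult Dk_step_mult_powr Dk_smooth_step Dk_smooth_step' smooth_step_0 smooth_step'_0)

lemma step_power1_deriv: "(step_power1 n hrd step_power1' n r) (at r)"
proof (cases "r > 0")
 case True
 show ?thesis unfolding step_power1_def[abs_def] step_power1'_def
  by (rule DERIV_cong[OF DERIV_mult[OF smooth_step_deriv has_real_derivative_powr[OF True]]]) (simp add: mult.commute mult.left_commute)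
next
 case False
 have "((%r. 0) hrd step_power1' n r) (at r)"
  using False smooth_step_0[of r] smooth_step'_0[of r] by (simp add: step_power1'_def)
 thus ?thesis by (rule has_field_derivative_transform_within_open[of _ _ _ "{..<1/4}"])
   (use False smooth_step_0 in "auto simp: step_power1_def")
qed

text \<open>In dimension N the Laplacian of F(|x|^2) is 4 r F'' + 2 N F' at r = |x|^2; here N = n +
  1 and F' = \<open>step_power1 n\<close>. It vanishes where the step is constant, because r powr (-
  N / 2) is, up to a constant, the derivative of the fundamental solution.\<close>

definition ring1 :: "nat => real => real" where
 "ring1 n r = 4 * (r * step_power1' n r) + (2 * (real n + 1)) * step_power1 n r"

lemma Dk_ring1: "Dk m UNIV (ring1 n)"
 unfolding ring1_def[abs_def] by (intro Dk_add Dk_cmult Dk_mult[OF Dk_ident] Dk_step_power1 Dk_step_power1')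

lemma ring1_eq: "r > 0 ==> ring1 n r = 4 * (smooth_step' r * r powr (1 - (real n + 1) / 2))"
 using powr_add[of r 1 "- (real n + 1) / 2"] powr_add[of r 1 "- (real n + 1) / 2 - 1"]
 by (simp add: ring1_def step_power1_def step_power1'_def field_simps)

lemma ring1_nonneg: "ring1 n r >= 0"
proof (cases "r > 0")
 case False
 thus ?thesis using smooth_step_0[of r] smooth_step'_0[of r] by (simp add: ring1_def step_power1_def step_power1'_def)
qed (simp add: ring1_eq smooth_step'_nonneg)

lemma ring1_zero: "r >= 1 | r <= 1/4 ==> ring1 n r = 0"
 using smooth_step_0[of r] smooth_step'_0[of r] smooth_step'_1[of r] ring1_eq[of r n] by (auto simp: ring1_def step_power1_def step_power1'_def)

lemma ring1_pos: "1/4 < r ==> r < 1 ==> ring1 n r > 0"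
 using smooth_step'_pos[of r] by (simp add: ring1_eq)

text \<open>The factor e^-(n + 1) makes the value for r >= e^2 independent of e, so that the
  difference for two radii has compact support.\<close>

definition step_power :: "nat => real => real => real" where
 "step_power n e r = inverse (e ^ (n + 1)) * step_power1 n (inverse (e^2) * r)"

definition step_power' :: "nat => real => real => real" where
 "step_power' n e r = inverse (e ^ (n + 1)) * (inverse (e^2) * step_power1' n (inverse (e^2) * r))"

definition ring :: "nat => real => real => real" where
 "ring n e r = inverse (e ^ (n + 1)) * ring1 n (inverse (e^2) * r)"

lemma Dk_scaled: "(!!m. Dk m UNIV f) ==> Dk m UNIV (%r. f (c * r))" by (rule Dk_comp[where T=UNIV and f=f, OF _ _ Dk_cmult[OF Dk_ident]]) auto

lemma Dk_step_power: "Dk m UNIV (step_power n e)"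
 unfolding step_power_def[abs_def] by (intro Dk_cmult Dk_scaled Dk_step_power1)

lemma Dk_step_power': "Dk m UNIV (step_power' n e)"
 unfolding step_power'_def[abs_def] by (intro Dk_cmult Dk_scaled[of "step_power1' n"] Dk_step_power1')

lemma Dk_ring: "Dk m UNIV (ring n e)"
 unfolding ring_def[abs_def] by (intro Dk_cmult Dk_scaled Dk_ring1)

lemma step_power_deriv: "(step_power n e hrd step_power' n e r) (at r)"
proof -
 have "((%r. step_power1 n (inverse (e^2) * r)) hrd step_power1' n (inverse (e^2) * r) * inverse (e^2)) (at r)"
  by (rule DERIV_chain2[OF step_power1_deriv]) (auto intro!: derivative_eq_intros)
 from DERIV_cmult[OF this, of "inverse (e ^ (n + 1))"] show ?thesis by (simp add: step_power_def[abs_def] step_power'_def mult.commute)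
qed

lemma step_power_ring: "e > 0 ==> 4 * (r * step_power' n e r) + (2 * (real n + 1)) * step_power n e r = ring n e r"
 by (simp add: step_power_def step_power'_def ring_def ring1_def field_simps)

lemma step_power_outside:
 assumes "e > 0" "r >= e^2" shows "step_power n e r = r powr (- (real n + 1) / 2)"
proof -
 have e2: "e^2 > 0" using assms by simp
 hence "r > 0" using assms(2) by linarith
 have "inverse (e^2) * r >= 1" using assms e2 by (simp add: field_simps)
 hence "step_power n e r = inverse (e ^ (n + 1)) * (inverse (e^2) * r) powr (- (real n + 1) / 2)"
  by (simp add: step_power_def step_power1_def smooth_step_1)
 also have "(inverse (e^2) * r) powr (- (real n + 1) / 2) = inverse (e^2) powr (- (real n + 1) / 2) * r powr (- (real n + 1) / 2)" by (rule powr_mult)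
 also have "inverse (e^2) powr (- (real n + 1) / 2) = e ^ (n + 1)"
 proof -
  have "inverse (e^2) = e powr (-2)" using assms(1) by (simp add: powr_minus)
  hence "inverse (e^2) powr (- (real n + 1) / 2) = e powr (real (n + 1))"
   using assms(1) by (simp add: powr_powr add_divide_distrib)
  thus ?thesis by (simp only: powr_realpow[OF assms(1)])
 qed
 finally have eq: "step_power n e r = inverse (e ^ (n + 1)) * (e ^ (n + 1) * r powr (- (real n + 1) / 2))" .
 have "e ^ (n + 1) ~= 0" using assms(1) by simp
 hence "inverse (e ^ (n + 1)) * e ^ (n + 1) = 1" by (rule left_inverse)
 thus ?thesis unfolding eq by (simp only: mult.assoc[symmetric] mult_1_left)
qed

lemma step_power_inside: "e > 0 ==> r <= e^2 / 4 ==> step_power n e r = 0"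
proof -
 assume "e > 0" "r <= e^2 / 4"
 hence "inverse (e^2) * r <= 1/4" by (simp add: field_simps)
 thus ?thesis by (simp add: step_power_def step_power1_def smooth_step_0)
qed

lemma ring_nonneg: "e > 0 ==> ring n e r >= 0" by (simp add: ring_def ring1_nonneg)

lemma ring_zero: "e > 0 ==> r >= e^2 ==> ring n e r = 0"
proof -
 assume "e > 0" "r >= e^2"
 hence "inverse (e^2) * r >= 1" by (simp add: field_simps)
 thus ?thesis by (simp add: ring_def ring1_zero)
qed

text \<open>The weight exp (k * s) is the factor of the harmonic lift. For functions of the squared
  radius that vanish from 1 on, the limits -1 and 1 lose nothing.\<close>

definition exp_average :: "real => (real => real) => real => real" where
 "exp_average k f r = integral {-1..1} (%s. exp (k * s) * f (r + s^2))"

lemma exp_average_cont: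
 fixes f :: "real => real" assumes "continuous_on UNIV f"
 shows "continuous_on S (%s. exp (k * s) * f (r + s^2))" by (intro continuous_intros continuous_on_compose2[OF assms]) auto

lemma exp_average_integrable:
 fixes f :: "real => real"
 shows "continuous_on UNIV f ==> (%s. exp (k * s) * f (r + s^2)) integrable_on {-1..1}" by (intro integrable_continuous_real exp_average_cont)

lemma exp_average_deriv:
 assumes d: "!!x. (f hrd f' x) (at x)" and c: "continuous_on UNIV f'"
 shows "(exp_average k f hrd exp_average k f' r) (at r)"
proof -
 have cf: "continuous_on UNIV f" using d by (meson DERIV_isCont continuous_at_imp_continuous_on)
 have "((%r. integral (cbox (-1) 1) (%s. exp (k * s) * f (r + s^2))) has_field_derivative
   integral (cbox (-1) 1) (%s. exp (k * s) * f' (r + s^2))) (at r within UNIV)"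
 proof (rule leibniz_rule_field_derivative)
  show "((%x. exp (k * t) * f (x + t^2)) hrd exp (k * t) * f' (x + t^2)) (at x within UNIV)" for x t
  proof -
   have "((%x. f (x + t^2)) hrd f' (x + t^2)) (at x)"
   using DERIV_shift[of f "f' (x + t^2)" x "t^2"] d by blast
   thus ?thesis by (rule DERIV_cmult)
  qed
  show "(%s. exp (k * s) * f (x + s^2)) integrable_on cbox (-1) 1" for x
   using exp_average_integrable[OF cf] by simp
  show "continuous_on (UNIV \<times> cbox (- 1) 1) (%(x, t). exp (k * t) * f' (x + t^2))"
   unfolding split_beta by (intro continuous_intros continuous_on_compose2[OF c]) auto
 qed auto
 thus ?thesis by (simp add: exp_average_def[abs_def])
qed

lemma Dk_exp_average: "Dk m UNIV f ==> Dk m UNIV (exp_average k f)"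
proof (induction m arbitrary: f)
 case 0
 hence c: "continuous_on UNIV f" by simp
 have "continuous_on UNIV (%r. integral (cbox (-1) 1) (%s. exp (k * s) * f (r + s^2)))" by (rule integral_continuous_on_param, unfold split_beta)
   (intro continuous_intros continuous_on_compose2[OF c], auto)
 thus ?case by (simp add: exp_average_def[abs_def])
next
 case (Suc m)
 then obtain f' where f': "!!x. (f hrd f' x) (at x)" "Dk m UNIV f'" by auto
 show ?case using exp_average_deriv[OF f'(1) Dk_continuous[OF f'(2)]] Suc.IH[OF f'(2)] by auto
qed

lemma exp_average_add:
 assumes "continuous_on UNIV f" "continuous_on UNIV g"
 shows "exp_average k (%x. f x + g x) r = exp_average k f r + exp_average k g r"
 unfolding exp_average_def distrib_left by (rule integral_add[OF exp_average_integrable[OF assms(1)] exp_average_integrable[OF assms(2)]])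

lemma exp_average_nonneg: "continuous_on UNIV f ==> (!!x. f x >= 0) ==> exp_average k f r >= 0"
 unfolding exp_average_def by (intro integral_nonneg exp_average_integrable) auto

text \<open>Integration over \<open>s\<close> turns \<open>n * (n + 1)\<close>-dimensional radial Laplacians into each other up to the
  zeroth order term, by partial integration in \<open>s\<close>.\<close>

lemma exp_average_Helmholtz:
 assumes d: "!!x. (D hrd D' x) (at x)" "!!x. (D' hrd D'' x) (at x)" "continuous_on UNIV D''"
  and z: "!!x. x >= 1 ==> D x = 0 & D' x = 0" and r: "r >= 0"
 shows "4 * r * exp_average k D'' r + 2 * N * exp_average k D' r + k^2 * exp_average k D r =
  exp_average k (%x. 4 * (x * D'' x) + (2 * (N + 1)) * D' x) r"
proof -
 have c: "continuous_on UNIV D" "continuous_on UNIV D'" using d by (meson DERIV_isCont continuous_at_imp_continuous_on)+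
 \<comment> \<open>The boundary term of the two partial integrations in s; it vanishes at both ends
   because r + 1 >= 1.\<close>
 define F where "F s = k * exp (k * s) * D (r + s^2) - exp (k * s) * (2 * s) * D' (r + s^2)" for s
 define F' where "F' s = exp (k * s) * (k^2 * D (r + s^2) - 4 * s^2 * D'' (r + s^2) - 2 * D' (r + s^2))" for s
 have DF: "(F hrd F' s) (at s)" for s
 proof -
  have q: "((%s. r + s^2) hrd 2 * s) (at s)" by (auto intro!: derivative_eq_intros)
  note 1 = DERIV_chain2[OF d(1) q] and 2 = DERIV_chain2[OF d(2) q]
  have e: "((%s. exp (k * s)) hrd k * exp (k * s)) (at s)" by (auto intro!: derivative_eq_intros)
  have 3: "((%s. exp (k * s) * (2 * s)) hrd k * exp (k * s) * (2 * s) + exp (k * s) * 2) (at s)" by (auto intro!: derivative_eq_intros)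
  have "(F hrd ((k * (k * exp (k * s))) * D (r + s^2) + D' (r + s^2) * (2 * s) * (k * exp (k * s))) -
   ((k * exp (k * s) * (2 * s) + exp (k * s) * 2) * D' (r + s^2) + D'' (r + s^2) * (2 * s) * (exp (k * s) * (2 * s)))) (at s)"
   unfolding F_def by (intro DERIV_diff DERIV_mult DERIV_cmult 1 2 3 e)
  thus ?thesis by (rule DERIV_cong) (simp add: F'_def power2_eq_square algebra_simps)
 qed
 have "(F' has_integral (F 1 - F (-1))) {-1..1}" by (rule fundamental_theorem_of_calculus)
   (use DF in "auto simp: has_real_derivative_iff_has_vector_derivative[symmetric] intro: has_field_derivative_at_within")
 moreover have "F 1 = 0" "F (-1) = 0" using z[of "r + 1"] r by (simp_all add: F_def)
 ultimately have F0: "(F' has_integral 0) {-1..1}" by simp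
 have i: "((%s. exp (k * s) * f (r + s^2)) has_integral exp_average k f r) {-1..1}" if "continuous_on UNIV f" for f
  unfolding exp_average_def by (rule integrable_integral[OF exp_average_integrable[OF that]])
 have cg: "continuous_on UNIV (%x. 4 * (x * D'' x) + (2 * (N + 1)) * D' x)" by (intro continuous_intros d(3) c)
 have "((%s. exp (k * s) * (4 * ((r + s^2) * D'' (r + s^2)) + (2 * (N + 1)) * D' (r + s^2)) + F' s) has_integral
   exp_average k (%x. 4 * (x * D'' x) + (2 * (N + 1)) * D' x) r + 0) {-1..1}" by (rule has_integral_add[OF i[OF cg] F0])
 moreover have "((%s. 4 * r * (exp (k * s) * D'' (r + s^2)) + 2 * N * (exp (k * s) * D' (r + s^2)) + k^2 * (exp (k * s) * D (r + s^2))) has_integral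
   4 * r * exp_average k D'' r + 2 * N * exp_average k D' r + k^2 * exp_average k D r) {-1..1}"
  by (intro has_integral_add has_integral_mult_right i c d(3))
 moreover have "exp (k * s) * (4 * ((r + s^2) * D'' (r + s^2)) + (2 * (N + 1)) * D' (r + s^2)) + F' s =
   4 * r * (exp (k * s) * D'' (r + s^2)) + 2 * N * (exp (k * s) * D' (r + s^2)) + k^2 * (exp (k * s) * D (r + s^2))" for s
  by (simp add: F'_def algebra_simps)
 ultimately show ?thesis by (simp add: has_integral_unique)
qed

section \<open>Radial functions and the kernel\<close>

definition radial :: "(real => real) => real^'n => complex" where
 "radial q y = of_real (q ((norm y)^2))"

lemma smooth_radial: "(!!m. Dk m UNIV q) ==> smooth (radial q)"
 unfolding radial_def[abs_def] using smooth_real_comp[of q "%y. (norm y)^2"] smooth_normsq[of 0] by simp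

lemma has_derivative_normsq: "((%y::real^'n. (norm y)^2) has_derivative (%h. 2 * (y *. h))) (at y)"
 unfolding power2_norm_eq_inner
 by (rule has_derivative_eq_rhs[OF has_derivative_inner[OF has_derivative_ident has_derivative_ident]]) (simp add: inner_commute fun_eq_iff)

lemma partial_radial:
 assumes "!!x. (q hrd q' x) (at x)"
 shows "partial i (radial q) y = of_real (q' ((norm y)^2) * (2 * y $ i))"
 unfolding radial_def[abs_def] by (subst partial_real_comp[OF has_derivative_normsq assms]) (simp add: inner_axis)

lemma laplacian_radial:
 fixes y :: "real^'n"
 assumes "!!x. (q hrd q' x) (at x)" "!!x. (q' hrd q'' x) (at x)"
 shows "laplacian (radial q) y = of_real (4 * (norm y)^2 * q'' ((norm y)^2) + 2 * real CARD('n) * q' ((norm y)^2))"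
proof -
 have p: "partial i (radial q) = (%y. radial q' y * of_real (2 * (axis i 1 *. y)))" for i :: 'n
  by (rule ext) (simp add: partial_radial[OF assms(1)] radial_def inner_axis')
 have d: "(radial q' has_derivative (%h. complex_of_real (q'' ((norm y)^2) * (2 * (y *. h))))) (at y)"
 proof -
  have "((%y. q' ((norm y)^2)) has_derivative (%h. q'' ((norm y)^2) * (2 * (y *. h)))) (at y)"
   using diff_chain_at[OF has_derivative_normsq assms(2)[unfolded has_field_derivative_def], of y] by (simp add: o_def)
  thus ?thesis unfolding radial_def[abs_def] by (rule has_derivative_of_real)
 qed
 have "partial i (partial i (radial q)) y = of_real (q' ((norm y)^2) * 2 + q'' ((norm y)^2) * (2 * (y $ i)) * (2 * (y $ i)))" for i :: 'n
 proof -
  have l: "((%y. complex_of_real (2 * (axis i 1 *. y))) has_derivative (%h. complex_of_real (2 * (axis i 1 *. h)))) (at y)"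
   by (intro bounded_linear_imp_has_derivative bounded_linear_compose[OF bounded_linear_of_real] bounded_linear_const_mult bounded_linear_inner_right)
  show ?thesis unfolding p by (subst partial_eq[OF has_derivative_mult[OF d l]]) (simp add: radial_def inner_axis' inner_axis algebra_simps)
 qed
 hence "laplacian (radial q) y = (SUM i:(UNIV::'n set). of_real (q' ((norm y)^2) * 2 + q'' ((norm y)^2) * (2 * (y $ i)) * (2 * (y $ i))))"
  by (simp add: laplacian_def)
 also have "... = of_real (SUM i:(UNIV::'n set). q' ((norm y)^2) * 2 + 4 * q'' ((norm y)^2) * (y $ i * y $ i))"
  by (simp add: mult.assoc mult.left_commute)
 also have "(SUM i:(UNIV::'n set). q' ((norm y)^2) * 2 + 4 * q'' ((norm y)^2) * (y $ i * y $ i)) =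
   real CARD('n) * (q' ((norm y)^2) * 2) + 4 * q'' ((norm y)^2) * (y *. y)" by (simp add: sum.distrib sum_distrib_left inner_vec_def)
 finally show ?thesis by (simp add: power2_norm_eq_inner mult.commute mult.left_commute)
qed

text \<open>It takes the place of spherical means: convolution multiplies solutions of the Helmholtz
  equation by a constant independent of e. It is not normalised; the constant is identified later as
  the limit of the masses.\<close>

definition kernel :: "real => real => real^'n => complex" where
 "kernel k e = radial (exp_average k (ring CARD('n) e))"

lemma exp_average_ring_zero:
 assumes "e > 0" "r >= e^2" shows "exp_average k (ring n e) r = 0"
proof -
 have "exp_average k (ring n e) r = integral {-1..1} (%s::real. 0)"
  unfolding exp_average_def
 proof (rule Henstock_Kurzweil_Integration.integral_cong)
  fix s :: real
  have "r + s^2 >= e^2" using assms(2) zero_le_power2[of s] by linarith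
  thus "exp (k * s) * ring n e (r + s^2) = 0" using assms(1) by (simp add: ring_zero)
 qed
 thus ?thesis by simp
qed

lemma kernel_outside:
 assumes "e > 0" "norm y >= e" shows "kernel k e y = 0"
proof -
 have "(norm y)^2 >= e^2" using assms by (intro power_mono) auto
 thus ?thesis using exp_average_ring_zero[OF assms(1)] by (simp add: kernel_def radial_def)
qed

lemma test_radial:
 assumes "!!m. Dk m UNIV q" "e > 0" "!!r. r >= e^2 ==> q r = 0" "cball 0 e <= U"
 shows "test U (radial q :: real^'n => complex)"
proof (rule test_functionI[OF smooth_radial[OF assms(1)] compact_cball assms(4)])
 show "radial q x = 0" if "x ~: cball 0 e" for x :: "real^'n"
 proof -
  have "(norm x)^2 >= e^2" using that assms(2) by (intro power_mono) auto
  thus ?thesis using assms(3) by (simp add: radial_def)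
 qed
qed

lemma test_kernel: "e > 0 ==> cball 0 e <= U ==> test U (kernel k e)"
 unfolding kernel_def by (rule test_radial) (auto intro: Dk_exp_average Dk_ring exp_average_ring_zero)

lemma kernel_Re:
 assumes "e > 0" shows "kernel k e y = of_real (Re (kernel k e y))" "Re (kernel k e y) >= 0"
 using exp_average_nonneg[OF Dk_continuous[OF Dk_ring[of 0]] ring_nonneg[OF assms]] by (simp_all add: kernel_def radial_def)

text \<open>At squared radius e^2 / 2 the scaled argument is 1/2, where \<open>smooth_step'\<close>
  is positive; so the nonnegative continuous integrand is nonzero at s = 0.\<close>

lemma kernel_pos:
 assumes "0 < e" "e <= 1" "(norm y)^2 = e^2 / 2"
 shows "Re (kernel k e (y::real^'n)) > 0"
proof -
 let ?f = "%s. exp (k * s) * ring CARD('n) e (e^2 / 2 + s^2)"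
 have c: "continuous_on {-1..1} ?f" by (rule exp_average_cont[OF Dk_continuous[OF Dk_ring[of 0]]])
 have "inverse (e^2) * (e^2 / 2) = 1/2" using assms(1) by simp
 hence "ring CARD('n) e (e^2 / 2) > 0" using assms(1) by (simp add: ring_def ring1_pos)
 hence "?f 0 ~= 0" by simp
 moreover have "integral {-1..1} ?f = 0 <-> (ALL s:{-1..1}. ?f s = 0)" by (rule integral_eq_0_iff[OF c]) (use ring_nonneg[OF assms(1)] in auto)
 moreover have "(0::real) : {-1..1}" by simp
 ultimately have "integral {-1..1} ?f ~= 0" by blast
 hence "exp_average k (ring CARD('n) e) (e^2 / 2) ~= 0" by (simp add: exp_average_def)
 moreover have "Re (kernel k e y) = exp_average k (ring CARD('n) e) (e^2 / 2)" by (simp only: kernel_def radial_def assms(3) Re_complex_of_real)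
 ultimately show ?thesis using kernel_Re(2)[OF assms(1), of k y] by linarith
qed

text \<open>The step powers for the two radii agree beyond e^2. Their difference D' therefore has a
  primitive D with D = 0 beyond e^2, and averaging D over the extra variable gives a test function
  P. It makes convolutions with solutions independent of the radius.\<close>

lemma kernel_difference:
 assumes "0 < e'" "e' <= e" "e <= 1"
 obtains P :: "'n::finite fn" where "!!U. cball 0 e <= U ==> test U P"
  "!!y. laplacian P y + of_real (k^2) * P y = kernel k e' y - kernel k e y"
proof -
 let ?n = "CARD('n)"
 have e: "0 < e" using assms by linarith
 define D' where "D' x = step_power ?n e' x + (-1) * step_power ?n e x" for x
 define D'' where "D'' x = step_power' ?n e' x + (-1) * step_power' ?n e x" for x
 have DD': "Dk m UNIV D'" for m unfolding D'_def[abs_def] by (intro Dk_add Dk_cmult Dk_step_power)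
 have DD'': "Dk m UNIV D''" for m unfolding D''_def[abs_def] by (intro Dk_add Dk_cmult Dk_step_power')
 have d2: "(D' hrd D'' x) (at x)" for x
  unfolding D'_def[abs_def] D''_def by (intro DERIV_add DERIV_cmult step_power_deriv)
 have ee: "e'^2 <= e^2" "e^2 <= 1" using assms by (auto intro: power_mono simp: power_le_one)
 have D'out: "D' x = 0" if "x >= e^2" for x
 proof -
  have "x >= e'^2" using that ee(1) by linarith
  thus ?thesis using step_power_outside[OF assms(1)] step_power_outside[OF e that] by (simp add: D'_def)
 qed
 have D'in: "D' x = 0" if "x <= e'^2 / 4" for x
 proof -
  have "x <= e^2 / 4" using that ee(1) by linarith
  thus ?thesis using step_power_inside[OF assms(1) that] step_power_inside[OF e] by (simp add: D'_def)
 qed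
 obtain F where F: "!!x. (F hrd D' x) (at x)"
  by (rule antiderivative_pos[where a="e'^2 / 4", OF Dk_continuous[OF DD'[of 0]] _ D'in]) (simp, assumption, rule that)
 \<comment> \<open>F is constant beyond e^2; removing this constant makes the support
   bounded.\<close>
 define D where "D x = F x + - F (e^2)" for x
 have d1: "(D hrd D' x) (at x)" for x
  unfolding D_def[abs_def] by (rule DERIV_cong[OF DERIV_add[OF F DERIV_const]]) simp
 have Dout: "D x = 0" if "x >= e^2" for x
 proof (cases "x = e^2")
  case False
  have "continuous_on {e\<^sup>2..x} F" using F by (meson DERIV_isCont continuous_at_imp_continuous_on)
  moreover have "DERIV F y :> 0" if "e^2 < y" for y using F[of y] D'out[of y] that by simp
  ultimately have "F x = F (e^2)" using DERIV_isconst2[of "e^2" x F x] that False by auto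
  thus ?thesis by (simp add: D_def)
 qed (simp add: D_def)
 have DD: "Dk m UNIV D" for m
 proof -
  have "Dk (Suc m) UNIV D" using d1 DD' by auto
  thus ?thesis by (rule Dk_Suc_imp)
 qed
 define P :: "'n fn" where "P = radial (exp_average k D)"
 have q0: "exp_average k D r = 0" if "r >= e^2" for r
 proof -
  have "exp_average k D r = integral {-1..1} (%s::real. 0)" unfolding exp_average_def
  proof (rule Henstock_Kurzweil_Integration.integral_cong)
   fix s :: real
   have "r + s^2 >= e^2" using that zero_le_power2[of s] by linarith
   thus "exp (k * s) * D (r + s^2) = 0" by (simp add: Dout)
  qed
  thus ?thesis by simp
 qed
 have "test U P" if "cball 0 e <= U" for U
  unfolding P_def by (rule test_radial[OF Dk_exp_average[OF DD] e q0 that])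
 moreover have "laplacian P y + of_real (k^2) * P y = kernel k e' y - kernel k e y" for y
 proof -
  let ?r = "(norm y)^2"
  have "laplacian P y + of_real (k^2) * P y =
   of_real (4 * ?r * exp_average k D'' ?r + 2 * real ?n * exp_average k D' ?r + k^2 * exp_average k D ?r)"
   unfolding P_def
   by (subst laplacian_radial[OF exp_average_deriv[OF d1 Dk_continuous[OF DD'[of 0]]] exp_average_deriv[OF d2 Dk_continuous[OF DD''[of 0]]]])
   (simp add: radial_def)
  also have "4 * ?r * exp_average k D'' ?r + 2 * real ?n * exp_average k D' ?r + k^2 * exp_average k D ?r =
   exp_average k (%x. 4 * (x * D'' x) + (2 * (real ?n + 1)) * D' x) ?r"
   by (rule exp_average_Helmholtz[OF d1 d2 Dk_continuous[OF DD''[of 0]]]) (use Dout D'out ee in auto)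
  also have "(%x. 4 * (x * D'' x) + (2 * (real ?n + 1)) * D' x) = (%x. ring ?n e' x + (-1) * ring ?n e x)"
   by (rule ext) (simp add: D'_def D''_def step_power_ring[OF assms(1), symmetric] step_power_ring[OF e, symmetric] algebra_simps)
  also have "exp_average k (%x. ring ?n e' x + (-1) * ring ?n e x) ?r = exp_average k (ring ?n e') ?r + exp_average k (%x. (-1) * ring ?n e x) ?r"
   by (intro exp_average_add Dk_continuous[OF Dk_ring[of 0]] Dk_continuous[OF Dk_cmult[OF Dk_ring[of 0]]])
  also have "exp_average k (%x. (-1) * ring ?n e x) ?r = - exp_average k (ring ?n e) ?r" by (simp add: exp_average_def)
  finally show ?thesis by (simp add: kernel_def radial_def)
 qed
 ultimately show thesis by (rule that)
qed

text \<open>The derivative of the scaled ring is O(e^-(n + 3)). It is nonzero only for |s| <= e,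
  which gains one factor e, and the inner derivative 2 y_i gains another.\<close>

lemma kernel_partial_bound:
 obtains C where "C > 0" "!!e y i. 0 < e ==> e <= 1 ==> norm (partial i (kernel k e) (y :: real^'n)) <= C / e ^ (CARD('n) + 1)"
proof -
 let ?n = "CARD('n)"
 obtain r1 where r1: "!!x. (ring1 ?n hrd r1 x) (at x)" "Dk 0 UNIV r1"
  using Dk_ring1[of "Suc 0" ?n] by auto
 have r1z: "r1 x = 0" if "x > 1 | x < 1/4" for x
 proof -
  have "((%x. 0) hrd r1 x) (at x)"
  proof (cases "x > 1")
   case True
   show ?thesis by (rule has_field_derivative_transform_within_open[OF r1(1), of "{1<..}"]) (use True ring1_zero in auto)
  next
   case False
   thus ?thesis by (intro has_field_derivative_transform_within_open[OF r1(1), of "{..<1/4}"]) (use that ring1_zero in auto)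
  qed
  thus ?thesis using DERIV_unique DERIV_const by blast
 qed
 have "compact (r1 ` {0..1})" by (intro compact_continuous_image continuous_on_subset[OF Dk_continuous[OF r1(2)]]) auto
 then obtain B where B: "B > 0" "!!x. x : {0..1} ==> norm (r1 x) <= B"
  using compact_imp_bounded bounded_pos by (metis imageI)
 have rB: "\<bar>r1 x\<bar> <= B" for x
  using B(2)[of x] B(1) r1z[of x] by (cases "x : {0..1}") auto
 define C where "C = 4 * exp \<bar>k\<bar> * B"
 have "norm (partial i (kernel k e) y) <= C / e ^ (?n + 1)" if e: "0 < e" "e <= 1" for e i and y :: "real^'n"
 proof (cases "norm y > e")
  case True
  have "partial i (kernel k e) y = 0" by (rule partial_outside[of "cball 0 e"]) (use True in "auto intro!: kernel_outside[OF e(1)]")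
  thus ?thesis using e B(1) by (simp add: C_def)
 next
  case False
  define h' where "h' x = inverse (e ^ (?n + 1)) * (inverse (e^2) * r1 (inverse (e^2) * x))" for x
  have dh: "(ring ?n e hrd h' x) (at x)" for x
  proof -
   have "((%r. ring1 ?n (inverse (e^2) * r)) hrd r1 (inverse (e^2) * x) * inverse (e^2)) (at x)"
   by (rule DERIV_chain2[OF r1(1)]) (auto intro!: derivative_eq_intros)
   from DERIV_cmult[OF this, of "inverse (e ^ (?n + 1))"] show ?thesis by (simp add: ring_def[abs_def] h'_def mult.commute)
  qed
  have ch: "continuous_on UNIV h'" unfolding h'_def by (intro continuous_intros continuous_on_compose2[OF Dk_continuous[OF r1(2)]]) auto
  define E where "E = inverse (e ^ (?n + 1)) * (inverse (e^2) * B)"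
  have E: "E >= 0" using e B(1) by (simp add: E_def)
  have hE: "\<bar>h' x\<bar> <= E" for x
   unfolding h'_def E_def using e rB by (simp add: abs_mult mult_left_mono)
  have hz: "h' x = 0" if "x > e^2" for x
  proof -
   have "inverse (e^2) * x > 1" using that e by (simp add: field_simps)
   thus ?thesis by (simp add: h'_def r1z)
  qed
  let ?r = "(norm y)^2"
  have le: "norm (exp_average k h' ?r) <= integral {-1..1} (%s. if s : {-e..e} then exp \<bar>k\<bar> * E else 0)"
   unfolding exp_average_def
  proof (rule Henstock_Kurzweil_Integration.integral_norm_bound_integral[OF exp_average_integrable[OF ch]])
   show "(%s. if s : {-e..e} then exp \<bar>k\<bar> * E else 0) integrable_on {-1..1}"
   using integrable_restrict_Int[of "{-e..e}" "%s. exp \<bar>k\<bar> * E" "{-1..1}"] e integrable_const_ivl[of "exp \<bar>k\<bar> * E" "-e" e]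
   by (simp add: Int_absorb2)
   fix s :: real assume s: "s : {-1..1}"
   show "norm (exp (k * s) * h' (?r + s^2)) <= (if s : {-e..e} then exp \<bar>k\<bar> * E else 0)"
   proof (cases "s : {-e..e}")
   case True
   have "k * s <= \<bar>k\<bar> * \<bar>s\<bar>" by (metis abs_ge_self abs_mult)
   also have "... <= \<bar>k\<bar> * 1" using s by (intro mult_left_mono) auto
   finally have "k * s <= \<bar>k\<bar>" by simp
   thus ?thesis using True hE[of "?r + s^2"] E by (simp add: abs_mult mult_mono)
   next
   case False
   hence "e < \<bar>s\<bar>" by auto
   hence "e^2 < \<bar>s\<bar>\<^sup>2" using e by (intro power_strict_mono) auto
   hence "?r + s^2 > e^2" using zero_le_power2[of "norm y"] power2_abs[of s] by linarith
   thus ?thesis using False hz[of "?r + s^2"] by (simp only: if_False mult_zero_right norm_zero order_refl)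
   qed
  qed
  also have "... = integral ({-e..e} Int {-1..1}) (%s. exp \<bar>k\<bar> * E)" by (rule integral_restrict_Int)
  also have "{-e..e} Int {-1..1} = {-e..e}" using e by auto
  also have "integral {-e..e} (%s. exp \<bar>k\<bar> * E) = 2 * e * (exp \<bar>k\<bar> * E)" using e by simp
  finally have le': "\<bar>exp_average k h' ?r\<bar> <= 2 * e * (exp \<bar>k\<bar> * E)" unfolding real_norm_def .
  have "\<bar>y $ i\<bar> <= e" using component_le_norm_cart[of y i] False by linarith
  have "norm (partial i (kernel k e) y) = \<bar>exp_average k h' ?r\<bar> * (2 * \<bar>y $ i\<bar>)"
   unfolding kernel_def by (subst partial_radial[OF exp_average_deriv[OF dh ch]]) (simp add: norm_mult abs_mult)
  also have "... <= (2 * e * (exp \<bar>k\<bar> * E)) * (2 * e)" by (intro mult_mono le') (use \<open>\<bar>y $ i\<bar> <= e\<close> e E in auto)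
  also have "... = C / e ^ (?n + 1)" using e by (simp add: C_def E_def field_simps power2_eq_square)
  finally show ?thesis .
 qed
 moreover have "C > 0" using B(1) by (simp add: C_def)
 ultimately show thesis using that by blast
qed

section \<open>Regularity and unique continuation\<close>

definition helm :: "real => (real^'n => complex) => real^'n => complex" where
 "helm k f x = laplacian f x + of_real (k^2) * f x"

definition weak_helm :: "real => (real^'n) set => (real^'n => complex) => bool" where
 "weak_helm k U u <-> (ALL ph. test U ph --> (LI x. u x * helm k ph x) = 0)"

lemma test_helm: "test U f ==> test U (helm k f)"
 unfolding helm_def[abs_def] laplacian_def by (intro test_add test_sum test_partial test_cmult)

lemma partial_reflect_shift:
 fixes f :: "'n::finite fn"
 assumes "smooth f" shows "partial i (%y. f (x - y)) = (%y. (-1) * partial i f (x - y))"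
proof
 fix y
 have "partial i (%y. f (- y + x)) y = (SU j. (- axis i 1) $ j *R partial j f (- y + x))"
  by (rule partial_affine_comp) (simp_all add: linear_uminus smooth_differentiable[OF assms])
 thus "partial i (%y. f (x - y)) y = (-1) * partial i f (x - y)"
  by (simp add: axis_def if_distrib[of uminus] if_distrib[of "%a. a *R b" for b] cong: if_cong)
qed

lemma partial_cmult:
 assumes "f differentiable (at x)" shows "partial i (%x. c * f x) x = c * partial i f x"
 using partial_mult[of "%x. c" x f i] assms by (simp add: partial_const)

lemma helm_reflect_shift:
 assumes "smooth f" shows "helm k (%y. f (x - y)) y = helm k f (x - y)"
proof -
 have "smooth (%y. f (x - y))" using smooth_comp_affine[of uminus f x] assms by (simp add: linear_uminus)
 have sp: "smooth (partial i f)" for i by (rule smooth_partial[OF assms])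
 hence "smooth (%y. partial i f (x - y))" for i using smooth_comp_affine[of uminus "partial i f" x] by (simp add: linear_uminus)
 hence "partial i (partial i (%y. f (x - y))) y = partial i (partial i f) (x - y)" for i
  unfolding partial_reflect_shift[OF assms] by (subst partial_cmult[OF smooth_differentiable]) (simp_all add: partial_reflect_shift[OF sp])
 thus ?thesis by (simp add: helm_def laplacian_def)
qed

lemma reflect_cball: "{y. x - y : cball 0 e} = cball (x::real^'n) e" by (auto simp: dist_norm norm_minus_commute)

text \<open>The reflected function P(x - y) from \<open>kernel_difference\<close> is supported in
  the ball of radius e around x, hence admissible, and its image under the Helmholtz operator is the
  difference of the two kernels.\<close>

lemma conv_kernel_eq:
 fixes u :: "'n::finite fn"
 assumes u: "Lint u" "weak_helm k U u" and e: "0 < e'" "e' <= e" "e <= 1" and x: "cball x e <= U"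
 shows "conv u (kernel k e') x = conv u (kernel k e) x"
proof -
 obtain P :: "'n fn" where P: "!!V. cball 0 e <= V ==> test V P"
  "!!y. laplacian P y + of_real (k^2) * P y = kernel k e' y - kernel k e y" by (rule kernel_difference[OF e]) (rule that)
 have sP: "smooth P" using P(1)[of UNIV] test_smooth by auto
 have "test (cball x e) (%y. P (x - y))" using test_shift[OF P(1)[OF order_refl], of x] unfolding reflect_cball .
 hence "test U (%y. P (x - y))" using x by (rule test_mono)
 hence "(LI y. u y * helm k (%y. P (x - y)) y) = 0" using u(2) by (simp add: weak_helm_def)
 hence "(LI y. u y * (kernel k e' (x - y) - kernel k e (x - y))) = 0"
  unfolding helm_reflect_shift[OF sP] unfolding helm_def P(2) .
 moreover have "0 < e" using e by linarith
 hence "Lint (%y. u y * kernel k e' (x - y))" "Lint (%y. u y * kernel k e (x - y))"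
  using conv_integrable[OF u(1) test_kernel] e(1) by auto
 ultimately show ?thesis by (simp add: conv_def right_diff_distrib Bintegral_diff)
qed

lemma classical_weak_laplacian:
 fixes v :: "'n::finite fn"
 assumes "open U" "Ck_on 2 U v" "test U ph"
 shows "Lint (%x. v x * partial i (partial i ph) x)" "Lint (%x. partial i (partial i v) x * ph x)"
  "(LI x. v x * partial i (partial i ph) x) = (LI x. partial i (partial i v) x * ph x)"
proof -
 have c: "Ck_on (Suc (Suc 0)) U v" using assms(2) by (simp only: numeral_2_eq_2)
 have c1: "Ck_on 1 U v" unfolding One_nat_def by (rule Ck_on_Suc_imp[OF c])
 have c2: "Ck_on 1 U (partial i v)" unfolding One_nat_def using c by (metis Ck_on.simps(2))
 note 1 = integration_by_parts[OF assms(1) c1 test_partial[OF assms(3)], of i i] and 2 = integration_by_parts[OF assms(1) c2 assms(3), of i]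
 show "Lint (%x. v x * partial i (partial i ph) x)" by (rule 1(1))
 show "Lint (%x. partial i (partial i v) x * ph x)" by (rule 2(2))
 show "(LI x. v x * partial i (partial i ph) x) = (LI x. partial i (partial i v) x * ph x)"
  using 1(3) 2(3) by simp
qed

lemma classical_imp_weak_helm:
 fixes v :: "'n::finite fn"
 assumes "open U" "Ck_on 2 U v" "!!x. x : U ==> helm k v x = 0"
 shows "weak_helm k U v"
 unfolding weak_helm_def
proof (intro allI impI)
 fix ph :: "'n fn" assume ph: "test U ph"
 obtain K where K: "compact K" "K <= U" "!!x. x ~: K ==> ph x = 0" by (rule test_functionE[OF ph]) (rule that)
 note c = classical_weak_laplacian[OF assms(1,2) ph]
 have "Ck_on 1 U v" by (rule Ck_on_mono[OF _ assms(2)]) simp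
 have vi: "Lint (%x. v x * ph x)"
 proof -
  obtain ze W where ze: "test U ze" "open W" "K <= W" "!!y. y : W ==> ze y = 1" by (rule cutoff_exists[OF K(1) assms(1) K(2)]) (rule that)
  have "continuous_on (U Un - K) (%x. v x * ph x)"
  proof (rule continuous_on_open_Un[OF assms(1)])
   show "open (- K)" using compact_imp_closed[OF K(1)] by (rule open_Compl)
   show "continuous_on U (%x. v x * ph x)" by (intro continuous_on_mult Ck_on_continuous[OF assms(2)] smooth_continuous test_smooth[OF ph])
   show "continuous_on (- K) (%x. v x * ph x)" by (rule continuous_on_eq[of _ "%x. 0"]) (use K(3) in auto)
  qed
  moreover have "U Un - K = UNIV" using K(2) by auto
  ultimately have "continuous_on UNIV (%x. v x * ph x)" by simp
  thus ?thesis by (rule compact_support_integrable[OF _ K(1)]) (simp add: K(3))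
 qed
 have "(LI x. v x * helm k ph x) = (LI x. (SU i. v x * partial i (partial i ph) x) + of_real (k^2) * (v x * ph x))"
  by (rule Bintegral_cong) (simp_all add: helm_def laplacian_def sum_distrib_left distrib_left mult.left_commute)
 also have "... = (SU i. (LI x. v x * partial i (partial i ph) x)) + of_real (k^2) * (LI x. v x * ph x)"
  by (subst Bintegral_add) (use c(1) vi in "simp_all add: Bintegral_sum")
 also have "... = (SU i. (LI x. partial i (partial i v) x * ph x)) + of_real (k^2) * (LI x. v x * ph x)" by (simp only: c(3))
 also have "... = (LI x. (SU i. partial i (partial i v) x * ph x) + of_real (k^2) * (v x * ph x))"
  by (subst Bintegral_add) (use c(2) vi in "simp_all add: Bintegral_sum")
 also have "... = (\<integral>x. 0 \<partial>(lebesgue :: (real^'n) measure))"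
 proof (rule Bintegral_cong)
  fix x
  have "(SU i. partial i (partial i v) x * ph x) + of_real (k^2) * (v x * ph x) = helm k v x * ph x"
   by (simp add: helm_def laplacian_def sum_distrib_right distrib_right mult.assoc)
  thus "(SU i. partial i (partial i v) x * ph x) + of_real (k^2) * (v x * ph x) = 0"
   using assms(3)[of x] K(2,3) by (cases "x : U") auto
 qed simp
 finally show "(LI x. v x * helm k ph x) = 0" by simp
qed

section \<open>The masses of the kernels\<close>

lemma Dk_trig: "Dk m UNIV (%x. a * cos (k * x) + b * sin (k * x))"
proof (induction m arbitrary: a b)
 case 0 show ?case by (auto intro!: continuous_intros)
next
 case (Suc m)
 have "((%x. a * cos (k * x) + b * sin (k * x)) hrd (b * k) * cos (k * x) + (- a * k) * sin (k * x)) (at x)" for x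
  by (auto intro!: derivative_eq_intros)
 with Suc[of "b * k" "- a * k"] show ?case
  unfolding Dk.simps by (intro exI[of _ "%x. (b * k) * cos (k * x) + (- a * k) * sin (k * x)"]) blast
qed

text \<open>A plane wave shows that the masses of the kernels converge to a positive constant.\<close>

lemma plane_wave_helm:
 fixes i :: "'n::finite" and x :: "real^'n" and k :: real
 defines "w \<equiv> %x::real^'n. complex_of_real (cos (k * (axis i 1 *. x)))"
 shows "smooth w" "helm k w x = 0"
proof -
 have s: "smooth (%x. complex_of_real (g (axis i 1 *. x)))" if "!!m. Dk m UNIV g" for g by (rule smooth_real_comp[OF that smooth_inner])
 show "smooth w" unfolding w_def using s[of "%x. cos (k * x)"] Dk_trig[of _ 1 k 0] by simp
 have di: "((%x. axis i 1 *. x) has_derivative (%h. axis i 1 *. h)) (at x)" for x :: "real^'n"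
  by (rule bounded_linear_imp_has_derivative[OF bounded_linear_inner_right])
 have p: "partial j w = (%x. of_real (- k * sin (k * (axis i 1 *. x)) * (axis i 1 *. (axis j 1 :: real^'n))))" for j
 proof
  fix x
  have "((%r. cos (k * r)) hrd - k * sin (k * r)) (at r)" for r by (auto intro!: derivative_eq_intros)
  thus "partial j w x = of_real (- k * sin (k * (axis i 1 *. x)) * (axis i 1 *. (axis j 1 :: real^'n)))"
   unfolding w_def using partial_real_comp[OF di, of "%r. cos (k * r)" "- k * sin (k * (axis i 1 *. x))" x j] by blast
 qed
 have "partial j (partial j w) x = (if j = i then of_real (- (k * k) * cos (k * (axis i 1 *. x))) else 0)" for j
 proof (cases "j = i")
  case True
  have "((%r. - k * sin (k * r)) hrd - (k * k) * cos (k * r)) (at r)" for r by (auto intro!: derivative_eq_intros)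
  from partial_real_comp[OF di this, of i x] show ?thesis
   unfolding p using True by (simp add: inner_axis_axis)
 next
  case False
  hence "partial j w = (%x. 0)" unfolding p by (auto simp: inner_axis_axis)
  thus ?thesis using False by (simp add: partial_const)
 qed
 thus "helm k w x = 0" by (simp add: helm_def laplacian_def w_def power2_eq_square)
qed

lemma integral_pos_continuous:
 fixes f :: "real^'n => real"
 assumes "continuous_on UNIV f" "Lint f" "!!x. f x >= 0" "f y > 0"
 shows "(LI x. f x) > 0"
proof -
 have "continuous (at y) f" using assms(1) by (simp add: continuous_on_eq_continuous_at)
 then obtain d where d: "d > 0" "!!x. dist x y < d ==> dist (f x) (f y) < f y / 2"
  unfolding continuous_at_eps_delta using assms(4) by (metis half_gt_zero)
 have b: "f x >= f y / 2" if "x : ball y d" for x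
 proof -
  have "\<bar>f x - f y\<bar> < f y / 2" using d(2)[of x] that by (simp add: dist_real_def dist_commute)
  thus ?thesis by linarith
 qed
 have "0 < f y / 2 * measure lebesgue (ball y d)" using content_ball_pos[OF d(1), of y] assms(4) by simp
 also have "... = (LI x. f y / 2 * indicator (ball y d) x)" by simp
 also have "... <= (LI x. f x)"
 proof (rule integral_mono[OF _ assms(2)])
  show "Lint (%x. f y / 2 * indicator (ball y d) x)"
   using lmeasurable_ball[of y d] by (intro integrable_mult_right integrable_real_indicator) (auto simp: fmeasurable_def)
  show "f y / 2 * indicator (ball y d) x <= f x" for x
   using b[of x] assms(3)[of x] by (auto simp: indicator_def)
 qed
 finally show ?thesis .
qed

definition kernel_mass :: "'n::finite itself => real => real => real" where
 "kernel_mass T k e = (LI x. Re (kernel k e (x :: real^'n)))"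

text \<open>The integral c of the plane wave against the kernel does not depend on e. On the support
  the wave lies between cos (k * e) and 1, so the mass lies between c and c / cos (k * e).\<close>

lemma kernel_mass_tendsto:
 assumes "k > 0"
 shows "EX c>0. (ALL e. 0 < e & e <= 1 --> kernel_mass TYPE('n::finite) k e > 0) &
  (ALL e. (ALL j::nat. 0 < e j & e j <= 1) & e ---> 0 --> (%j. kernel_mass TYPE('n::finite) k (e j)) ---> c)"
proof -
 fix i :: 'n
 define w where "w x = complex_of_real (cos (k * (axis i 1 *. x)))" for x :: "real^'n"
 have ww: "smooth w" "!!x. helm k w x = 0" unfolding w_def[abs_def] using plane_wave_helm[of k i] by auto
 have weak: "weak_helm k UNIV w" by (rule classical_imp_weak_helm) (use ww in "auto simp: smooth_def simp del: Ck_on.simps")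
 let ?m = "kernel_mass TYPE('n) k"
 let ?K = "%e x::real^'n. Re (kernel k e x)"
 have tk: "test UNIV (kernel k e :: real^'n => complex)" if "e > 0" for e using test_kernel[OF that, of UNIV] by simp
 have Ki: "Lint (?K e)" if "e > 0" for e by (rule integrable_Re[OF test_integrable[OF tk[OF that]]])
 have Kc: "continuous_on UNIV (?K e)" if "e > 0" for e by (intro continuous_on_Re smooth_continuous test_smooth[OF tk[OF that]])
 have mpos: "?m e > 0" if "0 < e" "e <= 1" for e
 proof -
  define y :: "real^'n" where "y = (e / sqrt 2) *R axis i 1"
  have "(norm y)^2 = e^2 / 2" by (simp add: y_def norm_axis_1 power_divide)
  thus ?thesis unfolding kernel_mass_def
   by (intro integral_pos_continuous[OF Kc[OF that(1)] Ki[OF that(1)] kernel_Re(2)[OF that(1)] kernel_pos[OF that]])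
 qed
 define C where "C e = (LI x. w x * kernel k e x)" for e
 have wk: "Lint (%x. w x * kernel k e x)" if "e > 0" for e by (rule test_integrable[OF test_mult_smooth[OF ww(1) tk[OF that]]])
 have Ceq: "C e' = C e" if e: "0 < e'" "e' <= e" "e <= 1" for e e'
 proof -
  obtain P :: "'n fn" where P: "!!V. cball 0 e <= V ==> test V P"
   "!!y. laplacian P y + of_real (k^2) * P y = kernel k e' y - kernel k e y" by (rule kernel_difference[OF e]) (rule that)
  have "(LI x. w x * helm k P x) = 0" using weak P(1)[of UNIV] by (simp add: weak_helm_def)
  hence "(LI x. w x * kernel k e' x - w x * kernel k e x) = 0" unfolding helm_def P(2) by (simp add: right_diff_distrib)
  thus ?thesis using wk[of e] wk[of e'] e by (simp add: C_def)
 qed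
 \<comment> \<open>A reference radius with e <= 1 and k * e <= 1, so that the cosine is positive on
   the support.\<close>
 define c where "c = Re (C (min 1 (1 / k)))"
 have ReC: "Re (C e) = (LI x. cos (k * (axis i 1 *. x)) * ?K e x)" if "e > 0" for e
 proof -
  have "Re (C e) = (LI x. Re (w x * kernel k e x))" unfolding C_def by (rule integral_Re[OF wk[OF that], symmetric])
  thus ?thesis by (simp add: w_def)
 qed
 have est: "cos (k * e) * ?m e <= c" "c <= ?m e" if e: "0 < e" "e <= 1" "k * e <= 1" for e
 proof -
  have "e <= min 1 (1 / k)" using e assms by (simp add: field_simps)
  hence c: "c = Re (C e)" unfolding c_def using Ceq[of e "min 1 (1/k)"] e by simp
  have int: "Lint (%x. cos (k * (axis i 1 *. x)) * ?K e x)"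
   using integrable_Re[OF wk[OF e(1)]] by (simp add: w_def)
  show "c <= ?m e" unfolding c ReC[OF e(1)] kernel_mass_def
  proof (rule integral_mono[OF int Ki[OF e(1)]])
   show "cos (k * (axis i 1 *. x)) * ?K e x <= ?K e x" for x
   using mult_right_mono[OF cos_le_one kernel_Re(2)[OF e(1)]] by simp
  qed
  have "cos (k * e) * ?m e = (LI x. cos (k * e) * ?K e x)" using Ki[OF e(1)] by (simp add: kernel_mass_def)
  also have "... <= c" unfolding c ReC[OF e(1)]
  proof (rule integral_mono[OF _ int])
   show "Lint (%x. cos (k * e) * ?K e x)" using Ki[OF e(1)] by simp
   show "cos (k * e) * ?K e x <= cos (k * (axis i 1 *. x)) * ?K e x" for x
   proof (cases "norm x >= e")
   case True
   show ?thesis unfolding kernel_outside[OF e(1) True] by simp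
   next
   case False
   have "\<bar>axis i 1 *. x\<bar> <= e" using False component_le_norm_cart[of x i] by (simp add: inner_axis')
   hence "\<bar>k * (axis i 1 *. x)\<bar> <= k * e" using assms by (simp add: abs_mult)
   moreover have "k * e <= pi" using e(3) pi_gt3 by linarith
   ultimately have "cos (k * e) <= cos \<bar>k * (axis i 1 *. x)\<bar>" by (intro cos_monotone_0_pi_le) auto
   hence "cos (k * e) <= cos (k * (axis i 1 *. x))" by (simp only: cos_abs_real)
   thus ?thesis by (rule mult_right_mono[OF _ kernel_Re(2)[OF e(1)]])
   qed
  qed
  finally show "cos (k * e) * ?m e <= c" .
 qed
 have cos_pos: "cos (k * e) > 0" if "0 < e" "k * e <= 1" for e
 proof -
  have "0 < k * e" using that(1) assms by simp
  thus ?thesis using that(2) pi_gt3 by (intro cos_gt_zero_pi) linarith+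
 qed
 define e0 where "e0 = min 1 (1 / k)"
 have e0: "0 < e0" "e0 <= 1" "k * e0 <= 1" using assms by (auto simp: e0_def min_def field_simps)
 have cpos: "c > 0"
  using est(1)[OF e0] mult_pos_pos[OF cos_pos[OF e0(1,3)] mpos[OF e0(1,2)]] by linarith
 have "(%j. ?m (e j)) ---> c" if e: "!!j::nat. 0 < e j & e j <= 1" "e ---> 0" for e
 proof (rule tendsto_sandwich)
  have "(%j. k * e j) ---> k * 0" by (intro tendsto_mult tendsto_const e(2))
  hence lim: "(%j. k * e j) ---> 0" by simp
  hence ev: "\<forall>\<^sub>F j in sequentially. k * e j < 1" by (rule order_tendstoD) simp
  show "\<forall>\<^sub>F j in sequentially. c <= ?m (e j)"
   using ev by eventually_elim (use est(2) e(1) in "auto intro: less_imp_le")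
  show "\<forall>\<^sub>F j in sequentially. ?m (e j) <= c / cos (k * e j)"
   using ev
  proof eventually_elim
   case (elim j)
   hence k: "k * e j <= 1" by simp
   have "cos (k * e j) * ?m (e j) <= c" using est(1)[of "e j"] e(1)[of j] k by blast
   moreover have "cos (k * e j) > 0" using cos_pos[of "e j"] e(1)[of j] k by blast
   ultimately show ?case by (simp add: pos_le_divide_eq mult.commute)
  qed
  have "(%j. c / cos (k * e j)) ---> c / cos 0" by (intro tendsto_divide tendsto_const tendsto_cos lim) simp
  thus "(%j. c / cos (k * e j)) ---> c" by simp
 qed (rule tendsto_const)
 thus ?thesis using cpos mpos by blast
qed

lemma kernel_mollifier:
 assumes "0 < e" "e <= 1" "kernel_mass TYPE('n::finite) k e > 0"
 shows "mollifier e (%x::real^'n::finite. of_real (inverse (kernel_mass TYPE('n::finite) k e)) * kernel k e x)"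
proof -
 let ?m = "kernel_mass TYPE('n) k e"
 have tk: "test UNIV (kernel k e :: real^'n => complex)" using test_kernel[OF assms(1), of UNIV] by simp
 have "(LI x. kernel k e (x::real^'n)) = (LI x. of_real (Re (kernel k e (x::real^'n))))" by (rule Bintegral_cong[OF refl kernel_Re(1)[OF assms(1)]])
 also have "... = of_real ?m" unfolding kernel_mass_def by (rule integral_complex_of_real)
 finally have m: "(LI x. kernel k e (x::real^'n)) = of_real ?m" .
 show ?thesis unfolding mollifier_def
 proof (intro conjI test_cmult tk allI impI)
  show "EX rh. ALL x. of_real (inverse ?m) * kernel k e (x::real^'n) = of_real (rh x) & 0 <= rh x"
  proof (intro exI allI)
   fix x :: "real^'n"
   show "of_real (inverse ?m) * kernel k e x = of_real (inverse ?m * Re (kernel k e x)) & 0 <= inverse ?m * Re (kernel k e x)"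
   using kernel_Re[OF assms(1), of k x] assms(3) by simp
  qed
  show "(LI x. of_real (inverse ?m) * kernel k e (x::real^'n)) = 1"
   using m assms(3) test_integrable[OF tk] by (simp flip: of_real_mult)
  fix x :: "real^'n" assume "of_real (inverse ?m) * kernel k e x ~= 0"
  hence "kernel k e x ~= 0" by auto
  thus "norm x < e" using kernel_outside[OF assms(1), of x k] by (cases "norm x < e") auto
 qed
qed

lemma conv_cmult: "conv u (%x. c * et x) x = c * conv u et x"
proof -
 have "conv u (%x. c * et x) x = (LI y. c * (u y * et (x - y)))" by (simp add: conv_def mult.left_commute)
 thus ?thesis by (simp add: conv_def)
qed

text \<open>On A the convolution is the same for all smaller radii. It is the mass times a
  mollification of u; as the radius tends to 0 the masses tend to c and the mollifications to u. The
  constant is fixed before u, U and e, as unique continuation requires uniformity.\<close>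

lemma kernel_representation:
 assumes "k > 0"
 shows "EX c>0. ALL (u :: real^'n::finite => complex) K U e A. L2 u & compact K & (ALL x. x ~: K --> u x = 0) & weak_helm k U u &
   0 < e & e <= 1 & A : sets lebesgue & (ALL x:A. cball x e <= U) --> (AEL x. x : A --> conv u (kernel k e) x = of_real c * u x)"
proof -
 let ?m = "kernel_mass TYPE('n) k"
 obtain c where c: "c > 0" "!!e. 0 < e ==> e <= 1 ==> ?m e > 0"
  "!!e. (!!j::nat. 0 < e j & e j <= 1) ==> e ---> 0 ==> (%j. ?m (e j)) ---> c"
  using kernel_mass_tendsto[where 'n='n, OF assms] by blast
 have "AEL x. x : A --> conv u (kernel k e) x = of_real c * u x"
  if u: "L2 u" "compact K" "!!x. x ~: K ==> u x = 0" "weak_helm k U u" and e: "0 < e" "e <= 1"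
   and A: "A : sets lebesgue" "!!x. x : A ==> cball x e <= U" for u :: "'n fn" and K U e A
 proof -
  have ui: "Lint u" by (rule L2_integrable[OF u(1) compact_imp_bounded[OF u(2)] u(3)])
  define E where "E j = e * inverse (real (Suc j))" for j
  have E: "0 < E j" "E j <= e" "E j <= 1" for j
  proof -
   show "0 < E j" using e by (simp add: E_def)
   have "inverse (real (Suc j)) <= 1" by (simp add: field_simps)
   thus "E j <= e" using mult_left_mono[of "inverse (real (Suc j))" 1 e] e by (simp add: E_def)
   thus "E j <= 1" using e by linarith
  qed
  have E0: "E ---> 0" unfolding E_def using tendsto_mult_right_zero[OF LIMSEQ_inverse_real_of_nat, of e] by simp
  have mE: "(%j. ?m (E j)) ---> c" by (rule c(3)) (use E E0 in auto)
  define et where "et j x = of_real (inverse (?m (E j))) * kernel k (E j) (x::real^'n)" for j x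
  have mol: "mollifier (E j) (et j)" for j
   unfolding et_def by (rule kernel_mollifier) (use E c(2) in auto)
  have lim: "L2lim (%j. conv u (et j)) u" by (rule mollify_L2lim[OF u(1) mol E0])
  have tk: "test UNIV (kernel k e :: real^'n => complex)" if "e > 0" for e using test_kernel[OF that, of UNIV] by simp
  have L2c: "L2 (conv u th)" if t: "test UNIV th" for th
  proof -
   obtain C where C: "compact C" "!!x. x ~: C ==> th x = 0" by (rule test_functionE[OF t]) (rule that)
   show ?thesis by (rule L2_test[OF test_conv[OF ui u(2,3) t C, of UNIV]]) auto
  qed
  define w where "w x = (if x : A then conv u (kernel k e) x - of_real c * u x else 0)" for x
  have L2w: "L2 w"
  proof -
   have d: "L2 (%x. conv u (kernel k e) x - of_real c * u x)" by (intro L2_diff L2_cmult u(1) L2c tk e)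
   show ?thesis
   proof (rule L2_dominated[OF d, of _ 1])
   show "w : LM" unfolding w_def
   using L2_measurable[OF d] A(1) by (intro measurable_If_set borel_measurable_const) auto
   qed (simp add: w_def)
  qed
  have weq: "w x = of_real (?m (E j)) * (conv u (et j) x - u x) + of_real (?m (E j) - c) * u x" if "x : A" for x j
  proof -
   have "conv u (kernel k (E j)) x = conv u (kernel k e) x" by (rule conv_kernel_eq[OF ui u(4) E(1) E(2) e(2) A(2)[OF that]])
   moreover have "conv u (et j) x = of_real (inverse (?m (E j))) * conv u (kernel k (E j)) x"
   unfolding et_def by (rule conv_cmult)
   moreover have "?m (E j) ~= 0" using c(2)[OF E(1,3), of j] by simp
   ultimately show ?thesis using that by (simp add: w_def field_simps)
  qed
  have le: "(LI x. (norm (w x))^2) <= 2 * (?m (E j))^2 * (LI x. (norm (conv u (et j) x - u x))^2) + 2 * (?m (E j) - c)^2 * (LI x. (norm (u x))^2)" for j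
  proof -
   have t: "test UNIV (et j)" using mol by (simp add: mollifier_def)
   have 1: "Lint (%x. (norm (conv u (et j) x - u x))^2)" by (rule L2_sq_integrable[OF L2_diff[OF L2c[OF t] u(1)]])
   have 2: "Lint (%x. (norm (u x))^2)" by (rule L2_sq_integrable[OF u(1)])
   have "(LI x. (norm (w x))^2) <= (LI x. 2 * (?m (E j))^2 * (norm (conv u (et j) x - u x))^2 + 2 * (?m (E j) - c)^2 * (norm (u x))^2)"
   proof (rule integral_mono[OF L2_sq_integrable[OF L2w]])
   show "Lint (%x. 2 * (?m (E j))^2 * (norm (conv u (et j) x - u x))^2 + 2 * (?m (E j) - c)^2 * (norm (u x))^2)"
   using 1 2 by simp
   fix x
   show "(norm (w x))^2 <= 2 * (?m (E j))^2 * (norm (conv u (et j) x - u x))^2 + 2 * (?m (E j) - c)^2 * (norm (u x))^2"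
   proof (cases "x : A")
   case True
   have n: "(norm (complex_of_real a * z))^2 = a^2 * (norm z)^2" for a z by (simp add: norm_mult power_mult_distrib)
   show ?thesis unfolding weq[OF True, of j]
   using norm_sq_add_le[of "of_real (?m (E j)) * (conv u (et j) x - u x)" "of_real (?m (E j) - c) * u x"]
   unfolding n by (simp only: mult.assoc)
   qed (simp add: w_def)
   qed
   thus ?thesis using 1 2 by simp
  qed
  have "(%j. 2 * (?m (E j))^2 * (LI x. (norm (conv u (et j) x - u x))^2) + 2 * (?m (E j) - c)^2 * (LI x. (norm (u x))^2))
   ---> 2 * c^2 * 0 + 2 * (c - c)^2 * (LI x. (norm (u x))^2)"
   by (intro tendsto_add tendsto_mult tendsto_power tendsto_diff tendsto_const mE lim[unfolded L2lim_def])
  hence "(LI x. (norm (w x))^2) <= 2 * c^2 * 0 + 2 * (c - c)^2 * (LI x. (norm (u x))^2)" by (rule LIMSEQ_le_const) (use le in blast)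
  hence "(LI x. (norm (w x))^2) = 0" by (intro antisym) (simp_all add: Bochner_Integration.integral_nonneg)
  from L2_zero_AE[OF L2w this] show ?thesis by eventually_elim (auto simp: w_def)
 qed
 thus ?thesis using c(1) by (intro exI[of _ c]) blast
qed

text \<open>v is the convolution of u with the kernel, divided by c. It solves the equation at each
  x of A because the kernel centred at x is itself a test function for the weak equation.\<close>

lemma Weyl_lemma:
 fixes u :: "'n::finite fn"
 assumes "k > 0" "L2 u" "compact K" "!!x. x ~: K ==> u x = 0" "weak_helm k U u" "0 < e" "e <= 1"
  "A : sets lebesgue" "!!x. x : A ==> cball x e <= U"
 obtains v where "smooth v" "!!x. x : A ==> helm k v x = 0" "AEL x. x : A --> v x = u x"
proof -
 obtain c where c: "c > 0" "ALL (u :: real^'n => complex) K U e A. L2 u & compact K & (ALL x. x ~: K --> u x = 0) & weak_helm k U u &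
   0 < e & e <= 1 & A : sets lebesgue & (ALL x:A. cball x e <= U) --> (AEL x. x : A --> conv u (kernel k e) x = of_real c * u x)"
  using kernel_representation[OF assms(1)] by blast
 have ui: "Lint u" by (rule L2_integrable[OF assms(2) compact_imp_bounded[OF assms(3)] assms(4)])
 let ?ka = "kernel k e :: real^'n => complex"
 have tk: "test UNIV ?ka" using test_kernel[OF assms(6), of UNIV] by simp
 define v where "v x = of_real (inverse c) * conv u ?ka x" for x
 have sc: "smooth (conv u ?ka)" by (rule smooth_conv[OF ui tk])
 have sv: "smooth v" unfolding v_def by (intro smooth_mult smooth_const sc)
 have pv: "partial i (partial i v) x = of_real (inverse c) * conv u (partial i (partial i ?ka)) x" for i x
 proof -
  have "partial i v = (%x. of_real (inverse c) * partial i (conv u ?ka) x)"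
   unfolding v_def by (rule ext) (rule partial_cmult[OF smooth_differentiable[OF sc]])
  thus ?thesis
   by (simp add: partial_cmult[OF smooth_differentiable[OF smooth_partial[OF sc]]] partial_conv[OF ui tk] partial_conv[OF ui test_partial[OF tk]]
   partial_cmult[OF smooth_differentiable[OF smooth_conv[OF ui test_partial[OF tk]]]])
 qed
 have hv: "helm k v x = 0" if "x : A" for x
 proof -
  have "test (cball x e) (%y. ?ka (x - y))"
   using test_shift[OF test_kernel[OF assms(6) order_refl], of x] unfolding reflect_cball .
  hence "test U (%y. ?ka (x - y))" using assms(9)[OF that] by (rule test_mono)
  hence "(LI y. u y * helm k (%y. ?ka (x - y)) y) = 0" using assms(5) by (simp add: weak_helm_def)
  hence "0 = (LI y. u y * helm k ?ka (x - y))" unfolding helm_reflect_shift[OF test_smooth[OF tk]] by simp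
  also have "... = (LI y. (SU i. u y * partial i (partial i ?ka) (x - y)) + of_real (k^2) * (u y * ?ka (x - y)))"
   by (rule Bintegral_cong) (simp_all add: helm_def laplacian_def sum_distrib_left distrib_left mult.left_commute)
  also have "... = (SU i. conv u (partial i (partial i ?ka)) x) + of_real (k^2) * conv u ?ka x"
   unfolding conv_def using conv_integrable[OF ui tk] conv_integrable[OF ui test_partial[OF test_partial[OF tk]]]
   by (subst Bintegral_add) (simp_all add: Bintegral_sum)
  finally have z: "(SU i. conv u (partial i (partial i ?ka)) x) + of_real (k^2) * conv u ?ka x = 0" by simp
  have "helm k v x = of_real (inverse c) * ((SU i. conv u (partial i (partial i ?ka)) x) + of_real (k^2) * conv u ?ka x)"
   unfolding helm_def laplacian_def pv by (simp add: v_def sum_distrib_left distrib_left mult.left_commute)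
  thus ?thesis using z by simp
 qed
 have "AEL x. x : A --> conv u ?ka x = of_real c * u x" by (rule c(2)[rule_format]) (use assms(2-9) in blast)
 hence "AEL x. x : A --> v x = u x" by eventually_elim (use c(1) in "simp add: v_def")
 thus thesis using sv hv that by blast
qed

section \<open>Analyticity along lines and unique continuation\<close>

definition dir_deriv :: "real^'n => (real^'n => complex) => real^'n => complex" where
 "dir_deriv a f x = (SU i. of_real (a $ i) * partial i f x)"

lemma test_dir_deriv: "test U f ==> test U (dir_deriv a f)"
 unfolding dir_deriv_def[abs_def] by (intro test_sum test_cmult test_partial)

lemma dir_deriv_cong:
 assumes "open S" "x : S" "!!y. y : S ==> f y = g y" shows "dir_deriv a f x = dir_deriv a g x"
 unfolding dir_deriv_def using partial_cong[OF assms] by simp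

lemma dir_deriv_conv:
 assumes "Lint g" "test UNIV et"
 shows "dir_deriv a (conv g et) x = conv g (dir_deriv a et) x"
proof -
 have "conv g (dir_deriv a et) x = (LI y. (SU i. of_real (a $ i) * (g y * partial i et (x - y))))"
  by (simp add: conv_def dir_deriv_def sum_distrib_left mult.left_commute)
 also have "... = (SU i. of_real (a $ i) * conv g (partial i et) x)"
  unfolding conv_def using conv_integrable[OF assms(1) test_partial[OF assms(2)]] by (subst Bintegral_sum) simp_all
 finally show ?thesis by (simp add: dir_deriv_def partial_conv[OF assms])
qed

lemma dir_deriv_cmult:
 assumes "smooth f" shows "dir_deriv a (%x. c * f x) x = c * dir_deriv a f x"
 unfolding dir_deriv_def partial_cmult[OF smooth_differentiable[OF assms]] by (simp add: sum_distrib_left mult.left_commute)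

lemma has_vector_derivative_line:
 assumes "smooth f"
 shows "((%t. f (x + t *R a)) has_vector_derivative dir_deriv a f (x + t *R a)) (at t)"
proof -
 have 1: "((%t. x + t *R a) has_derivative (%h. h *R a)) (at t)" by (auto intro!: derivative_eq_intros)
 have 2: "(f has_derivative (%h. SU i. (h $ i) *R partial i f (x + t *R a))) (at (x + t *R a))"
  by (rule has_derivative_partial[OF smooth_differentiable[OF assms]])
 have eq: "(SU i. ((h *R a) $ i) *R partial i f (x + t *R a)) = h *R dir_deriv a f (x + t *R a)" for h
  by (simp add: dir_deriv_def scaleR_conv_of_real[where 'a=complex] sum_distrib_left mult.assoc)
 show ?thesis
  unfolding has_vector_derivative_def using diff_chain_at[OF 1 2] unfolding o_def eq .
qed

lemma continuous_AE_eq: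
 fixes f g :: "'n::finite fn"
 assumes "open A" "continuous_on A f" "continuous_on A g" "AEL x. x : A --> f x = g x" "x : A"
 shows "f x = g x"
proof (rule ccontr)
 assume ne: "f x ~= g x"
 define B where "B = {x\<in>A. f x - g x ~= 0}"
 have "open B"
 proof -
  have "continuous_on A (%x. f x - g x)" using assms(2,3) by (rule continuous_on_diff)
  hence "open (A Int (%x. f x - g x) -` (- {0}))" by (intro continuous_open_preimage assms(1)) auto
  moreover have "A Int (%x. f x - g x) -` (- {0}) = B" by (auto simp: B_def)
  ultimately show ?thesis by simp
 qed
 moreover have "x : B" using ne assms(5) by (simp add: B_def)
 ultimately have "~ negligible B" by (intro open_not_negligible) auto
 moreover have "negligible B"
 proof -
  have "AEL x. x ~: B" using assms(4) by eventually_elim (auto simp: B_def)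
  moreover have "B : sets lebesgue" using \<open>open B\<close> by auto
  ultimately have "B : null_sets lebesgue" using AE_iff_null_sets by blast
  thus ?thesis by (simp add: negligible_iff_null_sets)
 qed
 ultimately show False by simp
qed

lemma kernel_dir_deriv_bound:
 obtains C where "C > 0" "!!e (a::real^'n) y. 0 < e ==> e <= 1 ==> norm a <= 1 ==> norm (dir_deriv a (kernel k e) y) <= C / e ^ (CARD('n) + 1) * indicator (cball 0 e) y"
proof -
 have "EX C>0. ALL e y i. 0 < e & e <= 1 --> norm (partial i (kernel k e) (y :: real^'n)) <= C / e ^ (CARD('n) + 1)"
  by (rule kernel_partial_bound[of k, where 'n='n]) blast
 then obtain C where C: "C > 0" "!!e y i. 0 < e ==> e <= 1 ==> norm (partial i (kernel k e) (y :: real^'n)) <= C / e ^ (CARD('n) + 1)" by blast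
 have "norm (dir_deriv a (kernel k e) y) <= (CARD('n) * C) / e ^ (CARD('n) + 1) * indicator (cball 0 e) y"
  if e: "0 < e" "e <= 1" and a: "norm a <= 1" for e and a y :: "real^'n"
 proof (cases "y : cball 0 e")
  case False
  have "partial i (kernel k e) y = 0" for i by (rule partial_outside[of "cball 0 e"]) (use False in "auto intro!: kernel_outside[OF e(1)]")
  thus ?thesis using False by (simp add: dir_deriv_def indicator_def)
 next
  case True
  have "norm (dir_deriv a (kernel k e) y) <= (SUM i:(UNIV::'n set). C / e ^ (CARD('n) + 1))"
   unfolding dir_deriv_def
  proof (rule sum_norm_le)
   fix i :: 'n
   have "\<bar>a $ i\<bar> <= 1" using component_le_norm_cart[of a i] a by linarith
   hence "\<bar>a $ i\<bar> * norm (partial i (kernel k e) y) <= 1 * (C / e ^ (CARD('n) + 1))"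
   using C(2)[OF e] by (intro mult_mono) auto
   thus "norm (of_real (a $ i) * partial i (kernel k e) y) <= C / e ^ (CARD('n) + 1)" by (simp add: norm_mult)
  qed
  thus ?thesis using True by simp
 qed
 moreover have "real CARD('n) * C > 0" using C(1) by simp
 ultimately show thesis using that by blast
qed

text \<open>The pointwise bound e^-(n + 1) times the volume V e^n of the support leaves 1 / e: each
  derivative of a solution costs a factor L / e, at the price of looking e further away.\<close>

lemma conv_kernel_deriv_bound:
 obtains L where "L > 0" "!!e (a::real^'n) g x B. [|0 < e; e <= 1; norm a <= 1; Lint g; !!y. y : cball x e ==> norm (g y) <= B|]
   ==> norm (conv g (dir_deriv a (kernel k e)) x) <= L / e * B"
proof -
 have "EX C>0. ALL e (a::real^'n) y. 0 < e & e <= 1 & norm a <= 1 --> norm (dir_deriv a (kernel k e) y) <= C / e ^ (CARD('n) + 1) * indicator (cball 0 e) y"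
  by (rule kernel_dir_deriv_bound[of k, where 'n='n]) blast
 then obtain C where C: "C > 0" "!!e (a::real^'n) y. 0 < e ==> e <= 1 ==> norm a <= 1 ==> norm (dir_deriv a (kernel k e) y) <= C / e ^ (CARD('n) + 1) * indicator (cball 0 e) y"
  by blast
 define V where "V = measure lebesgue (cball (0::real^'n) 1)"
 have V: "V > 0" unfolding V_def using content_cball_pos[of 1 "0::real^'n"] by simp
 have "norm (conv g (dir_deriv a (kernel k e)) x) <= C * V / e * B"
  if e: "0 < e" "e <= 1" and a: "norm a <= 1" and g: "Lint g" "!!y. y : cball x e ==> norm (g y) <= B"
  for e B and a x :: "real^'n" and g
 proof -
  have tk: "test UNIV (dir_deriv a (kernel k e))" by (intro test_dir_deriv test_kernel e) simp
  have B: "B >= 0" using order_trans[OF norm_ge_zero g(2)[of x]] e by simp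
  have "norm (conv g (dir_deriv a (kernel k e)) x) <= (LI y. B * (C / e ^ (CARD('n) + 1)) * indicator (cball x e) y)"
   unfolding conv_def
  proof (rule Bochner_Integration.integral_norm_bound_integral[OF conv_integrable[OF g(1) tk]])
   show "Lint (%y. B * (C / e ^ (CARD('n) + 1)) * indicator (cball x e) y)"
   using lmeasurable_cball[of x e] by (intro integrable_mult_right integrable_real_indicator) (auto simp: fmeasurable_def)
   fix y
   show "norm (g y * dir_deriv a (kernel k e) (x - y)) <= B * (C / e ^ (CARD('n) + 1)) * indicator (cball x e) y"
   proof (cases "y : cball x e")
   case True
   hence "x - y : cball 0 e" using reflect_cball[of x e] by blast
   hence d: "norm (dir_deriv a (kernel k e) (x - y)) <= C / e ^ (CARD('n) + 1)" using C(2)[OF e a, of "x - y"] by simp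
   show ?thesis using True mult_mono[OF g(2)[OF True] d B norm_ge_zero] by (simp add: norm_mult)
   next
   case False
   hence "x - y ~: cball 0 e" using reflect_cball[of x e] by blast
   thus ?thesis using C(2)[OF e a, of "x - y"] False by simp
   qed
  qed
  also have "... = B * (C / e ^ (CARD('n) + 1)) * measure lebesgue (cball x e)" by simp
  also have "measure lebesgue (cball x e) = e ^ CARD('n) * V"
   unfolding V_def using content_ball_conv_unit_ball[of e x] e by (simp add: content_cball_conv_ball)
  also have "B * (C / e ^ (CARD('n) + 1)) * (e ^ CARD('n) * V) = C * V / e * B" using e by (simp add: field_simps)
  finally show ?thesis .
 qed
 moreover have "C * V > 0" using C(1) V by simp
 ultimately show thesis using that by blast
qed

lemma power_over_fact_le_exp:
 fixes y :: real assumes "y >= 0" shows "y ^ n / fact n <= exp y"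
proof -
 have "(SUM i:{n}. y ^ i /\<^sub>R fact i) <= (\<Sum>i. y ^ i /\<^sub>R fact i)" by (rule sum_le_suminf[OF summable_exp_generic]) (use assms in auto)
 thus ?thesis by (simp add: exp_def divide_inverse mult.commute)
qed

text \<open>The bound \<open>|D\<^sup>n v| \<le> (L n / R)\<^sup>n M\<close>, obtained by \<open>n\<close> applications of the kernel with radius \<open>R / n\<close>,
  makes \<open>v\<close> analytic along lines.\<close>

lemma vanishing_on_line:
 fixes W :: "nat => real^'n => complex" and a x0 :: "real^'n"
 assumes W: "!!m. smooth (W m)" "!!m x. W (Suc m) x = dir_deriv a (W m) x" "!!m. W m x0 = 0"
  and B: "!!n x. n > 0 ==> dist x0 x < R ==> norm (W n x) <= (L * n / R) ^ n * M"
  and a: "norm a = 1" and h: "0 < h" "6 * L * h < R" "h < R" and L: "L > 0" and M: "M >= 0"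
 shows "W 0 (x0 + h *R a) = 0"
proof -
 have R: "R > 0" using h by linarith
 \<comment> \<open>Maclaurin's formula concerns real functions, so p stands for the real or the
   imaginary part.\<close>
 have est: "\<bar>p (W 0 (x0 + h *R a))\<bar> <= M * (1/2) ^ n"
  if n: "n > 0" and p: "bounded_linear p" "!!z. \<bar>p z\<bar> <= norm z" for n and p :: "complex => real"
 proof -
  define diff where "diff m t = p (W m (x0 + t *R a))" for m t
  have D: "DERIV (diff m) t :> diff (Suc m) t" for m t
   unfolding diff_def W(2) has_real_derivative_iff_has_vector_derivative
   by (rule bounded_linear.has_vector_derivative[OF p(1) has_vector_derivative_line[OF W(1)]])
  obtain t where t: "0 < t" "t < h" "diff 0 h = (\<Sum>m<n. (diff m 0 / fact m) * h ^ m) + (diff n t / fact n) * h ^ n"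
   using Maclaurin[OF h(1) n refl, of diff] D by blast
  have "diff m 0 = 0" for m using W(3) linear_0[OF bounded_linear.linear[OF p(1)]] by (simp add: diff_def)
  hence "diff 0 h = (diff n t / fact n) * h ^ n" using t(3) by simp
  hence "\<bar>diff 0 h\<bar> = \<bar>diff n t\<bar> / fact n * h ^ n" using h by (simp add: abs_mult)
  also have "... <= ((L * n / R) ^ n * M) / fact n * h ^ n"
  proof (intro mult_right_mono divide_right_mono)
   have "norm (W n (x0 + t *R a)) <= (L * n / R) ^ n * M" by (rule B[OF n]) (use t h a in "simp add: dist_norm")
   thus "\<bar>diff n t\<bar> <= (L * n / R) ^ n * M" unfolding diff_def using p(2) order_trans by blast
  qed (use h in auto)
  also have "... = (real n ^ n / fact n) * (M * (L * h / R) ^ n)" by (simp add: power_mult_distrib power_divide mult_ac)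
  also have "... <= exp (real n) * (M * (L * h / R) ^ n)" by (intro mult_right_mono power_over_fact_le_exp) (use L M R h in auto)
  also have "exp (real n) = exp 1 ^ n" by (simp add: exp_of_nat_mult[symmetric])
  also have "exp 1 ^ n * (M * (L * h / R) ^ n) = M * (exp 1 * (L * h / R)) ^ n"
   by (simp only: power_mult_distrib[of "exp 1" "L * h / R"] mult.left_commute)
  also have "... <= M * (1/2) ^ n"
  proof (intro mult_left_mono power_mono M)
   \<comment> \<open>Since n^n / n! <= exp n, the remainder behaves like (exp 1 * L * h / R)^n. The
     6 in the hypothesis on h is twice the bound 3 for exp 1, so this base is at most 1/2.\<close>
   have "exp 1 * (L * h / R) <= 3 * (L * h / R)" by (intro mult_right_mono exp_le) (use L R h in auto)
   also have "... <= 1/2" using h R by (simp add: field_simps)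
   finally show "exp 1 * (L * h / R) <= 1/2" .
  qed (use L R h in auto)
  finally show ?thesis by (simp add: diff_def)
 qed
 have z: "p (W 0 (x0 + h *R a)) = 0" if p: "bounded_linear p" "!!z. \<bar>p z\<bar> <= norm z" for p :: "complex => real"
 proof -
  have "(%n. M * (1/2) ^ n) ---> M * 0" by (intro tendsto_mult tendsto_const LIMSEQ_realpow_zero) auto
  hence "\<bar>p (W 0 (x0 + h *R a))\<bar> <= M * 0" by (rule LIMSEQ_le_const) (use est[OF _ p] in "auto intro!: exI[of _ 1]")
  thus ?thesis by simp
 qed
 show ?thesis using z[OF bounded_linear_Re] z[OF bounded_linear_Im] abs_Re_le_cmod abs_Im_le_cmod by (simp add: complex_eq_iff)
qed

text \<open>The point is that c0 does not depend on de, v or x0: however small the ball of zeros, it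
  grows to a fixed fraction of R. This is what lets the zero set be followed to its limit
  points.\<close>

lemma local_continuation:
 assumes "k > 0"
 shows "EX c0>0. ALL v U (x0::real^'n) R de. 0 < R & R <= 1 & open U & cball x0 (4 * R) <= U & Ck_on 2 U v & (ALL x:U. helm k v x = 0) &
   de > 0 & (ALL x:ball x0 de. v x = 0) --> (ALL x:ball x0 (c0 * R). v x = 0)"
proof -
 obtain c where c: "c > 0" "ALL (u :: real^'n => complex) K U e A. L2 u & compact K & (ALL x. x ~: K --> u x = 0) & weak_helm k U u &
   0 < e & e <= 1 & A : sets lebesgue & (ALL x:A. cball x e <= U) --> (AEL x. x : A --> conv u (kernel k e) x = of_real c * u x)"
  using kernel_representation[OF assms] by blast
 have "EX L>0. ALL e (a::real^'n) g x B. 0 < e & e <= 1 & norm a <= 1 & test UNIV g & (ALL y: cball x e. norm (g y) <= B)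
   --> norm (conv g (dir_deriv a (kernel k e)) x) <= L / e * B" by (rule conv_kernel_deriv_bound[of k, where 'n='n]) (blast intro: test_integrable)
 then obtain L0 where L0: "L0 > 0" "!!e (a::real^'n) g x B. 0 < e ==> e <= 1 ==> norm a <= 1 ==> test UNIV g ==> (ALL y: cball x e. norm (g y) <= B)
   ==> norm (conv g (dir_deriv a (kernel k e)) x) <= L0 / e * B" by blast
 define L where "L = L0 / c"
 have L: "L > 0" using L0 c by (simp add: L_def)
 \<comment> \<open>1 / (6 * L) is the condition on h of \<open>vanishing_on_line\<close>.\<close>
 define c0 where "c0 = min 1 (1 / (6 * L))"
 have c0: "c0 > 0" using L by (simp add: c0_def)
 have "v x = 0"
  if R: "0 < R" "R <= 1" and U: "open U" "cball x0 (4 * R) <= U" and v: "Ck_on 2 U v" "!!x. x : U ==> helm k v x = 0"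
   and de: "de > 0" "!!x. x : ball x0 de ==> v x = 0" and x: "x : ball x0 (c0 * R)"
  for v :: "'n fn" and U R de and x0 x :: "real^'n"
 proof -
  let ?K = "cball x0 (4 * R)" and ?ka = "%e. kernel k e :: real^'n => complex"
  \<comment> \<open>Four nested balls absorb successive losses of R: u is supported in radius 4 R,
    W0 equals v in 3 R, the kernels reproduce W0 and its derivatives in 2 R, and the estimates are
    used in R.\<close>
  define u where "u x = (if x : ?K then v x else 0)" for x
  have vc: "continuous_on U v" by (rule Ck_on_continuous[OF v(1)])
  have u2: "L2 u"
  proof -
   have "compact (v ` ?K)" by (intro compact_continuous_image continuous_on_subset[OF vc U(2)] compact_cball)
   then obtain B where B: "B > 0" "!!x. x : ?K ==> norm (v x) <= B" using compact_imp_bounded bounded_pos by (metis imageI)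
   have i: "integrable lborel (%x. indicator ?K x *R v x)" by (rule borel_integrable_compact[OF compact_cball continuous_on_subset[OF vc U(2)]])
   have "(%x. indicator ?K x *R v x) = u" by (auto simp: u_def indicator_def)
   hence ui: "Lint u" using i by (simp add: integrable_completion borel_measurable_integrable)
   have "Lint (%x. (norm (u x))^2)"
   proof (rule integrable_dominated)
   show "Lint (%x. B * norm (u x))" using ui by simp
   show "(%x. (norm (u x))^2) : LM"
   by (rule borel_measurable_power[OF measurable_compose[OF borel_measurable_integrable[OF ui] borel_measurable_norm]])
   show "norm ((norm (u x))^2) <= B * norm (u x)" for x
   using mult_right_mono[OF B(2)[of x] norm_ge_zero[of "v x"]] by (auto simp: power2_eq_square u_def)
   qed
   thus ?thesis using borel_measurable_integrable[OF ui] by (simp add: L2_def)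
  qed
  have uK: "x ~: ?K ==> u x = 0" for x by (simp add: u_def)
  have ui: "Lint u" by (rule L2_integrable[OF u2 bounded_cball uK])
  have weak: "weak_helm k (ball x0 (4 * R)) u"
   unfolding weak_helm_def
  proof (intro allI impI)
   fix ph :: "'n fn" assume ph: "test (ball x0 (4 * R)) ph"
   obtain C where C: "C <= ball x0 (4 * R)" "!!x. x ~: C ==> helm k ph x = 0" by (rule test_functionE[OF test_helm[OF ph]]) (rule that)
   have "test U ph" by (rule test_mono[OF ph]) (use U(2) ball_subset_cball in blast)
   hence "(LI x. v x * helm k ph x) = 0"
   using classical_imp_weak_helm[OF U(1) v] by (simp add: weak_helm_def)
   moreover have "(%x. u x * helm k ph x) = (%x. v x * helm k ph x)"
   proof
   fix x show "u x * helm k ph x = v x * helm k ph x"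
   using C by (cases "x : C") (auto simp: u_def)
   qed
   ultimately show "(LI x. u x * helm k ph x) = 0" by simp
  qed
  define W0 where "W0 x = of_real (inverse c) * conv u (?ka R) x" for x
  have tk: "test UNIV (?ka e)" if "e > 0" for e by (rule test_kernel[OF that]) simp
  have tW0: "test UNIV W0" unfolding W0_def
  proof (rule test_cmult)
   obtain C where C: "compact C" "!!x. x ~: C ==> ?ka R x = 0" by (rule test_functionE[OF tk[OF R(1)]]) (rule that)
   show "test UNIV (conv u (?ka R))" by (rule test_conv[OF ui compact_cball uK tk[OF R(1)] C]) auto
  qed
  have sub: "cball x R <= ball x0 (4 * R)" if "x : ball x0 (3 * R)" for x
  proof
   fix y assume "y : cball x R"
   thus "y : ball x0 (4 * R)" using that dist_triangle[of x0 y x] by (simp add: dist_commute)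
  qed
  have "AEL x. x : ball x0 (3 * R) --> conv u (?ka R) x = of_real c * u x"
   using c(2)[rule_format, of u ?K "ball x0 (4 * R)" R "ball x0 (3 * R)"] u2 uK weak R sub by auto
  hence W0u: "AEL x. x : ball x0 (3 * R) --> W0 x = u x" by eventually_elim (use c(1) in "simp add: W0_def")
  have W0v: "W0 x = v x" if "x : ball x0 (3 * R)" for x
  proof (rule continuous_AE_eq[OF open_ball _ _ _ that])
   show "continuous_on (ball x0 (3 * R)) W0" by (intro smooth_continuous test_smooth[OF tW0])
   have s: "ball x0 (3 * R) <= ?K" using R by auto
   show "continuous_on (ball x0 (3 * R)) v" by (rule continuous_on_subset[OF vc]) (use s U(2) in blast)
   show "AEL x. x : ball x0 (3 * R) --> W0 x = v x"
   using W0u by eventually_elim (use s in "auto simp: u_def")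
  qed
  show ?thesis
  proof (cases "x = x0")
   case True
   thus ?thesis using de by simp
  next
   case False
   define h where "h = norm (x - x0)"
   define a where "a = (x - x0) /\<^sub>R h"
   have h: "h > 0" using False by (simp add: h_def)
   have a: "norm a = 1" using h by (simp add: a_def h_def)
   have xh: "x0 + h *R a = x" using h by (simp add: a_def)
   have hc: "h < c0 * R" using x by (simp add: h_def dist_norm norm_minus_commute)
   also have "c0 * R <= 1 * R" using R by (intro mult_right_mono) (auto simp: c0_def)
   finally have hR: "h < R" by simp
   have "c0 * R <= (1 / (6 * L)) * R" using R by (intro mult_right_mono) (auto simp: c0_def)
   hence "6 * L * (c0 * R) <= 6 * L * ((1 / (6 * L)) * R)" using L by (intro mult_left_mono) auto
   also have "6 * L * ((1 / (6 * L)) * R) = R" using L by simp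
   finally have "6 * L * (c0 * R) <= R" .
   moreover have "6 * L * h < 6 * L * (c0 * R)" using hc L by (intro mult_strict_left_mono) auto
   ultimately have h6: "6 * L * h < R" by linarith
   define W where "W m = (dir_deriv a ^^ m) W0" for m
   have tW: "test UNIV (W m)" for m by (induction m) (simp_all add: W_def tW0 test_dir_deriv)
   have WS: "W (Suc m) x = dir_deriv a (W m) x" for m x by (simp add: W_def)
   have Wz: "ALL x:ball x0 (min de R). W m x = 0" for m
   proof (induction m)
   case 0
   show ?case using W0v de R by (auto simp: W_def)
   next
   case (Suc m)
   show ?case
   proof
   fix x assume x: "x : ball x0 (min de R)"
   have "dir_deriv a (W m) x = dir_deriv a (%x. 0) x" by (rule dir_deriv_cong[OF open_ball x]) (use Suc in blast)
   thus "W (Suc m) x = 0" by (simp add: WS dir_deriv_def partial_const)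
   qed
   qed
   \<comment> \<open>Convolution commutes with directional derivatives, so the reproduction passes
     from W0 to all iterated derivatives W m.\<close>
   have rep: "ALL x:ball x0 (2 * R). conv (W m) (?ka e) x = of_real c * W m x" if e: "0 < e" "e <= R" for m e
   proof (induction m)
   case 0
   show ?case
   proof
   fix x assume x: "x : ball x0 (2 * R)"
   have s: "y : ball x0 (3 * R)" if "?ka e (x - y) ~= 0" for y
   proof -
   have "norm (x - y) < e" using kernel_outside[OF e(1), of "x - y" k] that by linarith
   thus ?thesis using x e dist_triangle[of x0 y x] by (simp add: dist_norm norm_minus_commute)
   qed
   have "conv W0 (?ka e) x = conv u (?ka e) x"
   unfolding conv_def
   proof (rule integral_cong_AE)
   show "(%y. W0 y * ?ka e (x - y)) \<in> borel_measurable lebesgue"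
   by (rule borel_measurable_integrable[OF conv_integrable[OF test_integrable[OF tW0] tk[OF e(1)]]])
   show "(%y. u y * ?ka e (x - y)) \<in> borel_measurable lebesgue" by (rule borel_measurable_integrable[OF conv_integrable[OF ui tk[OF e(1)]]])
   show "AE y in lebesgue. W0 y * ?ka e (x - y) = u y * ?ka e (x - y)"
   using W0u by eventually_elim (use s in auto)
   qed
   also have "... = conv u (?ka R) x" by (rule conv_kernel_eq[OF ui weak e R(2) sub]) (use x R in auto)
   also have "... = of_real c * W0 x" using c(1) by (simp add: W0_def)
   finally show "conv (W 0) (?ka e) x = of_real c * W 0 x" by (simp add: W_def)
   qed
   next
   case (Suc m)
   have cm: "conv (W m') (?ka e) = conv (?ka e) (W m')" for m' by (rule conv_commute[OF test_measurable[OF tW] test_measurable[OF tk[OF e(1)]]])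
   show ?case
   proof
   fix x assume x: "x : ball x0 (2 * R)"
   have "conv (W (Suc m)) (?ka e) x = conv (?ka e) (dir_deriv a (W m)) x"
   unfolding cm using WS[of m, abs_def] by (simp add: W_def)
   also have "... = dir_deriv a (conv (W m) (?ka e)) x"
   unfolding cm by (rule dir_deriv_conv[OF test_integrable[OF tk[OF e(1)]] tW, symmetric])
   also have "... = dir_deriv a (%x. of_real c * W m x) x" by (rule dir_deriv_cong[OF open_ball x]) (use Suc in blast)
   also have "... = of_real c * W (Suc m) x" by (simp add: dir_deriv_cmult[OF test_smooth[OF tW]] WS)
   finally show "conv (W (Suc m)) (?ka e) x = of_real c * W (Suc m) x" .
   qed
   qed
   obtain M where M: "M > 0" "!!x. norm (W0 x) <= M" by (rule test_bounded[OF tW0]) (rule that)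
   \<comment> \<open>Each derivative costs L / e and consumes the distance e; n derivatives with e =
     R / n, starting from a point within R, stay within 2 R.\<close>
   have bound: "dist x0 x + real m * e < 2 * R ==> norm (W m x) <= (L / e) ^ m * M" if e: "0 < e" "e <= R" for m e x
   proof (induction m arbitrary: x)
   case 0 show ?case using M(2) by (simp add: W_def)
   next
   case (Suc m)
   have d: "dist x0 x + real m * e + e < 2 * R" using Suc.prems by (simp add: algebra_simps)
   have "real m * e >= 0" using e by simp
   hence "dist x0 x < 2 * R" using d e by linarith
   hence x: "x : ball x0 (2 * R)" by simp
   have "norm (conv (W m) (dir_deriv a (?ka e)) x) <= L0 / e * ((L / e) ^ m * M)"
   proof (rule L0(2)[OF e(1) _ _ tW])
   show "ALL y:cball x e. norm (W m y) <= (L / e) ^ m * M"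
   proof
   fix y assume "y : cball x e"
   hence "dist x0 y + real m * e < 2 * R" using d dist_triangle[of x0 y x] by simp
   thus "norm (W m y) <= (L / e) ^ m * M" by (rule Suc.IH)
   qed
   qed (use a e R in auto)
   moreover have "conv (W m) (dir_deriv a (?ka e)) x = of_real c * W (Suc m) x"
   proof -
   have "conv (W m) (dir_deriv a (?ka e)) x = dir_deriv a (conv (W m) (?ka e)) x"
   by (rule dir_deriv_conv[OF test_integrable[OF tW] tk[OF e(1)], symmetric])
   also have "... = dir_deriv a (%x. of_real c * W m x) x" by (rule dir_deriv_cong[OF open_ball x]) (use rep[OF e] in blast)
   also have "... = of_real c * W (Suc m) x" by (simp add: dir_deriv_cmult[OF test_smooth[OF tW]] WS)
   finally show ?thesis .
   qed
   ultimately have "c * norm (W (Suc m) x) <= L0 / e * ((L / e) ^ m * M)" using c(1) by (simp add: norm_mult)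
   hence "norm (W (Suc m) x) <= (L0 / e * ((L / e) ^ m * M)) / c" using c(1) by (simp only: pos_le_divide_eq mult.commute)
   also have "... = (L / e) ^ Suc m * M" by (simp add: L_def mult_ac)
   finally show ?case .
   qed
   have "W 0 (x0 + h *R a) = 0"
   proof (rule vanishing_on_line[where W = W and R = R and L = L and M = M, OF test_smooth[OF tW] WS _ _ a h h6 hR L])
   show "W m x0 = 0" for m using Wz[of m] de R by auto
   show "norm (W n x) <= (L * n / R) ^ n * M" if "n > 0" "dist x0 x < R" for n x
   proof -
   have "norm (W n x) <= (L / (R / n)) ^ n * M"
   proof (rule bound)
   show "R / n <= R" using that R by (simp add: field_simps)
   qed (use that R in auto)
   thus ?thesis by simp
   qed
   qed (use M in simp)
   hence "W0 x = 0" unfolding xh by (simp add: W_def)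
   moreover have "x : ball x0 (3 * R)" using hR R by (simp add: h_def dist_norm norm_minus_commute)
   ultimately show ?thesis using W0v by simp
  qed
 qed
 thus ?thesis using c0 by (intro exI[of _ c0]) blast
qed

text \<open>The interior Z of the zero set is relatively closed: a limit point z has a point x0 of Z
  within c0 * R / 2, and the ball of radius c0 * R about x0, where v vanishes, contains a
  neighbourhood of z.\<close>

theorem unique_continuation:
 fixes v :: "'n::finite fn"
 assumes "k > 0" "open U" "connected U" "Ck_on 2 U v" "!!x. x : U ==> helm k v x = 0"
  and V: "open V" "V ~= {}" "V <= U" "!!x. x : V ==> v x = 0" and x: "x : U"
 shows "v x = 0"
proof -
 obtain c0 where c0: "c0 > 0" "ALL v U (x0::real^'n) R de. 0 < R & R <= 1 & open U & cball x0 (4 * R) <= U & Ck_on 2 U v & (ALL x:U. helm k v x = 0) &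
   de > 0 & (ALL x:ball x0 de. v x = 0) --> (ALL x:ball x0 (c0 * R). v x = 0)"
  using local_continuation[OF assms(1)] by blast
 define Z where "Z = interior {x\<in>U. v x = 0}"
 have Zo: "open Z" and ZU: "Z <= U" and Zv: "!!x. x : Z ==> v x = 0"
  using interior_subset[of "{x\<in>U. v x = 0}"] by (auto simp: Z_def)
 have VZ: "V <= Z" unfolding Z_def using V by (intro interior_maximal) auto
 have "closure Z Int U <= Z"
 proof
  fix z assume z: "z : closure Z Int U"
  then obtain r where r: "r > 0" "cball z r <= U" using assms(2) open_contains_cball by blast
  define R where "R = min 1 (r / 8)"
  have R: "0 < R" "R <= 1" "8 * R <= r" using r by (auto simp: R_def)
  define d where "d = min R (c0 * R / 2)"
  have d: "d > 0" "d <= R" "d <= c0 * R / 2" using R c0 by (auto simp: d_def)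
  obtain x0 where x0: "x0 : Z" "dist x0 z < d" using z d(1) closure_approachable by blast
  obtain de where de: "de > 0" "ball x0 de <= Z" using Zo x0(1) openE by blast
  have "cball x0 (4 * R) <= cball z r"
  proof
   fix y assume "y : cball x0 (4 * R)"
   thus "y : cball z r" using x0(2) d(2) R dist_triangle[of z y x0] by (simp add: dist_commute)
  qed
  hence "0 < R & R <= 1 & open U & cball x0 (4 * R) <= U & Ck_on 2 U v & (ALL x:U. helm k v x = 0) &
   de > 0 & (ALL x:ball x0 de. v x = 0)"
   using R(1,2) assms(2,4,5) r(2) de Zv by blast
  hence "ALL x:ball x0 (c0 * R). v x = 0" using c0(2) by blast
  moreover have "ball z (c0 * R / 2) <= ball x0 (c0 * R)"
  proof
   fix y assume "y : ball z (c0 * R / 2)"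
   thus "y : ball x0 (c0 * R)" using x0(2) d(3) dist_triangle[of x0 y z] by simp
  qed
  ultimately have "ball z (min (c0 * R / 2) r) <= {x\<in>U. v x = 0}" using r(2) by auto
  hence "ball z (min (c0 * R / 2) r) <= Z" unfolding Z_def by (intro interior_maximal) auto
  thus "z : Z" using c0 R r by (meson centre_in_ball min_less_iff_conj mult_pos_pos half_gt_zero subsetD)
 qed
 hence "closedin (top_of_set U) Z"
  unfolding closedin_closed using closure_subset ZU by (intro exI[of _ "closure Z"]) auto
 moreover have "openin (top_of_set U) Z" using Zo ZU by (simp add: open_subset)
 ultimately have "Z = {} | Z = U" using assms(3) unfolding connected_clopen by blast
 thus ?thesis using VZ V(2) x Zv by auto
qed

section \<open>The divergence theorem for fields tangential to the flat part of the boundary\<close>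

lemma test_UNIV: "test U ph ==> test UNIV ph" by (rule test_mono) simp_all

lemma edge_width_tendsto: "(%j. c / real (Suc j)) ---> 0"
 using tendsto_mult[OF tendsto_const[of c] LIMSEQ_inverse_real_of_nat] by (simp add: divide_inverse)

lemma slab_lmeasurable: "ball 0 R Int {x::real^'n. \<bar>a *. x - b\<bar> < e} \<in> lmeasurable"
 by (rule bounded_set_imp_lmeasurable) (auto intro: bounded_subset[OF bounded_ball] sets_completionI_sets)

lemma slab_tendsto:
 fixes a :: "real^'n"
 assumes "a ~= 0"
 shows "(%j. measure lebesgue (ball 0 R Int {x. \<bar>a *. x - b\<bar> < c / real (Suc j)})) ---> 0"
proof -
 let ?A = "%j. ball 0 R Int {x. \<bar>a *. x - b\<bar> < c / real (Suc j)}"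
 have n: "AEL x. a *. x ~= b"
 proof -
  have "{x. a *. x = b} \<in> null_sets lebesgue" using negligible_hyperplane[of a b] assms by (simp add: negligible_iff_null_sets)
  from AE_not_in[OF this] show ?thesis by simp
 qed
 have "(%j. \<integral>x. indicator (?A j) x \<partial>lebesgue) ---> (\<integral>x. (0::real) \<partial>(lebesgue :: (real^'n) measure))"
 proof (rule integral_dominated_convergence[where w="indicator (ball 0 R)"])
  show "Lint (indicator (ball (0::real^'n) R) :: _ => real)"
   using lmeasurable_ball[of 0 R] by (intro integrable_real_indicator) (auto simp: fmeasurable_def)
  show "(indicator (?A j) :: _ => real) : LM" for j by (rule borel_measurable_indicator[OF fmeasurableD[OF slab_lmeasurable]])
  show "AEL x. norm (indicator (?A j) x :: real) <= indicator (ball 0 R) x" for j by (intro AE_I2) (simp add: indicator_def)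
  show "AEL x. (%j. indicator (?A j) x :: real) ---> 0"
   using n
  proof eventually_elim
   case (elim x)
   hence "\<bar>a *. x - b\<bar> > 0" by simp
   from order_tendstoD(2)[OF edge_width_tendsto[of c] this]
   have "\<forall>\<^sub>F j in sequentially. indicator (?A j) x = (0::real)" by eventually_elim (auto simp: indicator_def)
   thus ?case by (rule tendsto_eventually)
  qed
 qed simp
 thus ?thesis by simp
qed

lemma hyperplane_inner_lt_1:
 fixes a a' :: "real^'n"
 assumes "norm a = 1" "norm a' = 1" "a' ~= a" "a' ~= - a"
 shows "(a *. a')^2 < 1"
proof -
 have "\<bar>a *. a'\<bar> ~= norm a * norm a'" using norm_cauchy_schwarz_abs_eq[of a a'] assms by auto
 moreover have "\<bar>a *. a'\<bar> <= norm a * norm a'" by (rule Cauchy_Schwarz_ineq2)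
 ultimately have "\<bar>a *. a'\<bar> < 1" using assms by simp
 thus ?thesis by (simp add: abs_square_less_1)
qed

text \<open>Disjoint translates of the neighbourhood of the edge, along one hyperplane, fill a
  neighbourhood of that hyperplane, so its volume is small compared with its width.\<close>

lemma edge_tendsto:
 fixes a a' :: "real^'n"
 assumes a: "norm a = 1" "norm a' = 1" and ne: "{x. a *. x = b} ~= {x. a' *. x = b'}"
 shows "(%j. real (Suc j) * measure lebesgue (ball 0 R Int {x. \<bar>a *. x - b\<bar> < 2 / real (Suc j)} Int {x. \<bar>a' *. x - b'\<bar> < 2 / real (Suc j)})) ---> 0"
proof -
 let ?B = "%j. ball 0 R Int {x. \<bar>a *. x - b\<bar> < 2 / real (Suc j)} Int {x. \<bar>a' *. x - b'\<bar> < 2 / real (Suc j)}"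
 have Bm: "?B j : lmeasurable" for j by (intro fmeasurable_Int_fmeasurable slab_lmeasurable) (auto intro!: sets_completionI_sets)
 show ?thesis
 proof (cases "a' = a | a' = - a")
  case True
  \<comment> \<open>Parallel but distinct hyperplanes: the two slabs are disjoint once they are
    thin.\<close>
  then obtain s where s: "\<bar>s\<bar> = 1" "a' = s *R a" by (metis abs_1 abs_minus_cancel scaleR_one scaleR_minus1_left)
  have sb: "b' ~= s * b"
  proof
   assume "b' = s * b"
   hence "{x. a' *. x = b'} = {x. s * (a *. x) = s * b}" using s by simp
   also have "... = {x. a *. x = b}" using s(1) by auto
   finally show False using ne by simp
  qed
  hence "\<bar>s * b - b'\<bar> > 0" by simp
  from order_tendstoD(2)[OF edge_width_tendsto[of 4] this]
  have "\<forall>\<^sub>F j in sequentially. real (Suc j) * measure lebesgue (?B j) = 0"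
  proof eventually_elim
   case (elim j)
   have "x ~: ?B j" for x
   proof
   assume x: "x : ?B j"
   have "\<bar>s * (a *. x - b)\<bar> = \<bar>a *. x - b\<bar>" using s(1) by (simp add: abs_mult)
   hence "\<bar>s * (a *. x - b)\<bar> < 2 / real (Suc j)" using x by simp
   moreover have "\<bar>s * (a *. x) - b'\<bar> < 2 / real (Suc j)" using x s(2) by simp
   ultimately have "\<bar>s * b - b'\<bar> < 4 / real (Suc j)" by (simp add: right_diff_distrib)
   thus False using elim by simp
   qed
   hence "?B j = {}" by blast
   thus ?case by simp
  qed
  thus ?thesis by (rule tendsto_eventually)
 next
  case False
  define s where "s = 1 - (a *. a')^2"
  have s: "s > 0" using hyperplane_inner_lt_1[OF a] False by (simp add: s_def)
  define w where "w = a - (a *. a') *R a'"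
  have aa: "a *. a = 1" "a' *. a' = 1" using a by (simp_all add: dot_square_norm)
  have w: "a' *. w = 0" "a *. w = s" "norm w <= 2"
  proof -
   show "a' *. w = 0" "a *. w = s" using aa by (simp_all add: w_def s_def inner_diff_right inner_commute power2_eq_square)
   have "\<bar>a *. a'\<bar> <= 1" using Cauchy_Schwarz_ineq2[of a a'] a by simp
   thus "norm w <= 2" using norm_triangle_ineq4[of a "(a *. a') *R a'"] a by (simp add: w_def)
  qed
  let ?E = "%j. ball 0 (R + 8 / s) Int {x. \<bar>a' *. x - b'\<bar> < 2 / real (Suc j)}"
  \<comment> \<open>w is tangential to the second hyperplane, so the translates stay in its slab;
    each step advances by 4 / (j + 1) in direction a, the full width of the first slab, so they are
    disjoint. All shifts together have length at most 8 / s.\<close>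
  define c where "c j p = (4 * real p / (real (Suc j) * s)) *R w" for j p :: nat
  have le: "real (Suc j) * measure lebesgue (?B j) <= measure lebesgue (?E j)" for j
  proof -
   let ?D = "%p. (+) (c j p) ` ?B j"
   have D: "?D p : lmeasurable" for p by (rule measurable_translation[OF Bm])
   have ac: "a *. c j p = 4 * real p / real (Suc j)" "a' *. c j p = 0" for p using w s by (simp_all add: c_def)
   have dis: "disjoint_family_on ?D {..<Suc j}"
   unfolding disjoint_family_on_def
   proof (intro ballI impI)
   fix p p' assume pp: "p : {..<Suc j}" "p' : {..<Suc j}" "p ~= p'"
   have "False" if x: "x : ?B j" and y: "y : ?B j" and e: "c j p + x = c j p' + y" for x y
   proof -
   have "a *. (c j p + x) = a *. (c j p' + y)" using e by simp
   hence 1: "4 * real p / real (Suc j) + (a *. x - b) = 4 * real p' / real (Suc j) + (a *. y - b)" by (simp add: inner_add_right ac)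
   have "\<bar>4 * real p / real (Suc j) - 4 * real p' / real (Suc j)\<bar> < 4 / real (Suc j)" using 1 x y by auto
   hence "\<bar>(4 * real p - 4 * real p') / real (Suc j)\<bar> < 4 / real (Suc j)" by (simp add: diff_divide_distrib)
   hence "\<bar>4 * real p - 4 * real p'\<bar> < 4" by (simp add: abs_divide divide_less_cancel)
   thus False using pp(3) by linarith
   qed
   thus "?D p Int ?D p' = {}" by blast
   qed
   have sub: "(UN p:{..<Suc j}. ?D p) <= ?E j"
   proof
   fix y assume "y : (UN p:{..<Suc j}. ?D p)"
   then obtain p x where p: "p < Suc j" and xB: "x : ?B j" and y: "y = c j p + x" by blast
   have x: "norm x < R" using xB by simp
   have "norm (c j p) = 4 * real p / (real (Suc j) * s) * norm w" using s by (simp add: c_def)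
   also have "... <= 4 * real p / (real (Suc j) * s) * 2" using w(3) s by (intro mult_left_mono) auto
   also have "... = 8 / s * (real p / real (Suc j))" by simp
   also have "... <= 8 / s * 1" using p s by (intro mult_left_mono) auto
   finally have "norm y < R + 8 / s" using x norm_triangle_ineq[of "c j p" x] by (simp add: y)
   thus "y : ?E j" using xB by (simp add: y inner_add_right ac)
   qed
   have "(SUM p:{..<Suc j}. measure lebesgue (?D p)) = measure lebesgue (UN p:{..<Suc j}. ?D p)"
   by (rule measure_finite_Union[OF _ _ dis, symmetric]) (use fmeasurableD[OF D] fmeasurableD2[OF D] in "auto simp del: emeasure_completion")
   also have "... <= measure lebesgue (?E j)"
   using D by (intro measure_mono_fmeasurable[OF sub _ slab_lmeasurable] fmeasurableD fmeasurable.finite_UN) auto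
   finally show ?thesis by (simp add: measure_translation)
  qed
  have E: "(%j. measure lebesgue (?E j)) ---> 0" using a by (intro slab_tendsto) auto
  have nn: "0 <= real (Suc j) * measure lebesgue (?B j)" for j by simp
  show ?thesis by (rule tendsto_sandwich[OF always_eventually[OF allI[OF nn]] always_eventually[OF allI[OF le]] tendsto_const E])
 qed
qed

text \<open>A small move along the hyperplane cannot carry x - z across the frontier: the segment
  between both positions would meet the frontier, hence the hyperplane, which it avoids for almost
  every z.\<close>

lemma conv_locally_translation_invariant:
 fixes a v x :: "real^'n"
 assumes S: "open S" "bounded S" and e: "0 < e"
  and fr: "frontier S Int ball x (2 * e) <= {y. a *. y = b}" and a: "a ~= 0"
  and v: "a *. v = 0 | frontier S Int ball x (2 * e) = {}"
 shows "dir_deriv v (conv (indicator S) (kernel k e)) x = 0"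
proof -
 let ?ka = "kernel k e :: real^'n => complex"
 have ka: "test UNIV ?ka" using e by (rule test_kernel) simp
 have iS: "Lint (indicator S :: _ => complex)"
 proof -
  have "S : lmeasurable" using S by (simp add: lmeasurable_open)
  hence "Lint (indicator S :: _ => real)" by (intro integrable_real_indicator) (auto simp: fmeasurable_def)
  from integrable_of_real[OF this] show ?thesis by (simp add: of_real_indicator)
 qed
 have n: "AE z in lebesgue. a *. (x - z) ~= b"
 proof -
  have "{z. a *. z = a *. x - b} \<in> null_sets lebesgue" using negligible_hyperplane[of a] a by (simp add: negligible_iff_null_sets)
  from AE_not_in[OF this] show ?thesis by eventually_elim (simp add: inner_diff_right)
 qed
 have same: "y : S <-> y + w : S"
  if y: "y : ball x (2 * e)" "y + w : ball x (2 * e)" and w: "a *. w = 0 | frontier S Int ball x (2 * e) = {}" and yb: "a *. y ~= b" for y w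
 proof (rule ccontr)
  assume ne: "~ ?thesis"
  have sub: "closed_segment y (y + w) <= ball x (2 * e)" by (rule closed_segment_subset[OF y convex_ball])
  have "closed_segment y (y + w) Int frontier S ~= {}" by (rule connected_Int_frontier) (use ne in auto)
  then obtain z where z: "z : closed_segment y (y + w)" "z : frontier S" by blast
  hence "a *. z = b" "frontier S Int ball x (2 * e) ~= {}" using fr sub by auto
  moreover obtain t where "z = y + t *R w" using z(1) by (auto simp: in_segment algebra_simps)
  ultimately show False using w yb by (auto simp: inner_add_right)
 qed
 have const: "conv (indicator S) ?ka (x + t *R v) = conv (indicator S) ?ka x" if t: "norm (t *R v) < e" for t
 proof -
  have m: "(indicator S :: real^'n => complex) : LM" by (rule borel_measurable_integrable[OF iS])
  show ?thesis unfolding conv_reflect[OF m test_measurable[OF ka]]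
  proof (rule integral_cong_AE)
   have ms: "(%z. (indicator S (y - z) :: complex)) \<in> borel_measurable lebesgue" for y :: "real^'n"
   proof -
   have "(%z. (indicator S (y - z) :: complex)) \<in> borel_measurable lborel"
   using borel_open[OF S(1)] by measurable
   thus ?thesis by (rule measurable_completion)
   qed
   show "(%z. indicator S (x + t *R v - z) * ?ka z) : LM" "(%z. indicator S (x - z) * ?ka z) : LM"
   by (intro borel_measurable_times ms test_measurable[OF ka])+
   show "AE z in lebesgue. indicator S (x + t *R v - z) * ?ka z = indicator S (x - z) * ?ka z"
   using n
   proof eventually_elim
   case (elim z)
   show ?case
   proof (cases "norm z < e")
   case False
   thus ?thesis using kernel_outside[OF e, of z k] by simp
   next
   case True
   have "x - z : ball x (2 * e)" using True e by (simp add: dist_norm)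
   moreover have "norm (x - (x - z + t *R v)) < 2 * e" using True t norm_triangle_ineq4[of z "t *R v"] by simp
   moreover have "a *. (t *R v) = 0 | frontier S Int ball x (2 * e) = {}" using v by auto
   ultimately have "x - z : S <-> x - z + t *R v : S" using elim same[of "x - z" "t *R v"] by (simp add: dist_norm)
   hence "indicator S (x - z + t *R v) = (indicator S (x - z) :: complex)" by (simp add: indicator_def)
   moreover have "x + t *R v - z = x - z + t *R v" by simp
   ultimately show ?thesis by (simp only:)
   qed
   qed
  qed
 qed
 have 1: "((%t. conv (indicator S) ?ka (x + t *R v)) has_vector_derivative dir_deriv v (conv (indicator S) ?ka) (x + 0 *R v)) (at 0)"
  by (rule has_vector_derivative_line[OF smooth_conv[OF iS ka]])
 have 2: "((%t. conv (indicator S) ?ka (x + t *R v)) has_vector_derivative 0) (at 0)"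
 proof (rule has_vector_derivative_transform_within_open[where f="%_. conv (indicator S) ?ka x"])
  have "continuous_on UNIV (%t. norm (t *R v))" by (intro continuous_intros)
  thus "open {t. norm (t *R v) < e}" by (intro open_Collect_less continuous_intros)
  show "0 : {t. norm (t *R v) < e}" using e by simp
  show "conv (indicator S) ?ka x = conv (indicator S) ?ka (x + t *R v)" if "t : {t. norm (t *R v) < e}" for t
   using const[of t] that by simp
 qed simp
 show ?thesis using vector_derivative_unique_at[OF 1 2] by simp
qed

lemma partial_dir_deriv: "partial i f x = dir_deriv (axis i 1) f x"
proof -
 have "(SU j. complex_of_real (axis i 1 $ j) * partial j f x) = (SU j. if j = i then partial j f x else 0)" by (intro sum.cong) (auto simp: axis_def)
 thus ?thesis by (simp add: dir_deriv_def)
qed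

lemma dir_deriv_diff_scaleR: "dir_deriv (v - c *R a) f x = dir_deriv v f x - of_real c * dir_deriv a f x"
 by (simp add: dir_deriv_def left_diff_distrib sum_subtractf sum_distrib_left mult.assoc)

text \<open>The gradient of the mollified indicator function of \<open>S\<close> is normal to the flat boundary, where the
  normal component of \<open>X\<close> vanishes; the neighbourhood of the edges is too small to contribute.\<close>

theorem divergence_theorem_flat:
 fixes S :: "(real^'n) set" and Q :: "((real^'n) \<times> real) set" and X :: "'n => real^'n => complex"
 assumes S: "open S" "bounded S" and Q: "finite Q" "!!q. q : Q ==> norm (fst q) = 1"
  "!!q q'. q : Q ==> q' : Q ==> q ~= q' ==> {x. fst q *. x = snd q} ~= {x. fst q' *. x = snd q'}"
  and fr: "frontier S <= (UN q:Q. {x. fst q *. x = snd q})"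
  and X: "!!i. test UNIV (X i)"
  and flat: "!!x q. x : frontier S ==> q : Q ==> fst q *. x = snd q ==> (!!q'. q' : Q ==> fst q' *. x = snd q' ==> q' = q) ==>
   (SU i. of_real (fst q $ i) * X i x) = 0"
 shows "(LI x. (if x : S then SU i. partial i (X i) x else 0)) = 0"
proof -
 define e where "e j = 1 / real (Suc j)" for j
 have e: "0 < e j" "e j <= 1" for j by (simp_all add: e_def)
 have e0: "e ---> 0" unfolding e_def by (rule edge_width_tendsto)
 \<comment> \<open>Here the Helmholtz kernel only serves as a mollifier with the derivative bound L
   / e; the wave number 1 is arbitrary.\<close>
 define M where "M j = kernel_mass TYPE('n) 1 (e j)" for j
 obtain c where c: "c > 0" "!!j. M j > 0" "M ---> c"
  using kernel_mass_tendsto[of 1, where 'n='n] e e0 unfolding M_def by (metis zero_less_one)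
 have iS: "Lint (indicator S :: _ => complex)"
 proof -
  have "S : lmeasurable" using S by (simp add: lmeasurable_open)
  hence "Lint (indicator S :: _ => real)" by (intro integrable_real_indicator) (auto simp: fmeasurable_def)
  from integrable_of_real[OF this] show ?thesis by (simp add: of_real_indicator)
 qed
 have L2S: "L2 (indicator S :: _ => complex)"
 proof -
  have "(%x. (norm (indicator S x :: complex))^2) = (%x. norm (indicator S x :: complex))" by (auto simp: indicator_def)
  thus ?thesis using iS by (simp add: L2_def borel_measurable_integrable)
 qed
 define ze where "ze j = conv (indicator S) (kernel 1 (e j) :: real^'n => complex)" for j
 have tk: "test UNIV (kernel 1 (e j) :: real^'n => complex)" for j by (rule test_kernel[OF e(1)]) simp
 have zes: "smooth (ze j)" for j unfolding ze_def by (rule smooth_conv[OF iS tk])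
 have zet: "test UNIV (ze j)" for j
 proof -
  have "kernel 1 (e j) x = 0" if "x ~: cball 0 (e j)" for x :: "real^'n" using that by (intro kernel_outside e) auto
  moreover have "compact (closure S)" using S by simp
  ultimately show ?thesis unfolding ze_def
   by (intro test_conv[OF iS, where K="closure S" and C="cball 0 (e j)"] tk) (use closure_subset[of S] in "auto simp: indicator_def")
 qed
 define g where "g x = (SU i. partial i (X i) x)" for x
 have tg: "test UNIV g" unfolding g_def[abs_def] by (intro test_sum test_partial X)
 define I where "I j x = (SU i. X i x * partial i (ze j) x)" for j x
 have tI: "Lint (%x. X i x * partial i (ze j) x)" for i j by (rule test_integrable[OF test_mult_smooth'[OF X smooth_partial[OF zes]]])
 have Ii: "Lint (I j)" for j unfolding I_def by (intro Bintegrable_sum tI)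
 \<comment> \<open>The derivatives move onto the smoothed indicator, whose gradient lives near the
   frontier.\<close>
 have parts: "(LI x. ze j x * g x) = - (LI x. I j x)" for j
 proof -
  have C1: "Ck_on 1 UNIV (ze j)" using zes by (simp add: smooth_def)
  have "(LI x. ze j x * g x) = (LI x. (SU i. ze j x * partial i (X i) x))" by (simp add: g_def sum_distrib_left)
  also have "... = (SU i. \<integral>x. ze j x * partial i (X i) x \<partial>lebesgue)"
   by (rule Bintegral_sum) (rule integration_by_parts(1)[OF open_UNIV C1 X])
  also have "... = (SU i. - (LI x. X i x * partial i (ze j) x))"
   by (intro sum.cong refl) (simp add: integration_by_parts(3)[OF open_UNIV C1 X] mult.commute)
  also have "... = - (LI x. I j x)"
   unfolding I_def sum_negf by (subst Bintegral_sum[OF tI]) simp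
  finally show ?thesis .
 qed
 have "(%j. \<integral>x. I j x \<partial>lebesgue) ---> 0"
 proof -
  have "EX L>0. ALL e (a::real^'n) g x B. 0 < e & e <= 1 & norm a <= 1 & Lint g & (ALL y: cball x e. norm (g y) <= B)
   --> norm (conv g (dir_deriv a (kernel 1 e)) x) <= L / e * B" by (rule conv_kernel_deriv_bound[of 1, where 'n='n]) blast
  then obtain L where L: "L > 0" "!!e (a::real^'n) g x B. 0 < e ==> e <= 1 ==> norm a <= 1 ==> Lint g ==> (ALL y: cball x e. norm (g y) <= B)
   ==> norm (conv g (dir_deriv a (kernel 1 e)) x) <= L / e * B" by blast
  have Dz: "norm (dir_deriv a (ze j) x) <= L / e j" if "norm a <= 1" for a x j
   unfolding ze_def dir_deriv_conv[OF iS tk] using L(2)[OF e that iS, of x j 1] by (simp add: indicator_def)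
  have "EX B>0. ALL x. norm (X i x) <= B" for i by (rule test_bounded[OF X[of i]]) blast
  then obtain B where B: "!!i. B i > 0" "!!i x. norm (X i x) <= B i" by metis
  have "EX C>0. ALL x y. norm (X i x - X i y) <= C * norm (x - y)" for i by (rule test_Lipschitz[OF X[of i]]) blast
  then obtain Lm where Lm: "!!i. Lm i > 0" "!!i x y. norm (X i x - X i y) <= Lm i * norm (x - y)" by metis
  have "EX K. compact K & (ALL x. x ~: K --> X i x = 0)" for i by (rule test_functionE[OF X[of i]]) blast
  then obtain K where K: "!!i. compact (K i)" "!!i x. x ~: K i ==> X i x = 0" by metis
  have bK: "bounded (\<Union>i. K i)" by (intro bounded_UN ballI compact_imp_bounded K(1)) simp
  obtain R where R: "ALL x:(\<Union>i. K i). norm x < R" using iffD1[OF bounded_pos_less bK] by blast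
  have XR: "X i x = 0" if "~ norm x < R" for i x using R K(2) that by blast
  define slab where "slab j q = ball 0 R Int {x. \<bar>fst q *. x - snd q\<bar> < 2 / real (Suc j)}" for j and q :: "(real^'n) \<times> real"
  define P where "P = {p \<in> Q \<times> Q. fst p ~= snd p}"
  have P: "finite P" using Q(1) by (auto simp: P_def intro: finite_subset[OF _ finite_cartesian_product[OF Q(1) Q(1)]])
  define edge where "edge j p = slab j (fst p) Int {x. \<bar>fst (snd p) *. x - snd (snd p)\<bar> < 2 / real (Suc j)}" for j and p :: "((real^'n) \<times> real) \<times> ((real^'n) \<times> real)"
  have slm: "slab j q : lmeasurable" for j q unfolding slab_def by (rule slab_lmeasurable)
  have edm: "edge j p : lmeasurable" for j p
   unfolding edge_def by (intro fmeasurable_Int_fmeasurable slm) (auto intro!: sets_completionI_sets)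
  \<comment> \<open>C1 is for points near one hyperplane only: there the normal component of X is at
    most Lm * 2 * e j by its zero on the frontier, and the gradient of \<open>ze j\<close> is at
    most L / e j. C2 is for points near two hyperplanes, where a factor 1 / e j remains, to be
    absorbed by the volume of the edge.\<close>
  define C1 where "C1 = 2 * sum Lm UNIV * L"
  define C2 where "C2 = sum B UNIV * L"
  have C: "C1 >= 0" "C2 >= 0" using L(1) less_imp_le[OF Lm(1)] less_imp_le[OF B(1)] by (simp_all add: C1_def C2_def sum_nonneg)
  define b where "b j x = C1 * (SUM q:Q. indicator (slab j q) x) + C2 * (real (Suc j) * (SUM p:P. indicator (edge j p) x))" for j x
  have ind: "Lint (indicator (slab j q) :: _ => real)" "Lint (indicator (edge j p) :: _ => real)" for j q p
   using slm edm by (simp_all add: lmeasurable_iff_integrable[symmetric])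
  have b0: "b j x >= 0" for j x unfolding b_def using C by (intro add_nonneg_nonneg mult_nonneg_nonneg sum_nonneg) auto
  have bint: "Lint (b j)" "(LI x. b j x) = C1 * (SUM q:Q. measure lebesgue (slab j q)) + C2 * (SUM p:P. real (Suc j) * measure lebesgue (edge j p))" for j
   unfolding b_def using ind slm edm by (simp_all add: fmeasurableD sum_distrib_left Bintegral_sum del: of_nat_Suc)
  have point: "norm (I j x) <= b j x" for j x
  proof (cases "norm x < R")
   case False
   thus ?thesis using XR b0 by (simp add: I_def)
  next
   case True
   have pz: "partial i (ze j) x = dir_deriv (axis i 1) (ze j) x" for i by (rule partial_dir_deriv)
   show ?thesis
   proof (cases "frontier S Int ball x (2 * e j) = {}")
   case True
   hence "dir_deriv (axis i 1) (ze j) x = 0" for i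
   unfolding ze_def by (intro conv_locally_translation_invariant[OF S e(1), where a="axis i 1" and b=0]) auto
   thus ?thesis using b0 by (simp add: I_def pz)
   next
   case False
   then obtain p where p: "p : frontier S" "norm (x - p) < 2 * e j" by (auto simp: dist_norm)
   have near: "\<bar>fst q *. x - snd q\<bar> < 2 / real (Suc j)" if "q : Q" "fst q *. p' = snd q" "norm (x - p') < 2 * e j" for q p'
   proof -
   have "\<bar>fst q *. x - snd q\<bar> = \<bar>fst q *. (x - p')\<bar>" using that by (simp add: inner_diff_right)
   also have "... <= norm (x - p')" using Cauchy_Schwarz_ineq2[of "fst q" "x - p'"] Q(2)[OF that(1)] by simp
   finally show ?thesis using that(3) by (simp add: e_def)
   qed
   obtain q where q: "q : Q" "fst q *. p = snd q" using fr p(1) by blast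
   show ?thesis
   proof (cases "EX q':Q. q' ~= q & \<bar>fst q' *. x - snd q'\<bar> < 2 / real (Suc j)")
   case True
   then obtain q' where q': "q' : Q" "q' ~= q" "\<bar>fst q' *. x - snd q'\<bar> < 2 / real (Suc j)" by blast
   have xe: "x : edge j (q, q')" "(q, q') \<in> P"
   using near[OF q p(2)] q' q(1) \<open>norm x < R\<close> by (auto simp: edge_def slab_def P_def)
   have "norm (I j x) <= (SU i. norm (X i x * partial i (ze j) x))" unfolding I_def by (rule norm_sum)
   also have "... <= (SU i. B i * (L / e j))"
   unfolding norm_mult pz by (intro sum_mono mult_mono B(2) Dz) (use B(1) in "auto intro: less_imp_le")
   also have "... = C2 * (real (Suc j) * 1)" unfolding sum_distrib_right[symmetric] by (simp add: C2_def e_def)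
   also have "... <= C2 * (real (Suc j) * (SUM p:P. indicator (edge j p) x))"
   proof (intro mult_left_mono C)
   have "indicator (edge j (q, q')) x <= (SUM p:P. indicator (edge j p) x :: real)" by (rule member_le_sum[OF xe(2) _ P]) simp
   thus "1 <= (SUM p:P. indicator (edge j p) x :: real)" using xe(1) by simp
   qed simp
   also have "... <= b j x" unfolding b_def using C by (simp add: sum_nonneg)
   finally show ?thesis .
   next
   case False
   let ?a = "fst q"
   have uniq: "q' = q" if "q' : Q" "fst q' *. p' = snd q'" "norm (x - p') < 2 * e j" for q' p'
   using near[OF that] that(1) False by blast
   have fra: "frontier S Int ball x (2 * e j) <= {y. ?a *. y = snd q}"
   proof
   fix y assume y: "y : frontier S Int ball x (2 * e j)"
   then obtain q' where q': "q' : Q" "fst q' *. y = snd q'" using fr by blast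
   have "q' = q" by (rule uniq[OF q']) (use y in "simp add: dist_norm")
   thus "y : {y. ?a *. y = snd q}" using q' by simp
   qed
   have na: "norm ?a = 1" by (rule Q(2)[OF q(1)])
   hence a0: "?a ~= 0" "?a *. ?a = 1" by (auto simp: dot_square_norm)
   have Y0: "(SU i. of_real (?a $ i) * X i p) = 0" by (rule flat[OF p(1) q]) (rule uniq[OF _ _ p(2)])
   \<comment> \<open>A coordinate direction minus its normal part is tangential, and the smoothed
     indicator is constant along it; so its gradient is normal.\<close>
   have tang: "dir_deriv (axis i 1) (ze j) x = of_real (?a $ i) * dir_deriv ?a (ze j) x" for i
   proof -
   have "dir_deriv (axis i 1 - (?a $ i) *R ?a) (ze j) x = 0"
   unfolding ze_def by (rule conv_locally_translation_invariant[OF S e(1) fra a0(1)]) (simp add: inner_diff_right inner_axis a0(2))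
   thus ?thesis by (simp add: dir_deriv_diff_scaleR)
   qed
   have ai: "\<bar>?a $ i\<bar> <= 1" for i using component_le_norm_cart[of ?a i] na by simp
   have "I j x = (SU i. of_real (?a $ i) * X i x) * dir_deriv ?a (ze j) x"
   unfolding I_def pz tang by (simp add: sum_distrib_left sum_distrib_right mult_ac)
   also have "(SU i. of_real (?a $ i) * X i x) = (SU i. of_real (?a $ i) * (X i x - X i p))"
   using Y0 by (simp add: right_diff_distrib sum_subtractf)
   finally have I: "norm (I j x) = norm (SU i. of_real (?a $ i) * (X i x - X i p)) * norm (dir_deriv ?a (ze j) x)" by (simp add: norm_mult)
   have "norm (SU i. of_real (?a $ i) * (X i x - X i p)) <= (SU i. Lm i * (2 * e j))"
   proof (rule sum_norm_le)
   fix i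
   have "norm (X i x - X i p) <= Lm i * (2 * e j)" by (rule order_trans[OF Lm(2) mult_left_mono]) (use p(2) Lm(1)[of i] in auto)
   hence "\<bar>?a $ i\<bar> * norm (X i x - X i p) <= 1 * (Lm i * (2 * e j))" by (intro mult_mono ai) auto
   thus "norm (of_real (?a $ i) * (X i x - X i p)) <= Lm i * (2 * e j)" by (simp add: norm_mult)
   qed
   also have "... = sum Lm UNIV * (2 * e j)" unfolding sum_distrib_right[symmetric] ..
   finally have "norm (I j x) <= sum Lm UNIV * (2 * e j) * (L / e j)"
   unfolding I using Dz[of ?a j x] na less_imp_le[OF Lm(1)] less_imp_le[OF e(1)[of j]] by (intro mult_mono mult_nonneg_nonneg sum_nonneg) simp_all
   also have "... = C1 * 1" using e(1)[of j] by (simp add: C1_def)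
   also have "... <= C1 * (SUM q:Q. indicator (slab j q) x)"
   proof (intro mult_left_mono C)
   have "indicator (slab j q) x <= (SUM q:Q. indicator (slab j q) x :: real)" by (rule member_le_sum[OF q(1) _ Q(1)]) simp
   thus "1 <= (SUM q:Q. indicator (slab j q) x :: real)" using near[OF q p(2)] \<open>norm x < R\<close> by (simp add: slab_def)
   qed
   also have "... <= b j x" unfolding b_def using C by (simp add: sum_nonneg)
   finally show ?thesis .
   qed
   qed
  qed
  have slab0: "(%j. measure lebesgue (slab j q)) ---> 0" if "q : Q" for q
   unfolding slab_def using Q(2)[OF that] by (intro slab_tendsto) auto
  have edge0: "(%j. real (Suc j) * measure lebesgue (edge j p)) ---> 0" if "p : P" for p
   unfolding edge_def slab_def using that Q(2) by (intro edge_tendsto Q(3)) (auto simp: P_def)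
  have "(%j. C1 * (SUM q:Q. measure lebesgue (slab j q)) + C2 * (SUM p:P. real (Suc j) * measure lebesgue (edge j p)))
   ---> C1 * (SUM q:Q. 0) + C2 * (SUM p:P. 0)" by (intro tendsto_add tendsto_mult_left tendsto_sum slab0 edge0)
  hence lim: "(%j. \<integral>x. b j x \<partial>lebesgue) ---> 0" unfolding bint by simp
  have nb: "norm (LI x. I j x) <= (LI x. b j x)" for j by (rule Bochner_Integration.integral_norm_bound_integral[OF Ii bint(1) point])
  show ?thesis by (rule Lim_null_comparison[OF always_eventually[OF allI[OF nb]] lim])
 qed
 hence z: "(%j. \<integral>x. ze j x * g x \<partial>lebesgue) ---> 0" unfolding parts using tendsto_minus by fastforce
 \<comment> \<open>Dividing by the masses turns the smoothed indicators into mollifications. The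
   masses tend to a positive limit, so the limit 0 of the integrals persists.\<close>
 define et where "et j x = of_real (inverse (M j)) * kernel 1 (e j) (x :: real^'n)" for j x
 have mol: "mollifier (e j) (et j)" for j
  unfolding et_def[abs_def] M_def by (rule kernel_mollifier[OF e]) (use c(2) in "simp add: M_def")
 have lim: "L2lim (%j. conv (indicator S) (et j)) (indicator S)" by (rule mollify_L2lim[OF L2S mol e0])
 have ce: "conv (indicator S) (et j) x = of_real (inverse (M j)) * ze j x" for j x
  unfolding et_def[abs_def] ze_def by (rule conv_cmult)
 hence ce': "conv (indicator S) (et j) = (%x. of_real (inverse (M j)) * ze j x)" for j by blast
 have "(%j. \<integral>x. (of_real (inverse (M j)) * ze j x) * g x \<partial>lebesgue) ---> (LI x. indicator S x * g x)"
  by (rule L2lim_product[OF L2_test[OF test_cmult[OF zet]] L2S lim[unfolded ce'] L2_test[OF tg]])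
 moreover have "(LI x. (of_real (inverse (M j)) * ze j x) * g x) = of_real (inverse (M j)) * (LI x. ze j x * g x)" for j by (simp add: mult.assoc)
 ultimately have "(%j. of_real (inverse (M j)) * (LI x. ze j x * g x)) ---> (LI x. indicator S x * g x)" by simp
 moreover have "(%j. of_real (inverse (M j)) * (LI x. ze j x * g x)) ---> of_real (inverse c) * 0"
  using c by (intro tendsto_mult z tendsto_of_real tendsto_inverse) auto
 ultimately have "(LI x. indicator S x * g x) = 0" using LIMSEQ_unique by fastforce
 moreover have "(%x. indicator S x * g x) = (%x. if x : S then g x else 0)" by auto
 ultimately have "(LI x. (if x : S then g x else 0)) = 0" by simp
 thus ?thesis unfolding g_def .
qed

section \<open>Approximation on Lipschitz domains\<close>

text \<open>With z = h - t e, the height e . y grows by at least t - |z|, while the graph below y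
  rises by at most L |z|. The aperture 1 / (L + 2) leaves room between the two.\<close>

lemma lipschitz_inward_cone_open:
 fixes S :: "(real^'n) set"
 assumes e: "norm e = 1" and g: "L-lipschitz_on {y. e *. y = 0} g"
  and S: "!!y. y : ball p r ==> y : S <-> g (y - (e *. y) *R e) < e *. y"
  and y: "y : S" "y : ball p r" "y + h : ball p r" and h: "norm (h - t *R e) < t / (L + 2)"
 shows "y + h : S"
proof -
 have ee: "e *. e = 1" using e by (simp add: dot_square_norm)
 have L: "L >= 0" by (rule lipschitz_on_nonneg[OF g])
 define z where "z = h - t *R e"
 have hz: "h = t *R e + z" by (simp add: z_def)
 have zt: "(L + 2) * norm z < t" using h L by (simp add: z_def pos_less_divide_eq mult.commute)
 let ?P = "%y. y - (e *. y) *R e"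
 have P0: "?P y : {y. e *. y = 0}" for y by (simp add: inner_diff_right ee)
 have ez: "\<bar>e *. z\<bar> <= norm z" using Cauchy_Schwarz_ineq2[of e z] e by simp
 have Pz: "?P (y + h) - ?P y = z - (e *. z) *R e" by (simp add: hz inner_add_right ee algebra_simps)
 have "norm (z - (e *. z) *R e) <= norm z + \<bar>e *. z\<bar>" using norm_triangle_ineq4[of z "(e *. z) *R e"] e by simp
 hence n1: "(norm (z - (e *. z) *R e))^2 <= (norm z)^2"
  unfolding power2_norm_eq_inner by (simp add: inner_diff_left inner_diff_right ee inner_commute)
 hence n: "norm (z - (e *. z) *R e) <= norm z" by (rule power2_le_imp_le) simp
 have "dist (g (?P (y + h))) (g (?P y)) <= L * dist (?P (y + h)) (?P y)" by (rule lipschitz_onD[OF g P0 P0])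
 also have "... <= L * norm z" unfolding dist_norm Pz by (rule mult_left_mono[OF n L])
 finally have "g (?P (y + h)) <= g (?P y) + L * norm z" by (simp add: dist_real_def)
 moreover have "g (?P y) < e *. y" using S[OF y(2)] y(1) by simp
 moreover have "e *. (y + h) = e *. y + t + e *. z" by (simp add: hz inner_add_right ee)
 moreover have "L * norm z + 2 * norm z < t" using zt by (simp add: distrib_right)
 ultimately have "g (?P (y + h)) < e *. (y + h)" using ez norm_ge_zero[of z] by linarith
 thus ?thesis using S[OF y(3)] by simp
qed

text \<open>Interior points are included with e = 0, hence only norm e <= 1. A point of the closure
  is replaced by a nearby point of S, which the openness of the cone permits.\<close>

lemma lipschitz_inward_cone:
 fixes S :: "(real^'n) set"
 assumes S: "open S" "lipschitz_boundary S" and p: "p : closure S"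
 shows "EX r>0. EX e c. norm e <= 1 & 0 < c & c <= 1 &
  (ALL y:closure S Int ball p r. ALL t h. 0 < t & norm (h - t *R e) < c * t & y + h : ball p r --> y + h : S)"
proof (cases "p : S")
 case True
 then obtain r where "r > 0" "ball p r <= S" using S(1) open_contains_ball by blast
 thus ?thesis by (intro exI[of _ r] conjI exI[of _ 0] exI[of _ 1]) auto
next
 case False
 hence "p : frontier S" using p S(1) by (simp add: frontier_def interior_open)
 then obtain e g L r where e: "norm e = 1" "r > 0" "L-lipschitz_on {y. e *. y = 0} g"
  and y: "!!y. y : ball p r ==> y : S <-> g (y - (e *. y) *R e) < e *. y"
  using S(2) unfolding lipschitz_boundary_def by blast
 have L: "L >= 0" by (rule lipschitz_on_nonneg[OF e(3)])
 have "y + h : S" if yc: "y : closure S" "y : ball p r" and h: "norm (h - t *R e) < 1 / (L + 2) * t" and yh: "y + h : ball p r" for y t h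
 proof -
  define d where "d = min (t / (L + 2) - norm (h - t *R e)) (r - dist p y)"
  have "d > 0" using h yc by (simp add: d_def)
  then obtain y' where y': "y' : S" "dist y' y < d" using yc(1) closure_approachable by blast
  have "dist p y' <= dist p y + dist y' y" by (metis dist_commute dist_triangle)
  hence b: "y' : ball p r" using y'(2) by (simp add: d_def)
  have "norm (h + (y - y') - t *R e) <= norm (h - t *R e) + norm (y - y')"
   using norm_triangle_ineq[of "h - t *R e" "y - y'"] by (simp add: algebra_simps)
  also have "... < t / (L + 2)" using y'(2) by (simp add: d_def dist_norm norm_minus_commute)
  finally have "y' + (h + (y - y')) \<in> S" by (intro lipschitz_inward_cone_open[OF e(1) e(3) y y'(1) b]) (use yh in "simp_all add: algebra_simps")
  thus ?thesis by (simp add: algebra_simps)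
 qed
 thus ?thesis using e L by (intro exI[of _ r] conjI exI[of _ e] exI[of _ "1 / (L + 2)"]) auto
qed

text \<open>If a frontier point p were interior to the closure, p - t e would be a limit of points
  of S; from one of these the inward cone reaches p, which would then lie in S.\<close>

lemma lipschitz_interior_closure:
 fixes S :: "(real^'n) set"
 assumes S: "open S" "lipschitz_boundary S" shows "interior (closure S) = S"
proof (rule antisym)
 show "S <= interior (closure S)" using S(1) closure_subset interior_maximal by blast
 show "interior (closure S) <= S"
 proof (rule subsetI, rule ccontr)
  fix p assume p: "p : interior (closure S)" "p ~: S"
  hence pc: "p : closure S" using interior_subset by blast
  hence "p : frontier S" using p(2) S(1) by (simp add: frontier_def interior_open)
  then obtain e g L r where e: "norm e = 1" "r > 0" "L-lipschitz_on {y. e *. y = 0} g"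
   and y: "!!y. y : ball p r ==> y : S <-> g (y - (e *. y) *R e) < e *. y"
   using S(2) unfolding lipschitz_boundary_def by blast
  have L: "L >= 0" by (rule lipschitz_on_nonneg[OF e(3)])
  obtain d where d: "d > 0" "ball p d <= closure S" using p(1) unfolding mem_interior by blast
  define t where "t = min d r / 2"
  have t: "t > 0" "t < d" "t < r" using d e by (auto simp: t_def)
  define q where "q = p - t *R e"
  have q: "q : ball p r" "q : closure S" using t d(2) e(1) by (auto simp: q_def dist_norm subset_iff)
  define m where "m = min (t / (L + 2)) (r - dist p q)"
  have "m > 0" using t q L by (simp add: m_def)
  then obtain q' where q': "q' : S" "dist q' q < m" using q(2) closure_approachable by blast
  have "dist p q' <= dist p q + dist q' q" by (metis dist_commute dist_triangle)
  hence b: "q' : ball p r" using q'(2) by (simp add: m_def)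
  have "norm ((p - q') - t *R e) < t / (L + 2)" using q'(2) by (simp add: m_def dist_norm norm_minus_commute q_def algebra_simps)
  hence "q' + (p - q') \<in> S" by (intro lipschitz_inward_cone_open[OF e(1) e(3) y q'(1) b]) (use e in simp_all)
  thus False using p(2) by simp
 qed
qed

text \<open>The test functions range over the whole space. For a field that is zero outside a
  domain, this encodes the divergence f inside together with a vanishing normal component on the
  boundary.\<close>

definition weak_div0 :: "('n => real^'n => complex) => (real^'n => complex) => bool" where
 "weak_div0 V f <-> (ALL i. L2 (V i)) & L2 f &
   (ALL ph. test UNIV ph --> (LI x. (SU i. V i x * partial i ph x) + f x * ph x) = 0)"

text \<open>Testing with ze y * et (x - y) shows that localisation and mollification keep the
  divergence up to the commutator with the gradient of ze.\<close>

lemma divergence_conv: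
 fixes ze et :: "'n::finite fn"
 assumes w: "weak_div0 V f" and ze: "test UNIV ze" and et: "test UNIV et"
 shows "(SU i. partial i (conv (%y. ze y * V i y) et) x) = conv (%y. ze y * f y + (SU i. partial i ze y * V i y)) et x"
proof -
 have L: "L2 (V i)" "L2 f" for i using w by (auto simp: weak_div0_def)
 have etx: "test UNIV (%y. et (x - y))" using test_shift[OF et, of x] by simp
 define ph where "ph y = ze y * et (x - y)" for y
 have ph: "test UNIV ph" unfolding ph_def[abs_def] by (rule test_mult_smooth'[OF ze test_smooth[OF etx]])
 have p: "partial i ph y = partial i ze y * et (x - y) - ze y * partial i et (x - y)" for i y
 proof -
  have "partial i ph y = ze y * partial i (%y. et (x - y)) y + partial i ze y * et (x - y)"
   unfolding ph_def[abs_def] by (intro partial_mult smooth_differentiable test_smooth[OF ze] test_smooth[OF etx])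
  thus ?thesis by (simp add: partial_reflect_shift[OF test_smooth[OF et]])
 qed
 have detx: "test UNIV (%y. partial i et (x - y))" for i using test_shift[OF test_partial[OF et], of x i] by simp
 have i1: "Lint (%y. V i y * (partial i ze y * et (x - y)))" for i
  by (intro L2_product L L2_test[OF test_mult_smooth'[OF test_partial[OF ze] test_smooth[OF etx]]])
 have i2: "Lint (%y. V i y * (ze y * partial i et (x - y)))" for i by (intro L2_product L L2_test[OF test_mult_smooth'[OF ze test_smooth[OF detx]]])
 have i3: "Lint (%y. f y * ph y)" by (intro L2_product L L2_test[OF ph])
 have "0 = (LI y. (SU i. V i y * partial i ph y) + f y * ph y)"
  using w ph by (simp add: weak_div0_def)
 also have "... = (LI y. ((SU i. V i y * (partial i ze y * et (x - y))) + f y * ph y) - (SU i. V i y * (ze y * partial i et (x - y))))"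
  by (intro Bintegral_cong refl) (simp add: p right_diff_distrib sum_subtractf)
 also have "... = (LI y. (SU i. V i y * (partial i ze y * et (x - y))) + f y * ph y) - (LI y. (SU i. V i y * (ze y * partial i et (x - y))))"
  by (intro Bintegral_diff Bintegrable_add Bintegrable_sum i1 i2 i3)
 also have "(LI y. (SU i. V i y * (ze y * partial i et (x - y)))) = (SU i. conv (%y. ze y * V i y) (partial i et) x)"
  unfolding conv_def by (subst Bintegral_sum[OF i2]) (simp add: mult_ac)
 also have "... = (SU i. partial i (conv (%y. ze y * V i y) et) x)"
 proof (intro sum.cong refl)
  fix i
  have "Lint (%y. ze y * V i y)" using L2_product[OF L(1) L2_test[OF ze], of i] by (simp add: mult.commute)
  from partial_conv[OF this et] show "conv (%y. ze y * V i y) (partial i et) x = partial i (conv (%y. ze y * V i y) et) x" by simp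
 qed
 also have "(LI y. (SU i. V i y * (partial i ze y * et (x - y))) + f y * ph y) = conv (%y. ze y * f y + (SU i. partial i ze y * V i y)) et x"
  unfolding conv_def ph_def by (intro Bintegral_cong refl) (simp add: distrib_left sum_distrib_left mult_ac)
 finally show ?thesis by simp
qed

text \<open>The approximation shifts inwards while mollifying, on each piece of a partition of unity.\<close>

lemma lipschitz_approximation:
 fixes S :: "(real^'n) set"
 assumes S: "open S" "bounded S" "lipschitz_boundary S"
 shows "EX J :: nat => (real^'n => complex) => real^'n => complex.
  (ALL g. L2 g & (ALL x. x ~: S --> g x = 0) --> (ALL n. test S (J n g)) & L2lim (%n. J n g) g) &
  (ALL V f. weak_div0 V f & (ALL x. x ~: S --> (ALL i. V i x = 0) & f x = 0) -->
   L2lim (%n x. SU i. partial i (J n (V i)) x) f) &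
  (ALL n. J n (%x. 0) = (%x. 0))"
proof -
 have cS: "compact (closure S)" using S(2) by simp
 have "ALL p:closure S. EX r e c. r > 0 & norm e <= 1 & 0 < c & c <= 1 &
  (ALL y:closure S Int ball p r. ALL t h. 0 < t & norm (h - t *R e) < c * t & y + h : ball p r --> y + h : S)"
  using lipschitz_inward_cone[OF S(1,3)] by blast
 then obtain r e c where rec: "ALL p:closure S. r p > 0 & norm (e p) <= 1 & 0 < c p & c p <= 1 &
  (ALL y:closure S Int ball p (r p). ALL t h. 0 < t & norm (h - t *R e p) < c p * t & y + h : ball p (r p) --> y + h : S)"
  unfolding bchoice_iff by blast
 hence r: "!!p. p : closure S ==> r p > 0" and e: "!!p. p : closure S ==> norm (e p) <= 1"
  and c: "!!p. p : closure S ==> 0 < c p" "!!p. p : closure S ==> c p <= 1" by blast+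
 have cone: "y + h : S" if "p : closure S" "y : closure S" "y : ball p (r p)" "0 < t" "norm (h - t *R e p) < c p * t" "y + h : ball p (r p)" for p y t h
  using rec that by blast
 have r2: "p : closure S ==> r p / 2 > 0" for p using r by simp
 obtain P ze W where P: "finite P" "P <= closure S" "open W" "closure S <= W" "!!p. p : P ==> test (ball p (r p / 2)) (ze p)"
  "!!y. y : W ==> (SUM p:P. ze p y) = 1" by (rule compact_partition[OF cS r2]) (assumption, rule that)
 have Pc: "p : closure S" if "p : P" for p using that P(2) by blast
 have ze: "test UNIV (ze p)" if "p : P" for p by (rule test_UNIV[OF P(5)[OF that]])
 \<comment> \<open>Supports lie within r p / 2 of p and are moved by less than 2 * t p n <= r p / 2,
   so they stay in the ball where the cone condition of p holds.\<close>
 define t where "t p n = r p / 4 / real (Suc n)" for p and n :: nat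
 have t: "0 < t p n" "2 * t p n <= r p / 2" if "p : P" for p n
 proof -
  show "0 < t p n" using r[OF Pc[OF that]] by (simp add: t_def)
  have "r p / 4 / real (Suc n) <= r p / 4 / 1" using r[OF Pc[OF that]] by (intro divide_left_mono) auto
  hence "t p n <= r p / 4" unfolding t_def by (simp only: div_by_1)
  thus "2 * t p n <= r p / 2" by linarith
 qed
 have "EX et. p : P --> mollifier (2 * t p n) et & (ALL x. et x ~= 0 --> x : cball (t p n *R e p) (c p * t p n / 2))" for p n
 proof (cases "p : P")
  case True
  have ct: "c p * t p n / 2 > 0" using c(1)[OF Pc[OF True]] t(1)[OF True] by simp
  obtain et where et: "mollifier (norm (t p n *R e p) + c p * t p n / 2) et" "!!x. et x ~= 0 ==> x : ball (t p n *R e p) (c p * t p n / 2)"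
   by (rule mollifier_exists[OF ct]) (rule that)
  have "norm (t p n *R e p) + c p * t p n / 2 <= t p n * 1 + 1 * t p n"
   using e[OF Pc[OF True]] c[OF Pc[OF True]] t(1)[OF True, of n] by (intro add_mono) (auto intro!: mult_left_mono mult_right_mono)
  hence "mollifier (2 * t p n) et" using et(1) by (fastforce simp: mollifier_def)
  moreover have "ALL x. et x ~= 0 --> x : cball (t p n *R e p) (c p * t p n / 2)" using et(2) ball_subset_cball by blast
  ultimately show ?thesis by blast
 qed simp
 hence "ALL p. ALL n. EX et. p : P --> mollifier (2 * t p n) et & (ALL x. et x ~= 0 --> x : cball (t p n *R e p) (c p * t p n / 2))" by blast
 then obtain et where et: "ALL p n. p : P --> mollifier (2 * t p n) (et p n) & (ALL x. et p n x ~= 0 --> x : cball (t p n *R e p) (c p * t p n / 2))"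
  unfolding choice_iff by blast
 have mol: "mollifier (2 * t p n) (et p n)" if "p : P" for p n using et that by blast
 have ett: "test UNIV (et p n)" if "p : P" for p n using mol[OF that, of n] by (simp add: mollifier_def)
 have t0: "(%n. 2 * t p n) ---> 0" for p
  unfolding t_def using tendsto_mult[OF tendsto_const[of 2] edge_width_tendsto[of "r p / 4"]] by (simp only: mult_zero_right)
 define J where "J n g x = (SUM p:P. conv (%y. ze p y * g y) (et p n) x)" for n g x
 have piece: "test S (conv (%y. ze p y * g y) (et p n))"
  if p: "p : P" and g: "L2 g" "!!x. x ~: S ==> g x = 0" for p n g
 proof -
  obtain K where K: "compact K" "K <= ball p (r p / 2)" "!!x. x ~: K ==> ze p x = 0" by (rule test_functionE[OF P(5)[OF p]]) (rule that)
  have i: "Lint (%y. ze p y * g y)" using L2_product[OF g(1) L2_test[OF ze[OF p]]] by (simp add: mult.commute)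
  show ?thesis
  proof (rule test_conv[OF i, where K="K Int closure S" and C="cball (t p n *R e p) (c p * t p n / 2)"])
   show "compact (K Int closure S)" using K(1) cS by (rule compact_Int)
   show "ze p x * g x = 0" if "x ~: K Int closure S" for x
   using that K(3)[of x] g(2)[of x] closure_subset[of S] by auto
   show "test UNIV (et p n)" by (rule ett[OF p])
   show "compact (cball (t p n *R e p) (c p * t p n / 2))" by simp
   show "et p n x = 0" if "x ~: cball (t p n *R e p) (c p * t p n / 2)" for x using et p that by blast
   show "x + y : S" if x: "x : K Int closure S" and y: "y : cball (t p n *R e p) (c p * t p n / 2)" for x y
   proof -
   have cp: "0 < c p" "c p <= 1" using c Pc[OF p] by auto
   have y': "norm (y - t p n *R e p) <= c p * t p n / 2" using y by (simp add: dist_norm norm_minus_commute)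
   hence n1: "norm (y - t p n *R e p) < c p * t p n" using cp t(1)[OF p, of n] by (smt (verit) field_sum_of_halves mult_pos_pos)
   have "norm y <= norm (y - t p n *R e p) + norm (t p n *R e p)" using norm_triangle_ineq[of "y - t p n *R e p" "t p n *R e p"] by simp
   also have "... < 1 * t p n + t p n * 1"
   proof (rule add_less_le_mono)
   show "norm (y - t p n *R e p) < 1 * t p n" using n1 mult_right_mono[OF cp(2) less_imp_le[OF t(1)[OF p, of n]]] by linarith
   show "norm (t p n *R e p) <= t p n * 1" using e[OF Pc[OF p]] t(1)[OF p, of n] by (auto intro!: mult_left_mono)
   qed
   also have "... <= r p / 2" using t(2)[OF p, of n] by simp
   finally have ny: "norm y < r p / 2" .
   have xb: "dist p x < r p / 2" using x K(2) by auto
   have "dist p (x + y) <= dist p x + norm y" using norm_triangle_ineq4[of "p - x" y] by (simp add: dist_norm algebra_simps)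
   hence "x + y : ball p (r p)" using ny xb by simp
   moreover have "x : ball p (r p)" using xb zero_le_dist[of p x] by (simp, linarith)
   ultimately show ?thesis using x by (intro cone[OF Pc[OF p] _ _ t(1)[OF p] n1]) auto
   qed
  qed
 qed
 have one: "(SUM p:P. ze p x * g x) = g x" if g: "!!x. x ~: S ==> g x = 0" for g :: "'n fn" and x
 proof (cases "x : S")
  case True
  hence "x : W" using P(4) closure_subset by blast
  thus ?thesis using P(6) by (simp add: sum_distrib_right[symmetric])
 qed (simp add: g)
 \<comment> \<open>The gradients of a partition of unity sum to zero on S, so the commutator terms
   cancel in the limit.\<close>
 have dz: "(SUM p:P. partial i (ze p) x) = 0" if "x : S" for i x
 proof -
  have "x : W" using that P(4) closure_subset by blast
  hence "partial i (%x. SUM p:P. ze p x) x = partial i (%x. 1) x" by (intro partial_cong[OF P(3)] P(6))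
  moreover have "((%x. SUM p:P. ze p x) has_derivative (%h. SUM p:P. SU i. (h $ i) *R partial i (ze p) x)) (at x)"
   by (intro has_derivative_sum has_derivative_partial smooth_differentiable test_smooth[OF ze])
  hence "partial i (%x. SUM p:P. ze p x) x = (SUM p:P. SU k. (axis i 1 $ k) *R partial k (ze p) x)" by (rule partial_eq)
  moreover have "(SU k. (axis i 1 $ k) *R partial k (ze p) x) = partial i (ze p) x" for p
  proof -
   have "(SU k. (axis i 1 $ k) *R partial k (ze p) x) = (SU k. if k = i then partial k (ze p) x else 0)" by (intro sum.cong) (auto simp: axis_def)
   thus ?thesis by simp
  qed
  ultimately show ?thesis by (simp add: partial_const)
 qed
 have 1: "test S (J n g)" "L2lim (%n. J n g) g" if g: "L2 g" "!!x. x ~: S ==> g x = 0" for g n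
 proof -
  show "test S (J n g)" unfolding J_def[abs_def] by (intro test_sum piece g)
  have "L2lim (%n x. SUM p:P. conv (%y. ze p y * g y) (et p n) x) (%x. SUM p:P. ze p x * g x)"
   by (intro L2lim_sum P(1) L2_test[OF piece] g L2_mult_test[OF _ ze] mollify_L2lim[OF _ mol t0])
  moreover have "(%x. SUM p:P. ze p x * g x) = g" using one[of g] g(2) by blast
  ultimately show "L2lim (%n. J n g) g" by (simp add: J_def[abs_def])
 qed
 have 2: "L2lim (%n x. SU i. partial i (J n (V i)) x) f"
  if w: "weak_div0 V f" and z: "!!x i. x ~: S ==> V i x = 0" "!!x. x ~: S ==> f x = 0" for V f
 proof -
  have L: "L2 (V i)" "L2 f" for i using w by (auto simp: weak_div0_def)
  define F where "F p y = ze p y * f y + (SU i. partial i (ze p) y * V i y)" for p y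
  have LF: "L2 (F p)" if "p : P" for p
   unfolding F_def by (intro L2_add L2_sum L2_mult_test[OF L(2) ze] L2_mult_test[OF L(1) test_partial[OF ze]] that)
  have zF: "F p x = 0" if "x ~: S" for p x using z that by (simp add: F_def)
  have eq: "(SU i. partial i (J n (V i)) x) = (SUM p:P. conv (F p) (et p n) x)" for n x
  proof -
   have "partial i (J n (V i)) x = (SUM p:P. partial i (conv (%y. ze p y * V i y) (et p n)) x)" for i
   proof -
   have "((%x. SUM p:P. conv (%y. ze p y * V i y) (et p n) x) has_derivative
   (%h. SUM p:P. frechet_derivative (conv (%y. ze p y * V i y) (et p n)) (at x) h)) (at x)"
   by (intro has_derivative_sum frechet_derivative_works[THEN iffD1] smooth_differentiable test_smooth[OF piece] L z)
   from partial_eq[OF this] show ?thesis unfolding J_def[abs_def] by (simp add: partial_def)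
   qed
   hence "(SU i. partial i (J n (V i)) x) = (SUM p:P. SU i. partial i (conv (%y. ze p y * V i y) (et p n)) x)" by (simp add: sum.swap[of _ P])
   also have "... = (SUM p:P. conv (F p) (et p n) x)"
   unfolding F_def by (intro sum.cong refl divergence_conv[OF w] ze ett)
   finally show ?thesis .
  qed
  have "L2lim (%n x. SUM p:P. conv (F p) (et p n) x) (%x. SUM p:P. F p x)"
  proof (intro L2lim_sum P(1) LF mollify_L2lim[OF _ mol t0])
   fix p n assume p: "p : P"
   obtain K where K: "compact K" "K <= ball p (r p / 2)" "!!x. x ~: K ==> ze p x = 0" by (rule test_functionE[OF P(5)[OF p]]) (rule that)
   have b: "bounded (closure S)" by (rule compact_imp_bounded[OF cS])
   have zc: "F p x = 0" if "x ~: closure S" for x using zF that closure_subset by blast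
   have i: "Lint (F p)" by (rule L2_integrable[OF LF[OF p] b zc])
   obtain C where C: "compact C" "C <= UNIV" "!!x. x ~: C ==> et p n x = 0" by (rule test_functionE[OF ett[OF p, of n]]) (rule that)
   show "L2 (conv (F p) (et p n))" by (rule L2_test[OF test_conv[OF i cS zc ett[OF p] C(1,3) UNIV_I]])
  qed
  moreover have "(%x. SUM p:P. F p x) = f"
  proof
   fix x
   show "(SUM p:P. F p x) = f x"
   proof (cases "x : S")
   case True
   have "(SUM p:P. F p x) = (SUM p:P. ze p x * f x) + (SU i. (SUM p:P. partial i (ze p) x) * V i x)"
   by (simp add: F_def sum.distrib sum_distrib_right sum.swap[of _ P])
   thus ?thesis using one[of f] z(2) dz[OF True] by simp
   qed (simp add: zF z)
  qed
  ultimately show ?thesis by (simp add: eq)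
 qed
 have "J n (%x. 0) = (%x. 0)" for n by (simp add: J_def[abs_def] conv_def)
 thus ?thesis using 1 2 by (intro exI[of _ J]) blast
qed

section \<open>Zero traces and zero normal traces, tested on the whole space\<close>

lemma L2_component:
 fixes V :: "real^'n => complex^'m"
 assumes "L2 V" shows "L2 (%x. V x $ i)"
proof (rule L2_dominated[OF assms, where B=1])
 have "(%v::complex^'m. v $ i) : borel_measurable borel" by (intro borel_measurable_continuous_onI continuous_on_component continuous_on_id)
 from measurable_compose[OF L2_measurable[OF assms] this] show "(%x. V x $ i) : LM" .
 show "norm (V x $ i) <= 1 * norm (V x)" for x using Finite_Cartesian_Product.norm_nth_le[of "V x" i] by simp
qed

lemma norm_sq_vec: "(norm (v :: complex^'m))^2 = (SU i. (norm (v $ i))^2)" by (simp add: norm_vec_def L2_set_def sum_nonneg)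

text \<open>The hypothesis makes the zero extension of u weakly differentiable across the boundary.
  Fields with the single component u in direction i turn the convergence of divergences into the
  convergence of each partial derivative.\<close>

lemma zero_traceI:
 fixes S :: "(real^'n) set" and u :: "'n fn"
 assumes S: "open S" "bounded S" "lipschitz_boundary S" and L: "L2_on S u" "L2_on S G"
  and w: "!!ph i. test UNIV ph ==> (LIO S (%x. u x * partial i ph x)) = - (LIO S (%x. G x $ i * ph x))"
 shows "zero_trace S u G"
proof -
 have Sm: "S : sets lebesgue" using S(1) by simp
 define u0 where "u0 x = (if x : S then u x else 0)" for x
 define G0 where "G0 x = (if x : S then G x else 0)" for x
 have L0: "L2 u0" "L2 (%x. G0 x $ i)" for i
  using L L2_on_iff[OF Sm] L2_component unfolding u0_def[abs_def] G0_def[abs_def] by blast+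
 obtain J :: "nat => (real^'n => complex) => real^'n => complex" where
  J: "!!g n. L2 g ==> (!!x. x ~: S ==> g x = 0) ==> test S (J n g)"
   "!!g. L2 g ==> (!!x. x ~: S ==> g x = 0) ==> L2lim (%n. J n g) g"
   "!!V f. weak_div0 V f ==> (ALL x. x ~: S --> (ALL i. V i x = 0) & f x = 0) ==>
   L2lim (%n x. SU i. partial i (J n (V i)) x) f" "!!n. J n (%x. 0) = (%x. 0)"
  using lipschitz_approximation[OF S] by blast
 have z: "x ~: S ==> u0 x = 0" "x ~: S ==> G0 x = 0" for x by (simp_all add: u0_def G0_def)
 have t0: "test S (J n u0)" for n by (rule J(1)[OF L0(1) z(1)])
 have J0: "J n (%x. 0) = (%x. 0)" for n by (rule J(4))
 have lim: "L2lim (%n. partial i (J n u0)) (%x. G0 x $ i)" for i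
 proof -
  define V where "V k = (if k = i then u0 else (%x. 0))" for k
  have "weak_div0 V (%x. G0 x $ i)"
   unfolding weak_div0_def
  proof (intro conjI allI impI)
   show "L2 (V k)" for k by (cases "k = i") (simp_all add: V_def L0 L2_zero)
   show "L2 (%x. G0 x $ i)" by (rule L0)
   fix ph :: "'n fn" assume ph: "test UNIV ph"
   have "(SU k. V k x * partial k ph x) = (SU k. if k = i then u0 x * partial k ph x else 0)" for x by (intro sum.cong) (auto simp: V_def)
   hence eq: "(SU k. V k x * partial k ph x) = u0 x * partial i ph x" for x by simp
   have "(LI x. u0 x * partial i ph x) = - (LI x. G0 x $ i * ph x)"
   using w[OF ph, of i] unfolding integral_on[OF Sm] u0_def G0_def by (simp add: if_distrib[of "%c. c * _"] if_distrib[of "%v. v $ i"] cong: if_cong)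
   thus "(LI x. (SU k. V k x * partial k ph x) + G0 x $ i * ph x) = 0"
   unfolding eq using L2_product[OF L0(1) L2_test[OF test_partial[OF ph]], of i] L2_product[OF L0(2) L2_test[OF ph], of i] by simp
  qed
  from J(3)[OF this] have "L2lim (%n x. SU k. partial k (J n (V k)) x) (%x. G0 x $ i)"
   using z by (simp add: V_def)
  moreover have "(SU k. partial k (J n (V k)) x) = partial i (J n u0) x" for n x
  proof -
   have "(SU k. partial k (J n (V k)) x) = (SU k. if k = i then partial k (J n u0) x else 0)" by (intro sum.cong) (auto simp: V_def J0 partial_const)
   thus ?thesis by simp
  qed
  ultimately show ?thesis by simp
 qed
 have out: "J n u0 x = 0" "partial i (J n u0) x = 0" if x: "x ~: S" for n i x
 proof -
  obtain K where K: "compact K" "K <= S" "!!x. x ~: K ==> J n u0 x = 0" "!!x i. x ~: K ==> partial i (J n u0) x = 0"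
   by (rule test_functionE[OF t0[of n]]) (rule that)
  show "J n u0 x = 0" "partial i (J n u0) x = 0" using K x by blast+
 qed
 have i1: "Lint (%x. (norm (J n u0 x - u0 x))^2)" for n by (rule L2_sq_integrable[OF L2_diff[OF L2_test[OF t0] L0(1)]])
 have i2: "Lint (%x. (norm (partial i (J n u0) x - G0 x $ i))^2)" for n i
  by (rule L2_sq_integrable[OF L2_diff[OF L2_test[OF test_partial[OF t0]] L0(2)]])
 have eq: "(LIO S (%x. (norm (J n u0 x - u x))^2 + (norm (grad (J n u0) x - G x))^2)) =
   (LI x. (norm (J n u0 x - u0 x))^2) + (SU i. \<integral>x. (norm (partial i (J n u0) x - G0 x $ i))^2 \<partial>lebesgue)" for n
 proof -
  have "(if x : S then (norm (J n u0 x - u x))\<^sup>2 + (norm (grad (J n u0) x - G x))^2 else 0) =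
   (norm (J n u0 x - u0 x))^2 + (SU i. (norm (partial i (J n u0) x - G0 x $ i))^2)" for x
   by (cases "x : S") (simp_all add: u0_def G0_def norm_sq_vec grad_def out)
  hence "(LIO S (%x. (norm (J n u0 x - u x))^2 + (norm (grad (J n u0) x - G x))^2)) =
   (LI x. (norm (J n u0 x - u0 x))^2 + (SU i. (norm (partial i (J n u0) x - G0 x $ i))^2))"
   unfolding integral_on[OF Sm] by simp
  thus ?thesis using i1 i2 by simp
 qed
 have "(%n. (LI x. (norm (J n u0 x - u0 x))^2) + (SU i. \<integral>x. (norm (partial i (J n u0) x - G0 x $ i))^2 \<partial>lebesgue)) ---> 0 + (SUM i:(UNIV::'n set). 0)"
  using lim J(2)[OF L0(1) z(1)] unfolding L2lim_def by (intro tendsto_add tendsto_sum) auto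
 hence "(%n. \<integral>x. (norm (J n u0 x - u x))^2 + (norm (grad (J n u0) x - G x))^2 \<partial>lebesgue_on S) ---> 0" by (simp add: eq)
 moreover have "H1G S u G" unfolding has_H1_gradient_def using L w test_UNIV by blast
 ultimately show ?thesis unfolding zero_trace_def using t0 by (intro conjI exI[of _ "%n. J n u0"]) simp_all
qed

text \<open>The hypothesis with smooth ph extends to all of H^1: the approximating fields have
  compact support in S, where Green's formula is the definition of the weak gradient of ps, and
  their divergences converge.\<close>

lemma normal_trace_zero:
 fixes S :: "(real^'n) set" and V :: "real^'n => complex^'n"
 assumes S: "open S" "bounded S" "lipschitz_boundary S" and L: "L2_on S V" "L2_on S f"
  and w: "!!ph. test UNIV ph ==> (LIO S (%x. cdot (V x) (grad ph x) + f x * ph x)) = 0"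
  and ps: "H1G S ps H"
 shows "NT S V f ps H = 0"
proof -
 have Sm: "S : sets lebesgue" using S(1) by simp
 define V0 where "V0 i x = (if x : S then V x else 0) $ i" for i x
 define f0 where "f0 x = (if x : S then f x else 0)" for x
 define ps0 where "ps0 x = (if x : S then ps x else 0)" for x
 define H0 where "H0 i x = (if x : S then H x else 0) $ i" for i x
 have "L2_on S ps" "L2_on S H" using ps by (auto simp: has_H1_gradient_def)
 hence L0: "L2 (V0 i)" "L2 f0" "L2 ps0" "L2 (H0 i)" for i
  using L L2_on_iff[OF Sm] L2_component unfolding V0_def[abs_def] f0_def[abs_def] ps0_def[abs_def] H0_def[abs_def] by blast+
 have z: "ALL x. x ~: S --> (ALL i. V0 i x = 0) & f0 x = 0" by (simp add: V0_def f0_def)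
 have wd: "weak_div0 V0 f0"
  unfolding weak_div0_def
 proof (intro conjI allI impI L0)
  fix ph :: "'n fn" assume ph: "test UNIV ph"
  have "(SU i. V0 i x * partial i ph x) + f0 x * ph x = (if x : S then cdot (V x) (grad ph x) + f x * ph x else 0)" for x
   by (simp add: V0_def f0_def cdot_def grad_def)
  thus "(LI x. (SU i. V0 i x * partial i ph x) + f0 x * ph x) = 0"
   using w[OF ph] unfolding integral_on[OF Sm] by simp
 qed
 obtain J :: "nat => (real^'n => complex) => real^'n => complex" where
  J: "!!g n. L2 g ==> (!!x. x ~: S ==> g x = 0) ==> test S (J n g)"
   "!!g. L2 g ==> (!!x. x ~: S ==> g x = 0) ==> L2lim (%n. J n g) g"
   "!!V f. weak_div0 V f ==> (ALL x. x ~: S --> (ALL i. V i x = 0) & f x = 0) ==>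
   L2lim (%n x. SU i. partial i (J n (V i)) x) f"
  using lipschitz_approximation[OF S] by blast
 have tJ: "test S (J n (V0 i))" for n i by (rule J(1)[OF L0(1)]) (use z in blast)
 have lJ: "L2lim (%n. J n (V0 i)) (V0 i)" for i by (rule J(2)[OF L0(1)]) (use z in blast)
 have lim1: "(%n. \<integral>x. (SU i. partial i (J n (V0 i)) x) * ps0 x \<partial>lebesgue) ---> (LI x. f0 x * ps0 x)"
  by (intro L2lim_product J(3)[OF wd z] L0 L2_sum L2_test[OF test_partial[OF tJ]])
 have lim2: "(%n. SU i. \<integral>x. J n (V0 i) x * H0 i x \<partial>lebesgue) ---> (SU i. \<integral>x. V0 i x * H0 i x \<partial>lebesgue)"
  by (intro tendsto_sum L2lim_product L0 lJ L2_test[OF tJ])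
 have "(LI x. (SU i. partial i (J n (V0 i)) x) * ps0 x) = - (SU i. \<integral>x. J n (V0 i) x * H0 i x \<partial>lebesgue)" for n
 proof -
  have i: "Lint (%x. partial i (J n (V0 i)) x * ps0 x)" for i by (rule L2_product[OF L2_test[OF test_partial[OF tJ]] L0(3)])
  have "(LI x. partial i (J n (V0 i)) x * ps0 x) = - (LI x. J n (V0 i) x * H0 i x)" for i
  proof -
   have "(LIO S (%x. ps x * partial i (J n (V0 i)) x)) = - (LIO S (%x. H x $ i * J n (V0 i) x))"
   using ps tJ unfolding has_H1_gradient_def by blast
   moreover have "(if x : S then ps x * partial i (J n (V0 i)) x else 0) = partial i (J n (V0 i)) x * ps0 x"
   "(if x : S then H x $ i * J n (V0 i) x else 0) = J n (V0 i) x * H0 i x" for x by (simp_all add: ps0_def H0_def)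
   ultimately show ?thesis unfolding integral_on[OF Sm] by simp
  qed
  thus ?thesis using i by (simp add: sum_distrib_right Bintegral_sum sum_negf)
 qed
 with lim1 have "(%n. - (SU i. \<integral>x. J n (V0 i) x * H0 i x \<partial>lebesgue)) ---> (LI x. f0 x * ps0 x)" by simp
 from LIMSEQ_unique[OF this tendsto_minus[OF lim2]]
 have fin: "(LI x. f0 x * ps0 x) = - (SU i. \<integral>x. V0 i x * H0 i x \<partial>lebesgue)" .
 have "NT S V f ps H = (LI x. (SU i. V0 i x * H0 i x) + f0 x * ps0 x)"
  unfolding normal_trace_def integral_on[OF Sm] by (intro Bintegral_cong refl) (simp add: cdot_def V0_def f0_def ps0_def H0_def)
 also have "... = (SU i. \<integral>x. V0 i x * H0 i x \<partial>lebesgue) + (LI x. f0 x * ps0 x)"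
  using L2_product[OF L0(1,4)] L2_product[OF L0(2,3)] by (simp add: Bintegral_sum)
 finally show ?thesis using fin by simp
qed

section \<open>Geometry of the paving\<close>

definition rigid :: "(real^'n => real^'n) => bool" where
 "rigid sg <-> (EX L c. orthogonal_transformation L & sg = (%x. L x + c))"

lemma rigid_id: "rigid id"
 unfolding rigid_def using bounded_linear.linear[OF bounded_linear_ident]
 by (intro exI[of _ "%x. x"] exI[of _ 0]) (auto simp: orthogonal_transformation_def)

lemma rigid_comp:
 assumes "rigid sg" "rigid ta" shows "rigid (sg o ta)"
proof -
 obtain L c L' c' where L: "orthogonal_transformation L" "sg = (%x. L x + c)"
  and L': "orthogonal_transformation L'" "ta = (%x. L' x + c')" using assms unfolding rigid_def by blast
 have "linear L" using L(1) by (rule orthogonal_transformation_linear)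
 hence "sg o ta = (%x. (L o L') x + (L c' + c))" by (auto simp: L L' linear_add)
 thus ?thesis unfolding rigid_def using orthogonal_transformation_compose[OF L(1) L'(1)] by blast
qed

lemma rigid_inverse:
 assumes "rigid sg" obtains ta where "rigid ta" "!!x. ta (sg x) = x" "!!x. sg (ta x) = x"
proof -
 obtain L c where L: "orthogonal_transformation L" "sg = (%x. L x + c)" using assms unfolding rigid_def by blast
 have i: "orthogonal_transformation (inv L)" by (rule orthogonal_transformation_inv[OF L(1)])
 have "linear L" using L(1) by (rule orthogonal_transformation_linear)
 have li: "linear (inv L)" using i by (rule orthogonal_transformation_linear)
 have b: "inv L (L x) = x" "L (inv L x) = x" for x
  using orthogonal_transformation_inj[OF L(1)] orthogonal_transformation_surj[OF L(1)] by (simp_all add: inv_f_f surj_f_inv_f)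
 have "rigid (%x. inv L x + - inv L c)" unfolding rigid_def using i by blast
 moreover have "inv L (sg x) + - inv L c = x" "sg (inv L x + - inv L c) = x" for x
  using \<open>linear L\<close> li by (simp_all add: L linear_add linear_diff b)
 ultimately show thesis by (rule that)
qed

lemma rigid_dist: "rigid sg ==> dist (sg x) (sg y) = dist x y"
 by (auto simp: rigid_def dist_norm orthogonal_transformation_norm linear_diff[OF orthogonal_transformation_linear, symmetric])

lemma rigid_continuous: "rigid sg ==> continuous_on U sg"
 unfolding continuous_on_iff by (metis rigid_dist)

lemma rigid_inj: "rigid sg ==> inj sg" by (metis injI rigid_dist dist_eq_0_iff)

lemma rigid_closure: assumes "rigid sg" shows "sg ` closure U = closure (sg ` U)"
proof -
 obtain ta where ta: "rigid ta" "!!x. ta (sg x) = x" "!!x. sg (ta x) = x" by (rule rigid_inverse[OF assms]) (rule that)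
 have a: "sg ` closure U <= closure (sg ` U)" by (rule image_closure_subset[OF rigid_continuous[OF assms] closed_closure closure_subset])
 have b: "ta ` closure (sg ` U) <= closure U"
  by (rule image_closure_subset[OF rigid_continuous[OF ta(1)] closed_closure]) (use ta(2) closure_subset in force)
 show ?thesis
 proof (rule antisym[OF a], rule subsetI)
  fix x assume "x : closure (sg ` U)"
  hence "ta x : closure U" using b by blast
  thus "x : sg ` closure U" using ta(3)[of x] by (metis imageI)
 qed
qed

lemma rigid_open: assumes "rigid sg" "open U" shows "open (sg ` U)"
proof -
 obtain ta where ta: "rigid ta" "!!x. ta (sg x) = x" "!!x. sg (ta x) = x" by (rule rigid_inverse[OF assms(1)]) (rule that)
 have "sg ` U = ta -` U" using ta(2,3) by (auto simp: image_iff) (metis)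
 thus ?thesis using open_vimage[OF assms(2) rigid_continuous[OF ta(1)]] by simp
qed

lemma rigid_ball: assumes "rigid sg" shows "sg x : ball (sg p) r <-> x : ball p r"
 using rigid_dist[OF assms] by simp

lemma rigid_measure:
 assumes "rigid sg" "U : lmeasurable" shows "sg ` U : lmeasurable" "measure lebesgue (sg ` U) = measure lebesgue U"
proof -
 obtain L c where L: "orthogonal_transformation L" "sg = (%x. L x + c)" using assms unfolding rigid_def by blast
 obtain ta where ta: "rigid ta" "!!x. ta (sg x) = x" "!!x. sg (ta x) = x" by (rule rigid_inverse[OF assms(1)]) (rule that)
 obtain L' c' where L': "orthogonal_transformation L'" "ta = (%x. L' x + c')" using ta(1) unfolding rigid_def by blast
 have im: "sg ` U = ta -` U" using ta(2,3) by (auto simp: image_iff) (metis)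
 have U: "U : sets lebesgue" by (rule fmeasurableD[OF assms(2)])
 have m: "sg ` U : sets lebesgue"
  using measurable_sets[OF lebesgue_isometry(2)[OF L'(1), of c'] U] by (simp add: im L'(2))
 have "emeasure lebesgue (sg ` U) = emeasure (distr lebesgue lebesgue sg) (sg ` U)" using lebesgue_isometry(1)[OF L(1), of c] by (simp add: L(2))
 also have "... = emeasure lebesgue (sg -` sg ` U)"
  using emeasure_distr[OF lebesgue_isometry(2)[OF L(1), of c], of "sg ` U"] m by (simp add: L(2) del: emeasure_completion)
 also have "sg -` sg ` U = U" by (rule inj_vimage_image_eq[OF rigid_inj[OF assms(1)]])
 finally have e: "emeasure lebesgue (sg ` U) = emeasure lebesgue U" .
 show "sg ` U : lmeasurable" using m assms(2) unfolding fmeasurable_def mem_Collect_eq e by blast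
 show "measure lebesgue (sg ` U) = measure lebesgue U" unfolding measure_def e ..
qed

lemma rigid_negligible:
 assumes "rigid sg" "negligible U" shows "negligible (sg ` U)"
proof -
 have "U : lmeasurable" "measure lebesgue U = 0" using assms(2) by (simp_all add: negligible_iff_measure)
 thus ?thesis using rigid_measure[OF assms(1)] by (simp add: negligible_iff_measure)
qed

lemma rigid_hyperplane_reflection:
 assumes "a ~= 0" shows "rigid (hrefl a b)"
proof -
 let ?L = "%x. x - (2 * (a *. x) / (a *. a)) *R a"
 have "linear ?L" by (auto intro!: linearI simp: inner_add_right algebra_simps add_divide_distrib)
 moreover have "?L v *. ?L w = v *. w" for v w
  using assms by (simp add: inner_diff_left inner_diff_right inner_commute field_simps)
 ultimately have "orthogonal_transformation ?L" by (simp add: orthogonal_transformation_def)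
 moreover have "hrefl a b = (%x. ?L x + (2 * b / (a *. a)) *R a)"
  unfolding hyperplane_reflection_def right_diff_distrib diff_divide_distrib scaleR_diff_left by (rule ext) (simp only: diff_diff_eq2 diff_add_eq)
 ultimately show ?thesis unfolding rigid_def by blast
qed

lemma hyperplane_reflection_scale:
 assumes "s ~= 0" shows "hrefl (s *R a) (s * b) = hrefl a b"
proof
 fix x
 have "2 * ((s *R a) *. x - s * b) / ((s *R a) *. (s *R a)) * s = 2 * (a *. x - b) / (a *. a)"
  using assms by (cases "a *. a = 0") (simp_all add: field_simps)
 thus "hrefl (s *R a) (s * b) x = hrefl a b x"
  unfolding hyperplane_reflection_def scaleR_scaleR by simp
qed

text \<open>Reflecting an image across an image hyperplane amounts to a reflection of S itself,
  composed on the right. Words of reflections can thus be built from the hyperplanes of S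
  alone.\<close>

lemma hyperplane_reflection_conjugate:
 assumes "orthogonal_transformation L" "sg = (%x. L x + c)"
 shows "hrefl (L a) (b + L a *. c) o sg = sg o hrefl a b"
proof
 fix x
 have l: "linear L" and i: "L v *. L w = v *. w" for v w using assms(1) by (auto simp: orthogonal_transformation_def)
 show "(hrefl (L a) (b + L a *. c) o sg) x = (sg o hrefl a b) x"
  by (simp add: hyperplane_reflection_def assms(2) linear_diff[OF l] linear_scale[OF l] inner_add_right i)
qed

lemma hyperplane_reflection_fixed: "a *. x = b ==> hrefl a b x = x" by (simp add: hyperplane_reflection_def)

lemma hyperplane_reflection_involution:
 assumes "a ~= 0" shows "hrefl a b (hrefl a b x) = x"
proof -
 define k where "k = 2 * (a *. x - b) / (a *. a)"
 have "k * (a *. a) = 2 * (a *. x - b)" using assms by (simp add: k_def)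
 hence "2 * (a *. (x - k *R a) - b) = (- k) * (a *. a)" by (simp add: inner_diff_right)
 hence "2 * (a *. (x - k *R a) - b) / (a *. a) = - k" using assms by simp
 thus ?thesis unfolding hyperplane_reflection_def k_def[symmetric] by simp
qed

text \<open>v is the part of a' tangential to the first hyperplane. Moving from x along v stays in
  both hyperplanes, so v is orthogonal to a' and to a, hence zero.\<close>

lemma hyperplane_locally_unique:
 fixes a a' :: "real^'n"
 assumes a: "a ~= 0" "a' ~= 0" and x: "a *. x = b" and r: "r > 0" and H: "!!y. y : ball x r ==> a *. y = b ==> a' *. y = b'"
 shows "EX s. s ~= 0 & a' = s *R a & b' = s * b"
proof -
 define s where "s = (a' *. a) / (a *. a)"
 define v where "v = a' - s *R a"
 have av: "a *. v = 0" using a by (simp add: v_def s_def inner_diff_right inner_commute)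
 define t where "t = r / 2 / (norm v + 1)"
 have nv: "norm v + 1 > 0" using norm_ge_zero[of v] by linarith
 have t: "t > 0" using r nv by (simp add: t_def)
 have "t * norm v < t * (norm v + 1)" using t by simp
 also have "... = r / 2" using nonzero_eq_divide_eq[THEN iffD1, OF _ t_def] nv by simp
 finally have "x + t *R v : ball x r" using r t by (simp add: dist_norm)
 hence "a' *. (x + t *R v) = b'" by (rule H) (simp add: inner_add_right x av)
 moreover have b': "a' *. x = b'" by (rule H) (use r x in auto)
 ultimately have "a' *. v = 0" using t by (simp add: inner_add_right)
 hence "v *. v = 0" using av by (simp add: v_def inner_diff_left)
 hence "a' = s *R a" by (simp add: v_def)
 thus ?thesis using a(2) b' x by (intro exI[of _ s]) auto
qed

lemma hyperplane_avoid:
 fixes a x :: "real^'n"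
 assumes "finite Q" "a ~= 0" "!!q. q : Q ==> fst q ~= 0 & ~ (EX s. s ~= 0 & fst q = s *R a & snd q = s * b)" "a *. x = b" "r > 0"
 shows "EX y:ball x r. a *. y = b & (ALL q:Q. fst q *. y ~= snd q)"
 using assms(1,3)
proof (induction Q rule: finite_induct)
 case empty
 thus ?case using assms(4,5) by (intro bexI[of _ x]) auto
next
 case (insert q Q)
 then obtain y where y: "y : ball x r" "a *. y = b" "ALL q:Q. fst q *. y ~= snd q" by blast
 have "open (ball x r - (UN q:Q. {y. fst q *. y = snd q}))"
  using insert.hyps by (intro open_Diff open_ball closed_UN ballI closed_hyperplane) auto
 moreover have "y : ball x r - (UN q:Q. {y. fst q *. y = snd q})" using y by blast
 ultimately obtain d where d: "d > 0" "ball y d <= ball x r - (UN q:Q. {y. fst q *. y = snd q})"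
  unfolding open_contains_ball by blast
 have q: "fst q ~= 0" "~ (EX s. s ~= 0 & fst q = s *R a & snd q = s * b)" using insert.prems[of q] by auto
 obtain z where z: "z : ball y d" "a *. z = b" "fst q *. z ~= snd q"
  using hyperplane_locally_unique[OF assms(2) q(1) y(2) d(1), of "snd q"] q(2) by blast
 thus ?case using d(2) by (intro bexI[of _ z]) auto
qed

section \<open>The frontier of a polytopal set\<close>

definition frontier_in :: "(real^'n) set => ((real^'n) \<times> real) set => bool" where
 "frontier_in S Q <-> finite Q & (ALL q:Q. norm (fst q) = 1) &
  (ALL q:Q. ALL q':Q. q ~= q' --> {x. fst q *. x = snd q} ~= {x. fst q' *. x = snd q'}) &
  frontier S <= (UN q:Q. {x. fst q *. x = snd q})"

text \<open>The closure is a finite union of polytopes, whose frontiers lie in the bounding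
  hyperplanes of their halfspaces; regular openness identifies the frontier of S with that of its
  closure.\<close>

lemma polytopal_frontier:
 fixes S :: "(real^'n) set"
 assumes S: "open S" "interior (closure S) = S" "polytopal S"
 obtains Q where "frontier_in S Q"
proof -
 obtain PPo where P: "finite PPo" "!!P. P : PPo ==> polytope P" "closure S = \<Union>PPo" using S(3) unfolding polytopal_def by blast
 have "EX HH. finite HH & (ALL h:HH. EX a b. a ~= 0 & h = {x. a *. x = b}) & frontier P <= \<Union>HH" if PP: "P : PPo" for P
 proof -
  obtain F where F: "finite F" "P = \<Inter>F" "ALL h:F. EX a b. a ~= 0 & h = {x. a *. x <= b}"
   using polytope_imp_polyhedron[OF P(2)[OF PP]] unfolding polyhedron_def by blast
  obtain a b where ab: "!!h. h : F ==> a h ~= 0 & h = {x. a h *. x <= b h}" using F(3) by metis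
  have "x : \<Union>((%h. {x. a h *. x = b h}) ` F)" if x: "x : frontier P" for x
  proof (rule ccontr)
   assume n: "~ ?thesis"
   have "closed P" using polytope_imp_closed P(2) \<open>P : PPo\<close> by blast
   hence "x : P" using x frontier_subset_closed by blast
   hence "x : h" if "h : F" for h using F(2) that by blast
   hence "a h *. x <= b h" if "h : F" for h using ab[OF that] that by blast
   moreover have "a h *. x ~= b h" if "h : F" for h using n that by blast
   ultimately have lt: "a h *. x < b h" if "h : F" for h using that by (metis order_le_imp_less_or_eq)
   have o: "open (\<Inter>h\<in>F. {x. a h *. x < b h})" using F(1) by (intro open_INT ballI open_halfspace_lt)
   have s: "(\<Inter>h\<in>F. {x. a h *. x < b h}) <= P"
   proof -
   have "{x. a h *. x < b h} <= h" if "h : F" for h using ab[OF that] less_imp_le by blast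
   thus ?thesis unfolding F(2) by blast
   qed
   have "x : interior P" by (rule interiorI[OF o _ s]) (use lt in blast)
   thus False using x by (simp add: frontier_def)
  qed
  thus ?thesis using F(1) ab by (intro exI[of _ "(%h. {x. a h *. x = b h}) ` F"]) auto
 qed
 then obtain HH where HH: "!!P. P : PPo ==> finite (HH P) & (ALL h:HH P. EX a b. a ~= 0 & h = {x. a *. x = b}) & frontier P <= \<Union>(HH P)" by metis
 define H where "H = (UN P:PPo. HH P)"
 have H: "finite H" using P(1) HH by (auto simp: H_def)
 have "EX q. norm (fst q) = 1 & h = {x. fst q *. x = snd q}" if h: "h : H" for h
 proof -
  obtain P where P: "P : PPo" "h : HH P" using h unfolding H_def by blast
  obtain a b where ab: "a ~= 0" "h = {x. a *. x = b}" using HH[OF P(1)] P(2) by (elim conjE) blast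
  thus ?thesis by (intro exI[of _ "(a /\<^sub>R norm a, b / norm a)"]) (auto simp: field_simps)
 qed
 \<comment> \<open>One unit normal is chosen for each hyperplane as a set, so a normal and its
   negative cannot both occur for it.\<close>
 then obtain q where q: "!!h. h : H ==> norm (fst (q h)) = 1 & h = {x. fst (q h) *. x = snd (q h)}" by metis
 have "frontier S = frontier (closure S)" using S by (simp add: frontier_def interior_open)
 also have "... <= (UN P:PPo. frontier P)" unfolding P(3) by (rule frontier_Union_subset[OF P(1)])
 also have "... <= \<Union>H"
 proof (rule UN_least)
  fix P assume P: "P : PPo"
  have "frontier P <= \<Union>(HH P)" using HH[OF P] by (elim conjE)
  moreover have "HH P <= H" unfolding H_def using P by (rule UN_upper)
  ultimately show "frontier P <= \<Union>H" by (rule order_trans[OF _ Union_mono])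
 qed
 also have "... <= (UN p:q ` H. {x. fst p *. x = snd p})" using q by blast
 finally have fr: "frontier S <= (UN p:q ` H. {x. fst p *. x = snd p})" .
 have "{x. fst p *. x = snd p} ~= {x. fst p' *. x = snd p'}" if pp: "p : q ` H" "p' : q ` H" "p ~= p'" for p p'
 proof -
  obtain h h' where h: "h : H" "h' : H" "p = q h" "p' = q h'" using pp by blast
  hence "{x. fst p *. x = snd p} = h" "{x. fst p' *. x = snd p'} = h'" using q by auto
  thus ?thesis using h pp(3) by auto
 qed
 hence "frontier_in S (q ` H)" unfolding frontier_in_def using H q fr by blast
 thus thesis by (rule that)
qed

locale regular_open =
 fixes S :: "(real^'n) set"
 assumes S: "open S" "interior (closure S) = S"
begin

lemma frontier_S: "frontier S = closure S - S"
 using S(1) by (simp add: frontier_def interior_open)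

text \<open>Each half of the ball is connected and misses the frontier, so it lies inside or outside
  S. Both inside would make x interior to the closure; both outside would separate x from S.\<close>

lemma flat_side:
 assumes x: "x : frontier S" "a *. x = b" and a: "a ~= 0" and r: "r > 0" "frontier S Int ball x r <= {y. a *. y = b}"
 shows "EX s:{1, -1 :: real}. ALL y:ball x r. y : S <-> s * (a *. y - b) > 0"
proof -
 define A where "A s = ball x r Int {y. s * (a *. y - b) > 0}" for s
 have cA: "A s <= S | A s Int S = {}" for s
 proof (rule ccontr)
  assume n: "~ ?thesis"
  have e: "{y. s * (a *. y - b) > 0} = {y. (s *R a) *. y > s * b}" by (simp add: right_diff_distrib)
  have "connected (A s)" unfolding A_def e by (intro convex_connected convex_Int convex_ball convex_halfspace_gt)
  hence "A s Int frontier S ~= {}" by (rule connected_Int_frontier) (use n in auto)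
  thus False using r(2) by (auto simp: A_def)
 qed
 have move: "EX t>0. y + (s * t) *R a : U" if U: "open U" "y : U" "\<bar>s\<bar> = 1" for U y and s :: real
 proof -
  obtain d where d: "d > 0" "ball y d <= U" using U(1,2) open_contains_ball by blast
  define t where "t = d / 2 / norm a"
  have "norm ((s * t) *R a) = d / 2" using a d U(3) by (simp add: t_def abs_mult)
  hence "y + (s * t) *R a : ball y d" using d by (simp add: dist_norm)
  moreover have "t > 0" using a d by (simp add: t_def)
  ultimately show ?thesis using d(2) by blast
 qed
 have aa: "a *. a > 0" using a by simp
 have on: "a *. y = b ==> s * (a *. (y + (s' * t) *R a) - b) = s * s' * (t * (a *. a))" for y s s' t by (simp add: inner_add_right)
 have on': "a *. y = b ==> \<bar>s\<bar> = 1 ==> t > 0 ==> s * (a *. (y + (s * t) *R a) - b) > 0" for y s t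
 proof -
  assume as: "a *. y = b" "\<bar>s\<bar> = 1" "t > 0"
  hence "s * s = 1" by (metis abs_mult_self_eq mult_1)
  thus "s * (a *. (y + (s * t) *R a) - b) > 0" unfolding on[OF as(1)] using aa as(3) by simp
 qed
 have lim: "y : closure S" if y: "y : ball x r" "a *. y = b" and s: "\<bar>s\<bar> = 1" "A s <= S" for y s
 proof (rule ccontr)
  assume "y ~: closure S"
  hence "open (ball x r - closure S)" "y : ball x r - closure S" using y by auto
  then obtain t where t: "t > 0" "y + (s * t) *R a : ball x r - closure S" using move s(1) by blast
  hence "y + (s * t) *R a : A s" using on'[OF y(2) s(1) t(1)] by (simp add: A_def)
  thus False using t(2) s(2) closure_subset by blast
 qed
 have notS: "y ~: S" if y: "y : ball x r" "a *. y = b" and s: "\<bar>s\<bar> = 1" "A s Int S = {}" for y s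
 proof
  assume "y : S"
  hence "open (ball x r Int S)" "y : ball x r Int S" using y S(1) by auto
  then obtain t where t: "t > 0" "y + (s * t) *R a : ball x r Int S" using move s(1) by blast
  hence "y + (s * t) *R a : A s" using on'[OF y(2) s(1) t(1)] by (simp add: A_def)
  thus False using t(2) s(2) by blast
 qed
 have tri: "a *. y = b | y : A 1 | y : A (-1)" if "y : ball x r" for y using that by (auto simp: A_def)
 have "~ (A 1 <= S & A (-1) <= S)"
 proof
  assume as: "A 1 <= S & A (-1) <= S"
  have "ball x r <= closure S"
  proof
   fix y assume y: "y : ball x r"
   show "y : closure S" using tri[OF y] lim[OF y, of 1] as closure_subset[of S] by auto
  qed
  hence "x : interior (closure S)" using r(1) by (meson centre_in_ball interiorI open_ball)
  thus False using x(1) S(2) frontier_S by simp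
 qed
 moreover have "~ (A 1 Int S = {} & A (-1) Int S = {})"
 proof
  assume as: "A 1 Int S = {} & A (-1) Int S = {}"
  have "x : closure S" using x(1) frontier_S by simp
  then obtain y where y: "y : S" "dist y x < r" using r(1) closure_approachable by blast
  hence yb: "y : ball x r" by (simp add: dist_commute)
  show False using tri[OF yb] notS[OF yb, of 1] as y(1) by auto
 qed
 ultimately have "(A 1 <= S & A (- 1) Int S = {}) | (A (-1) <= S & A (- (-1)) Int S = {})"
  using cA[of 1] cA[of "-1"] by auto
 then obtain s :: real where s: "s : {1, -1}" "A s <= S" "A (- s) Int S = {}" by blast
 have "y : S <-> s * (a *. y - b) > 0" if y: "y : ball x r" for y
 proof -
  have 1: "a *. y = b ==> y ~: S" using notS[OF y, of "- s"] s by auto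
  have 2: "s * (a *. y - b) > 0 ==> y : S" using y s(2) by (auto simp: A_def)
  have 3: "s * (a *. y - b) < 0 ==> y ~: S" using y s(3) by (auto simp: A_def)
  have "a *. y ~= b ==> s * (a *. y - b) ~= 0" using s(1) by auto
  thus ?thesis using 1 2 3 linorder_neq_iff[of "s * (a *. y - b)" 0] by fastforce
 qed
 thus ?thesis using s(1) by blast
qed

text \<open>Near x only one hyperplane is present, and S lies on exactly one side of it; so every
  nearby point of this hyperplane is a limit of S outside S.\<close>

lemma flat_boundaryI:
 assumes Q: "frontier_in S Q" and x: "x : frontier S" "q : Q" "fst q *. x = snd q" "!!q'. q' : Q ==> fst q' *. x = snd q' ==> q' = q"
 shows "x : flat_boundary S (fst q) (snd q)"
proof -
 let ?a = "fst q" and ?b = "snd q"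
 have fin: "finite Q" and fr: "frontier S <= (UN q:Q. {x. fst q *. x = snd q})" using Q by (auto simp: frontier_in_def)
 have a: "?a ~= 0" using Q x(2) by (force simp: frontier_in_def)
 have "open (- (UN q':Q - {q}. {y. fst q' *. y = snd q'}))"
  using fin by (intro open_Compl closed_UN ballI closed_hyperplane) auto
 moreover have "x : - (UN q':Q - {q}. {y. fst q' *. y = snd q'})" using x(4) by blast
 ultimately obtain r where r: "r > 0" "ball x r <= - (UN q':Q - {q}. {y. fst q' *. y = snd q'})"
  unfolding open_contains_ball by blast
 have sub: "frontier S Int ball x r <= {y. ?a *. y = ?b}" using fr r(2) by blast
 obtain s :: real where s: "s : {1, -1}" "!!y. y : ball x r ==> y : S <-> s * (?a *. y - ?b) > 0"
  using flat_side[OF x(1,3) a r(1) sub] by blast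
 have "y : frontier S" if y: "?a *. y = ?b" "y : ball x r" for y
 proof -
  have "y ~: S" using s(2)[OF y(2)] y(1) by simp
  moreover have "y : closure S"
  proof (rule ccontr)
   assume "y ~: closure S"
   hence "open (ball x r - closure S)" "y : ball x r - closure S" using y by auto
   then obtain d where d: "d > 0" "ball y d <= ball x r - closure S" unfolding open_contains_ball by blast
   have na: "norm ?a = 1" "?a *. ?a = 1" using Q x(2) by (auto simp: frontier_in_def dot_square_norm)
   define z where "z = y + (s * d / 2) *R ?a"
   have "z : ball y d" using d s(1) na by (auto simp: z_def dist_norm)
   moreover have "s * (?a *. z - ?b) > 0" using s(1) d na y(1) by (auto simp: z_def inner_add_right)
   ultimately show False using s(2)[of z] d(2) closure_subset by blast
  qed
  ultimately show ?thesis using frontier_S by simp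
 qed
 hence "frontier S Int ball x r = {y. ?a *. y = ?b} Int ball x r" using sub by blast
 thus ?thesis unfolding flat_boundary_def using x(3) r(1) by blast
qed

lemma flat_boundary_sub: "a ~= 0 ==> flat_boundary S a b <= frontier S Int {x. a *. x = b}"
 unfolding flat_boundary_def using centre_in_ball by blast

lemma flat_boundary_ball:
 assumes "frontier S Int ball x r = {y. a *. y = b} Int ball x r"
 shows "{y. a *. y = b} Int ball x r <= flat_boundary S a b"
proof
 fix y assume y: "y : {y. a *. y = b} Int ball x r"
 then obtain d where d: "d > 0" "ball y d <= ball x r" by (meson IntD2 open_ball open_contains_ball)
 hence "frontier S Int ball y d = {y. a *. y = b} Int ball y d" using assms by blast
 thus "y : flat_boundary S a b" unfolding flat_boundary_def using y d(1) by blast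
qed

lemma facetE:
 assumes "F : facets S"
 obtains C a b x r where "a ~= 0" "F = closure C" "C : components (flat_boundary S a b)" "x : C" "r > 0"
  "{y. a *. y = b} Int ball x r <= C" "F <= {y. a *. y = b}" "F <= frontier S" "a *. x = b"
  "frontier S Int ball x r = {y. a *. y = b} Int ball x r"
proof -
 obtain C a b where C: "F = closure C" "a ~= 0" "C : components (flat_boundary S a b)" using assms unfolding facets_def by blast
 have Cs: "C <= flat_boundary S a b" by (rule in_components_subset[OF C(3)])
 obtain x where x: "x : C" using in_components_nonempty[OF C(3)] by blast
 then obtain r where r: "r > 0" "frontier S Int ball x r = {y. a *. y = b} Int ball x r" "a *. x = b" using Cs unfolding flat_boundary_def by blast
 have cb: "{y. a *. y = b} Int ball x r <= C"
 proof (rule components_maximal[OF C(3)])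
  show "connected ({y. a *. y = b} Int ball x r)" by (intro convex_connected convex_Int convex_hyperplane convex_ball)
  show "{y. a *. y = b} Int ball x r <= flat_boundary S a b" by (rule flat_boundary_ball[OF r(2)])
  show "C Int ({y. a *. y = b} Int ball x r) ~= {}" using x r by auto
 qed
 have "F <= frontier S Int {y. a *. y = b}" unfolding C(1)
  by (rule closure_minimal[OF order_trans[OF Cs flat_boundary_sub[OF C(2)]] closed_Int[OF frontier_closed closed_hyperplane]])
 thus thesis using C x r cb by (intro that[of a C b x r]) auto
qed

lemma facet_of_flat:
 assumes "a ~= 0" "x : flat_boundary S a b"
 obtains C where "C : components (flat_boundary S a b)" "x : C" "closure C : facets S"
proof -
 obtain C where C: "C : components (flat_boundary S a b)" "x : C"
  using assms(2) Union_components[of "flat_boundary S a b"] by blast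
 moreover have "closure C : facets S" unfolding facets_def using assms(1) C(1) by blast
 ultimately show thesis by (rule that)
qed

text \<open>Facet normals span the space: the line in direction v through a generic point of S
  leaves the bounded set S at a flat frontier point, through a hyperplane not parallel to v.\<close>

lemma facets_span:
 assumes Q: "frontier_in S Q" and ne: "S ~= {}" "bounded S" and v: "v ~= 0"
 obtains q x where "q : Q" "x : flat_boundary S (fst q) (snd q)" "fst q *. v ~= 0"
proof -
 have fin: "finite Q" and fr: "frontier S <= (UN q:Q. {x. fst q *. x = snd q})"
  and na: "!!q. q : Q ==> norm (fst q) = 1"
  and dis: "!!q q'. q : Q ==> q' : Q ==> q ~= q' ==> {x. fst q *. x = snd q} ~= {x. fst q' *. x = snd q'}"
  using Q by (auto simp: frontier_in_def)
 \<comment> \<open>c . x = d results from eliminating t between the two hyperplane equations at x +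
   t v: it holds if the line meets both hyperplanes in one point. N collects the points that are not
   generic in this sense, and the hyperplanes themselves.\<close>
 define c where "c q q' = (fst q' *. v) *R fst q - (fst q *. v) *R fst q'" for q q' :: "(real^'n) \<times> real"
 define d where "d q q' = (fst q' *. v) * snd q - (fst q *. v) * snd q'" for q q' :: "(real^'n) \<times> real"
 define N where "N = (UN q:Q. {x. fst q *. x = snd q}) Un (UN q:Q. UN q':Q. if c q q' = 0 then {} else {x. c q q' *. x = d q q'})"
 have "negligible N" unfolding N_def
  using fin na by (intro negligible_Un negligible_Union) (auto intro!: negligible_Union negligible_hyperplane split: if_splits, force)
 hence "~ S <= N" using open_not_negligible[OF S(1) ne(1)] negligible_subset by blast
 then obtain x where x: "x : S" "x ~: N" by blast
 obtain R where R: "!!y. y : S ==> norm y <= R" using ne(2) unfolding bounded_iff by blast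
 define T where "T = (R + norm x + 1) / norm v"
 have R0: "R >= 0" using R[OF x(1)] norm_ge_zero[of x] by linarith
 have "norm (T *R v) = R + norm x + 1" using v R0 by (simp add: T_def)
 hence "norm (x + T *R v) > R" using norm_triangle_ineq4[of "x + T *R v" x] by simp
 hence "x + T *R v ~: S" using R by fastforce
 hence "closed_segment x (x + T *R v) Int frontier S ~= {}" using x(1) by (intro connected_Int_frontier) auto
 then obtain z where z: "z : closed_segment x (x + T *R v)" "z : frontier S" by blast
 then obtain t where t: "z = x + t *R v" by (auto simp: in_segment algebra_simps)
 have nz: "fst q *. v ~= 0" if "q : Q" "fst q *. z = snd q" for q
 proof
  assume "fst q *. v = 0"
  hence "fst q *. x = snd q" using that by (simp add: t inner_add_right)
  thus False using x(2) that(1) by (auto simp: N_def)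
 qed
 obtain q where q: "q : Q" "fst q *. z = snd q" using z(2) fr by blast
 have "q' = q" if q': "q' : Q" "fst q' *. z = snd q'" for q'
 proof (rule ccontr)
  assume ne: "q' ~= q"
  have n: "fst q *. v ~= 0" "fst q' *. v ~= 0" using nz q q' by auto
  have "c q q' *. x = d q q'" by (simp add: c_def d_def q(2)[symmetric] q'(2)[symmetric] t inner_add_right inner_diff_left algebra_simps)
  hence c0: "c q q' = 0" using x(2) q(1) q'(1) by (auto simp: N_def split: if_splits)
  have "c q q' *. y = 0" for y by (simp add: c0)
  hence p: "(fst q' *. v) * (fst q *. y) = (fst q *. v) * (fst q' *. y)" for y by (simp add: c_def inner_diff_left)
  have "fst q *. y = snd q <-> fst q' *. y = snd q'" for y
  proof -
   have "(fst q' *. v) * (fst q *. y - snd q) = (fst q *. v) * (fst q' *. y - snd q')"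
   using p[of y] p[of z] q(2) q'(2) by (simp add: right_diff_distrib)
   thus ?thesis using n by (metis eq_iff_diff_eq_0 mult_eq_0_iff)
  qed
  thus False using dis[OF q(1) q'(1)] ne by auto
 qed
 hence "z : flat_boundary S (fst q) (snd q)" by (rule flat_boundaryI[OF Q z(2) q])
 thus thesis using nz[OF q] q(1) by (intro that[of q z])
qed

end

section \<open>Flat boundaries under rigid motions, and the side of a facet\<close>

lemma image_eq_if_mem_iff:
 assumes "!!z. f z : B <-> z : A" "!!y. f (g y) = y" shows "f ` A = B"
proof (intro antisym subsetI)
 fix y assume "y : B"
 hence "g y : A" using assms(1)[of "g y"] assms(2)[of y] by simp
 thus "y : f ` A" using assms(2)[of y] by (intro image_eqI[of y f "g y"]) simp_all
qed (use assms(1) in blast)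

lemma flat_boundary_image_iff:
 assumes rh: "rigid rh" "rh ` frontier S = frontier S" and H: "!!z. a' *. rh z = b' <-> a *. z = b"
 shows "rh x : flat_boundary S a' b' <-> x : flat_boundary S a b"
proof -
 obtain rh' where rh': "rigid rh'" "!!x. rh' (rh x) = x" "!!x. rh (rh' x) = x" by (rule rigid_inverse[OF rh(1)]) (rule that)
 have b: "rh ` ball x r = ball (rh x) r" for r by (rule image_eq_if_mem_iff[where f=rh and g=rh', OF rigid_ball[OF rh(1)] rh'(3)])
 have h: "rh ` {z. a *. z = b} = {z. a' *. z = b'}" by (rule image_eq_if_mem_iff[where f=rh and g=rh', OF _ rh'(3)]) (use H in simp)
 have "frontier S Int ball (rh x) r = {y. a' *. y = b'} Int ball (rh x) r <-> frontier S Int ball x r = {y. a *. y = b} Int ball x r" for r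
 proof -
  have "frontier S Int ball (rh x) r = rh ` (frontier S Int ball x r)" "{y. a' *. y = b'} Int ball (rh x) r = rh ` ({y. a *. y = b} Int ball x r)"
   by (simp_all add: image_Int[OF rigid_inj[OF rh(1)]] rh(2) b h)
  thus ?thesis using inj_image_eq_iff[OF rigid_inj[OF rh(1)]] by metis
 qed
 thus ?thesis unfolding flat_boundary_def using H by blast
qed

lemma components_rigid_image:
 assumes rh: "rigid rh" and C: "C : components U" shows "rh ` C : components (rh ` U)"
proof -
 obtain rh' where rh': "rigid rh'" "!!x. rh' (rh x) = x" "!!x. rh (rh' x) = x" by (rule rigid_inverse[OF rh(1)]) (rule that)
 have C': "C ~= {}" "C <= U" "connected C" "!!D. D ~= {} ==> C <= D ==> D <= U ==> connected D ==> D = C"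
  using C unfolding in_components_maximal by blast+
 have inv: "rh' ` rh ` A = A" "rh ` rh' ` A = A" for A using rh'(2,3) by (simp_all add: image_image)
 show ?thesis unfolding in_components_maximal
 proof (intro conjI allI impI)
  show "rh ` C ~= {}" "rh ` C <= rh ` U" using C'(1,2) by auto
  show "connected (rh ` C)" by (rule connected_continuous_image[OF rigid_continuous[OF rh] C'(3)])
  fix D assume D: "D ~= {} & rh ` C <= D & D <= rh ` U & connected D"
  have "rh' ` D = C"
  proof (rule C'(4))
   show "rh' ` D ~= {}" using D by simp
   show "C <= rh' ` D" using D image_mono[of "rh ` C" D rh'] inv by simp
   show "rh' ` D <= U" using D image_mono[of D "rh ` U" rh'] inv by simp
   show "connected (rh' ` D)" using D by (intro connected_continuous_image[OF rigid_continuous[OF rh'(1)]]) blast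
  qed
  thus "D = rh ` C" using inv(2)[of D] by simp
 qed
qed

context regular_open
begin

lemma flat_component_ball:
 assumes "C : components (flat_boundary S a b)" "x : C"
 obtains r where "r > 0" "a *. x = b" "frontier S Int ball x r = {y. a *. y = b} Int ball x r" "{y. a *. y = b} Int ball x r <= C"
proof -
 have "x : flat_boundary S a b" using assms in_components_subset by blast
 then obtain r where r: "r > 0" "a *. x = b" "frontier S Int ball x r = {y. a *. y = b} Int ball x r" unfolding flat_boundary_def by blast
 have "{y. a *. y = b} Int ball x r <= C"
 proof (rule components_maximal[OF assms(1)])
  show "connected ({y. a *. y = b} Int ball x r)" by (intro convex_connected convex_Int convex_hyperplane convex_ball)
  show "{y. a *. y = b} Int ball x r <= flat_boundary S a b" by (rule flat_boundary_ball[OF r(3)])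
  show "C Int ({y. a *. y = b} Int ball x r) ~= {}" using assms(2) r by auto
 qed
 with r show thesis by (rule that)
qed

definition side :: "real^'n => real => real => (real^'n) set" where
 "side a b s = {x. EX r>0. ALL y:ball x r. y : S <-> s * (a *. y - b) > 0}"

lemma open_side: "open (side a b s)"
 unfolding open_contains_ball
proof
 fix x assume "x : side a b s"
 then obtain r where r: "r > 0" "ALL y:ball x r. y : S <-> s * (a *. y - b) > 0" unfolding side_def by blast
 have "ball x (r/2) <= side a b s"
 proof
  fix z assume z: "z : ball x (r/2)"
  have "ball z (r/2) <= ball x r"
  proof
   fix y assume "y : ball z (r/2)"
   thus "y : ball x r" using z dist_triangle[of x y z] by simp
  qed
  thus "z : side a b s" unfolding side_def using r by (intro CollectI exI[of _ "r/2"]) auto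
 qed
 thus "EX e>0. ball x e <= side a b s" using r(1) by (intro exI[of _ "r/2"]) auto
qed

text \<open>The points with S on a given side form an open set; the two open sets cover the
  connected C and do not meet on it, so one of them contains C.\<close>

lemma flat_component_side:
 assumes a: "a ~= 0" and C: "C : components (flat_boundary S a b)"
 obtains s :: real where "s : {1, -1}" "C <= side a b s"
proof -
 have on: "a *. x = b" if "x : C" for x using flat_component_ball[OF C that] by blast
 have sub: "C <= side a b 1 Un side a b (-1)"
 proof
  fix x assume x: "x : C"
  obtain r where r: "r > 0" "a *. x = b" "frontier S Int ball x r = {y. a *. y = b} Int ball x r" by (rule flat_component_ball[OF C x]) (rule that)
  have "x : frontier S" using flat_boundary_sub[OF a, of b] x in_components_subset[OF C] by blast
  then obtain s :: real where "s : {1, -1}" "ALL y:ball x r. y : S <-> s * (a *. y - b) > 0"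
   using flat_side[OF _ r(2) a r(1)] r(3) by blast
  thus "x : side a b 1 Un side a b (-1)" unfolding side_def using r(1) by blast
 qed
 have dis: "side a b 1 Int side a b (-1) Int C = {}"
 proof (rule ccontr)
  assume "~ ?thesis"
  then obtain x where x: "x : side a b 1" "x : side a b (-1)" "x : C" by blast
  obtain r where r: "r > 0" "ALL y:ball x r. y : S <-> 1 * (a *. y - b) > 0" using x(1) unfolding side_def by blast
  obtain r' where r': "r' > 0" "ALL y:ball x r'. y : S <-> - 1 * (a *. y - b) > 0" using x(2) unfolding side_def by blast
  define t where "t = min r r' / 2 / norm a"
  have t: "t > 0" "t * norm a < r" "t * norm a < r'" using r(1) r'(1) a by (auto simp: t_def)
  hence "x + t *R a : ball x r" "x + t *R a : ball x r'" by (simp_all add: dist_norm)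
  moreover have "a *. (x + t *R a) - b > 0" using on[OF x(3)] t(1) a by (simp add: inner_add_right)
  ultimately show False using r(2) r'(2) by (smt (verit))
 qed
 have "side a b 1 Int C = {} | side a b (-1) Int C = {}"
  using connectedD[OF in_components_connected[OF C] open_side open_side dis sub] .
 thus thesis using sub that[of 1] that[of "-1"] by blast
qed

end

section \<open>The tiles of the paving\<close>

locale paving = regular_open S for S :: "(real^'n) set" +
 fixes T :: "(real^'n) set" and Q :: "((real^'n) \<times> real) set"
 assumes bounded_S: "bounded S" and S_ne: "S ~= {}" and T: "open T" "closure S <= T" and Q: "frontier_in S Q"
  and overlap: "!!sg ta. sg : successive_reflections S T ==> ta : successive_reflections S T ==> sg ` closure S ~= ta ` closure S ==>
   sg ` closure S Int ta ` closure S <= \<Union>(skeleton S T)"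
  and colour: "!!E. E : skeleton S T ==> \<exists>!F. F : facets S & (EX sg:successive_reflections S T. E = sg ` F)"
begin

abbreviation SR where "SR \<equiv> successive_reflections S T"

lemma sr_rigid: "sg : SR ==> rigid sg"
 by (induction rule: successive_reflections.induct) (intro rigid_id rigid_comp rigid_hyperplane_reflection; assumption)+

text \<open>Pulled back by sg, the hyperplane contains a disc of the facet F. Finitely many other
  hyperplanes cannot cover that disc, so it is one of those in Q.\<close>

lemma reflection_of_image:
 assumes sg: "rigid sg" and F: "F : facets S" "sg ` F <= {y. a' *. y = b'}" "a' ~= 0"
 shows "EX q:Q. hrefl a' b' o sg = sg o hrefl (fst q) (snd q)"
proof -
 obtain C a b x r where C: "a ~= 0" "F = closure C" "r > 0" "{y. a *. y = b} Int ball x r <= C" "a *. x = b"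
   "frontier S Int ball x r = {y. a *. y = b} Int ball x r" by (rule facetE[OF F(1)]) (rule that)
 obtain L c where L: "orthogonal_transformation L" "sg = (%x. L x + c)" using sg unfolding rigid_def by blast
 have Li: "L v *. L w = v *. w" for v w using L(1) by (simp add: orthogonal_transformation_def)
 obtain ta where ta: "!!x. sg (ta x) = x" by (rule rigid_inverse[OF sg]) (rule that)
 have La: "L a ~= 0" using Li[of a a] C(1) by auto
 have on: "L a *. sg z = b + L a *. c <-> a *. z = b" for z by (simp add: L(2) inner_add_right Li)
 have loc: "a' *. y = b'" if y: "y : ball (sg x) r" "L a *. y = b + L a *. c" for y
 proof -
  have "ta y : ball x r" using y(1) rigid_ball[OF sg, of "ta y" x r] ta by simp
  moreover have "a *. ta y = b" using on[of "ta y"] y(2) ta by simp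
  ultimately have "ta y : F" using C(2,4) closure_subset by blast
  thus ?thesis using F(2) ta[of y] by (metis (mono_tags, lifting) imageI mem_Collect_eq subsetD)
 qed
 obtain s where s: "s ~= 0" "a' = s *R L a" "b' = s * (b + L a *. c)"
  using hyperplane_locally_unique[OF La F(3) on[THEN iffD2, OF C(5)] C(3) loc] by blast
 have eq: "hrefl a' b' o sg = sg o hrefl a b"
  unfolding s(2,3) hyperplane_reflection_scale[OF s(1)] by (rule hyperplane_reflection_conjugate[OF L])
 have Qf: "finite Q" "!!q. q : Q ==> fst q ~= 0" "frontier S <= (UN q:Q. {x. fst q *. x = snd q})" using Q by (force simp: frontier_in_def)+
 have "EX q:Q. EX s. s ~= 0 & fst q = s *R a & snd q = s * b"
 proof (rule ccontr)
  assume "~ ?thesis"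
  then obtain y where y: "y : ball x r" "a *. y = b" "ALL q:Q. fst q *. y ~= snd q"
   using hyperplane_avoid[OF Qf(1) C(1) _ C(5,3)] Qf(2) by blast
  hence "y : frontier S" using C(6) by blast
  thus False using Qf(3) y(3) by blast
 qed
 then obtain q t where "q : Q" "t ~= 0" "fst q = t *R a" "snd q = t * b" by blast
 thus ?thesis using eq hyperplane_reflection_scale[of t a b] by (intro bexI[of _ q]) auto
qed

text \<open>The mirror tile is reached by reflecting S in its own facet before applying sg. In this
  form both isometries agree at the points of the facet, which pairs the terms of a fold.\<close>

lemma sr_reflect:
 assumes "sg : SR" "F : facets S" "sg ` F Int T ~= {}" "a ~= 0" "F <= {x. a *. x = b}"
 shows "sg o hrefl a b : SR"
proof -
 obtain L c where L: "orthogonal_transformation L" "sg = (%x. L x + c)" using sr_rigid[OF assms(1)] unfolding rigid_def by blast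
 have Li: "L v *. L w = v *. w" for v w using L(1) by (simp add: orthogonal_transformation_def)
 have "L a ~= 0" using Li[of a a] assms(4) by auto
 moreover have "sg ` F <= {x. L a *. x = b + L a *. c}" using assms(5) by (auto simp: L(2) inner_add_right Li)
 ultimately have "hrefl (L a) (b + L a *. c) o sg : SR" by (rule successive_reflections.reflect[OF assms(1-3)])
 thus ?thesis unfolding hyperplane_reflection_conjugate[OF L] .
qed

text \<open>Every isometry is a word in the reflections of the finite set Q. Countability makes the
  union of all images of the frontier a null set.\<close>

lemma sr_countable: "countable SR"
proof -
 define word :: "((real^'n) \<times> real) list => real^'n => real^'n" where "word = foldl (%sg q. sg o hrefl (fst q) (snd q)) id"
 have "EX l:lists Q. sg = word l" if "sg : SR" for sg
  using that
 proof (induction rule: successive_reflections.induct)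
  case start
  show ?case by (intro bexI[of _ "[]"]) (simp_all add: word_def)
 next
  case (reflect sg F a b)
  obtain l where l: "l : lists Q" "sg = word l" using reflect.IH by blast
  obtain q where q: "q : Q" "hrefl a b o sg = sg o hrefl (fst q) (snd q)"
   using reflection_of_image[OF sr_rigid[OF reflect.hyps(1)] reflect.hyps(2,5,4)] by blast
  have "word (l @ [q]) = word l o hrefl (fst q) (snd q)" by (simp add: word_def)
  thus ?case using l q by (intro bexI[of _ "l @ [q]"]) auto
 qed
 hence "SR <= word ` lists Q" by blast
 moreover have "countable (lists Q)" using Q by (intro countable_lists countable_finite) (simp add: frontier_in_def)
 ultimately show ?thesis by (meson countable_image countable_subset)
qed

lemma skeleton_negligible: "negligible (\<Union>(skeleton S T))"
proof -
 have "negligible (UN q:Q. {x. fst q *. x = snd q})"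
  using Q by (intro negligible_Union finite_imageI) (auto simp: frontier_in_def intro!: negligible_hyperplane)
 hence fr: "negligible (frontier S)" by (rule negligible_subset) (use Q in "simp add: frontier_in_def")
 have "(UN sg:SR. sg ` frontier S) : null_sets lebesgue"
  using rigid_negligible[OF sr_rigid fr] by (intro null_sets_UN' sr_countable) (simp add: negligible_iff_null_sets)
 hence n: "negligible (UN sg:SR. sg ` frontier S)" by (simp add: negligible_iff_null_sets)
 have "F <= frontier S" if "F : facets S" for F by (rule facetE[OF that])
 hence "\<Union>(skeleton S T) <= (UN sg:SR. sg ` frontier S)" unfolding skeleton_def by blast
 thus ?thesis by (rule negligible_subset[OF n])
qed

lemma rigid_symmetry:
 assumes "rigid rh" "rh ` closure S = closure S" shows "rh ` S = S" "rh ` frontier S = frontier S"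
proof -
 obtain rh' where rh': "rigid rh'" "!!x. rh' (rh x) = x" "!!x. rh (rh' x) = x" by (rule rigid_inverse[OF assms(1)]) (rule that)
 have sub: "al ` S <= S" if "rigid al" "al ` closure S = closure S" for al
 proof -
  have "al ` S <= closure S" using that(2) closure_subset by blast
  hence "al ` S <= interior (closure S)" by (rule interior_maximal[OF _ rigid_open[OF that(1) S(1)]])
  thus ?thesis by (simp add: S(2))
 qed
 have "rh' ` closure S = rh' ` rh ` closure S" by (simp add: assms(2))
 hence "rh' ` closure S = closure S" by (simp add: image_image rh'(2))
 from sub[OF rh'(1) this] have "S <= rh ` S" using rh'(3) by (metis image_eqI image_subset_iff subsetI)
 thus S': "rh ` S = S" using sub[OF assms] by blast
 show "rh ` frontier S = frontier S" unfolding frontier_S image_set_diff[OF rigid_inj[OF assms(1)]] S' assms(2) ..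
qed

text \<open>The two isometries differ by a symmetry of \<open>S\<close> that, by uniqueness of colours, preserves every facet and
  hence every facet normal.\<close>

lemma sr_unique:
 assumes sg: "sg : SR" and ta: "ta : SR" and eq: "sg ` closure S = ta ` closure S"
 shows "sg = ta"
proof -
 obtain ta' where ta': "rigid ta'" "!!x. ta' (ta x) = x" "!!x. ta (ta' x) = x" by (rule rigid_inverse[OF sr_rigid[OF ta]]) (rule that)
 define rh where "rh = ta' o sg"
 have rh: "rigid rh" unfolding rh_def by (rule rigid_comp[OF ta'(1) sr_rigid[OF sg]])
 have tarh: "ta (rh x) = sg x" for x by (simp add: rh_def ta'(3))
 have "rh ` closure S = ta' ` sg ` closure S" unfolding rh_def by (rule image_comp[symmetric])
 hence "rh ` closure S = ta' ` ta ` closure S" using eq by simp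
 hence cl: "rh ` closure S = closure S" by (simp add: image_image ta'(2))
 note sym = rigid_symmetry[OF rh cl]
 obtain L c where L: "orthogonal_transformation L" "rh = (%x. L x + c)" using rh unfolding rigid_def by blast
 have lL: "linear L" and Li: "L v *. L w = v *. w" for v w using L(1) by (auto simp: orthogonal_transformation_def)
 \<comment> \<open>rh maps F to a facet F', and sg \<open>F = ta\<close> F' is one element of the
   skeleton; its only colour is both F and F'.\<close>
 have fac: "rh ` F = F" if F: "F : facets S" for F
 proof -
  obtain C a b where C: "F = closure C" "a ~= 0" "C : components (flat_boundary S a b)" using F unfolding facets_def by blast
  have on: "L a *. rh z = b + L a *. c <-> a *. z = b" for z by (simp add: L(2) inner_add_right Li)
  have iff: "rh x : flat_boundary S (L a) (b + L a *. c) <-> x : flat_boundary S a b" for x by (rule flat_boundary_image_iff[OF rh sym(2) on])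
  have "rh ` flat_boundary S a b = flat_boundary S (L a) (b + L a *. c)"
  proof (rule image_eq_if_mem_iff[where f=rh and g="inv rh", OF iff])
   show "rh (inv rh y) = y" for y
   proof -
   obtain x where "y = rh x" by (rule rigid_inverse[OF rh]) metis
   thus ?thesis by (simp add: rigid_inj[OF rh])
   qed
  qed
  hence "rh ` C : components (flat_boundary S (L a) (b + L a *. c))" using components_rigid_image[OF rh C(3)] by simp
  moreover have "L a ~= 0" using Li[of a a] C(2) by auto
  moreover have "rh ` F = closure (rh ` C)" unfolding C(1) by (rule rigid_closure[OF rh])
  ultimately have F': "rh ` F : facets S" unfolding facets_def by blast
  have E: "sg ` F : skeleton S T" unfolding skeleton_def using sg F by blast
  have "sg ` F = ta ` rh ` F" by (simp add: image_image tarh)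
  thus ?thesis using colour[OF E] F F' sg ta by blast
 qed
 have "rh y = y" for y
 proof (rule ccontr)
  assume "rh y ~= y"
  hence v: "rh y - y ~= 0" by simp
  obtain q x where q: "q : Q" "x : flat_boundary S (fst q) (snd q)" "fst q *. (rh y - y) ~= 0"
   by (rule facets_span[OF Q S_ne bounded_S v]) (rule that)
  define a b where "a = fst q" and "b = snd q"
  have a: "a ~= 0" using Q q(1) by (force simp: a_def frontier_in_def)
  obtain C where C: "C : components (flat_boundary S a b)" "x : C" "closure C : facets S"
   by (rule facet_of_flat[OF a q(2)[folded a_def b_def]]) (rule that)
  obtain r where r: "r > 0" "a *. x = b" "frontier S Int ball x r = {y. a *. y = b} Int ball x r" "{y. a *. y = b} Int ball x r <= C"
   by (rule flat_component_ball[OF C(1,2)]) (rule that)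
  have CH: "closure C <= {y. a *. y = b}"
   by (rule closure_minimal[OF _ closed_hyperplane]) (use in_components_subset[OF C(1)] flat_boundary_sub[OF a] in blast)
  \<comment> \<open>a' is the normal of the hyperplane pulled back by rh. As rh preserves the facet,
    a' is a multiple s of a; the sign of s is still open.\<close>
  define a' where "a' = adjoint L a"
  have a': "a' *. z = a *. L z" for z unfolding a'_def using adjoint_works[OF lL, of z a] by (simp add: inner_commute)
  obtain z0 where z0: "L z0 = a" using orthogonal_transformation_surj[OF L(1)] by (metis surjD)
  have a'0: "a' ~= 0" using a'[of z0] a by (auto simp: z0)
  have loc: "a' *. z = b - a *. c" if z: "z : ball x r" "a *. z = b" for z
  proof -
   have "z : closure C" using z r(4) closure_subset by blast
   hence "rh z : closure C" using fac[OF C(3)] by blast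
   hence "a *. rh z = b" using CH by blast
   thus ?thesis by (simp add: a' L(2) inner_add_right)
  qed
  obtain s where s: "s ~= 0" "a' = s *R a" "b - a *. c = s * b"
   using hyperplane_locally_unique[OF a a'0 r(2,1) loc] by blast
  have sc: "a *. rh z - b = s * (a *. z - b)" for z
   using a'[of z] s(2,3) by (simp add: L(2) inner_add_right right_diff_distrib)
  have ons: "a *. rh z = b <-> a *. z = b" for z using sc[of z] s(1) by auto
  have "x : flat_boundary S a b" using q(2) by (simp add: a_def b_def)
  hence "rh x : flat_boundary S a b" using flat_boundary_image_iff[OF rh sym(2) ons] by blast
  moreover have "rh x : closure C" using fac[OF C(3)] C(2) closure_subset by blast
  moreover obtain D where D: "closed D" "C = flat_boundary S a b Int D" using closedin_component[OF C(1)] unfolding closedin_closed by blast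
  moreover have "closure C <= D" by (rule closure_minimal[OF _ D(1)]) (use D(2) in blast)
  ultimately have rhx: "rh x : C" by blast
  \<comment> \<open>x and rh x lie in the same component, so S lies on the same side at both. A
    point of S just off x goes to a point of S, which forces s > 0; isometry then gives s = 1, and
    the displacement rh y - y is orthogonal to a.\<close>
  obtain k :: real where k: "k : {1, -1}" "C <= side a b k" by (rule flat_component_side[OF a C(1)]) (rule that)
  obtain r1 where r1: "r1 > 0" "ALL y:ball x r1. y : S <-> k * (a *. y - b) > 0" using k(2) C(2) unfolding side_def by blast
  obtain r2 where r2: "r2 > 0" "ALL y:ball (rh x) r2. y : S <-> k * (a *. y - b) > 0" using k(2) rhx unfolding side_def by blast
  define t where "t = min r1 r2 / 2 / norm a"
  have t: "t > 0" "t * norm a < r1" "t * norm a < r2" using r1(1) r2(1) a by (auto simp: t_def)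
  define z where "z = x + (k * t) *R a"
  have zb: "z : ball x r1" "z : ball x r2" using t k(1) by (auto simp: z_def dist_norm)
  have kz: "k * (a *. z - b) > 0" using k(1) t(1) a r(2) by (auto simp: z_def inner_add_right)
  hence "z : S" using r1(2) zb(1) by blast
  hence "rh z : S" using sym(1) by blast
  moreover have "rh z : ball (rh x) r2" using zb(2) rigid_ball[OF rh] by blast
  ultimately have "k * (a *. rh z - b) > 0" using r2(2) by blast
  hence "s * (k * (a *. z - b)) > 0" by (simp add: sc mult.left_commute)
  hence spos: "s > 0" using kz by (simp add: zero_less_mult_iff)
  have n: "norm (L v) = norm v" for v by (rule orthogonal_transformation_norm[OF L(1)])
  have na: "norm a > 0" using a by simp
  have "norm a' = s * norm a" using s(2) spos by simp
  moreover have "norm a' = norm a"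
  proof (rule antisym)
   have "norm a' * norm a' = a *. L a'" using a'[of a'] by (simp add: power2_norm_eq_inner[symmetric] power2_eq_square[symmetric])
   also have "... <= norm a * norm a'" using norm_cauchy_schwarz[of a "L a'"] by (simp add: n)
   finally show "norm a' <= norm a" using a'0 by (simp add: mult_le_cancel_right)
   have "norm a * norm a = a' *. z0" using a'[of z0] z0 by (simp add: power2_norm_eq_inner[symmetric] power2_eq_square[symmetric])
   also have "... <= norm a' * norm a" using norm_cauchy_schwarz[of a' z0] n[of z0] z0 by simp
   finally show "norm a <= norm a'" using na by (simp add: mult_le_cancel_right)
  qed
  ultimately have "s = 1" using na by simp
  hence "a *. (rh y - y) = 0" using sc[of y] by (simp add: inner_diff_right)
  thus False using q(3) by (simp add: a_def)
 qed
 hence "ta (rh x) = ta x" for x by simp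
 thus ?thesis using tarh by auto
qed

text \<open>Distinct isometries have distinct closed tiles, so the intersection of the open tiles is
  an open set within the skeleton, a null set.\<close>

lemma sr_disjoint:
 assumes "sg : SR" "ta : SR" "sg ~= ta" shows "sg ` S Int ta ` S = {}"
proof (rule ccontr)
 assume ne: "sg ` S Int ta ` S ~= {}"
 have "open (sg ` S Int ta ` S)" using assms by (intro open_Int rigid_open sr_rigid S)
 moreover have "sg ` S Int ta ` S <= \<Union>(skeleton S T)"
  using overlap[OF assms(1,2)] sr_unique[OF assms(1,2)] assms(3) closure_subset[of S] by blast
 hence "negligible (sg ` S Int ta ` S)" by (rule negligible_subset[OF skeleton_negligible])
 ultimately show False using open_not_negligible ne by blast
qed

text \<open>Disjoint tiles of one positive volume, all within distance 2 * D of K, fit into a ball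
  only finitely often.\<close>

lemma sr_finite:
 assumes "bounded K" shows "finite {sg \<in> SR. sg ` closure S Int K ~= {}}"
proof (rule ccontr)
 assume inf: "infinite {sg \<in> SR. sg ` closure S Int K ~= {}}"
 obtain R where R: "!!x. x : K ==> norm x <= R" using assms unfolding bounded_iff by blast
 obtain D where D: "!!x. x : closure S ==> norm x <= D" using bounded_closure[OF bounded_S] unfolding bounded_iff by blast
 let ?B = "cball (0::real^'n) (R + 2 * D)"
 have Sm: "S : lmeasurable" using S(1) bounded_S by (simp add: lmeasurable_open)
 have M: "measure lebesgue S > 0"
  using open_not_negligible[OF S(1) S_ne] Sm by (simp add: negligible_iff_measure zero_less_measure_iff)
 obtain n :: nat where n: "measure lebesgue ?B < real n * measure lebesgue S" using reals_Archimedean3[OF M] by blast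
 obtain N where N: "N <= {sg \<in> SR. sg ` closure S Int K ~= {}}" "finite N" "card N = n" using infinite_arbitrarily_large[OF inf] by blast
 have sr: "sg : SR" if "sg : N" for sg using N(1) that by blast
 have m: "sg ` S : lmeasurable" "measure lebesgue (sg ` S) = measure lebesgue S" if "sg : N" for sg
  using rigid_measure[OF sr_rigid[OF sr[OF that]] Sm] by auto
 have sub: "(UN sg:N. sg ` S) <= ?B"
 proof
  fix y assume "y : (UN sg:N. sg ` S)"
  then obtain sg x where x: "sg : N" "x : S" "y = sg x" by blast
  obtain z where z: "z : closure S" "sg z : K" using N(1) x(1) by blast
  have "dist (sg x) (sg z) = dist x z" by (rule rigid_dist[OF sr_rigid[OF sr[OF x(1)]]])
  also have "... <= norm x + norm z" unfolding dist_norm by (rule norm_triangle_ineq4)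
  also have "... <= 2 * D" using D[of x] D[of z] x(2) z(1) closure_subset by force
  finally have "norm (sg x - sg z) <= 2 * D" by (simp add: dist_norm)
  hence "norm y <= R + 2 * D" using R[OF z(2)] norm_triangle_ineq[of "sg x - sg z" "sg z"] x(3) by simp
  thus "y : ?B" by simp
 qed
 have "disjoint_family_on (%sg. sg ` S) N" unfolding disjoint_family_on_def using sr_disjoint sr by blast
 hence "measure lebesgue (UN sg:N. sg ` S) = (SUM sg:N. measure lebesgue (sg ` S))"
  using N(2) fmeasurableD[OF m(1)] fmeasurableD2[OF m(1)] by (intro measure_finite_Union) (auto simp del: emeasure_completion)
 also have "... = real n * measure lebesgue S" using m(2) N(3) by simp
 finally have "real n * measure lebesgue S <= measure lebesgue ?B"
  using measure_mono_fmeasurable[OF sub sets.finite_UN[OF N(2) fmeasurableD[OF m(1)]] lmeasurable_cball] by simp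
 thus False using n by simp
qed

end

section \<open>Folding test functions\<close>

lemma has_derivative_dir_deriv:
 assumes "smooth f" shows "(f has_derivative (%h. dir_deriv h f x)) (at x)"
 using has_derivative_partial[OF smooth_differentiable[OF assms], of x] by (simp add: dir_deriv_def scaleR_conv_of_real)

lemma smooth_dir_deriv: "smooth f ==> smooth (dir_deriv a f)"
 unfolding dir_deriv_def[abs_def] by (intro smooth_sum smooth_mult smooth_const smooth_partial)

lemma partial_sum:
 assumes "!!j. j : J ==> smooth (f j)"
 shows "partial i (%x. SUM j:J. f j x) x = (SUM j:J. partial i (f j) x)"
proof -
 have "((%x. SUM j:J. f j x) has_derivative (%h. SUM j:J. dir_deriv h (f j) x)) (at x)" by (intro has_derivative_sum has_derivative_dir_deriv assms)
 from partial_eq[OF this] show ?thesis by (simp add: partial_dir_deriv)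
qed

lemma dir_deriv_sum:
 assumes "!!j. j : J ==> smooth (f j)"
 shows "dir_deriv a (%x. SUM j:J. f j x) x = (SUM j:J. dir_deriv a (f j) x)"
proof -
 have "dir_deriv a (%x. SUM j:J. f j x) x = (SU i. SUM j:J. of_real (a $ i) * partial i (f j) x)"
  by (simp add: dir_deriv_def partial_sum[OF assms] sum_distrib_left)
 also have "... = (SUM j:J. SU i. of_real (a $ i) * partial i (f j) x)" by (rule sum.swap)
 finally show ?thesis by (simp add: dir_deriv_def)
qed

lemma dir_deriv_affine:
 assumes "linear L" "smooth f"
 shows "dir_deriv v (%x. f (L x + c)) x = dir_deriv (L v) f (L x + c)"
proof -
 have "((%x. L x + c) has_derivative L) (at x)"
  using linear_imp_has_derivative[OF assms(1)] by (intro has_derivative_add_const)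
 from has_derivative_compose[OF this has_derivative_dir_deriv[OF assms(2)]]
 have "((%x. f (L x + c)) has_derivative (%h. dir_deriv (L h) f (L x + c))) (at x)" .
 from has_derivative_unique[OF has_derivative_dir_deriv[OF smooth_comp_affine[OF assms]] this]
 show ?thesis by metis
qed

text \<open>The second derivatives are taken along the vectors L (axis i 1); their products of
  components, summed over i, give the identity matrix since the matrix of L is orthogonal.\<close>

lemma laplacian_rigid:
 fixes L :: "real^'n => real^'n"
 assumes L: "orthogonal_transformation L" and f: "smooth f"
 shows "laplacian (%x. f (L x + c)) x = laplacian f (L x + c)"
proof -
 have lL: "linear L" by (rule orthogonal_transformation_linear[OF L])
 have p: "partial i (%x. f (L x + c)) = (%x. dir_deriv (L (axis i 1)) f (L x + c))" for i
  by (rule ext) (simp add: partial_dir_deriv dir_deriv_affine[OF lL f])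
 have dd: "dir_deriv w (dir_deriv w f) y = (SU j. SU k. of_real (w $ j * w $ k) * partial j (partial k f) y)" for w y
 proof -
  have "partial j (dir_deriv w f) y = (SU k. of_real (w $ k) * partial j (partial k f) y)" for j
   unfolding dir_deriv_def[abs_def]
   by (subst partial_sum) (simp_all add: partial_cmult smooth_differentiable smooth_partial f smooth_mult smooth_const)
  thus ?thesis by (simp add: dir_deriv_def[of w "dir_deriv w f"] sum_distrib_left mult.assoc)
 qed
 have orth: "(SU i. L (axis i 1) $ j * L (axis i 1) $ k) = (if j = k then 1 else 0)" for j k
 proof -
  have "orthogonal_matrix (matrix L)" using L orthogonal_transformation_matrix by blast
  hence "matrix L ** transpose (matrix L) = mat 1" by (simp add: orthogonal_matrix_def)
  hence "(matrix L ** transpose (matrix L)) $ j $ k = mat 1 $ j $ k" by simp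
  thus ?thesis by (simp add: matrix_matrix_mult_def transpose_def matrix_def mat_def)
 qed
 have "laplacian (%x. f (L x + c)) x = (SU i. dir_deriv (L (axis i 1)) (dir_deriv (L (axis i 1)) f) (L x + c))"
  unfolding laplacian_def p by (simp add: partial_dir_deriv dir_deriv_affine[OF lL smooth_dir_deriv[OF f]])
 also have "... = (SU j. SU k. of_real (SU i. L (axis i 1) $ j * L (axis i 1) $ k) * partial j (partial k f) (L x + c))"
  unfolding dd of_real_sum sum_distrib_right by (subst sum.swap, rule sum.cong[OF refl], rule sum.swap)
 also have "... = (SU j. SU k. if j = k then partial j (partial k f) (L x + c) else 0)"
  unfolding orth by (intro sum.cong refl) simp
 also have "... = laplacian f (L x + c)" by (simp add: laplacian_def)
 finally show ?thesis .
qed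

lemma smooth_rigid:
 assumes "rigid sg" "smooth f" shows "smooth (%x. f (sg x))"
proof -
 obtain L c where L: "orthogonal_transformation L" "sg = (%x. L x + c)" using assms(1) unfolding rigid_def by blast
 show ?thesis unfolding L(2) by (rule smooth_comp_affine[OF orthogonal_transformation_linear[OF L(1)] assms(2)])
qed

lemma helm_rigid:
 assumes "rigid sg" "smooth f" shows "helm k (%x. f (sg x)) x = helm k f (sg x)"
proof -
 obtain L c where L: "orthogonal_transformation L" "sg = (%x. L x + c)" using assms(1) unfolding rigid_def by blast
 show ?thesis unfolding helm_def L(2) laplacian_rigid[OF L(1) assms(2)] ..
qed

lemma test_rigid:
 assumes "rigid sg" "test UNIV f" shows "test UNIV (%x. f (sg x))"
proof -
 obtain ta where ta: "rigid ta" "!!x. ta (sg x) = x" "!!x. sg (ta x) = x" by (rule rigid_inverse[OF assms(1)]) (rule that)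
 obtain K where K: "compact K" "K <= UNIV" "!!x. x ~: K ==> f x = 0" by (rule test_functionE[OF assms(2)]) (rule that)
 have "f (sg x) = 0" if "x ~: ta ` K" for x
 proof (rule K(3))
  show "sg x ~: K" using that ta(2)[of x] by (metis imageI)
 qed
 thus ?thesis by (rule test_functionI[OF smooth_rigid[OF assms(1) test_smooth[OF assms(2)]]
   compact_continuous_image[OF rigid_continuous[OF ta(1)] K(1)] subset_UNIV])
qed

lemma rigid_change_of_variables:
 fixes f :: "real^'n => 'b::euclidean_space"
 assumes "rigid sg" "f : LM"
 shows "(%x. f (sg x)) \<in> borel_measurable lebesgue" "(LI x. f (sg x)) = (LI x. f x)"
  "Lint (%x. f (sg x)) <-> Lint f"
proof -
 obtain L c where L: "orthogonal_transformation L" "sg = (%x. L x + c)" using assms(1) unfolding rigid_def by blast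
 show "(%x. f (sg x)) \<in> borel_measurable lebesgue" unfolding L(2) by (rule isometry_measurable[OF L(1) assms(2)])
 show "(LI x. f (sg x)) = (LI x. f x)" unfolding L(2) by (rule isometry_integral[OF L(1) assms(2)])
 show "Lint (%x. f (sg x)) <-> Lint f" unfolding L(2) by (rule isometry_integrable[OF L(1) assms(2)])
qed

lemma L2_rigid:
 assumes "rigid sg" "L2 f" shows "L2 (%x. f (sg x))"
 unfolding L2_def
proof
 show "(%x. f (sg x)) \<in> borel_measurable lebesgue" by (rule rigid_change_of_variables(1)[OF assms(1) L2_measurable[OF assms(2)]])
 show "Lint (%x. (norm (f (sg x)))^2)"
  using rigid_change_of_variables(3)[OF assms(1) borel_measurable_integrable[OF L2_sq_integrable[OF assms(2)]]] L2_sq_integrable[OF assms(2)] by simp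
qed

section \<open>The parity of a composition of reflections\<close>

lemma linear_reflection: "linear (hrefl a 0)"
 by (rule linearI) (auto simp: hyperplane_reflection_def inner_add_right algebra_simps add_divide_distrib)

lemma hyperplane_reflection_affine: "hrefl a b x = hrefl a 0 x + hrefl a b 0"
 unfolding hyperplane_reflection_def by (simp add: right_diff_distrib diff_divide_distrib scaleR_diff_left)

lemma hyperplane_reflection_normal: "a ~= 0 ==> hrefl a 0 a = - a" by (simp add: hyperplane_reflection_def scaleR_2)

text \<open>An orthogonal map carries a to a multiple of a coordinate vector; the conjugate
  reflection is diagonal with a single entry -1.\<close>

lemma det_reflection:
 fixes a :: "real^'n"
 assumes "a ~= 0" shows "det (matrix (hrefl a 0)) = -1"
proof -
 obtain k :: 'n where True by blast
 let ?e = "axis k 1 :: real^'n"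
 have "norm a = norm (norm a *R ?e)" by simp
 then obtain f where f: "orthogonal_transformation f" "f a = norm a *R ?e" by (rule orthogonal_transformation_exists)
 have lf: "linear f" by (rule orthogonal_transformation_linear[OF f(1)])
 have "hrefl (f a) (0 + f a *. 0) o f = f o hrefl a 0" by (rule hyperplane_reflection_conjugate[OF f(1)]) simp
 hence "hrefl ?e 0 o f = f o hrefl a 0"
  using hyperplane_reflection_scale[of "norm a" ?e 0] assms by (simp add: f(2))
 hence "matrix (hrefl ?e 0) ** matrix f = matrix f ** matrix (hrefl a 0)" by (metis matrix_compose lf linear_reflection)
 hence "det (matrix (hrefl ?e 0)) * det (matrix f) = det (matrix f) * det (matrix (hrefl a 0))" by (metis det_mul)
 moreover have "det (matrix f) ~= 0" using orthogonal_transformation_det[OF f(1)] by auto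
 moreover have "det (matrix (hrefl ?e 0)) = -1"
 proof -
  have m: "matrix (hrefl ?e 0) $ i $ j = (if i = j then if i = k then -1 else 1 else 0)" for i j
   by (simp add: matrix_def hyperplane_reflection_def inner_axis_axis) (simp add: axis_def)
  have "det (matrix (hrefl ?e 0)) = (\<Prod>i\<in>UNIV. if i = k then -1 else (1::real))" by (subst det_diagonal) (simp_all add: m)
  thus ?thesis by simp
 qed
 ultimately have "det (matrix f) * det (matrix (hrefl a 0)) = det (matrix f) * (- 1)" "det (matrix f) ~= 0" by auto
 thus ?thesis by (metis mult_cancel_left)
qed

text \<open>The determinant of the linear part depends on the isometry only, not on the word of
  reflections that produced it; this is the sign used for Dirichlet eigenfunctions.\<close>

definition orientation :: "(real^'n => real^'n) => real" where
 "orientation sg = det (matrix (%x. sg x - sg 0))"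

lemma orientation_id: "orientation (id :: real^'n => real^'n) = 1"
proof -
 have "matrix (%x::real^'n. x) = mat 1" by (simp add: matrix_def mat_def vec_eq_iff axis_def)
 thus ?thesis by (simp add: orientation_def det_I)
qed

lemma orientation_reflection:
 assumes "rigid sg" "a ~= 0" shows "orientation (sg o hrefl a b) = - orientation sg"
proof -
 obtain L c where L: "orthogonal_transformation L" "sg = (%x. L x + c)" using assms(1) unfolding rigid_def by blast
 have lL: "linear L" by (rule orthogonal_transformation_linear[OF L(1)])
 have 1: "(%x. sg x - sg 0) = L" by (simp add: L(2) linear_0[OF lL])
 have "(sg o hrefl a b) x - (sg o hrefl a b) 0 = (L o hrefl a 0) x" for x
  unfolding o_def hyperplane_reflection_affine[of a b x] by (simp add: L(2) linear_add[OF lL])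
 hence 2: "(%x. (sg o hrefl a b) x - (sg o hrefl a b) 0) = L o hrefl a 0" by blast
 show ?thesis unfolding orientation_def 1 2 matrix_compose[OF linear_reflection lL] det_mul det_reflection[OF assms(2)] by simp
qed

text \<open>Fixed points of i are harmless, as g s = - g s holds there.\<close>

lemma sum_involution_zero:
 fixes g :: "'a => complex"
 assumes "!!s. s : A ==> i s : A" "!!s. s : A ==> i (i s) = s" "!!s. s : A ==> g (i s) = - g s"
 shows "(SUM s:A. g s) = 0"
proof -
 have "(SUM s:A. g s) = (SUM s:A. g (i s))" by (rule sum.reindex_bij_witness[of _ i i]) (use assms in auto)
 also have "... = - (SUM s:A. g s)" using assms(3) by (simp add: sum_negf)
 finally show ?thesis by simp
qed

section \<open>Green's formulas on the domain\<close>

lemma L2_vec: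
 fixes V :: "real^'n => complex^'m"
 assumes "!!i. L2 (%x. V x $ i)" shows "L2 V"
proof -
 have ax: "L2 (%x. axis i (V x $ i) :: complex^'m)" for i
 proof (rule L2_dominated[OF assms, where B=1])
  have "continuous_on UNIV (%c::complex. axis i c :: complex^'m)"
   unfolding axis_def
  proof (rule continuous_on_vec_lambda)
   show "continuous_on UNIV (%c::complex. if j = i then c else 0)" for j by (cases "j = i") simp_all
  qed
  hence "(%c::complex. axis i c :: complex^'m) : borel_measurable borel" by (rule borel_measurable_continuous_onI)
  from measurable_compose[OF L2_measurable[OF assms] this] show "(%x. axis i (V x $ i) :: complex^'m) : LM" .
  show "norm (axis i (V x $ i) :: complex^'m) <= 1 * norm (V x $ i)" for x
  proof -
   have "(norm (axis i (V x $ i) :: complex^'m))^2 = (SU j. if j = i then (norm (V x $ i))\<^sup>2 else 0)"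
   unfolding norm_sq_vec by (intro sum.cong) (auto simp: axis_def)
   thus ?thesis by simp
  qed
 qed
 have "V x = (SU i. axis i (V x $ i))" for x by (simp add: vec_eq_iff axis_def sum_component)
 moreover have "L2 (%x. SU i. axis i (V x $ i))" by (intro L2_sum ax)
 ultimately show ?thesis by simp
qed

lemma L2_restrict:
 assumes "L2 f" "U : sets lebesgue" shows "L2_on U f"
 unfolding L2_on_iff[OF assms(2)]
proof (rule L2_dominated[OF assms(1), where B=1])
 have "f : LM" by (rule L2_measurable[OF assms(1)])
 thus "(%x. if x : U then f x else 0) : LM"
  using assms(2) by (intro measurable_If_set borel_measurable_const) auto
qed simp

lemma L2_on_test:
 assumes "test UNIV Ph" "U : sets lebesgue"
 shows "L2_on U Ph" "L2_on U (grad Ph)" "L2_on U (laplacian Ph)"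
proof -
 show "L2_on U Ph" by (rule L2_restrict[OF L2_test[OF assms(1)] assms(2)])
 show "L2_on U (grad Ph)" by (rule L2_restrict[OF L2_vec assms(2)]) (simp add: grad_def L2_test[OF test_partial[OF assms(1)]])
 show "L2_on U (laplacian Ph)" unfolding laplacian_def[abs_def]
  by (intro L2_restrict[OF L2_test[where U=UNIV] assms(2)] test_sum test_partial assms(1))
qed

text \<open>u is a limit of test functions of U, for which the pairing vanishes by the definition of
  the weak divergence. Here the function is zero on the boundary; in
  \<open>normal_trace_zero\<close> it is the field.\<close>

lemma zero_trace_normal_trace:
 fixes U :: "(real^'n) set"
 assumes U: "open U" and z: "zero_trace U u H" and V: "L2_on U V" "L2_on U f" "WD U V f"
 shows "NT U V f u H = 0"
proof -
 have Um: "U : sets lebesgue" using U by simp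
 have uH: "L2_on U u" "L2_on U H" using z by (auto simp: zero_trace_def has_H1_gradient_def)
 obtain ph where ph: "!!n::nat. test U (ph n)"
  "(%n. \<integral>x. (norm (ph n x - u x))^2 + (norm (grad (ph n) x - H x))^2 \<partial>lebesgue_on U) ---> 0"
  using z unfolding zero_trace_def by blast
 define V0 where "V0 i x = (if x : U then V x else 0) $ i" for i x
 define f0 where "f0 x = (if x : U then f x else 0)" for x
 define u0 where "u0 x = (if x : U then u x else 0)" for x
 define H0 where "H0 i x = (if x : U then H x else 0) $ i" for i x
 have L0: "L2 (V0 i)" "L2 f0" "L2 u0" "L2 (H0 i)" for i
  using V uH L2_on_iff[OF Um] L2_component unfolding V0_def[abs_def] f0_def[abs_def] u0_def[abs_def] H0_def[abs_def] by blast+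
 have out: "ph n x = 0" "partial i (ph n) x = 0" if x: "x ~: U" for n i x
 proof -
  obtain K where K: "compact K" "K <= U" "!!x. x ~: K ==> ph n x = 0" "!!x i. x ~: K ==> partial i (ph n) x = 0"
   by (rule test_functionE[OF ph(1)[of n]]) (rule that)
  show "ph n x = 0" "partial i (ph n) x = 0" using K x by blast+
 qed
 have i1: "Lint (%x. (norm (ph n x - u0 x))^2)" for n by (rule L2_sq_integrable[OF L2_diff[OF L2_test[OF ph(1)] L0(3)]])
 have i2: "Lint (%x. (norm (partial i (ph n) x - H0 i x))^2)" for n i
  by (rule L2_sq_integrable[OF L2_diff[OF L2_test[OF test_partial[OF ph(1)]] L0(4)]])
 define E where "E n = (LI x. (norm (ph n x - u0 x))^2) + (SU i. \<integral>x. (norm (partial i (ph n) x - H0 i x))^2 \<partial>lebesgue)" for n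
 have "(LIO U (%x. (norm (ph n x - u x))^2 + (norm (grad (ph n) x - H x))^2)) = E n" for n
 proof -
  have "(if x : U then (norm (ph n x - u x))\<^sup>2 + (norm (grad (ph n) x - H x))^2 else 0) =
   (norm (ph n x - u0 x))^2 + (SU i. (norm (partial i (ph n) x - H0 i x))^2)" for x
   by (cases "x : U") (simp_all add: u0_def H0_def norm_sq_vec grad_def out)
  thus ?thesis unfolding integral_on[OF Um] E_def using i1 i2 by simp
 qed
 hence E0: "E ---> 0" using ph(2) by simp
 have pos: "0 <= (LI x. (norm (ph n x - u0 x))^2)" "0 <= (LI x. (norm (partial i (ph n) x - H0 i x))^2)" for n i
  by (simp_all add: Bochner_Integration.integral_nonneg)
 have e1: "(LI x. (norm (ph n x - u0 x))^2) <= E n" for n unfolding E_def using pos(2) by (simp add: sum_nonneg)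
 have e2: "(LI x. (norm (partial i (ph n) x - H0 i x))^2) <= E n" for n i
 proof -
  have "(LI x. (norm (partial i (ph n) x - H0 i x))^2) <= (SU i. \<integral>x. (norm (partial i (ph n) x - H0 i x))^2 \<partial>lebesgue)"
   by (rule member_le_sum) (use pos(2) in auto)
  thus ?thesis unfolding E_def using pos(1)[of n] by linarith
 qed
 have l1: "L2lim ph u0" unfolding L2lim_def
  by (rule tendsto_sandwich[OF always_eventually[OF allI[OF pos(1)]] always_eventually[OF allI[OF e1]] tendsto_const E0])
 have l2: "L2lim (%n. partial i (ph n)) (H0 i)" for i unfolding L2lim_def
  by (rule tendsto_sandwich[OF always_eventually[OF allI[OF pos(2)]] always_eventually[OF allI[OF e2]] tendsto_const E0])
 have "(%n. (SU i. \<integral>x. partial i (ph n) x * V0 i x \<partial>lebesgue) + (LI x. ph n x * f0 x)) --->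
  (SU i. \<integral>x. H0 i x * V0 i x \<partial>lebesgue) + (LI x. u0 x * f0 x)"
  by (intro tendsto_add tendsto_sum L2lim_product l1 l2 L0 L2_test[OF ph(1)] L2_test[OF test_partial[OF ph(1)]])
 moreover have "(SU i. \<integral>x. partial i (ph n) x * V0 i x \<partial>lebesgue) + (LI x. ph n x * f0 x) = 0" for n
 proof -
  have "(LIO U (%x. cdot (V x) (grad (ph n) x))) = - (LIO U (%x. f x * ph n x))"
   using V(3) ph(1) unfolding has_weak_div_def by blast
  moreover have "(if x : U then cdot (V x) (grad (ph n) x) else 0) = (SU i. partial i (ph n) x * V0 i x)"
   "(if x : U then f x * ph n x else 0) = ph n x * f0 x" for x by (simp_all add: cdot_def grad_def V0_def f0_def mult.commute)
  moreover have "Lint (%x. partial i (ph n) x * V0 i x)" for i by (rule L2_product[OF L2_test[OF test_partial[OF ph(1)]] L0(1)])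
  ultimately show ?thesis unfolding integral_on[OF Um] by (simp add: Bintegral_sum)
 qed
 ultimately have s: "(SU i. \<integral>x. H0 i x * V0 i x \<partial>lebesgue) + (LI x. u0 x * f0 x) = 0" by (simp add: LIMSEQ_const_iff)
 have "NT U V f u H = (LI x. (SU i. H0 i x * V0 i x) + u0 x * f0 x)"
  unfolding normal_trace_def integral_on[OF Um] by (intro Bintegral_cong refl) (simp add: cdot_def V0_def f0_def u0_def H0_def mult.commute)
 also have "... = (SU i. \<integral>x. H0 i x * V0 i x \<partial>lebesgue) + (LI x. u0 x * f0 x)"
  using L2_product[OF L0(4,1)] L2_product[OF L0(3,2)] by (simp add: Bintegral_sum)
 finally show ?thesis using s by simp
qed

lemma integrable_restrict:
 fixes f :: "real^'n => 'b::euclidean_space"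
 assumes "Lint f" "U : sets lebesgue" shows "integrable (lebesgue_on U) f"
 using integrable_mult_indicator[OF assms(2,1)] assms(2) by (simp add: integrable_restrict_space)

lemma L2_on_product:
 fixes f g :: "'n::finite fn"
 assumes "L2_on U f" "L2_on U g" "U : sets lebesgue" shows "integrable (lebesgue_on U) (%x. f x * g x)"
proof -
 have "Lint (%x. (if x : U then f x else 0) * (if x : U then g x else 0))"
  using assms by (intro L2_product) (simp_all add: L2_on_iff)
 moreover have "(%x. (if x : U then f x else 0) * (if x : U then g x else 0)) = (%x. indicator U x *R (f x * g x))" by (auto simp: indicator_def)
 ultimately show ?thesis using assms(3) by (simp add: integrable_restrict_space)
qed

lemma L2_on_component:
 fixes V :: "real^'n => complex^'m"
 assumes "L2_on U V" "U : sets lebesgue" shows "L2_on U (%x. V x $ i)"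
proof -
 have "L2 (%x. (if x : U then V x else 0) $ i)" using assms by (intro L2_component) (simp add: L2_on_iff)
 moreover have "(%x. (if x : U then V x else 0) $ i) = (%x. if x : U then V x $ i else 0)" by auto
 ultimately show ?thesis using assms(2) by (simp add: L2_on_iff)
qed

lemma L2_on_cdot:
 assumes "L2_on U V" "L2_on U W" "U : sets lebesgue" shows "integrable (lebesgue_on U) (%x. cdot (V x) (W x))"
 unfolding cdot_def by (intro Bintegrable_sum L2_on_product L2_on_component assms)

lemma L2_on_cmult:
 fixes f :: "'n::finite fn"
 assumes "L2_on U f" "U : sets lebesgue" shows "L2_on U (%x. c * f x)"
proof -
 have "L2 (%x. c * (if x : U then f x else 0))" using assms by (intro L2_cmult) (simp add: L2_on_iff)
 moreover have "(%x. c * (if x : U then f x else 0)) = (%x. if x : U then c * f x else 0)" by auto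
 ultimately show ?thesis using assms(2) by (simp add: L2_on_iff)
qed

lemma cdot_commute: "cdot v w = cdot w v" by (simp add: cdot_def mult.commute)

lemma normal_trace_add:
 assumes "L2_on U V" "L2_on U f" "L2_on U ps" "L2_on U H" "U : sets lebesgue"
 shows "NT U V f ps H = (LIO U (%x. cdot (V x) (H x))) + (LIO U (%x. f x * ps x))"
 unfolding normal_trace_def by (intro Bintegral_add L2_on_cdot L2_on_product assms)

text \<open>Green's second identity for w and Ph; the hypotheses 1 and 2 are its two boundary
  terms.\<close>

lemma green_difference:
 assumes U: "U : sets lebesgue" and w: "L2_on U w" "L2_on U G" and Ph: "test UNIV Ph"
  and 1: "NT U G (%x. - of_real (k^2) * w x) Ph (grad Ph) = 0" and 2: "NT U (grad Ph) (laplacian Ph) w G = 0"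
 shows "(LIO U (%x. w x * helm k Ph x)) = 0"
proof -
 note PhL = L2_on_test[OF Ph U]
 note cw = L2_on_cmult[OF w(1) U, of "- of_real (k^2)"]
 have i: "integrable (lebesgue_on U) (%x. laplacian Ph x * w x)" "integrable (lebesgue_on U) (%x. - of_real (k^2) * w x * Ph x)"
  by (intro L2_on_product PhL w cw U)+
 have "(LIO U (%x. w x * helm k Ph x)) = (LIO U (%x. laplacian Ph x * w x - - of_real (k^2) * w x * Ph x))"
  by (intro Bintegral_cong refl) (simp add: helm_def algebra_simps)
 also have "... = (LIO U (%x. laplacian Ph x * w x)) - (LIO U (%x. - of_real (k^2) * w x * Ph x))" by (rule Bintegral_diff[OF i])
 also have "... = NT U (grad Ph) (laplacian Ph) w G - NT U G (%x. - of_real (k^2) * w x) Ph (grad Ph)"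
  unfolding normal_trace_add[OF PhL(2,3) w U] normal_trace_add[OF w(2) cw PhL(1,2) U] by (simp add: cdot_commute)
 finally show ?thesis using 1 2 by simp
qed

lemma integral_on_test:
 fixes f ph :: "'n::finite fn"
 assumes "test U ph" "U : sets lebesgue"
 shows "(LIO U (%x. f x * ph x)) = (LI x. f x * ph x)"
proof -
 obtain K where K: "compact K" "K <= U" "!!x. x ~: K ==> ph x = 0" by (rule test_functionE[OF assms(1)]) (rule that)
 have "(if x : U then f x * ph x else 0) = f x * ph x" for x using K(2) K(3)[of x] by (cases "x : U") auto
 thus ?thesis unfolding integral_on[OF assms(2)] by simp
qed

lemma has_H1_gradient_test:
 fixes U :: "(real^'n) set"
 assumes "test UNIV Ph" "U : sets lebesgue" shows "H1G U Ph (grad Ph)"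
 unfolding has_H1_gradient_def
proof (intro conjI allI impI L2_on_test[OF assms])
 fix ph :: "'n fn" and i assume ph: "test U ph"
 have "Ck_on 1 UNIV Ph" using test_smooth[OF assms(1)] by (simp add: smooth_def)
 from integration_by_parts(3)[OF open_UNIV this test_UNIV[OF ph], of i]
 show "(LIO U (%x. Ph x * partial i ph x)) = - (LIO U (%x. grad Ph x $ i * ph x))"
  unfolding integral_on_test[OF ph assms(2)] integral_on_test[OF test_partial[OF ph] assms(2)] by (simp add: grad_def)
qed

lemma has_weak_div_test:
 fixes U :: "(real^'n) set"
 assumes Ph: "test UNIV Ph" and U: "U : sets lebesgue" shows "WD U (grad Ph) (laplacian Ph)"
 unfolding has_weak_div_def
proof (intro allI impI)
 fix ph :: "'n fn" assume ph: "test U ph"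
 have eq: "(LIO U (%x. partial i Ph x * partial i ph x)) = - (LIO U (%x. partial i (partial i Ph) x * ph x))" for i
  using has_H1_gradient_test[OF test_partial[OF Ph] U, of i] ph unfolding has_H1_gradient_def by (simp add: grad_def)
 have i: "integrable (lebesgue_on U) (%x. partial i Ph x * partial i ph x)" "integrable (lebesgue_on U) (%x. partial i (partial i Ph) x * ph x)" for i
  by (intro L2_on_product L2_on_test(1)[OF _ U] test_partial Ph test_UNIV[OF ph] U)+
 show "(LIO U (%x. cdot (grad Ph x) (grad ph x))) = - (LIO U (%x. laplacian Ph x * ph x))"
  unfolding cdot_def grad_def laplacian_def vec_lambda_beta sum_distrib_right by (simp add: Bintegral_sum[OF i(1)] Bintegral_sum[OF i(2)] eq sum_negf)
qed

context paving
begin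

lemma S_sets: "S : sets lebesgue" using S(1) by simp

text \<open>A frontier point on exactly one hyperplane lies on a facet, so conditions on facets
  suffice for \<open>divergence_theorem_flat\<close>.\<close>

lemma divergence_zero:
 assumes X: "!!i. test UNIV (X i)"
  and flat: "!!F a b x. F : facets S ==> x : F ==> a ~= 0 ==> F <= {x. a *. x = b} ==> (SU i. of_real (a $ i) * X i x) = 0"
 shows "(LIO S (%x. (SU i. partial i (X i) x))) = 0"
 unfolding integral_on[OF S_sets]
proof (rule divergence_theorem_flat[OF S(1) bounded_S _ _ _ _ X])
 show "finite Q" "!!q. q : Q ==> norm (fst q) = 1" "frontier S <= (UN q:Q. {x. fst q *. x = snd q})"
  "!!q q'. q : Q ==> q' : Q ==> q ~= q' ==> {x. fst q *. x = snd q} ~= {x. fst q' *. x = snd q'}"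
  using Q by (auto simp: frontier_in_def)
 fix x q assume x: "x : frontier S" "q : Q" "fst q *. x = snd q" "!!q'. q' : Q ==> fst q' *. x = snd q' ==> q' = q"
 have a: "fst q ~= 0" using Q x(2) by (force simp: frontier_in_def)
 have f: "x : flat_boundary S (fst q) (snd q)" by (rule flat_boundaryI[OF Q x(1-3)]) (rule x(4))
 obtain C where C: "C : components (flat_boundary S (fst q) (snd q))" "x : C" "closure C : facets S" by (rule facet_of_flat[OF a f]) (rule that)
 have "closure C <= {y. fst q *. y = snd q}"
  by (rule closure_minimal[OF _ closed_hyperplane]) (use in_components_subset[OF C(1)] flat_boundary_sub[OF a] in blast)
 thus "(SU i. of_real (fst q $ i) * X i x) = 0" using C closure_subset a by (intro flat[OF C(3)]) auto
qed

text \<open>Vanishing on the facets gives Ph zero trace, by the divergence theorem for the fields Ph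
  * ph in coordinate directions. One boundary term vanishes by the trace of Ph, the other by that of
  w.\<close>

lemma dirichlet_test_zero:
 assumes lip: "lipschitz_boundary S" and w: "zero_trace S w G" "WD S G (%x. - of_real (k^2) * w x)"
  and Ph: "test UNIV Ph" "!!F x. F : facets S ==> x : F ==> Ph x = 0"
 shows "(LIO S (%x. w x * helm k Ph x)) = 0"
proof -
 have wL: "L2_on S w" "L2_on S G" using w(1) by (auto simp: zero_trace_def has_H1_gradient_def)
 note PhL = L2_on_test[OF Ph(1) S_sets]
 have zt: "zero_trace S Ph (grad Ph)"
 proof (rule zero_traceI[OF S(1) bounded_S lip PhL(1,2)])
  fix ph :: "'n::finite fn" and i assume ph: "test UNIV ph"
  define X :: "'n => real^'n => complex" where "X j = (if j = i then (%x. Ph x * ph x) else (%x. 0))" for j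
  have X: "test UNIV (X j)" for j using test_mult_smooth'[OF Ph(1) test_smooth[OF ph]] by (cases "j = i") (simp_all add: X_def test_zero)
  have "(LIO S (%x. (SU j. partial j (X j) x))) = 0" by (rule divergence_zero[OF X]) (use Ph(2) in "auto simp: X_def intro!: sum.neutral")
  moreover have "(SU j. partial j (X j) x) = Ph x * partial i ph x + grad Ph x $ i * ph x" for x
  proof -
   have "(SU j. partial j (X j) x) = (SU j. if j = i then partial i (%x. Ph x * ph x) x else 0)" by (intro sum.cong) (auto simp: X_def partial_const)
   also have "... = partial i (%x. Ph x * ph x) x" by simp
   also have "... = Ph x * partial i ph x + partial i Ph x * ph x"
   by (intro partial_mult smooth_differentiable test_smooth[OF Ph(1)] test_smooth[OF ph])
   finally show ?thesis by (simp add: grad_def)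
  qed
  moreover have "integrable (lebesgue_on S) (%x. Ph x * partial i ph x)" "integrable (lebesgue_on S) (%x. grad Ph x $ i * ph x)"
   using test_integrable[OF test_mult_smooth'[OF Ph(1) test_smooth[OF test_partial[OF ph]]]]
   test_integrable[OF test_mult_smooth'[OF test_partial[OF Ph(1)] test_smooth[OF ph]]] by (auto simp: grad_def intro: integrable_restrict S_sets)
  ultimately show "(LIO S (%x. Ph x * partial i ph x)) = - (LIO S (%x. grad Ph x $ i * ph x))" by (simp add: eq_neg_iff_add_eq_0)
 qed
 have n1: "NT S G (%x. - of_real (k^2) * w x) Ph (grad Ph) = 0" by (rule zero_trace_normal_trace[OF S(1) zt wL(2) L2_on_cmult[OF wL(1) S_sets] w(2)])
 have n2: "NT S (grad Ph) (laplacian Ph) w G = 0" by (rule zero_trace_normal_trace[OF S(1) w(1) PhL(2,3) has_weak_div_test[OF Ph(1) S_sets]])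
 show ?thesis by (rule green_difference[OF S_sets wL Ph(1) n1 n2])
qed

text \<open>The field ph * grad Ph is tangential on the facets, so the normal trace of grad Ph
  vanishes against all of H^1, in particular against w, which is not smooth. The other boundary term
  is the Neumann condition itself.\<close>

lemma neumann_test_zero:
 assumes lip: "lipschitz_boundary S" and w: "H1G S w G"
  and nt: "!!ps H. H1G S ps H ==> NT S G (%x. - of_real (k^2) * w x) ps H = 0"
  and Ph: "test UNIV Ph" "!!F a b x. F : facets S ==> x : F ==> a ~= 0 ==> F <= {x. a *. x = b} ==> dir_deriv a Ph x = 0"
 shows "(LIO S (%x. w x * helm k Ph x)) = 0"
proof -
 have wL: "L2_on S w" "L2_on S G" using w by (auto simp: has_H1_gradient_def)
 note PhL = L2_on_test[OF Ph(1) S_sets]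
 have n1: "NT S G (%x. - of_real (k^2) * w x) Ph (grad Ph) = 0" by (rule nt[OF has_H1_gradient_test[OF Ph(1) S_sets]])
 have n2: "NT S (grad Ph) (laplacian Ph) w G = 0"
 proof (rule normal_trace_zero[OF S(1) bounded_S lip PhL(2,3) _ w])
  fix ph :: "'n::finite fn" assume ph: "test UNIV ph"
  have "(LIO S (%x. (SU i. partial i (%x. partial i Ph x * ph x) x))) = 0"
  proof (rule divergence_zero)
   show "test UNIV (%x. partial i Ph x * ph x)" for i by (rule test_mult_smooth'[OF test_partial[OF Ph(1)] test_smooth[OF ph]])
   fix F a b x assume F: "F : facets S" "x : F" "a ~= 0" "F <= {x. a *. x = b}"
   have "(SU i. of_real (a $ i) * (partial i Ph x * ph x)) = dir_deriv a Ph x * ph x" by (simp add: dir_deriv_def sum_distrib_right mult.assoc)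
   thus "(SU i. of_real (a $ i) * (partial i Ph x * ph x)) = 0" using Ph(2)[OF F] by simp
  qed
  moreover have "partial i (%x. partial i Ph x * ph x) x = partial i Ph x * partial i ph x + partial i (partial i Ph) x * ph x" for i x
   by (intro partial_mult smooth_differentiable test_smooth[OF test_partial[OF Ph(1)]] test_smooth[OF ph])
  ultimately show "(LIO S (%x. cdot (grad Ph x) (grad ph x) + laplacian Ph x * ph x)) = 0"
   by (simp add: cdot_def grad_def laplacian_def sum.distrib sum_distrib_right)
 qed
 show ?thesis by (rule green_difference[OF S_sets wL Ph(1) n1 n2])
qed

section \<open>Folding test functions and unfolding eigenfunctions\<close>

definition near :: "(real^'n) set => (real^'n => real^'n) set" where
 "near U = {sg \<in> SR. sg ` closure S Int U ~= {}}"

definition fold_sum :: "(real^'n) set => ((real^'n => real^'n) => real) => (real^'n => complex) => real^'n => complex" where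
 "fold_sum U e ph x = (SUM sg:near U. of_real (e sg) * ph (sg x))"

text \<open>Meant for w that vanish off the open set S: open tiles are disjoint, so at most one term
  is nonzero at each point, and e provides the sign on that tile.\<close>

definition unfold_sum :: "(real^'n) set => ((real^'n => real^'n) => real) => (real^'n => complex) => real^'n => complex" where
 "unfold_sum U e w x = (SUM sg:near U. of_real (e sg) * w (inv sg x))"

lemma near_rigid: "sg : near U ==> rigid sg"
 unfolding near_def using sr_rigid by blast

lemma near_finite: "bounded U ==> finite (near U)"
 unfolding near_def by (rule sr_finite)

lemma rigid_inv: assumes "rigid sg" shows "rigid (inv sg)" "inv sg (sg x) = x" "sg (inv sg x) = x"
proof -
 obtain ta where ta: "rigid ta" "!!x. ta (sg x) = x" "!!x. sg (ta x) = x" by (rule rigid_inverse[OF assms]) (rule that)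
 have "inv sg = ta" by (rule inv_equality) (use ta in auto)
 thus "rigid (inv sg)" "inv sg (sg x) = x" "sg (inv sg x) = x" using ta by simp_all
qed

text \<open>As U lies in T, the point sg x shows that the facet of the tile meets T, so the
  reflection is allowed; being fixed, it also shows that the mirror tile meets U.\<close>

lemma near_reflect:
 assumes F: "F : facets S" "x : F" "a ~= 0" "F <= {x. a *. x = b}" and U: "U <= T" and sg: "sg : near U" "sg x : U"
 shows "sg o hrefl a b : near U" "(sg o hrefl a b) x = sg x"
proof -
 have "hrefl a b x = x" by (rule hyperplane_reflection_fixed) (use F(2,4) in blast)
 hence fx: "(sg o hrefl a b) x = sg x" by simp
 thus "(sg o hrefl a b) x = sg x" .
 have "sg : SR" using sg(1) by (simp add: near_def)
 moreover have "sg ` F Int T ~= {}" using F(2) sg(2) U by blast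
 ultimately have "sg o hrefl a b : SR" using F by (intro sr_reflect[of _ F])
 moreover have "F <= frontier S" by (rule facetE[OF F(1)])
 hence "x : closure S" using F(2) frontier_S by blast
 hence "(sg o hrefl a b) ` closure S Int U ~= {}" using fx sg(2) by (metis disjoint_iff imageI)
 ultimately show "sg o hrefl a b : near U" by (simp add: near_def)
qed

lemma fold_sum_test:
 assumes "test U ph" shows "test UNIV (fold_sum U e ph)"
 unfolding fold_sum_def[abs_def] by (rule test_sum, rule test_cmult, rule test_rigid[OF near_rigid test_UNIV[OF assms]])

lemma reflection_twice: "a ~= 0 ==> sg o hrefl a b o hrefl a b = sg" by (rule ext) (simp add: hyperplane_reflection_involution)

lemma fold_sum_dirichlet:
 assumes F: "F : facets S" "x : F" and U: "U <= T" "bounded U" and ph: "test U ph"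
 shows "fold_sum U orientation ph x = 0"
proof -
 obtain a b where a: "a ~= 0" "F <= {x. a *. x = b}" by (rule facetE[OF F(1)]) (rule that)
 obtain K where K: "compact K" "K <= U" "!!x. x ~: K ==> ph x = 0" by (rule test_functionE[OF ph]) (rule that)
 \<comment> \<open>Terms with sg x outside U vanish. On the remaining index set, composition with
   the reflection is an involution.\<close>
 have "fold_sum U orientation ph x = (SUM sg:{sg\<in>near U. sg x : U}. of_real (orientation sg) * ph (sg x))"
  unfolding fold_sum_def by (rule sum.mono_neutral_right[OF near_finite[OF U(2)]]) (use K in auto)
 also have "... = 0"
 proof (rule sum_involution_zero[where i="%sg. sg o hrefl a b"])
  fix sg assume "sg : {sg\<in>near U. sg x : U}"
  hence sg: "sg : near U" "sg x : U" by auto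
  note nr = near_reflect[OF F a U(1) sg]
  show "sg o hrefl a b : {sg\<in>near U. sg x : U}" using nr sg(2) by simp
  show "sg o hrefl a b o hrefl a b = sg" by (rule reflection_twice[OF a(1)])
  show "of_real (orientation (sg o hrefl a b)) * ph ((sg o hrefl a b) x) = - (of_real (orientation sg) * ph (sg x))"
   unfolding nr(2) orientation_reflection[OF near_rigid[OF sg(1)] a(1)] by simp
 qed
 finally show ?thesis .
qed

lemma fold_sum_neumann:
 assumes F: "F : facets S" "x : F" "a ~= 0" "F <= {x. a *. x = b}" and U: "U <= T" "bounded U" and ph: "test U ph"
 shows "dir_deriv a (fold_sum U (%sg. 1) ph) x = 0"
proof -
 obtain K where K: "compact K" "K <= U" "!!x. x ~: K ==> ph x = 0" "!!x i. x ~: K ==> partial i ph x = 0" by (rule test_functionE[OF ph]) (rule that)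
 have sm: "smooth (%x. ph (sg x))" if "sg : near U" for sg by (rule smooth_rigid[OF near_rigid[OF that] test_smooth[OF ph]])
 have "fold_sum U (%sg. 1) ph = (%x. SUM sg:near U. ph (sg x))" by (simp add: fold_sum_def[abs_def])
 hence "dir_deriv a (fold_sum U (%sg. 1) ph) x = (SUM sg:near U. dir_deriv a (%x. ph (sg x)) x)" by (simp add: dir_deriv_sum[OF sm])
 also have "... = (SUM sg:{sg\<in>near U. sg x : U}. dir_deriv a (%x. ph (sg x)) x)"
 proof (rule sum.mono_neutral_right[OF near_finite[OF U(2)]])
  show "ALL sg:near U - {sg\<in>near U. sg x : U}. dir_deriv a (%x. ph (sg x)) x = 0"
  proof
   fix sg assume sg: "sg : near U - {sg\<in>near U. sg x : U}"
   then obtain L c where L: "orthogonal_transformation L" "sg = (%x. L x + c)" using near_rigid unfolding rigid_def by blast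
   have "sg x ~: K" using sg K(2) by blast
   hence "dir_deriv v ph (L x + c) = 0" for v using K(4) by (simp add: dir_deriv_def L(2))
   thus "dir_deriv a (%x. ph (sg x)) x = 0"
   unfolding L(2) dir_deriv_affine[OF orthogonal_transformation_linear[OF L(1)] test_smooth[OF ph]] .
  qed
 qed auto
 also have "... = 0"
 proof (rule sum_involution_zero[where i="%sg. sg o hrefl a b"])
  fix sg assume "sg : {sg\<in>near U. sg x : U}"
  hence sg: "sg : near U" "sg x : U" by auto
  note nr = near_reflect[OF F U(1) sg]
  show "sg o hrefl a b : {sg\<in>near U. sg x : U}" using nr sg(2) by simp
  show "sg o hrefl a b o hrefl a b = sg" by (rule reflection_twice[OF F(3)])
  let ?R = "hrefl a 0" and ?c = "hrefl a b 0"
  have "hrefl a b x = x" by (rule hyperplane_reflection_fixed) (use F(2,4) in blast)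
  hence Rx: "?R x + ?c = x" by (rule trans[OF hyperplane_reflection_affine[symmetric]])
  have "(%y. ph ((sg o hrefl a b) y)) = (%y. ph (sg (?R y + ?c)))"
   unfolding o_def by (rule ext) (subst hyperplane_reflection_affine, rule refl)
  \<comment> \<open>The reflection fixes x and its linear part sends a to - a, so the normal
    derivative changes sign.\<close>
  hence "dir_deriv a (%y. ph ((sg o hrefl a b) y)) x = dir_deriv (?R a) (%y. ph (sg y)) (?R x + ?c)"
   using dir_deriv_affine[OF linear_reflection sm[OF sg(1)], of a a ?c x] by simp
  also have "... = - dir_deriv a (%y. ph (sg y)) x"
   unfolding Rx hyperplane_reflection_normal[OF F(3)] by (simp add: dir_deriv_def sum_negf)
  finally show "dir_deriv a (%y. ph ((sg o hrefl a b) y)) x = - dir_deriv a (%y. ph (sg y)) x" .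
 qed
 finally show ?thesis .
qed

lemma helm_sum:
 fixes f :: "'j => real^'n => complex"
 assumes "!!j. j : J ==> smooth (f j)"
 shows "helm k (%x. SUM j:J. of_real (e j) * f j x) x = (SUM j:J. of_real (e j) * helm k (f j) x)"
proof -
 have c: "partial i (%x. SUM j:J. of_real (e j) * g j x) = (%x. SUM j:J. of_real (e j) * partial i (g j) x)" if g: "!!j. j : J ==> smooth (g j)" for i and g :: "'j => real^'n => complex"
 proof
  fix x
  have "partial i (%x. SUM j:J. of_real (e j) * g j x) x = (SUM j:J. partial i (%x. of_real (e j) * g j x) x)"
   by (intro partial_sum smooth_mult smooth_const g)
  thus "partial i (%x. SUM j:J. of_real (e j) * g j x) x = (SUM j:J. of_real (e j) * partial i (g j) x)"
   by (simp add: partial_cmult smooth_differentiable g)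
 qed
 have c1: "partial i (%x. SUM j:J. of_real (e j) * f j x) = (%x. SUM j:J. of_real (e j) * partial i (f j) x)" for i by (rule c) (rule assms)
 have c2: "partial i (%x. SUM j:J. of_real (e j) * partial i (f j) x) = (%x. SUM j:J. of_real (e j) * partial i (partial i (f j)) x)" for i
  by (rule c) (rule smooth_partial[OF assms])
 show ?thesis
  unfolding helm_def laplacian_def c1 c2 by (simp add: sum.distrib sum_distrib_left distrib_left mult.left_commute sum.swap[of _ J])
qed

text \<open>In each of the finitely many terms the isometry is moved from w to ph by a change of
  variables; the Helmholtz operator commutes with it.\<close>

lemma unfold_sum_integral:
 assumes w: "L2 w" and U: "bounded U" and ph: "test U ph"
 shows "L2 (unfold_sum U e w)" "(LI x. unfold_sum U e w x * helm k ph x) = (LI x. w x * helm k (fold_sum U e ph) x)"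
proof -
 have Lw: "L2 (%x. w (inv sg x))" if "sg : near U" for sg by (rule L2_rigid[OF rigid_inv(1)[OF near_rigid[OF that]] w])
 show "L2 (unfold_sum U e w)" unfolding unfold_sum_def[abs_def] by (intro L2_sum L2_cmult Lw)
 have sm: "smooth (%x. ph (sg x))" if "sg : near U" for sg by (rule smooth_rigid[OF near_rigid[OF that] test_smooth[OF ph]])
 have i1: "Lint (%x. w (inv sg x) * helm k ph x)" if "sg : near U" for sg by (rule L2_product[OF Lw[OF that] L2_test[OF test_helm[OF ph]]])
 have i2: "Lint (%x. w x * helm k (%x. ph (sg x)) x)" if "sg : near U" for sg
  by (rule L2_product[OF w L2_test[OF test_helm[OF test_rigid[OF near_rigid[OF that] test_UNIV[OF ph]]]]])
 have cv: "(LI x. w (inv sg x) * helm k ph x) = (LI x. w x * helm k (%x. ph (sg x)) x)" if "sg : near U" for sg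
  using rigid_change_of_variables(2)[OF near_rigid[OF that] borel_measurable_integrable[OF i1[OF that]]]
  by (simp add: rigid_inv(2)[OF near_rigid[OF that]] helm_rigid[OF near_rigid[OF that] test_smooth[OF ph]])
 have "(LI x. unfold_sum U e w x * helm k ph x) = (LI x. (SUM sg:near U. of_real (e sg) * (w (inv sg x) * helm k ph x)))"
  by (simp add: unfold_sum_def sum_distrib_right mult.assoc)
 also have "... = (SUM sg:near U. of_real (e sg) * (LI x. w (inv sg x) * helm k ph x))" by (subst Bintegral_sum) (use i1 in auto)
 also have "... = (SUM sg:near U. of_real (e sg) * (LI x. w x * helm k (%x. ph (sg x)) x))"
  using cv by simp
 also have "... = (LI x. (SUM sg:near U. of_real (e sg) * (w x * helm k (%x. ph (sg x)) x)))" by (subst Bintegral_sum) (use i2 in auto)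
 also have "... = (LI x. w x * helm k (fold_sum U e ph) x)"
 proof -
  have "helm k (fold_sum U e ph) x = (SUM sg:near U. of_real (e sg) * helm k (%x. ph (sg x)) x)" for x
   unfolding fold_sum_def[abs_def] by (rule helm_sum[OF sm])
  thus ?thesis by (simp add: sum_distrib_left mult.left_commute)
 qed
 finally show "(LI x. unfold_sum U e w x * helm k ph x) = (LI x. w x * helm k (fold_sum U e ph) x)" .
qed

lemma unfold_sum_eq:
 assumes e: "e id = 1" and w: "!!x. x ~: S ==> w x = 0" and U: "S <= U" "bounded U" and x: "x : S"
 shows "unfold_sum U e w x = w x"
proof -
 have id: "id : near U" unfolding near_def using successive_reflections.start[of S T] x U(1) closure_subset[of S] by auto
 have "w (inv sg x) = 0" if "sg : near U - {id}" for sg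
 proof (rule w, rule notI)
  assume "inv sg x : S"
  hence "x : sg ` S" using rigid_inv(3)[OF near_rigid, of sg U x] that by (metis DiffD1 imageI)
  moreover have "sg ` S Int id ` S = {}" using that id by (intro sr_disjoint) (auto simp: near_def)
  ultimately show False using x by auto
 qed
 hence "unfold_sum U e w x = of_real (e id) * w (inv id x)"
  unfolding unfold_sum_def by (subst sum.remove[OF near_finite[OF U(2)] id]) (simp add: sum.neutral)
 thus ?thesis using e by simp
qed

theorem extension_exists:
 assumes k: "k > 0" and conn: "connected S" and w: "L2 w" "!!x. x ~: S ==> w x = 0" and e: "e id = 1"
  and fold: "!!U ph. U <= T ==> bounded U ==> test U ph ==> (LI x. w x * helm k (fold_sum U e ph) x) = 0"
 shows "EX v D. open D & connected D & closure S <= D & smooth v & (ALL x:D. helm k v x = 0) & (AEL x. x : S --> v x = w x)"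
proof -
 have cS: "compact (closure S)" using bounded_S by simp
 obtain d where d: "d > 0" "(UN x:closure S. ball x d) <= T" by (rule compact_subset_open_imp_ball_epsilon_subset[OF cS T]) (rule that)
 \<comment> \<open>The weak equation holds in the neighbourhood U of width d. Kernels of radius r <=
   d/2 centred in the neighbourhood D of width d/2 stay inside U, so Weyl's lemma applies on
   D.\<close>
 define U where "U = (UN x:closure S. ball x d)"
 define D where "D = (UN x:closure S. ball x (d/2))"
 define r where "r = min (d/2) 1"
 have r: "r > 0" "r <= 1" "r <= d/2" using d by (auto simp: r_def)
 have SU: "closure S <= U" unfolding U_def using d by auto
 have bU: "bounded U"
 proof -
  obtain R where R: "!!x. x : closure S ==> norm x <= R" using compact_imp_bounded[OF cS] unfolding bounded_iff by blast
  have "norm y <= R + d" if "y : U" for y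
  proof -
   obtain x where x: "x : closure S" "dist x y < d" using \<open>y : U\<close> unfolding U_def by auto
   thus ?thesis using R[OF x(1)] norm_triangle_ineq2[of y x] by (simp add: dist_norm norm_minus_commute)
  qed
  thus ?thesis unfolding bounded_iff by blast
 qed
 let ?u = "unfold_sum U e w"
 define K where "K = (UN sg:near U. sg ` closure S)"
 have K: "compact K" unfolding K_def by (intro compact_UN near_finite bU compact_continuous_image rigid_continuous cS near_rigid)
 have uK: "?u x = 0" if "x ~: K" for x
  unfolding unfold_sum_def
 proof (rule sum.neutral, rule ballI)
  fix sg assume sg: "sg : near U"
  have "inv sg x ~: S"
  proof
   assume "inv sg x : S"
   hence "sg (inv sg x) : sg ` closure S" using closure_subset by blast
   thus False using that sg rigid_inv(3)[OF near_rigid[OF sg]] by (auto simp: K_def)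
  qed
  thus "of_real (e sg) * w (inv sg x) = 0" using w(2) by simp
 qed
 have uL: "L2 ?u" by (rule unfold_sum_integral(1)[OF w(1) bU test_zero])
 have UT: "U <= T" using d(2) by (simp add: U_def)
 have weak: "weak_helm k U ?u" unfolding weak_helm_def using unfold_sum_integral(2)[OF w(1) bU] fold[OF UT bU] by simp
 have oD: "open D" unfolding D_def by (intro open_UN ballI open_ball)
 have SD: "closure S <= D" unfolding D_def using d(1) by auto
 have cD: "connected D"
 proof -
  have "D = (UN x:closure S. closure S Un ball x (d/2))" using SD S_ne closure_subset[of S] unfolding D_def by auto
  moreover have "connected (UN x:closure S. closure S Un ball x (d/2))"
  proof (rule connected_Union)
   fix C assume "C : (%x. closure S Un ball x (d/2)) ` closure S"
   then obtain x where x: "x : closure S" "C = closure S Un ball x (d/2)" by blast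
   show "connected C" unfolding x(2) by (rule connected_Un[OF connected_imp_connected_closure[OF conn] connected_ball]) (use x(1) d(1) in auto)
  next
   show "\<Inter>((%x. closure S Un ball x (d/2)) ` closure S) ~= {}" using S_ne closure_subset[of S] by blast
  qed
  ultimately show ?thesis by simp
 qed
 have sub: "cball y r <= U" if y: "y : D" for y
 proof
  fix z assume z: "z : cball y r"
  obtain x where x: "x : closure S" "dist x y < d/2" using y unfolding D_def by auto
  have "dist x z < d" using x(2) z r(3) dist_triangle[of x z y] by simp
  thus "z : U" using x(1) by (auto simp: U_def)
 qed
 have Dm: "D : sets lebesgue" using oD by simp
 have "EX v. smooth v & (ALL x:D. helm k v x = 0) & (AEL x. x : D --> v x = ?u x)" by (rule Weyl_lemma[OF k uL K uK weak r(1,2) Dm sub]) blast+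
 then obtain v where v: "smooth v" "!!x. x : D ==> helm k v x = 0" "AEL x. x : D --> v x = ?u x" by blast
 have SD': "S <= D" "S <= U" using SD SU closure_subset[of S] by auto
 have "AEL x. x : S --> v x = w x"
  using v(3)
 proof eventually_elim
  case (elim x)
  show ?case
  proof
   assume x: "x : S"
   have "?u x = w x" by (rule unfold_sum_eq) (use e w(2) SD' bU x in simp_all)
   thus "v x = w x" using elim SD'(1) x by auto
  qed
 qed
 with oD cD SD v(1,2) show ?thesis by (intro exI[of _ v] exI[of _ D] conjI ballI)
qed

end

section \<open>Non-scattering and transmission frequencies\<close>

lemma cmat_mat: "cmat (mat c) *v v = c *R v"
proof -
 have "(SU j. complex_of_real (mat c $ i $ j) * v $ j) = (SU j. if i = j then complex_of_real c * v $ j else 0)" for i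
  by (intro sum.cong) (auto simp: mat_def)
 thus ?thesis by (simp add: vec_eq_iff cmat_def matrix_vector_mult_def scaleR_conv_of_real[where 'a=complex])
qed

lemma cdot_scaleR: "cdot (c *R v) w = of_real c * cdot v w" by (simp add: cdot_def sum_distrib_left scaleR_conv_of_real[where 'a=complex] mult.assoc)

lemma cdot_linear: "cdot (v + v') w = cdot v w + cdot v' w" "cdot (v - v') w = cdot v w - cdot v' w" "cdot 0 w = 0"
 by (simp_all add: cdot_def distrib_right left_diff_distrib sum.distrib sum_subtractf)

lemma L2_on_add:
 assumes "L2_on U f" "L2_on U g" "U : sets lebesgue" shows "L2_on U (%x. f x + g x)"
proof -
 have "L2 (%x. (if x : U then f x else 0) + (if x : U then g x else 0))" using assms by (intro L2_add) (simp_all add: L2_on_iff)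
 moreover have "(%x. (if x : U then f x else 0) + (if x : U then g x else 0)) = (%x. if x : U then f x + g x else 0)" by auto
 ultimately show ?thesis using assms(3) by (simp add: L2_on_iff)
qed

lemma L2_on_scaleR:
 assumes "L2_on U f" "U : sets lebesgue" shows "L2_on U (%x. c *R f x)"
proof -
 have "L2 (%x. c *R (if x : U then f x else 0))" using assms by (intro L2_scaleR) (simp_all add: L2_on_iff)
 moreover have "(%x. c *R (if x : U then f x else 0)) = (%x. if x : U then c *R f x else 0)" by auto
 ultimately show ?thesis using assms(2) by (simp add: L2_on_iff)
qed

lemma L2_on_diff:
 assumes "L2_on U f" "L2_on U g" "U : sets lebesgue" shows "L2_on U (%x. f x - g x)"
 using L2_on_add[OF assms(1) L2_on_scaleR[OF assms(2,3), of "-1"] assms(3)] by simp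

lemma AE_on_iff:
 assumes "U : sets lebesgue" shows "(AE x in lebesgue_on U. P x) <-> (AEL x. x : U --> P x)"
 using assms by (simp add: AE_restrict_space_iff)

lemma integral_supported:
 fixes f g :: "'n::finite fn"
 assumes U: "U : sets lebesgue" and g: "integrable (lebesgue_on U) g" and ae: "AEL x. f x = (if x : U then g x else 0)"
 shows "(LI x. f x) = (LIO U (%x. g x))"
proof -
 have "Lint (%x. indicator U x *R g x)" using g U by (simp add: integrable_restrict_space)
 moreover have "(%x. indicator U x *R g x) = (%x. if x : U then g x else 0)" by auto
 ultimately have m: "(%x. if x : U then g x else 0) : LM" by (simp add: borel_measurable_integrable)
 have "AEL x. (if x : U then g x else 0) = f x" using ae by eventually_elim simp
 from borel_measurable_AE[OF m this] have "f : LM" .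
 hence "(LI x. f x) = (LI x. (if x : U then g x else 0))" by (rule integral_cong_AE[OF _ m ae])
 thus ?thesis by (simp add: integral_on[OF U])
qed

lemma H1_gradient_unique:
 fixes U :: "(real^'n) set"
 assumes U: "open U" and u: "H1G U u G" "H1G U v H" and eq: "AEL x. x : U --> u x = v x"
 shows "AEL x. x : U --> G x = H x"
proof -
 have Um: "U : sets lebesgue" using U by simp
 have L: "L2_on U u" "L2_on U G" "L2_on U v" "L2_on U H" using u by (auto simp: has_H1_gradient_def)
 have "AEL x. x : U --> G x $ i = H x $ i" for i
 proof -
  define g where "g x = (if x : U then G x $ i - H x $ i else 0)" for x
  have "L2_on U (%x. G x $ i - H x $ i)" by (intro L2_on_diff L2_on_component L Um)
  hence g: "L2 g" unfolding g_def[abs_def] by (simp add: L2_on_iff[OF Um])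
  have "AEL x. x : U --> g x = 0"
  proof (rule fundamental_lemma[OF g U])
   fix ph :: "'n fn" assume ph: "test U ph"
   have i: "integrable (lebesgue_on U) (%x. G x $ i * ph x)" "integrable (lebesgue_on U) (%x. H x $ i * ph x)"
   by (intro L2_on_product L2_on_component L Um L2_on_test(1)[OF test_UNIV[OF ph]])+
   have m: "(%x. u x * partial i ph x) : borel_measurable (lebesgue_on U)" "(%x. v x * partial i ph x) : borel_measurable (lebesgue_on U)"
   using L2_on_product[OF L(1) L2_on_test(1)[OF test_partial[OF test_UNIV[OF ph]] Um] Um]
   L2_on_product[OF L(3) L2_on_test(1)[OF test_partial[OF test_UNIV[OF ph]] Um] Um] by (simp_all add: borel_measurable_integrable)
   have "AE x in lebesgue_on U. u x * partial i ph x = v x * partial i ph x"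
   unfolding AE_on_iff[OF Um] using eq by eventually_elim simp
   from integral_cong_AE[OF m this] have uv: "(LIO U (%x. u x * partial i ph x)) = (LIO U (%x. v x * partial i ph x))" .
   have GH: "(LIO U (%x. G x $ i * ph x)) = (LIO U (%x. H x $ i * ph x))"
   proof -
   have "(LIO U (%x. u x * partial i ph x)) = - (LIO U (%x. G x $ i * ph x))"
   "(LIO U (%x. v x * partial i ph x)) = - (LIO U (%x. H x $ i * ph x))"
   using u ph unfolding has_H1_gradient_def by blast+
   thus ?thesis using uv by simp
   qed
   have "(LI x. g x * ph x) = (LIO U (%x. g x * ph x))" by (rule integral_on_test[OF ph Um, symmetric])
   also have "... = (LIO U (%x. G x $ i * ph x - H x $ i * ph x))" by (intro Bintegral_cong refl) (simp add: g_def left_diff_distrib)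
   also have "... = 0" using i GH by simp
   finally show "(LI x. g x * ph x) = 0" .
  qed
  thus ?thesis by eventually_elim (simp add: g_def)
 qed
 hence "AEL x. ALL i:UNIV. x : U --> G x $ i = H x $ i" by (intro AE_finite_allI) auto
 thus ?thesis by eventually_elim (simp add: vec_eq_iff)
qed

lemma L2_on_continuous:
 fixes f :: "'n::finite fn"
 assumes "compact K" "continuous_on K f" "U <= K" "U : sets lebesgue" shows "L2_on U f"
proof -
 obtain B where B: "!!x. x : K ==> norm (f x) <= B" using compact_imp_bounded[OF compact_continuous_image[OF assms(2,1)]] unfolding bounded_iff by blast
 have i: "integrable lborel (%x. indicator K x *R f x)" by (rule borel_integrable_compact[OF assms(1,2)])
 hence i: "Lint (%x. indicator K x *R f x)" by (simp add: integrable_completion borel_measurable_integrable)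
 have "L2 (%x. indicator K x *R f x)"
  unfolding L2_def
 proof
  show m: "(%x. indicator K x *R f x) : LM" by (rule borel_measurable_integrable[OF i])
  show "Lint (%x. (norm (indicator K x *R f x))^2)"
  proof (rule integrable_dominated)
   show "Lint (%x. B * norm (indicator K x *R f x))" by (intro integrable_mult_right integrable_norm i)
   show "(%x. (norm (indicator K x *R f x))^2) : LM" by (rule borel_measurable_power[OF measurable_compose[OF m borel_measurable_norm]])
   show "norm ((norm (indicator K x *R f x))^2) <= B * norm (indicator K x *R f x)" for x
   using mult_right_mono[OF B[of x] norm_ge_zero[of "f x"]] by (auto simp: power2_eq_square indicator_def)
  qed
 qed
 from L2_restrict[OF this assms(4)] have "L2 (%x. if x : U then indicator K x *R f x else 0)" by (simp add: L2_on_iff[OF assms(4)])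
 moreover have "(%x. if x : U then indicator K x *R f x else 0) = (%x. if x : U then f x else 0)"
  by (rule ext) (use assms(3) in "auto simp: indicator_def")
 ultimately show ?thesis by (simp add: L2_on_iff[OF assms(4)])
qed

lemma classical_H1:
 fixes U :: "(real^'n) set"
 assumes U: "open U" "bounded U" "closure U <= D" and D: "open D" and v: "Ck_on 2 D v" "!!x. x : D ==> laplacian v x + of_real (k^2) * v x = 0"
 shows "H1G U v (grad v)" "WD U (grad v) (%x. - of_real (k^2) * v x)"
proof -
 have Um: "U : sets lebesgue" using U by simp
 have cU: "compact (closure U)" using U by simp
 have c1: "Ck_on 1 D v" using v(1) by (rule Ck_on_mono[rotated]) simp
 have c2: "Ck_on 1 D (partial i v)" for i using v(1) by (simp add: numeral_2_eq_2)
 have L: "L2_on U v" "L2_on U (partial i v)" for i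
  by (rule L2_on_continuous[OF cU continuous_on_subset[OF Ck_on_continuous U(3)] closure_subset Um], rule c1 c2)+
 have "L2 (%x. (if x : U then grad v x else 0) $ i)" for i
 proof -
  have "(%x. (if x : U then grad v x else 0) $ i) = (%x. if x : U then partial i v x else 0)" by (auto simp: grad_def)
  thus ?thesis using L(2)[of i] by (simp add: L2_on_iff[OF Um])
 qed
 hence LG: "L2_on U (grad v)" unfolding L2_on_iff[OF Um] by (rule L2_vec)
 have UD: "U <= D" using U(3) closure_subset by blast
 show H: "H1G U v (grad v)"
  unfolding has_H1_gradient_def
 proof (intro conjI allI impI L LG)
  fix ph :: "'n fn" and i assume ph: "test U ph"
  show "(LIO U (%x. v x * partial i ph x)) = - (LIO U (%x. grad v x $ i * ph x))"
   unfolding integral_on_test[OF ph Um] integral_on_test[OF test_partial[OF ph] Um]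
   using integration_by_parts(3)[OF D c1 test_mono[OF ph UD], of i] by (simp add: grad_def)
 qed
 show "WD U (grad v) (%x. - of_real (k^2) * v x)"
  unfolding has_weak_div_def
 proof (intro allI impI)
  fix ph :: "'n fn" assume ph: "test U ph"
  note p = integration_by_parts[OF D c2 test_mono[OF ph UD]]
  have eq: "(LIO U (%x. partial i v x * partial i ph x)) = - (LIO U (%x. partial i (partial i v) x * ph x))" for i
   unfolding integral_on_test[OF ph Um] integral_on_test[OF test_partial[OF ph] Um] by (rule p(3))
  have i: "integrable (lebesgue_on U) (%x. partial i v x * partial i ph x)" "integrable (lebesgue_on U) (%x. partial i (partial i v) x * ph x)" for i
   by (rule integrable_restrict[OF p(1) Um], rule integrable_restrict[OF p(2) Um])
  have "(LIO U (%x. cdot (grad v x) (grad ph x))) = - (LIO U (%x. laplacian v x * ph x))"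
   unfolding cdot_def grad_def laplacian_def vec_lambda_beta sum_distrib_right
   by (simp add: Bintegral_sum[OF i(1)] Bintegral_sum[OF i(2)] eq sum_negf)
  also have "(LIO U (%x. laplacian v x * ph x)) = (LIO U (%x. - of_real (k^2) * v x * ph x))"
  proof (intro Bintegral_cong refl)
   fix x assume "x : space (lebesgue_on U)"
   hence "laplacian v x = - of_real (k^2) * v x" using v(2)[of x] UD by (auto simp: eq_neg_iff_add_eq_0)
   thus "laplacian v x * ph x = - of_real (k^2) * v x * ph x" by simp
  qed
  finally show "(LIO U (%x. cdot (grad v x) (grad ph x))) = - (LIO U (%x. - of_real (k^2) * v x * ph x))" .
 qed
qed

text \<open>A test function times a coordinate direction is an admissible field.\<close>

lemma zero_trace_extension:
 fixes U :: "(real^'n) set"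
 assumes U: "open U" and z: "zero_trace U w G" and ph: "test UNIV ph"
 shows "(LIO U (%x. w x * partial i ph x)) = - (LIO U (%x. G x $ i * ph x))"
proof -
 have Um: "U : sets lebesgue" using U by simp
 have L: "L2_on U w" "L2_on U G" using z by (auto simp: zero_trace_def has_H1_gradient_def)
 define V :: "real^'n => complex^'n" where "V x = (\<chi> j. if j = i then ph x else 0)" for x
 have LV: "L2 V"
 proof (rule L2_vec)
  show "L2 (%x. V x $ j)" for j using L2_test[OF ph] by (cases "j = i") (simp_all add: V_def L2_zero)
 qed
 have cV: "cdot (V x) v = v $ i * ph x" for x v
 proof -
  have "cdot (V x) v = (SU j. if j = i then v $ j * ph x else 0)" unfolding cdot_def by (intro sum.cong) (auto simp: V_def)
  thus ?thesis by simp
 qed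
 have wd: "WD U V (partial i ph)"
  unfolding has_weak_div_def
 proof (intro allI impI)
  fix ps :: "'n fn" assume "test U ps"
  hence "(LIO U (%x. ph x * partial i ps x)) = - (LIO U (%x. grad ph x $ i * ps x))"
   using has_H1_gradient_test[OF ph Um] unfolding has_H1_gradient_def by blast
  thus "(LIO U (%x. cdot (V x) (grad ps x))) = - (LIO U (%x. partial i ph x * ps x))" by (simp add: cV grad_def mult.commute)
 qed
 note pph = L2_on_test(1)[OF test_partial[OF ph] Um]
 have "NT U V (partial i ph) w G = 0" by (rule zero_trace_normal_trace[OF U z L2_restrict[OF LV Um] pph wd])
 hence "(LIO U (%x. G x $ i * ph x)) + (LIO U (%x. partial i ph x * w x)) = 0"
  unfolding normal_trace_add[OF L2_restrict[OF LV Um] pph L Um] cV .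
 thus ?thesis by (simp add: eq_neg_iff_add_eq_0 mult.commute add.commute)
qed

text \<open>Near infinity the zero function is the smooth representative, so the radiation integral
  is zero.\<close>

lemma radiation_condition_zero:
 fixes u :: "'n::finite fn"
 assumes "bounded {x. u x ~= 0}" shows "radiation_condition k u"
proof -
 obtain R where R: "R > 0" "!!x. u x ~= 0 ==> norm x <= R" using assms unfolding bounded_pos by blast
 have "radial_derivative (%x. 0) x = 0" for x :: "real^'n" by (simp add: radial_derivative_def frechet_derivative_const)
 hence z: "sphere_integral r (%x :: real^'n. (cmod (radial_derivative (%x. 0) x - \<i> * of_real k * 0))^2) = 0" for r
  by (simp add: sphere_integral_def)
 show ?thesis unfolding radiation_condition_def
  by (intro exI[of _ R] conjI exI[of _ "%x. 0"] R(1) Ck_on_const AE_I2) (use R(2) z in "auto simp: not_le[symmetric]")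
qed

lemma integral_on_cong: "(!!x. x : U ==> f x = g x) ==> (LIO U (%x. f x)) = (LIO U (%x. g x))" by (rule Bintegral_cong) auto

lemma L2_on_subset:
 assumes "L2_on D f" "E <= D" "E : sets lebesgue" "D : sets lebesgue" shows "L2_on E f"
proof -
 have "L2_on E (%x. if x : D then f x else 0)" using assms by (intro L2_restrict) (simp_all add: L2_on_iff)
 moreover have "(if x : E then (if x : D then f x else 0) else 0) = (if x : E then f x else 0)" for x using assms(2) by auto
 ultimately show ?thesis using assms(3) by (simp add: L2_on_iff)
qed

lemma H1_restrict:
 fixes D E :: "(real^'n) set"
 assumes "H1G D u G" "E <= D" "open E" "open D" shows "H1G E u G"
 unfolding has_H1_gradient_def
proof (intro conjI allI impI)
 have m: "E : sets lebesgue" "D : sets lebesgue" using assms(3,4) by auto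
 show "L2_on E u" "L2_on E G" using assms(1) m by (auto simp: has_H1_gradient_def intro: L2_on_subset[OF _ assms(2)])
 fix ph :: "'n fn" and i assume ph: "test E ph"
 have ph': "test D ph" by (rule test_mono[OF ph assms(2)])
 hence "(LIO D (%x. u x * partial i ph x)) = - (LIO D (%x. G x $ i * ph x))"
  using assms(1) unfolding has_H1_gradient_def by blast
 thus "(LIO E (%x. u x * partial i ph x)) = - (LIO E (%x. G x $ i * ph x))"
  unfolding integral_on_test[OF ph m(1)] integral_on_test[OF ph' m(2)]
   integral_on_test[OF test_partial[OF ph] m(1)] integral_on_test[OF test_partial[OF ph'] m(2)] .
qed

lemma L2_on_zero: "L2_on U (%x. 0)" by (simp add: L2_on_def)

lemma H1_zero: "H1G U (%x. 0) (%x. 0)" by (simp add: has_H1_gradient_def L2_on_zero)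

lemma zero_trace_zero:
 fixes U :: "(real^'n) set" shows "zero_trace U (%x. 0) (%x. 0)"
proof -
 have "grad (%x. 0) x = 0" for x :: "real^'n" by (simp add: grad_def partial_const vec_eq_iff)
 thus ?thesis unfolding zero_trace_def using H1_zero[of U] by (intro conjI exI[of _ "%n x. 0"]) (simp_all add: test_zero)
qed

lemma H1_lincomb:
 fixes U :: "(real^'n) set"
 assumes u: "H1G U u Gu" "H1G U v Gv" and U: "U : sets lebesgue"
 shows "H1G U (%x. of_real c * u x + of_real d * v x) (%x. c *R Gu x + d *R Gv x)"
 unfolding has_H1_gradient_def
proof (intro conjI allI impI)
 have L: "L2_on U u" "L2_on U Gu" "L2_on U v" "L2_on U Gv" using u by (auto simp: has_H1_gradient_def)
 show "L2_on U (%x. of_real c * u x + of_real d * v x)" "L2_on U (%x. c *R Gu x + d *R Gv x)" by (intro L2_on_add L2_on_cmult L2_on_scaleR L U)+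
 fix ph :: "'n fn" and i assume ph: "test U ph"
 note t = L2_on_test(1)[OF test_UNIV[OF ph] U] L2_on_test(1)[OF test_partial[OF test_UNIV[OF ph]] U]
 note Lc = L2_on_component[OF L(2) U] L2_on_component[OF L(4) U]
 have e: "(LIO U (%x. u x * partial i ph x)) = - (LIO U (%x. Gu x $ i * ph x))"
  "(LIO U (%x. v x * partial i ph x)) = - (LIO U (%x. Gv x $ i * ph x))"
  using u ph unfolding has_H1_gradient_def by blast+
 have "(LIO U (%x. (of_real c * u x + of_real d * v x) * partial i ph x)) =
   of_real c * (LIO U (%x. u x * partial i ph x)) + of_real d * (LIO U (%x. v x * partial i ph x))"
  using L2_on_product[OF L(1) t(2) U] L2_on_product[OF L(3) t(2) U] by (simp add: distrib_right mult.assoc)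
 moreover have "(LIO U (%x. (c *R Gu x + d *R Gv x) $ i * ph x)) =
   of_real c * (LIO U (%x. Gu x $ i * ph x)) + of_real d * (LIO U (%x. Gv x $ i * ph x))"
  using L2_on_product[OF Lc(1) t(1) U] L2_on_product[OF Lc(2) t(1) U] by (simp add: distrib_right mult.assoc scaleR_conv_of_real[where 'a=complex])
 ultimately show "(LIO U (%x. (of_real c * u x + of_real d * v x) * partial i ph x)) =
   - (LIO U (%x. (c *R Gu x + d *R Gv x) $ i * ph x))" using e by simp
qed

lemma normal_trace_lincomb:
 assumes L: "L2_on U V" "L2_on U f" "L2_on U W" "L2_on U g" "L2_on U ps" "L2_on U H" and U: "U : sets lebesgue"
 shows "NT U (%x. c *R V x + d *R W x) (%x. of_real c * f x + of_real d * g x) ps H =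
  of_real c * NT U V f ps H + of_real d * NT U W g ps H"
proof -
 note i = L2_on_cdot[OF L(1,6) U] L2_on_cdot[OF L(3,6) U] L2_on_product[OF L(2,5) U] L2_on_product[OF L(4,5) U]
 have "NT U (%x. c *R V x + d *R W x) (%x. of_real c * f x + of_real d * g x) ps H =
  (LIO U (%x. of_real c * (cdot (V x) (H x) + f x * ps x) + of_real d * (cdot (W x) (H x) + g x * ps x)))"
  unfolding normal_trace_def by (intro Bintegral_cong refl) (simp add: cdot_linear cdot_scaleR algebra_simps)
 also have "... = of_real c * NT U V f ps H + of_real d * NT U W g ps H"
  unfolding normal_trace_def using i by (subst Bintegral_add) auto
 finally show ?thesis .
qed

lemma has_weak_div_iff:
 fixes U :: "(real^'n) set"
 assumes "L2_on U V" "L2_on U f" "U : sets lebesgue"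
 shows "WD U V f <-> (ALL ph. test U ph --> NT U V f ph (grad ph) = 0)"
proof -
 have "NT U V f ph (grad ph) = (LIO U (%x. cdot (V x) (grad ph x))) + (LIO U (%x. f x * ph x))"
  if "test U ph" for ph by (rule normal_trace_add[OF assms(1,2) L2_on_test(1,2)[OF test_UNIV[OF that] assms(3)] assms(3)])
 thus ?thesis unfolding has_weak_div_def by (simp add: eq_neg_iff_add_eq_0)
qed

lemma normal_trace_cong_AE:
 assumes L: "L2_on U V" "L2_on U f" "L2_on U V'" "L2_on U f'" "L2_on U ps" "L2_on U H" and U: "U : sets lebesgue"
  and eq: "AEL x. x : U --> V x = V' x" "AEL x. x : U --> f x = f' x"
 shows "NT U V f ps H = NT U V' f' ps H"
 unfolding normal_trace_def
proof (rule integral_cong_AE)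
 show "(%x. cdot (V x) (H x) + f x * ps x) : borel_measurable (lebesgue_on U)"
  by (rule borel_measurable_integrable[OF Bintegrable_add[OF L2_on_cdot[OF L(1,6) U] L2_on_product[OF L(2,5) U]]])
 show "(%x. cdot (V' x) (H x) + f' x * ps x) : borel_measurable (lebesgue_on U)"
  by (rule borel_measurable_integrable[OF Bintegrable_add[OF L2_on_cdot[OF L(3,6) U] L2_on_product[OF L(4,5) U]]])
 show "AE x in lebesgue_on U. cdot (V x) (H x) + f x * ps x = cdot (V' x) (H x) + f' x * ps x"
  unfolding AE_on_iff[OF U] using eq by eventually_elim simp
qed

section \<open>The transmission eigenvalue problem\<close>

locale scatterer =
 fixes S :: "(real^'n) set" and A :: "real^'n => real^'n^'n" and q :: "real^'n => real" and a :: real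
 assumes S: "open S" "bounded S" "S ~= {}" "connected S" "lipschitz_boundary S" and null: "negligible (frontier S)"
  and a: "a > 0" "a ~= 1"
  and A: "!!x. x : S ==> A x = mat a" "!!x. x ~: closure S ==> A x = mat 1"
  and q: "!!x. x : S ==> q x = a" "!!x. x ~: closure S ==> q x = 1"
begin

lemma Sm: "S : sets lebesgue" using S(1) by simp

text \<open>A and q are unspecified on the frontier; up to a null set the complement of S is the
  complement of its closure, where they are known.\<close>

lemma AE_outside: "AEL x. x ~: S --> x ~: closure S"
proof -
 have "AEL x. x ~: frontier S" using null by (intro AE_not_in) (simp add: negligible_iff_null_sets)
 thus ?thesis by eventually_elim (use S(1) in "auto simp: frontier_def interior_open")
qed

abbreviation F :: "real => (real^'n => complex) => real^'n => complex" where
 "F k u \<equiv> (%x. - of_real (k^2) * u x)"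

lemma F_lincomb: "F k (%x. of_real c * u x + of_real d * v x) = (%x. of_real c * F k u x + of_real d * F k v x)"
 by (rule ext) (simp add: algebra_simps)

lemma L2_F: "L2_on S u ==> L2_on S (F k u)" by (rule L2_on_cmult[OF _ Sm])

lemma normal_trace_coefficients:
 "NT S (%x. cmat (A x) *v Gu x) (%x. - of_real (k^2 * q x) * u x) ps H = of_real a * NT S Gu (F k u) ps H"
proof -
 have "NT S (%x. cmat (A x) *v Gu x) (%x. - of_real (k^2 * q x) * u x) ps H =
  (LIO S (%x. of_real a * (cdot (Gu x) (H x) + F k u x * ps x)))"
  unfolding normal_trace_def by (rule integral_on_cong) (simp add: A q cmat_mat cdot_scaleR algebra_simps)
 thus ?thesis by (simp add: normal_trace_def)
qed

lemma weak_div_coefficients: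
 "WD S (%x. cmat (A x) *v Gu x) (%x. - of_real (k^2 * q x) * u x) <-> WD S Gu (F k u)"
proof -
 have 1: "(LIO S (%x. cdot (cmat (A x) *v Gu x) (grad ph x))) = of_real a * (LIO S (%x. cdot (Gu x) (grad ph x)))" for ph
 proof -
  have "(LIO S (%x. cdot (cmat (A x) *v Gu x) (grad ph x))) = (LIO S (%x. of_real a * cdot (Gu x) (grad ph x)))"
   by (rule integral_on_cong) (simp add: A cmat_mat cdot_scaleR)
  thus ?thesis by simp
 qed
 have 2: "(LIO S (%x. - of_real (k^2 * q x) * u x * ph x)) = of_real a * (LIO S (%x. F k u x * ph x))" for ph
 proof -
  have "(LIO S (%x. - of_real (k^2 * q x) * u x * ph x)) = (LIO S (%x. of_real a * (F k u x * ph x)))"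
   by (rule integral_on_cong) (simp add: q algebra_simps)
  thus ?thesis by simp
 qed
 have 3: "of_real a * x = - (of_real a * y) <-> x = - y" for x y :: complex
  using a(1) by (metis mult_cancel_left mult_minus_right of_real_eq_0_iff less_irrefl)
 show ?thesis unfolding has_weak_div_def 1 2 3 ..
qed

text \<open>Division by a turns the equation of u into the Helmholtz equation; the constant remains
  only in the condition on the normal traces.\<close>

lemma transmission_iff:
 "k : transmission_eigenfrequencies S A q <-> k > 0 & (EX u v Gu Gv. H1G S u Gu & H1G S v Gv &
   ~ (AE x in lebesgue_on S. u x = 0 & v x = 0) & WD S Gu (F k u) & WD S Gv (F k v) &
   zero_trace S (%x. u x - v x) (%x. Gu x - Gv x) &
   (ALL ps H. H1G S ps H --> of_real a * NT S Gu (F k u) ps H = NT S Gv (F k v) ps H))"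
 unfolding transmission_eigenfrequencies_def mem_Collect_eq normal_trace_coefficients weak_div_coefficients ..

lemma transmission_subset: "transmission_eigenfrequencies S A q <= dirichlet_eigenfrequencies S Un neumann_eigenfrequencies S"
proof
 fix k assume "k : transmission_eigenfrequencies S A q"
 then obtain u v Gu Gv where k: "k > 0" and u: "H1G S u Gu" and v: "H1G S v Gv"
  and nz: "~ (AE x in lebesgue_on S. u x = 0 & v x = 0)" and du: "WD S Gu (F k u)" and dv: "WD S Gv (F k v)"
  and zt: "zero_trace S (%x. u x - v x) (%x. Gu x - Gv x)"
  and nt: "!!ps H. H1G S ps H ==> of_real a * NT S Gu (F k u) ps H = NT S Gv (F k v) ps H"
  unfolding transmission_iff by blast
 have L: "L2_on S u" "L2_on S Gu" "L2_on S v" "L2_on S Gv" using u v by (auto simp: has_H1_gradient_def)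
 note LF = L2_F[OF L(1), of k] L2_F[OF L(3), of k]
 have lc: "NT S (%x. c *R Gu x + d *R Gv x) (F k (%x. of_real c * u x + of_real d * v x)) ps H =
  of_real c * NT S Gu (F k u) ps H + of_real d * NT S Gv (F k v) ps H" if "L2_on S ps" "L2_on S H" for c d ps H
  unfolding F_lincomb by (rule normal_trace_lincomb[OF L(2) LF(1) L(4) LF(2) that Sm])
 have div: "WD S (%x. c *R Gu x + d *R Gv x) (F k (%x. of_real c * u x + of_real d * v x))" for c d
 proof (subst has_weak_div_iff)
  show "L2_on S (%x. c *R Gu x + d *R Gv x)" "L2_on S (F k (%x. of_real c * u x + of_real d * v x))" "S : sets lebesgue"
   by (intro L2_F L2_on_add L2_on_cmult L2_on_scaleR L Sm)+
  show "ALL ph. test S ph --> NT S (%x. c *R Gu x + d *R Gv x) (F k (%x. of_real c * u x + of_real d * v x)) ph (grad ph) = 0"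
  proof (intro allI impI)
   fix ph :: "'n::finite fn" assume ph: "test S ph"
   have "NT S Gu (F k u) ph (grad ph) = 0" "NT S Gv (F k v) ph (grad ph) = 0"
   using du dv ph has_weak_div_iff[OF L(2) LF(1) Sm] has_weak_div_iff[OF L(4) LF(2) Sm] by blast+
   thus "NT S (%x. c *R Gu x + d *R Gv x) (F k (%x. of_real c * u x + of_real d * v x)) ph (grad ph) = 0"
   using lc[OF L2_on_test(1,2)[OF test_UNIV[OF ph] Sm], of c d] by simp
  qed
 qed
 show "k : dirichlet_eigenfrequencies S Un neumann_eigenfrequencies S"
 proof (cases "AE x in lebesgue_on S. u x - v x = 0")
  case False
  have "WD S (%x. Gu x - Gv x) (F k (%x. u x - v x))" using div[of 1 "-1"] by simp
  thus ?thesis using False zt k unfolding dirichlet_eigenfrequencies_def zero_trace_def by blast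
 next
  case True
  \<comment> \<open>Where u = v, the function a u - v equals (a - 1) u; it is nonzero because a ~=
    1.\<close>
  let ?w = "%x. of_real a * u x + of_real (-1) * v x" and ?G = "%x. a *R Gu x + (-1) *R Gv x"
  have "NT S ?G (F k ?w) ps H = 0" if "H1G S ps H" for ps H
   using lc[of ps H a "-1"] nt[OF that] that by (simp add: has_H1_gradient_def)
  moreover have "~ (AE x in lebesgue_on S. ?w x = 0)"
  proof
   assume "AE x in lebesgue_on S. ?w x = 0"
   with True have "AE x in lebesgue_on S. u x = 0 & v x = 0"
   proof eventually_elim
   case (elim x)
   hence "v x = u x" "(of_real a - 1) * u x = 0" by (simp_all add: left_diff_distrib)
   moreover have "complex_of_real a - 1 ~= 0" using a(2) by (metis eq_iff_diff_eq_0 of_real_eq_1_iff)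
   ultimately show ?case by simp
   qed
   thus False using nz by simp
  qed
  ultimately show ?thesis using k H1_lincomb[OF u v Sm, of a "-1"] div[of a "-1"] unfolding neumann_eigenfrequencies_def by blast
 qed
qed

lemma dirichlet_subset: "dirichlet_eigenfrequencies S <= transmission_eigenfrequencies S A q"
proof
 fix k assume "k : dirichlet_eigenfrequencies S"
 then obtain w G where k: "k > 0" and w: "H1G S w G" "~ (AE x in lebesgue_on S. w x = 0)" "WD S G (F k w)" "zero_trace S w G"
  unfolding dirichlet_eigenfrequencies_def by blast
 have L: "L2_on S w" "L2_on S G" using w(1) by (auto simp: has_H1_gradient_def)
 \<comment> \<open>The pair is u = c w, v = a c w: normal traces match automatically, and u - v = w
   requires c (1 - a) = 1.\<close>
 define c where "c = 1 / (1 - a)"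
 have c: "c - a * c = 1" "c ~= 0" using a(2) by (simp_all add: c_def field_simps)
 have h: "H1G S (%x. of_real d * w x) (%x. d *R G x)" for d
  using H1_lincomb[OF w(1) w(1) Sm, of d 0] by simp
 have nt: "NT S (%x. d *R G x) (F k (%x. of_real d * w x)) ps H = of_real d * NT S G (F k w) ps H" if "L2_on S ps" "L2_on S H" for d ps H
  using normal_trace_lincomb[OF L(2) L2_F[OF L(1), of k] L(2) L2_F[OF L(1), of k] that Sm, of d 0] F_lincomb[of k d w 0 w] by simp
 have div: "WD S (%x. d *R G x) (F k (%x. of_real d * w x))" for d
 proof (subst has_weak_div_iff)
  show "L2_on S (%x. d *R G x)" "L2_on S (F k (%x. of_real d * w x))" "S : sets lebesgue" by (intro L2_F L2_on_cmult L2_on_scaleR L Sm)+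
  show "ALL ph. test S ph --> NT S (%x. d *R G x) (F k (%x. of_real d * w x)) ph (grad ph) = 0"
   using nt[OF L2_on_test(1,2)[OF test_UNIV Sm]] has_weak_div_iff[OF L(2) L2_F[OF L(1)] Sm] w(3) by auto
 qed
 have eq: "(%x. of_real c * w x - of_real (a * c) * w x) = w" "(%x. c *R G x - (a * c) *R G x) = G"
  using c(1) by (simp_all add: left_diff_distrib[symmetric] of_real_diff[symmetric] scaleR_diff_left[symmetric] del: of_real_mult of_real_diff)
 have "~ (AE x in lebesgue_on S. of_real c * w x = 0 & of_real (a * c) * w x = 0)" using w(2) c(2) a(1) by simp
 moreover have "of_real a * NT S (%x. c *R G x) (F k (%x. of_real c * w x)) ps H =
  NT S (%x. (a * c) *R G x) (F k (%x. of_real (a * c) * w x)) ps H" if "H1G S ps H" for ps H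
 proof -
  have "L2_on S ps" "L2_on S H" using that by (auto simp: has_H1_gradient_def)
  from nt[OF this, of c] nt[OF this, of "a * c"] show ?thesis by (simp only: of_real_mult mult.assoc)
 qed
 moreover have "zero_trace S (%x. of_real c * w x - of_real (a * c) * w x) (%x. c *R G x - (a * c) *R G x)" unfolding eq by (rule w(4))
 ultimately show "k : transmission_eigenfrequencies S A q" unfolding transmission_iff
  using k h[of c] h[of "a * c"] div[of c] div[of "a * c"] by blast
qed

text \<open>Take u = v = w: the traces agree, and both normal traces vanish, whatever the factor
  a.\<close>

lemma neumann_subset: "neumann_eigenfrequencies S <= transmission_eigenfrequencies S A q"
proof
 fix k assume "k : neumann_eigenfrequencies S"
 then obtain w G where k: "k > 0" and w: "H1G S w G" "~ (AE x in lebesgue_on S. w x = 0)" "WD S G (F k w)"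
  "!!ps H. H1G S ps H ==> NT S G (F k w) ps H = 0"
  unfolding neumann_eigenfrequencies_def by blast
 have "zero_trace S (%x. w x - w x) (%x. G x - G x)" using zero_trace_zero[of S] by simp
 thus "k : transmission_eigenfrequencies S A q" unfolding transmission_iff
  using k w by (intro conjI exI[of _ w] exI[of _ G]) auto
qed

end

section \<open>The scattering problem\<close>

context scatterer
begin

lemma test_in_ball:
 fixes ph :: "'n::finite fn"
 assumes "test UNIV ph" obtains R where "R > 0" "test (ball 0 R) ph" "closure S <= ball 0 R"
proof -
 obtain K where K: "compact K" "K <= UNIV" "!!x. x ~: K ==> ph x = 0" by (rule test_functionE[OF assms]) (rule that)
 have "bounded (K Un closure S)" using K(1) S(2) compact_imp_bounded by auto
 then obtain R where R: "R > 0" "!!x. x : K Un closure S ==> norm x < R" unfolding bounded_pos_less by blast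
 have "test (ball 0 R) ph" by (rule test_functionI[OF test_smooth[OF assms] K(1) _ K(3)]) (use R in auto)
 thus thesis using R by (intro that[of R]) auto
qed

lemma Smc: "- S : sets lebesgue" using Sm by (simp add: Compl_in_sets_lebesgue)

lemma open_domain_ball: "R > 0 ==> open_domain (ball (0::real^'n) R)" by (simp add: open_domain_def)

lemma normal_trace_F:
 assumes "L2_on S V" "L2_on S w" and ph: "test UNIV ph"
 shows "NT S V (F k w) ph (grad ph) = (LIO S (%x. cdot (V x) (grad ph x))) - of_real (k^2) * (LIO S (%x. w x * ph x))"
proof -
 have "(LIO S (%x. F k w x * ph x)) = (LIO S (%x. (- of_real (k^2)) * (w x * ph x)))" by (simp only: mult.assoc)
 also have "... = - of_real (k^2) * (LIO S (%x. w x * ph x))" by (rule integral_mult_right_zero)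
 finally show ?thesis using normal_trace_add[OF assms(1) L2_F[OF assms(2)] L2_on_test(1,2)[OF ph Sm] Sm, of k] by simp
qed

text \<open>The weak form of the scattering problem for a scattered field vanishing outside \<open>S\<close>. The incident
  field enters only through a function \<open>w\<close> that agrees with it on \<open>S\<close> up to the factor \<open>c\<close>.\<close>

lemma weak_form_iff:
 assumes us: "L2_on S us" "L2_on S Gs" "AEL x. u x = (if x : S then us x else 0)" "AEL x. G x = (if x : S then Gs x else 0)"
  and w: "L2_on S w" "L2_on S Gw" "S <= D" "AEL x. x : S --> ui x = of_real c * w x" "AEL x. x : S --> grad ui x = c *R Gw x"
  and ph: "test UNIV ph"
 shows "- (LI x. cdot (cmat (A x) *v G x) (grad ph x)) + of_real (k^2) * (LI x. of_real (q x) * u x * ph x)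
   = (LI x. cdot (cmat (A x - mat 1) *v (if x : D then grad ui x else 0)) (grad ph x))
   - of_real (k^2) * (LI x. of_real (q x - 1) * (if x : D then ui x else 0) * ph x)
  <-> - (of_real a * NT S Gs (F k us) ph (grad ph)) = of_real ((a - 1) * c) * NT S Gw (F k w) ph (grad ph)"
proof -
 note t = L2_on_test(1,2)[OF ph Sm]
 have 1: "(LI x. cdot (cmat (A x) *v G x) (grad ph x)) = (LIO S (%x. of_real a * cdot (Gs x) (grad ph x)))"
 proof (rule integral_supported[OF Sm])
  show "integrable (lebesgue_on S) (%x. of_real a * cdot (Gs x) (grad ph x))" using L2_on_cdot[OF us(2) t(2) Sm] by simp
  show "AEL x. cdot (cmat (A x) *v G x) (grad ph x) = (if x : S then of_real a * cdot (Gs x) (grad ph x) else 0)"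
   using us(4) by eventually_elim (simp add: A cmat_mat cdot_scaleR cdot_linear)
 qed
 have 2: "(LI x. of_real (q x) * u x * ph x) = (LIO S (%x. of_real a * (us x * ph x)))"
 proof (rule integral_supported[OF Sm])
  show "integrable (lebesgue_on S) (%x. of_real a * (us x * ph x))" using L2_on_product[OF us(1) t(1) Sm] by simp
  show "AEL x. of_real (q x) * u x * ph x = (if x : S then of_real a * (us x * ph x) else 0)"
   using us(3) by eventually_elim (simp add: q)
 qed
 have m: "mat a - mat 1 = (mat (a - 1) :: real^'n^'n)" by (simp add: mat_def vec_eq_iff)
 have 3: "(LI x. cdot (cmat (A x - mat 1) *v (if x : D then grad ui x else 0)) (grad ph x)) =
   (LIO S (%x. of_real ((a - 1) * c) * cdot (Gw x) (grad ph x)))"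
 proof (rule integral_supported[OF Sm])
  show "integrable (lebesgue_on S) (%x. of_real ((a - 1) * c) * cdot (Gw x) (grad ph x))" using L2_on_cdot[OF w(2) t(2) Sm] by simp
  have z: "cmat (0 :: real^'n^'n) *v w = 0" for w by (simp add: vec_eq_iff cmat_def matrix_vector_mult_def)
  show "AEL x. cdot (cmat (A x - mat 1) *v (if x : D then grad ui x else 0)) (grad ph x) =
   (if x : S then of_real ((a - 1) * c) * cdot (Gw x) (grad ph x) else 0)"
   using AE_outside w(5) by eventually_elim (use w(3) in "auto simp: A m cmat_mat cdot_scaleR cdot_linear z")
 qed
 have 4: "(LI x. of_real (q x - 1) * (if x : D then ui x else 0) * ph x) = (LIO S (%x. of_real ((a - 1) * c) * (w x * ph x)))"
 proof (rule integral_supported[OF Sm])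
  show "integrable (lebesgue_on S) (%x. of_real ((a - 1) * c) * (w x * ph x))" using L2_on_product[OF w(1) t(1) Sm] by simp
  show "AEL x. of_real (q x - 1) * (if x : D then ui x else 0) * ph x = (if x : S then of_real ((a - 1) * c) * (w x * ph x) else 0)"
   using AE_outside w(4) by eventually_elim (use w(3) in "auto simp: q")
 qed
 show ?thesis unfolding 1 2 3 4 normal_trace_F[OF us(2,1) ph] normal_trace_F[OF w(2,1) ph] integral_mult_right_zero by (simp add: algebra_simps)
qed

text \<open>On S, the total field us + ui and the incident field ui form the transmission pair. us
  has zero trace because it is in H^1 across the boundary and vanishes outside.\<close>

lemma nonscattering_subset: "nonscattering_frequencies S A q <= transmission_eigenfrequencies S A q"
proof
 fix k assume "k : nonscattering_frequencies S A q"
 then obtain T ui us where k: "k > 0" and T: "closure S <= T" "incident_field k T ui" and sc: "scattered_field A q k T ui us"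
  and us: "AE x in lebesgue_on (- S). us x = 0" unfolding nonscattering_frequencies_def by blast
 have inc: "open T" "connected T" "Ck_on 2 T ui" "!!x. x : T ==> laplacian ui x + of_real (k^2) * ui x = 0" "EX x:T. ui x ~= 0"
  using T(2) by (auto simp: incident_field_def open_domain_def)
 obtain G where G: "!!D. open_domain D ==> bounded D ==> H1G D us G"
  and eq: "!!ph. test UNIV ph ==>
   - (LI x. cdot (cmat (A x) *v G x) (grad ph x))
   + of_real (k^2) * (LI x. of_real (q x) * us x * ph x)
   = (LI x. cdot (cmat (A x - mat 1) *v (if x : T then grad ui x else 0)) (grad ph x))
   - of_real (k^2) * (LI x. of_real (q x - 1) * (if x : T then ui x else 0) * ph x)"
  using sc unfolding scattered_field_def Let_def by blast
 have ST: "S <= T" using T(1) closure_subset by blast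
 note v = classical_H1[OF S(1,2) T(1) inc(1,3,4)]
 have H1us: "H1G S us G" using S by (intro G) (simp_all add: open_domain_def)
 have L: "L2_on S us" "L2_on S G" "L2_on S ui" "L2_on S (grad ui)" using H1us v(1) by (auto simp: has_H1_gradient_def)
 have us0: "AEL x. x ~: S --> us x = 0" using us Smc AE_on_iff[of "- S"] by simp
 \<comment> \<open>H^1 regularity is given on bounded domains only; so uniqueness of weak gradients
   is applied on balls minus the closure of S, and these exhaust the exterior.\<close>
 have "AEL x. x : ball 0 (real n) - closure S --> G x = 0" for n :: nat
 proof (cases "n = 0")
  case False
  let ?E = "ball 0 (real n) - closure S"
  have oE: "open ?E" by (intro open_Diff open_ball closed_closure)
  have "H1G ?E us G" by (rule H1_restrict[OF G[OF open_domain_ball bounded_ball] _ oE open_ball]) (use False in auto)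
  moreover have "AEL x. x : ?E --> us x = 0" using us0 by eventually_elim (use closure_subset in auto)
  ultimately show ?thesis by (rule H1_gradient_unique[OF oE _ H1_zero])
 qed simp
 hence "AEL x. ALL n::nat. x : ball 0 (real n) - closure S --> G x = 0" unfolding AE_all_countable by blast
 with AE_outside have G0: "AEL x. x ~: S --> G x = 0"
 proof eventually_elim
  case (elim x)
  obtain n :: nat where "norm x < real n" using reals_Archimedean2 by blast
  thus ?case using elim by auto
 qed
 have zt: "zero_trace S us G"
 proof (rule zero_traceI[OF S(1,2,5) L(1,2)])
  fix ph :: "'n::finite fn" and i assume ph: "test UNIV ph"
  obtain R where R: "R > 0" "test (ball 0 R) ph" by (rule test_in_ball[OF ph]) (rule that)
  have Bm: "ball 0 R : sets lebesgue" by simp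
  have "(LIO (ball 0 R) (%x. us x * partial i ph x)) = - (LIO (ball 0 R) (%x. G x $ i * ph x))"
   using G[OF open_domain_ball[OF R(1)] bounded_ball] R(2) unfolding has_H1_gradient_def by blast
  hence "(LI x. us x * partial i ph x) = - (LI x. G x $ i * ph x)"
   unfolding integral_on_test[OF R(2) Bm] integral_on_test[OF test_partial[OF R(2)] Bm] .
  moreover have "(LI x. us x * partial i ph x) = (LIO S (%x. us x * partial i ph x))"
  proof (rule integral_supported[OF Sm L2_on_product[OF L(1) L2_on_test(1)[OF test_partial[OF ph] Sm] Sm]])
   show "AEL x. us x * partial i ph x = (if x : S then us x * partial i ph x else 0)" using us0 by eventually_elim auto
  qed
  moreover have "(LI x. G x $ i * ph x) = (LIO S (%x. G x $ i * ph x))"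
  proof (rule integral_supported[OF Sm L2_on_product[OF L2_on_component[OF L(2) Sm] L2_on_test(1)[OF ph Sm] Sm]])
   show "AEL x. G x $ i * ph x = (if x : S then G x $ i * ph x else 0)" using G0 by eventually_elim auto
  qed
  ultimately show "(LIO S (%x. us x * partial i ph x)) = - (LIO S (%x. G x $ i * ph x))" by simp
 qed
 have key: "- (of_real a * NT S G (F k us) ph (grad ph)) = of_real (a - 1) * NT S (grad ui) (F k ui) ph (grad ph)"
  if ph: "test UNIV ph" for ph
 proof -
  have "AEL x. us x = (if x : S then us x else 0)" "AEL x. G x = (if x : S then G x else 0)"
   using us0 by (eventually_elim, simp) (use G0 in "eventually_elim, simp")
  from iffD1[OF weak_form_iff[OF L(1,2) this L(3,4) ST _ _ ph, of ui 1 k] eq[OF ph]] show ?thesis by simp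
 qed
 let ?u = "%x. of_real 1 * us x + of_real 1 * ui x" and ?Gu = "%x. 1 *R G x + 1 *R grad ui x"
 have Hu: "H1G S ?u ?Gu" by (rule H1_lincomb[OF H1us v(1) Sm])
 hence Lu: "L2_on S ?u" "L2_on S ?Gu" by (auto simp: has_H1_gradient_def)
 have ntu: "NT S ?Gu (F k ?u) ps H = NT S G (F k us) ps H + NT S (grad ui) (F k ui) ps H" if "L2_on S ps" "L2_on S H" for ps H
  unfolding F_lincomb using normal_trace_lincomb[OF L(2) L2_F[OF L(1)] L(4) L2_F[OF L(3)] that Sm, where c=1 and d=1] by simp
 have bal: "of_real a * NT S ?Gu (F k ?u) ph (grad ph) = NT S (grad ui) (F k ui) ph (grad ph)" if ph: "test UNIV ph" for ph
 proof -
  have "of_real a * NT S G (F k us) ph (grad ph) + of_real (a - 1) * NT S (grad ui) (F k ui) ph (grad ph) = 0"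
   unfolding key[OF ph, symmetric] by simp
  thus ?thesis unfolding ntu[OF L2_on_test(1,2)[OF ph Sm]] by (simp add: algebra_simps)
 qed
 have div: "WD S ?Gu (F k ?u)"
  unfolding has_weak_div_iff[OF Lu(2) L2_F[OF Lu(1)] Sm]
 proof (intro allI impI)
  fix ph :: "'n fn" assume ph: "test S ph"
  have "NT S (grad ui) (F k ui) ph (grad ph) = 0" using v(2) ph has_weak_div_iff[OF L(4) L2_F[OF L(3)] Sm] by blast
  hence "of_real a * NT S ?Gu (F k ?u) ph (grad ph) = 0" using bal[OF test_UNIV[OF ph]] by simp
  thus "NT S ?Gu (F k ?u) ph (grad ph) = 0" using a(1) by simp
 qed
 \<comment> \<open>The weak form gives the balance for test functions of the whole space;
   \<open>normal_trace_zero\<close>, applied to the difference of the two fluxes, extends it to all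
   of H^1.\<close>
 have nt: "of_real a * NT S ?Gu (F k ?u) ps H = NT S (grad ui) (F k ui) ps H" if ps: "H1G S ps H" for ps H
 proof -
  have Lps: "L2_on S ps" "L2_on S H" using ps by (auto simp: has_H1_gradient_def)
  let ?V = "%x. a *R ?Gu x + (-1) *R grad ui x" and ?f = "%x. of_real a * F k ?u x + of_real (-1) * F k ui x"
  have lc: "NT S ?V ?f ps H = of_real a * NT S ?Gu (F k ?u) ps H + of_real (-1) * NT S (grad ui) (F k ui) ps H"
   if "L2_on S ps" "L2_on S H" for ps H by (rule normal_trace_lincomb[OF Lu(2) L2_F[OF Lu(1)] L(4) L2_F[OF L(3)] that Sm])
  have "NT S ?V ?f ps H = 0"
  proof (rule normal_trace_zero[OF S(1,2,5) _ _ _ ps])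
   show "L2_on S ?V" by (intro L2_on_add L2_on_scaleR Lu(2) L(4) Sm)
   show "L2_on S ?f" by (intro L2_on_add L2_on_cmult[OF L2_F] L2_F Lu(1) L(3) Sm)
   fix ph :: "'n fn" assume ph: "test UNIV ph"
   have "NT S ?V ?f ph (grad ph) = 0" using lc[OF L2_on_test(1,2)[OF ph Sm]] bal[OF ph] by simp
   thus "(LIO S (%x. cdot (?V x) (grad ph x) + ?f x * ph x)) = 0" unfolding normal_trace_def .
  qed
  thus ?thesis using lc[OF Lps] by simp
 qed
 have nz: "~ (AE x in lebesgue_on S. ?u x = 0 & ui x = 0)"
 proof
  assume "AE x in lebesgue_on S. ?u x = 0 & ui x = 0"
  hence "AEL x. x : S --> ui x = 0" unfolding AE_on_iff[OF Sm] by eventually_elim simp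
  hence z: "ui x = 0" if "x : S" for x
   using that by (intro continuous_AE_eq[OF S(1) continuous_on_subset[OF Ck_on_continuous[OF inc(3)] ST] continuous_on_const])
  have hz: "helm k ui x = 0" if "x : T" for x using inc(4)[OF that] by (simp add: helm_def)
  have "ui x = 0" if "x : T" for x by (rule unique_continuation[OF k inc(1,2,3) _ S(1,3) ST _ that]) (erule hz, erule z)
  thus False using inc(5) by blast
 qed
 have e: "(%x. ?u x - ui x) = us" "(%x. ?Gu x - grad ui x) = G" by auto
 have zt': "zero_trace S (%x. ?u x - ui x) (%x. ?Gu x - grad ui x)" unfolding e by (rule zt)
 show "k : transmission_eigenfrequencies S A q" unfolding transmission_iff
  by (intro conjI exI[of _ ?u] exI[of _ ui] exI[of _ ?Gu] exI[of _ "grad ui"] k Hu v nz div zt' allI impI nt)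
qed

text \<open>One construction for both kinds of eigenfunctions: the incident field is c times the
  extension v of w, and us is the intended scattered field on S. \<open>bal\<close> is what the weak
  form reduces to.\<close>

lemma nonscatteringI:
 assumes k: "k > 0" and w: "H1G S w G" "~ (AE x in lebesgue_on S. w x = 0)"
  and v: "smooth v" "open D" "connected D" "closure S <= D" "!!x. x : D ==> helm k v x = 0" "AEL x. x : S --> v x = w x"
  and c: "c ~= 0" and us: "zero_trace S us Gs"
  and bal: "!!ph. test UNIV ph ==> - (of_real a * NT S Gs (F k us) ph (grad ph)) = of_real ((a - 1) * c) * NT S G (F k w) ph (grad ph)"
 shows "k : nonscattering_frequencies S A q"
proof -
 have Ls: "L2_on S us" "L2_on S Gs" and Lw: "L2_on S w" "L2_on S G" using us w(1) by (auto simp: zero_trace_def has_H1_gradient_def)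
 have SD: "S <= D" using v(4) closure_subset by blast
 have C2: "Ck_on 2 D v" using v(1) by (auto simp: smooth_def intro: Ck_on_subset)
 have hv: "laplacian v x + of_real (k^2) * v x = 0" if "x : D" for x using v(5)[OF that] by (simp add: helm_def)
 note cl = classical_H1[OF S(1,2) v(4) v(2) C2 hv]
 have Lv: "L2_on S v" "L2_on S (grad v)" using cl(1) by (auto simp: has_H1_gradient_def)
 have gv: "AEL x. x : S --> grad v x = G x" by (rule H1_gradient_unique[OF S(1) cl(1) w(1) v(6)])
 define ui where "ui x = of_real c * v x" for x
 have gi: "grad ui x = c *R grad v x" for x
  using partial_cmult[OF smooth_differentiable[OF v(1)]] by (simp add: grad_def vec_eq_iff ui_def[abs_def] scaleR_conv_of_real[where 'a=complex])
 have su: "smooth ui" unfolding ui_def[abs_def] by (intro smooth_mult smooth_const v(1))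
 have pc: "partial i ui = (%x. of_real c * partial i v x)" for i
  unfolding ui_def[abs_def] by (rule ext) (rule partial_cmult[OF smooth_differentiable[OF v(1)]])
 have pcc: "partial i (partial i ui) x = of_real c * partial i (partial i v) x" for i x
  unfolding pc by (rule partial_cmult[OF smooth_differentiable[OF smooth_partial[OF v(1)]]])
 have inc: "incident_field k D ui"
  unfolding incident_field_def open_domain_def
 proof (intro conjI ballI)
  show "open D" "connected D" by fact+
  show "D ~= {}" using SD S(3) by blast
  show "Ck_on 2 D ui" using su by (auto simp: smooth_def intro: Ck_on_subset)
  show "laplacian ui x + of_real (k^2) * ui x = 0" if "x : D" for x
  proof -
   have "laplacian ui x + of_real (k^2) * ui x = of_real c * (laplacian v x + of_real (k^2) * v x)"
   by (simp add: laplacian_def pcc sum_distrib_left distrib_left ui_def mult.left_commute)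
   thus ?thesis using hv[OF that] by simp
  qed
  show "EX x:D. ui x ~= 0"
  proof (rule ccontr)
   assume "~ ?thesis"
   hence z: "v x = 0" if "x : S" for x using that SD c by (auto simp: ui_def)
   have "AE x in lebesgue_on S. w x = 0" unfolding AE_on_iff[OF Sm] using v(6) by eventually_elim (use z in auto)
   thus False using w(2) by simp
  qed
 qed
 define u0 where "u0 x = (if x : S then us x else 0)" for x
 define G0 where "G0 x = (if x : S then Gs x else 0)" for x
 have L0: "L2 u0" "L2 G0" using Ls unfolding L2_on_iff[OF Sm] u0_def[abs_def] G0_def[abs_def] by auto
 \<comment> \<open>Zero trace is what makes the extension by zero weakly differentiable, with
   gradient extended by zero.\<close>
 have H1: "H1G B u0 G0" if B: "open_domain B" for B
  unfolding has_H1_gradient_def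
 proof (intro conjI allI impI)
  have Bm: "B : sets lebesgue" using B by (simp add: open_domain_def)
  show "L2_on B u0" "L2_on B G0" by (rule L2_restrict[OF L0(1) Bm], rule L2_restrict[OF L0(2) Bm])
  fix ph :: "'n::finite fn" and i assume ph: "test B ph"
  note ph' = test_UNIV[OF ph]
  have 1: "(LI x. u0 x * partial i ph x) = (LIO S (%x. us x * partial i ph x))"
   by (rule integral_supported[OF Sm L2_on_product[OF Ls(1) L2_on_test(1)[OF test_partial[OF ph'] Sm] Sm]]) (simp add: u0_def)
  have 2: "(LI x. G0 x $ i * ph x) = (LIO S (%x. Gs x $ i * ph x))"
   by (rule integral_supported[OF Sm L2_on_product[OF L2_on_component[OF Ls(2) Sm] L2_on_test(1)[OF ph' Sm] Sm]]) (simp add: G0_def)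
  show "(LIO B (%x. u0 x * partial i ph x)) = - (LIO B (%x. G0 x $ i * ph x))"
   unfolding integral_on_test[OF ph Bm] integral_on_test[OF test_partial[OF ph] Bm] 1 2 by (rule zero_trace_extension[OF S(1) us ph'])
 qed
 have weq: "- (LI x. cdot (cmat (A x) *v G0 x) (grad ph x)) + of_real (k^2) * (LI x. of_real (q x) * u0 x * ph x)
   = (LI x. cdot (cmat (A x - mat 1) *v (if x : D then grad ui x else 0)) (grad ph x))
   - of_real (k^2) * (LI x. of_real (q x - 1) * (if x : D then ui x else 0) * ph x)"
  if ph: "test UNIV ph" for ph by (rule iffD2[OF weak_form_iff[OF Ls _ _ Lw SD _ _ ph] bal[OF ph]])
   (use v(6) gv in "auto simp: u0_def G0_def ui_def gi")
 have "bounded {x. u0 x ~= 0}" by (rule bounded_subset[OF S(2)]) (auto simp: u0_def)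
 hence rad: "radiation_condition k u0" by (rule radiation_condition_zero)
 have "scattered_field A q k D ui u0" unfolding scattered_field_def Let_def by (intro exI[of _ G0] conjI allI impI rad weq) (auto intro: H1)
 moreover have "AE x in lebesgue_on (- S). u0 x = 0" using Smc by (subst AE_on_iff) (auto simp: u0_def)
 ultimately show ?thesis unfolding nonscattering_frequencies_def using k v(4) inc by blast
qed

end

theorem proposition2p9:
  fixes \<Omega> :: "(real^'n) set" and A :: "real^'n \<Rightarrow> real^'n^'n" and q :: "real^'n \<Rightarrow> real" and a :: real
  assumes "CARD('n) \<ge> 2"
    and "open_domain \<Omega>" and "bounded \<Omega>" and "lipschitz_boundary \<Omega>" and "connected (- closure \<Omega>)"
    and "proper_paving_unit \<Omega>"
    and "a > 0" and "a \<noteq> 1"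
    and "\<And>x. x \<in> \<Omega> \<Longrightarrow> A x = mat a" and "\<And>x. x \<in> \<Omega> \<Longrightarrow> q x = a"
    and "\<And>x. x \<notin> closure \<Omega> \<Longrightarrow> A x = mat 1" and "\<And>x. x \<notin> closure \<Omega> \<Longrightarrow> q x = 1"
  shows "nonscattering_frequencies \<Omega> A q = transmission_eigenfrequencies \<Omega> A q \<and>
    transmission_eigenfrequencies \<Omega> A q = dirichlet_eigenfrequencies \<Omega> \<union> neumann_eigenfrequencies \<Omega>"
proof -
 have o: "open \<Omega>" "connected \<Omega>" "\<Omega> ~= {}" using assms(2) by (auto simp: open_domain_def)
 have ic: "interior (closure \<Omega>) = \<Omega>" by (rule lipschitz_interior_closure[OF o(1) assms(4)])
 obtain Q where Q: "frontier_in \<Omega> Q" by (rule polytopal_frontier[OF o(1) ic]) (use assms(6) in "auto simp: proper_paving_unit_def")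
 obtain T where T: "open T" "closure \<Omega> <= T"
  "ALL sg:successive_reflections \<Omega> T. ALL ta:successive_reflections \<Omega> T. sg ` closure \<Omega> ~= ta ` closure \<Omega> -->
   sg ` closure \<Omega> Int ta ` closure \<Omega> <= \<Union>(skeleton \<Omega> T)"
  "ALL E:skeleton \<Omega> T. \<exists>!F. F : facets \<Omega> & (EX sg:successive_reflections \<Omega> T. E = sg ` F)"
  using assms(6) unfolding proper_paving_unit_def by (elim conjE exE) (rule that)
 interpret paving \<Omega> T Q
 proof
  show "sg ` closure \<Omega> Int ta ` closure \<Omega> <= \<Union>(skeleton \<Omega> T)"
   if "sg : successive_reflections \<Omega> T" "ta : successive_reflections \<Omega> T" "sg ` closure \<Omega> ~= ta ` closure \<Omega>" for sg ta
   using T(3) that by blast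
  show "\<exists>!F. F : facets \<Omega> & (EX sg:successive_reflections \<Omega> T. E = sg ` F)" if "E : skeleton \<Omega> T" for E
   using T(4) that by (rule bspec)
  show "open \<Omega>" "interior (closure \<Omega>) = \<Omega>" "bounded \<Omega>" "\<Omega> ~= {}" "open T" "closure \<Omega> <= T" "frontier_in \<Omega> Q" by fact+
 qed
 have "negligible (UN q:Q. {x. fst q *. x = snd q})"
  using Q by (intro negligible_Union finite_imageI) (auto simp: frontier_in_def intro!: negligible_hyperplane)
 hence null: "negligible (frontier \<Omega>)" by (rule negligible_subset) (use Q in "simp add: frontier_in_def")
 interpret sc: scatterer \<Omega> A q a
 proof
  show "open \<Omega>" "bounded \<Omega>" "\<Omega> ~= {}" "connected \<Omega>" "lipschitz_boundary \<Omega>" "negligible (frontier \<Omega>)" "a > 0" "a ~= 1" by fact+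
  show "x : \<Omega> ==> A x = mat a" "x ~: closure \<Omega> ==> A x = mat 1" "x : \<Omega> ==> q x = a" "x ~: closure \<Omega> ==> q x = 1" for x
   using assms(9,10,11,12)[of x] by simp_all
 qed
 have ext: "EX v D. open D & connected D & closure \<Omega> <= D & smooth v & (ALL x:D. helm k v x = 0) & (AEL x. x : \<Omega> --> v x = w x)"
  if k: "k > 0" and w: "L2_on \<Omega> w" and e: "e id = 1"
   and fold: "!!U ph. U <= T ==> bounded U ==> test U ph ==> (LIO \<Omega> (%x. w x * helm k (fold_sum U e ph) x)) = 0" for k w e
 proof -
  define w0 where "w0 x = (if x : \<Omega> then w x else 0)" for x
  have "EX v D. open D & connected D & closure \<Omega> <= D & smooth v & (ALL x:D. helm k v x = 0) & (AEL x. x : \<Omega> --> v x = w0 x)"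
  proof (rule extension_exists[where k=k and w=w0 and e=e])
   show "k > 0" "connected \<Omega>" "e id = 1" by fact+
   show "L2 w0" using w unfolding L2_on_iff[OF S_sets] w0_def[abs_def] .
   show "w0 x = 0" if "x ~: \<Omega>" for x using that by (simp add: w0_def)
   fix U ph assume U: "U <= T" "bounded U" "test U ph"
   have "(%x. w0 x * helm k (fold_sum U e ph) x) = (%x. if x : \<Omega> then w x * helm k (fold_sum U e ph) x else 0)" by (auto simp: w0_def)
   thus "(LI x. w0 x * helm k (fold_sum U e ph) x) = 0" using fold[OF U] unfolding integral_on[OF S_sets] by simp
  qed
  thus ?thesis by (simp add: w0_def cong: conj_cong imp_cong)
 qed
 have d: "k : nonscattering_frequencies \<Omega> A q" if "k : dirichlet_eigenfrequencies \<Omega>" for k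
 proof -
  obtain w G where k: "k > 0" and w: "H1G \<Omega> w G" "~ (AE x in lebesgue_on \<Omega>. w x = 0)"
   "WD \<Omega> G (%x. - of_real (k^2) * w x)" "zero_trace \<Omega> w G"
   using \<open>k : dirichlet_eigenfrequencies \<Omega>\<close> unfolding dirichlet_eigenfrequencies_def by blast
  have wL: "L2_on \<Omega> w" using w(1) by (simp add: has_H1_gradient_def)
  obtain v D where v: "open D" "connected D" "closure \<Omega> <= D" "smooth v" "!!x. x : D ==> helm k v x = 0" "AEL x. x : \<Omega> --> v x = w x"
  proof -
   have "EX v D. open D & connected D & closure \<Omega> <= D & smooth v & (ALL x:D. helm k v x = 0) & (AEL x. x : \<Omega> --> v x = w x)"
   proof (rule ext[where e=orientation, OF k wL orientation_id])
   fix U ph assume U: "U <= T" "bounded U" "test U ph"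
   show "(LIO \<Omega> (%x. w x * helm k (fold_sum U orientation ph) x)) = 0"
   by (rule dirichlet_test_zero[OF assms(4) w(4,3) fold_sum_test[OF U(3)]]) (rule fold_sum_dirichlet[OF _ _ U])
   qed
   thus thesis by (elim exE conjE) (rule that, auto)
  qed
  show ?thesis
  proof (rule sc.nonscatteringI[OF k w(1,2) v(4,1,2,3,5,6) _ w(4)])
   \<comment> \<open>With us = w the balance reads - a = (a - 1) c, which determines c.\<close>
   show "a / (1 - a) ~= 0" using assms(7,8) by simp
   have "(a - 1) * (a / (1 - a)) = - a" using assms(8) by (simp add: field_simps)
   thus "- (of_real a * NT \<Omega> G (%x. - of_real (k^2) * w x) ph (grad ph)) =
   of_real ((a - 1) * (a / (1 - a))) * NT \<Omega> G (%x. - of_real (k^2) * w x) ph (grad ph)" for ph by simp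
  qed
 qed
 have n: "k : nonscattering_frequencies \<Omega> A q" if "k : neumann_eigenfrequencies \<Omega>" for k
 proof -
  obtain w G where k: "k > 0" and w: "H1G \<Omega> w G" "~ (AE x in lebesgue_on \<Omega>. w x = 0)"
   "!!ps H. H1G \<Omega> ps H ==> NT \<Omega> G (%x. - of_real (k^2) * w x) ps H = 0"
   using \<open>k : neumann_eigenfrequencies \<Omega>\<close> unfolding neumann_eigenfrequencies_def by blast
  have wL: "L2_on \<Omega> w" using w(1) by (simp add: has_H1_gradient_def)
  obtain v D where v: "open D" "connected D" "closure \<Omega> <= D" "smooth v" "!!x. x : D ==> helm k v x = 0" "AEL x. x : \<Omega> --> v x = w x"
  proof -
   have "EX v D. open D & connected D & closure \<Omega> <= D & smooth v & (ALL x:D. helm k v x = 0) & (AEL x. x : \<Omega> --> v x = w x)"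
   proof (rule ext[where e="%sg. 1", OF k wL refl])
   fix U ph assume U: "U <= T" "bounded U" "test U ph"
   show "(LIO \<Omega> (%x. w x * helm k (fold_sum U (%sg. 1) ph) x)) = 0"
   by (rule neumann_test_zero[OF assms(4) w(1) w(3) fold_sum_test[OF U(3)]], assumption) (rule fold_sum_neumann[OF _ _ _ _ U])
   qed
   thus thesis by (elim exE conjE) (rule that, auto)
  qed
  show ?thesis
  proof (rule sc.nonscatteringI[OF k w(1,2) v(4,1,2,3,5,6) _ zero_trace_zero])
   show "(1::real) ~= 0" by simp
   fix ph :: "'n fn" assume "test UNIV ph"
   from w(3)[OF has_H1_gradient_test[OF this S_sets]]
   show "- (of_real a * NT \<Omega> (%x. 0) (%x. - of_real (k^2) * 0) ph (grad ph)) =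
   of_real ((a - 1) * 1) * NT \<Omega> G (%x. - of_real (k^2) * w x) ph (grad ph)" by (simp add: normal_trace_def[of _ "%x. 0"] cdot_linear)
  qed
 qed
 show ?thesis
  using sc.nonscattering_subset sc.transmission_subset sc.dirichlet_subset sc.neumann_subset d n by blast
qed

end
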